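(* Let $\varepsilon>0$, let $\Phi_1,\Phi_2$ be quasi-Young functions of order $r_0\in(0,1]$, let $\omega,v\in\mathscr P_E(\mathbf R^{2d})$ with $v$ submultiplicative be such that $\omega$ is $v$-moderate, and let $\phi,\psi\in M^{r_0}_{(v)}(\mathbf R^d)$ be such that $$\{e^{i\varepsilon\langle\cdot,\kappa\rangle}\phi(\cdot-\varepsilon k)\}_{k,\kappa\in\mathbf Z^d}\quad\text{and}\quad\{e^{i\varepsilon\langle\cdot,\kappa\rangle}\psi(\cdot-\varepsilon k)\}_{k,\kappa\in\mathbf Z^d}$$ are dual frames to each other. Then the following is true: (1) the Gabor frame operator $S^\varepsilon_{\phi,\psi}=D^\varepsilon_\psi\circ C^\varepsilon_\phi$ is the identity operator on $M^{\Phi_1,\Phi_2}_{(\omega)}(\mathbf R^d)$; (2) if $f\in M^{\Phi_1,\Phi_2}_{(\omega)}(\mathbf R^d)$, then $$f=\sum_{k,\kappa\in\mathbf Z^d}(V_\psi f)(\varepsilon k,\varepsilon\kappa)e^{i\varepsilon\langle\cdot,\kappa\rangle}\phi(\cdot-\varepsilon k)=\sum_{k,\kappa\in\mathbf Z^d}(V_\phi f)(\varepsilon k,\varepsilon\kappa)e^{i\varepsilon\langle\cdot,\kappa\rangle}\psi(\cdot-\varepsilon k),$$ with unconditional convergence in $M^{\Phi_1,\Phi_2}_{(\omega)}(\mathbf R^d)$ when $\mathscr S(\mathbf R^{2d})$ is dense in $L^{\Phi_1,\Phi_2}(\mathbf R^{2d})$, and with convergence in $M^\infty_{(\omega)}(\mathbf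 R^d)$ with respect to the weak$^*$ topology otherwise. Furthermore, for $f\in M^{\Phi_1,\Phi_2}_{(\omega)}(\mathbf R^d)$, $$\|\{(V_\phi f)(j,\iota)\}_{j,\iota\in\varepsilon\mathbf Z^d}\|_{\ell^{\Phi_1,\Phi_2}_{(\omega)}(\varepsilon\mathbf Z^{2d})}\asymp\|\{(V_\psi f)(j,\iota)\}_{j,\iota\in\varepsilon\mathbf Z^d}\|_{\ell^{\Phi_1,\Phi_2}_{(\omega)}(\varepsilon\mathbf Z^{2d})}\asymp\|f\|_{M^{\Phi_1,\Phi_2}_{(\omega)}}.$$
   Context: Weights: a weight on $\mathbf R^n$ is a positive $\omega\in L^\infty_{loc}$ with $1/\omega\in L^\infty_{loc}$. It is $v$-moderate, for a positive weight $v$, if $\omega(x+y)\lesssim\omega(x)v(y)$; $\mathscr P_E(\mathbf R^n)$ is the set of weights that are $v$-moderate for some $v$. A weight $v$ is submultiplicative if it is even and $v(x+y)\lesssim v(x)v(y)$. $A\lesssim B$ means $A\le cB$ with a constant $c>0$ (independent of $f$); $A\asymp B$ means $A\lesssim B\lesssim A$. Young functions: a Young function is a convex $\Phi_0:[0,\infty)\to[0,\infty]$ with $\Phi_0(0)=0$, $\lim_{t\to\infty}\Phi_0(t)=\infty$; a quasi-Young function of order $r_0\in(0,1]$ is $\Phi(t)=\Phi_0(t^{r_0})$ with $\Phi_0$ Young. Orlicz quasi-norms: for a measure $\mu$, $\|f\|_{L^\Phi(\mu)}=\inf\{\lambda>0:\int\Phi(|f|/\lambda)\,d\mu\le1\}$,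 and $\|F\|_{L^{\Phi_1,\Phi_2}_{(\omega)}(\mu\otimes\mu)}=\big\|\,\xi\mapsto\|F(\cdot,\xi)\omega(\cdot,\xi)\|_{L^{\Phi_1}(\mu)}\big\|_{L^{\Phi_2}(\mu)}$. $L^{\Phi_1,\Phi_2}_{(\omega)}(\mathbf R^{2d})$ uses Lebesgue measure on $\mathbf R^d$ (no weight subscript means $\omega=1$); $\ell^{\Phi_1,\Phi_2}_{(\omega)}(\varepsilon\mathbf Z^{2d})$ uses counting measure on $\varepsilon\mathbf Z^d$ (so the weight is $\omega$ evaluated at the lattice points). Pilipović space: $\mathcal H'_\flat(\mathbf R^d)$ is the space of formal Hermite series $\sum_\alpha c(\alpha)h_\alpha$ with $|c(\alpha)|\lesssim r^{|\alpha|}\alpha!^{1/2}$ for every $r>0$ ($h_\alpha$ the $L^2$-normalized Hermite functions), dual via the $L^2$-form to the space $\mathcal H_\flat(\mathbf R^d)$ of Hermite series with $|c(\alpha)|\lesssim r^{|\alpha|}\alpha!^{-1/2}$ for some $r>0$. Modulation spaces: with $\phi_0(x)=\pi^{-d/4}e^{-|x|^2/2}$, $M^{\Phi_1,\Phi_2}_{(\omega)}(\mathbf R^d)=\{f\in\mathcal H'_\flat(\mathbf R^d):\|f\|_{M^{\Phi_1,\Phi_2}_{(\omega)}}:=\|V_{\phi_0}f\|_{L^{\Phi_1,\Phi_2}_{(\omega)}}<\infty\}$, and $M^{p}_{(v)}$ is defined in the same way with $L^{p}_{(v)}(\mathbf R^{2d})$. Here $V_\phi f(x,\xi)=\mathscr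 F(f\,\overline{\phi(\cdot-x)})(\xi)=(2\pi)^{-d/2}(f,e^{i\langle\cdot,\xi\rangle}\phi(\cdot-x))$, where $\mathscr Fg(\xi)=(2\pi)^{-d/2}\int g(y)e^{-i\langle y,\xi\rangle}dy$ and the pairing is the extension of the $L^2$ form (for $f\in M^\infty_{(\omega)}$ and $\phi\in M^1_{(v)}$ it is the duality between $M^\infty_{(\omega)}$ and $M^1_{(1/\omega)}$, which also gives the weak$^*$ topology on $M^\infty_{(\omega)}$). Gabor operators: $C^\varepsilon_\phi f=\{V_\phi f(j,\iota)\}_{j,\iota\in\varepsilon\mathbf Z^d}$ (from $M^\infty_{(\omega)}$ to $\ell^\infty_{(\omega)}(\varepsilon\mathbf Z^{2d})$) and $D^\varepsilon_\psi c=\sum_{j,\iota\in\varepsilon\mathbf Z^d}c(j,\iota)e^{i\langle\cdot,\iota\rangle}\psi(\cdot-j)$ (from $\ell^\infty_{(\omega)}(\varepsilon\mathbf Z^{2d})$ to $M^\infty_{(\omega)}$, series in the weak$^*$ sense). Dual frames: the two Gabor systems are dual frames to each other if both are frames for $L^2(\mathbf R^d)$ and, with the normalization of $V$ above, $f=\sum_{j,\iota\in\varepsilon\mathbf Z^d}V_\phi f(j,\iota)e^{i\langle\cdot,\iota\rangle}\psi(\cdot-j)=\sum_{j,\iota\in\varepsilon\mathbf Z^d}V_\psi f(j,\iota)e^{i\langle\cdot,\iota\rangle}\phi(\cdot-j)$ for all $f\in L^2(\mathbf R^d)$. *)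

theory Defs
  imports "HOL-Probability.Probability"
begin

section \<open>Weights\<close>

definition weight :: "('a::euclidean_space \<Rightarrow> real) \<Rightarrow> bool" where
  "weight \<omega> \<longleftrightarrow> \<omega> \<in> borel_measurable lebesgue \<and> (\<forall>x. \<omega> x > 0) \<and>
     (\<forall>K. compact K \<longrightarrow>
        (\<exists>C. AE x in lebesgue. x \<in> K \<longrightarrow> \<omega> x \<le> C) \<and>
        (\<exists>C. AE x in lebesgue. x \<in> K \<longrightarrow> 1 / \<omega> x \<le> C))"

definition moderate :: "('a::euclidean_space \<Rightarrow> real) \<Rightarrow> ('a \<Rightarrow> real) \<Rightarrow> bool" where
  "moderate v \<omega> \<longleftrightarrow> (\<exists>c>0. \<forall>x y. \<omega> (x + y) \<le> c * \<omega> x * v y)"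

definition moderate_weights :: "('a::euclidean_space \<Rightarrow> real) set" where
  "moderate_weights = {\<omega>. weight \<omega> \<and> (\<exists>v. weight v \<and> moderate v \<omega>)}"

definition submultiplicative :: "('a::euclidean_space \<Rightarrow> real) \<Rightarrow> bool" where
  "submultiplicative v \<longleftrightarrow>
     (\<forall>x. v (- x) = v x) \<and> (\<exists>c>0. \<forall>x y. v (x + y) \<le> c * v x * v y)"


section \<open>Young functions and Orlicz quasi-norms\<close>

text \<open>Young functions live on \<open>[0, \<infinity>)\<close>; their values at negative arguments are irrelevant.\<close>

definition young :: "(real \<Rightarrow> ennreal) \<Rightarrow> bool" where
  "young \<Phi> \<longleftrightarrow> \<Phi> 0 = 0 \<and> (\<Phi> \<longlongrightarrow> \<infinity>) at_top \<and>
     (\<forall>s\<ge>0. \<forall>t\<ge>0. \<forall>u\<in>{0..1}.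
        \<Phi> ((1 - u) * s + u * t) \<le> ennreal (1 - u) * \<Phi> s + ennreal u * \<Phi> t)"

definition quasi_young :: "real \<Rightarrow> (real \<Rightarrow> ennreal) \<Rightarrow> bool" where
  "quasi_young r \<Phi> \<longleftrightarrow> 0 < r \<and> r \<le> 1 \<and>
     (\<exists>\<Phi>\<^sub>0. young \<Phi>\<^sub>0 \<and> (\<forall>t\<ge>0. \<Phi> t = \<Phi>\<^sub>0 (t powr r)))"

text \<open>The argument is the modulus of the function. It may take the value \<open>\<infinity>\<close>, because it can itself
  be an inner quasi-norm; there \<open>\<Phi>\<close> is extended by \<open>\<Phi>(\<infinity>) = \<infinity>\<close>.\<close>

definition orlicz_norm :: "'a measure \<Rightarrow> (real \<Rightarrow> ennreal) \<Rightarrow> ('a \<Rightarrow> ennreal) \<Rightarrow> ennreal" where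
  "orlicz_norm M \<Phi> g = Inf {ennreal a | a. a > 0 \<and>
     (\<integral>\<^sup>+ x. (if g x = \<infinity> then \<infinity> else \<Phi> (enn2real (g x) / a)) \<partial>M) \<le> 1}"

definition mixed_orlicz_norm ::
  "'a measure \<Rightarrow> (real \<Rightarrow> ennreal) \<Rightarrow> (real \<Rightarrow> ennreal) \<Rightarrow> ('a \<times> 'a \<Rightarrow> real) \<Rightarrow>
   ('a \<times> 'a \<Rightarrow> complex) \<Rightarrow> ennreal" where
  "mixed_orlicz_norm M \<Phi>\<^sub>1 \<Phi>\<^sub>2 \<omega> F =
     orlicz_norm M \<Phi>\<^sub>2 (\<lambda>\<xi>. orlicz_norm M \<Phi>\<^sub>1 (\<lambda>x. ennreal (cmod (F (x, \<xi>)) * \<omega> (x, \<xi>))))"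

definition Lp_norm ::
  "ennreal \<Rightarrow> ('a::euclidean_space \<Rightarrow> real) \<Rightarrow> ('a \<Rightarrow> complex) \<Rightarrow> ennreal" where
  "Lp_norm p \<omega> F =
     (if p = \<infinity> then esssup lebesgue (\<lambda>z. ennreal (cmod (F z) * \<omega> z))
      else let I = (\<integral>\<^sup>+ z. ennreal ((cmod (F z) * \<omega> z) powr enn2real p) \<partial>lebesgue)
           in if I = \<infinity> then \<infinity> else ennreal (enn2real I powr (1 / enn2real p)))"


section \<open>Density of the Schwartz space in a mixed Orlicz space\<close>

definition iterated_partial ::
  "'a::euclidean_space list \<Rightarrow> ('a \<Rightarrow> complex) \<Rightarrow> 'a \<Rightarrow> complex" where
  "iterated_partial bs f = foldr (\<lambda>b g x. frechet_derivative g (at x) b) bs f"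

definition schwartz :: "('a::euclidean_space \<Rightarrow> complex) set" where
  "schwartz = {f. \<forall>bs. set bs \<subseteq> Basis \<longrightarrow>
     iterated_partial bs f differentiable_on UNIV \<and>
     (\<forall>k::nat. bounded (range (\<lambda>x. norm x ^ k * cmod (iterated_partial bs f x))))}"

definition mixed_orlicz_space ::
  "(real \<Rightarrow> ennreal) \<Rightarrow> (real \<Rightarrow> ennreal) \<Rightarrow> ('a::euclidean_space \<times> 'a \<Rightarrow> complex) set" where
  "mixed_orlicz_space \<Phi>\<^sub>1 \<Phi>\<^sub>2 = {F. F \<in> borel_measurable lebesgue \<and>
     mixed_orlicz_norm lebesgue \<Phi>\<^sub>1 \<Phi>\<^sub>2 (\<lambda>_. 1) F < \<infinity>}"

definition dense_in_mixed_orlicz ::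
  "('a::euclidean_space \<times> 'a \<Rightarrow> complex) set \<Rightarrow> (real \<Rightarrow> ennreal) \<Rightarrow> (real \<Rightarrow> ennreal) \<Rightarrow> bool" where
  "dense_in_mixed_orlicz S \<Phi>\<^sub>1 \<Phi>\<^sub>2 \<longleftrightarrow> S \<subseteq> mixed_orlicz_space \<Phi>\<^sub>1 \<Phi>\<^sub>2 \<and>
     (\<forall>F\<in>mixed_orlicz_space \<Phi>\<^sub>1 \<Phi>\<^sub>2. \<forall>e>0. \<exists>G\<in>S.
        mixed_orlicz_norm lebesgue \<Phi>\<^sub>1 \<Phi>\<^sub>2 (\<lambda>_. 1) (\<lambda>z. F z - G z) < e)"


section \<open>Hermite series and Pilipovi\'c spaces\<close>

definition hermite1 :: "nat \<Rightarrow> real \<Rightarrow> real" where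
  "hermite1 n t = (-1) ^ n / sqrt (2 ^ n * fact n * sqrt pi) * exp (t\<^sup>2 / 2)
     * (deriv ^^ n) (\<lambda>s. exp (- s\<^sup>2)) t"

definition hermite :: "('n::finite \<Rightarrow> nat) \<Rightarrow> real^'n \<Rightarrow> real" where
  "hermite \<alpha> x = (\<Prod>i\<in>UNIV. hermite1 (\<alpha> i) (x $ i))"

text \<open>A formal Hermite series is represented by its family of coefficients, indexed by
  multi-indices.\<close>

type_synonym 'n hermite_series = "('n \<Rightarrow> nat) \<Rightarrow> complex"

definition multi_fact :: "('n::finite \<Rightarrow> nat) \<Rightarrow> real" where
  "multi_fact \<alpha> = (\<Prod>i\<in>UNIV. fact (\<alpha> i))"

definition pilipovic_flat :: "'n::finite hermite_series set" where
  "pilipovic_flat =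
     {c. \<exists>r>0. \<exists>C. \<forall>\<alpha>. cmod (c \<alpha>) \<le> C * r ^ (\<Sum>i\<in>UNIV. \<alpha> i) / sqrt (multi_fact \<alpha>)}"

definition pilipovic_flat_dual :: "'n::finite hermite_series set" where
  "pilipovic_flat_dual =
     {c. \<forall>r>0. \<exists>C. \<forall>\<alpha>. cmod (c \<alpha>) \<le> C * r ^ (\<Sum>i\<in>UNIV. \<alpha> i) * sqrt (multi_fact \<alpha>)}"

text \<open>The \<open>L\<^sup>2\<close> form, for \<open>f\<close> in the dual Pilipovi\'c space and \<open>g\<close> in the Pilipovi\'c space.\<close>

definition l2_form :: "'n::finite hermite_series \<Rightarrow> 'n hermite_series \<Rightarrow> complex" where
  "l2_form f g = (\<Sum>\<^sub>\<infinity>\<alpha>. f \<alpha> * cnj (g \<alpha>))"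

text \<open>The Hermite series of a square integrable function.\<close>

definition hermite_coeffs :: "(real^'n \<Rightarrow> complex) \<Rightarrow> 'n::finite hermite_series" where
  "hermite_coeffs g \<alpha> = (LINT y|lebesgue. g y * of_real (hermite \<alpha> y))"

definition square_integrable :: "('a::euclidean_space \<Rightarrow> complex) set" where
  "square_integrable =
     {f. f \<in> borel_measurable lebesgue \<and> integrable lebesgue (\<lambda>x. (cmod (f x))\<^sup>2)}"

definition L2_norm :: "('a::euclidean_space \<Rightarrow> complex) \<Rightarrow> real" where
  "L2_norm f = sqrt (LINT x|lebesgue. (cmod (f x))\<^sup>2)"


section \<open>Modulation spaces\<close>

definition tf_shift :: "real^'n \<Rightarrow> real^'n \<Rightarrow> (real^'n \<Rightarrow> complex) \<Rightarrow> real^'n \<Rightarrow> complex" where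
  "tf_shift x \<xi> \<phi> = (\<lambda>y. cis (y \<bullet> \<xi>) * \<phi> (y - x))"

definition gaussian :: "real^'n \<Rightarrow> complex" where
  "gaussian x = of_real (pi powr (- (real CARD('n) / 4)) * exp (- (norm x)\<^sup>2 / 2))"

definition stft_gaussian ::
  "'n::finite hermite_series \<Rightarrow> (real^'n) \<times> (real^'n) \<Rightarrow> complex" where
  "stft_gaussian f = (\<lambda>(x, \<xi>). of_real ((2 * pi) powr (- (real CARD('n) / 2))) *
     l2_form f (hermite_coeffs (tf_shift x \<xi> gaussian)))"

definition modulation_norm ::
  "(real \<Rightarrow> ennreal) \<Rightarrow> (real \<Rightarrow> ennreal) \<Rightarrow> ((real^'n) \<times> (real^'n) \<Rightarrow> real) \<Rightarrow>
   'n::finite hermite_series \<Rightarrow> ennreal" where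
  "modulation_norm \<Phi>\<^sub>1 \<Phi>\<^sub>2 \<omega> f = mixed_orlicz_norm lebesgue \<Phi>\<^sub>1 \<Phi>\<^sub>2 \<omega> (stft_gaussian f)"

definition modulation_space ::
  "(real \<Rightarrow> ennreal) \<Rightarrow> (real \<Rightarrow> ennreal) \<Rightarrow> ((real^'n) \<times> (real^'n) \<Rightarrow> real) \<Rightarrow>
   'n::finite hermite_series set" where
  "modulation_space \<Phi>\<^sub>1 \<Phi>\<^sub>2 \<omega> = {f \<in> pilipovic_flat_dual. modulation_norm \<Phi>\<^sub>1 \<Phi>\<^sub>2 \<omega> f < \<infinity>}"

definition modulation_Lp_norm ::
  "ennreal \<Rightarrow> ((real^'n) \<times> (real^'n) \<Rightarrow> real) \<Rightarrow> 'n::finite hermite_series \<Rightarrow> ennreal" where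
  "modulation_Lp_norm p \<omega> f = Lp_norm p \<omega> (stft_gaussian f)"

definition modulation_Lp ::
  "ennreal \<Rightarrow> ((real^'n) \<times> (real^'n) \<Rightarrow> real) \<Rightarrow> 'n::finite hermite_series set" where
  "modulation_Lp p \<omega> = {f \<in> pilipovic_flat_dual. modulation_Lp_norm p \<omega> f < \<infinity>}"

text \<open>The duality between the weighted spaces \<open>M\<^sup>\<infinity>\<close> (weight \<open>\<omega>\<close>) and \<open>M\<^sup>1\<close> (weight \<open>1 / \<omega>\<close>): for
  fixed \<open>f\<close> in the former, \<open>g \<mapsto> (f, g)\<close> is the continuous extension of the \<open>L\<^sup>2\<close> form from
  the Pilipovi\'c space, which is dense in the latter.\<close>

definition dual_pairing ::
  "((real^'n) \<times> (real^'n) \<Rightarrow> real) \<Rightarrow> 'n::finite hermite_series \<Rightarrow> 'n hermite_series \<Rightarrow> complex" where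
  "dual_pairing \<omega> f g = (THE z. \<forall>h::nat \<Rightarrow> 'n hermite_series.
     (\<forall>m. h m \<in> pilipovic_flat) \<and>
     (\<lambda>m. modulation_Lp_norm 1 (\<lambda>z. 1 / \<omega> z) (\<lambda>\<alpha>. h m \<alpha> - g \<alpha>)) \<longlonglongrightarrow> 0 \<longrightarrow>
     (\<lambda>m. l2_form f (h m)) \<longlonglongrightarrow> z)"

text \<open>\<open>V\<^sub>\<phi> f\<close> for \<open>f\<close> in \<open>M\<^sup>\<infinity>\<close> with weight \<open>\<omega>\<close>, and its classical version for \<open>f\<close> in \<open>L\<^sup>2\<close>.\<close>

definition stft ::
  "((real^'n) \<times> (real^'n) \<Rightarrow> real) \<Rightarrow> (real^'n \<Rightarrow> complex) \<Rightarrow> 'n::finite hermite_series \<Rightarrow>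
   (real^'n) \<times> (real^'n) \<Rightarrow> complex" where
  "stft \<omega> \<phi> f = (\<lambda>(x, \<xi>). of_real ((2 * pi) powr (- (real CARD('n) / 2))) *
     dual_pairing \<omega> f (hermite_coeffs (tf_shift x \<xi> \<phi>)))"

definition stft_L2 ::
  "(real^'n \<Rightarrow> complex) \<Rightarrow> (real^'n \<Rightarrow> complex) \<Rightarrow> (real^'n) \<times> (real^'n) \<Rightarrow> complex" where
  "stft_L2 \<phi> f = (\<lambda>(x, \<xi>). of_real ((2 * pi) powr (- (real CARD('n) / 2))) *
     (LINT y|lebesgue. f y * cnj (\<phi> (y - x)) * cis (- (y \<bullet> \<xi>))))"


section \<open>Convergence of series\<close>

text \<open>As in \<^const>\<open>has_sum\<close>, unordered sums are limits along the net of finite partial sums, which is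
  unconditional convergence.\<close>

definition modulation_has_sum ::
  "(real \<Rightarrow> ennreal) \<Rightarrow> (real \<Rightarrow> ennreal) \<Rightarrow> ((real^'n) \<times> (real^'n) \<Rightarrow> real) \<Rightarrow>
   ('i \<Rightarrow> 'n::finite hermite_series) \<Rightarrow> 'n hermite_series \<Rightarrow> 'i set \<Rightarrow> bool" where
  "modulation_has_sum \<Phi>\<^sub>1 \<Phi>\<^sub>2 \<omega> u f A \<longleftrightarrow>
     ((\<lambda>F. modulation_norm \<Phi>\<^sub>1 \<Phi>\<^sub>2 \<omega> (\<lambda>\<alpha>. f \<alpha> - (\<Sum>i\<in>F. u i \<alpha>))) \<longlongrightarrow> 0) (finite_subsets_at_top A)"

definition weak_star_has_sum ::
  "((real^'n) \<times> (real^'n) \<Rightarrow> real) \<Rightarrow>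
   ('i \<Rightarrow> 'n::finite hermite_series) \<Rightarrow> 'n hermite_series \<Rightarrow> 'i set \<Rightarrow> bool" where
  "weak_star_has_sum \<omega> u f A \<longleftrightarrow>
     (\<forall>g\<in>modulation_Lp 1 (\<lambda>z. 1 / \<omega> z).
        ((\<lambda>F. dual_pairing \<omega> (\<lambda>\<alpha>. \<Sum>i\<in>F. u i \<alpha>) g) \<longlongrightarrow> dual_pairing \<omega> f g)
          (finite_subsets_at_top A))"

definition L2_has_sum ::
  "('i \<Rightarrow> 'a \<Rightarrow> complex) \<Rightarrow> ('a::euclidean_space \<Rightarrow> complex) \<Rightarrow> 'i set \<Rightarrow> bool" where
  "L2_has_sum u f A \<longleftrightarrow>
     ((\<lambda>F. L2_norm (\<lambda>x. f x - (\<Sum>i\<in>F. u i x))) \<longlongrightarrow> 0) (finite_subsets_at_top A)"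


section \<open>Gabor systems, frames and operators\<close>

definition grid :: "real \<Rightarrow> int^'n \<Rightarrow> real^'n" where
  "grid \<epsilon> k = (\<chi> i. \<epsilon> * of_int (k $ i))"

definition lattice :: "real \<Rightarrow> (real^'n) set" where
  "lattice \<epsilon> = range (grid \<epsilon>)"

definition gabor_frame :: "real \<Rightarrow> (real^'n \<Rightarrow> complex) \<Rightarrow> bool" where
  "gabor_frame \<epsilon> \<phi> \<longleftrightarrow> \<phi> \<in> square_integrable \<and>
     (\<exists>A>0. \<exists>B>0. \<forall>f\<in>square_integrable.
        let s = (\<Sum>\<^sub>\<infinity>(k, \<kappa>)\<in>UNIV. ennreal
          ((cmod (LINT y|lebesgue. f y * cnj (tf_shift (grid \<epsilon> k) (grid \<epsilon> \<kappa>) \<phi> y)))\<^sup>2))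
        in ennreal (A * (L2_norm f)\<^sup>2) \<le> s \<and> s \<le> ennreal (B * (L2_norm f)\<^sup>2))"

definition dual_gabor_frames ::
  "real \<Rightarrow> (real^'n \<Rightarrow> complex) \<Rightarrow> (real^'n \<Rightarrow> complex) \<Rightarrow> bool" where
  "dual_gabor_frames \<epsilon> \<phi> \<psi> \<longleftrightarrow> gabor_frame \<epsilon> \<phi> \<and> gabor_frame \<epsilon> \<psi> \<and>
     (\<forall>f\<in>square_integrable.
        L2_has_sum (\<lambda>(j, \<iota>) y. stft_L2 \<phi> f (j, \<iota>) * tf_shift j \<iota> \<psi> y) f (lattice \<epsilon> \<times> lattice \<epsilon>) \<and>
        L2_has_sum (\<lambda>(j, \<iota>) y. stft_L2 \<psi> f (j, \<iota>) * tf_shift j \<iota> \<phi> y) f (lattice \<epsilon> \<times> lattice \<epsilon>))"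

text \<open>The analysis operator \<open>C\<close> and the synthesis operator \<open>D\<close>. A sequence on the lattice is a
  function on the whole phase space of which only the values at lattice points matter.\<close>

definition gabor_analysis ::
  "real \<Rightarrow> ((real^'n) \<times> (real^'n) \<Rightarrow> real) \<Rightarrow> (real^'n \<Rightarrow> complex) \<Rightarrow> 'n::finite hermite_series \<Rightarrow>
   (real^'n) \<times> (real^'n) \<Rightarrow> complex" where
  "gabor_analysis \<epsilon> \<omega> \<phi> f = restrict (stft \<omega> \<phi> f) (lattice \<epsilon> \<times> lattice \<epsilon>)"

definition gabor_synthesis ::
  "real \<Rightarrow> ((real^'n) \<times> (real^'n) \<Rightarrow> real) \<Rightarrow> (real^'n \<Rightarrow> complex) \<Rightarrow>
   ((real^'n) \<times> (real^'n) \<Rightarrow> complex) \<Rightarrow> 'n::finite hermite_series" where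
  "gabor_synthesis \<epsilon> \<omega> \<psi> c = (THE f. f \<in> modulation_Lp \<infinity> \<omega> \<and>
     weak_star_has_sum \<omega> (\<lambda>(j, \<iota>) \<alpha>. c (j, \<iota>) * hermite_coeffs (tf_shift j \<iota> \<psi>) \<alpha>) f
       (lattice \<epsilon> \<times> lattice \<epsilon>))"

definition gabor_frame_operator ::
  "real \<Rightarrow> ((real^'n) \<times> (real^'n) \<Rightarrow> real) \<Rightarrow> (real^'n \<Rightarrow> complex) \<Rightarrow> (real^'n \<Rightarrow> complex) \<Rightarrow>
   'n::finite hermite_series \<Rightarrow> 'n hermite_series" where
  "gabor_frame_operator \<epsilon> \<omega> \<phi> \<psi> = gabor_synthesis \<epsilon> \<omega> \<psi> \<circ> gabor_analysis \<epsilon> \<omega> \<phi>"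


section \<open>Comparison of quasi-norms\<close>

definition lesssim_on :: "'a set \<Rightarrow> ('a \<Rightarrow> ennreal) \<Rightarrow> ('a \<Rightarrow> ennreal) \<Rightarrow> bool" where
  "lesssim_on A N N' \<longleftrightarrow> (\<exists>c>0. \<forall>f\<in>A. N f \<le> ennreal c * N' f)"

definition equivalent_on :: "'a set \<Rightarrow> ('a \<Rightarrow> ennreal) \<Rightarrow> ('a \<Rightarrow> ennreal) \<Rightarrow> bool" where
  "equivalent_on A N N' \<longleftrightarrow> lesssim_on A N N' \<and> lesssim_on A N' N"

end

theory Submission
 imports Defs "HOL-Complex_Analysis.Complex_Analysis"
begin

text \<open>The short-time Fourier transform \<open>V f\<close> with Gaussian window determines \<open>f\<close> and is, up to a Gaussian
 factor, the entire Bargmann transform of \<open>f\<close>. Its mean value inequality bounds \<open>|V f|\<^sup>r\<close> at a point by a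
 local integral for every \<open>r > 0\<close>, so moderate weights and translates turn continuous quasi-norms into
 discrete ones and back. For \<open>L\<^sup>2\<close> the frame identity expands the reproducing kernel of \<open>V\<close>; integrating
 this expansion against \<open>V f\<close> gives the pointwise Gabor expansion of \<open>V f\<close> for every \<open>f\<close> in \<open>M\<^sup>\<infinity>\<close>. With
 \<open>\<Phi> = \<Theta> (t\<^sup>r)\<close> the quasi-norms become \<open>r\<close>-th roots of Luxemburg gauges, for which the analysis and
 synthesis operators are discrete convolutions with summable sequences. Norm convergence is thus the
 convergence of tails in the sequence space, which follows from the density of Schwartz functions.\<close>

text \<open>Three obstacles shape the constructions. Slices of a Lebesgue measurable weight may fail
  to be measurable; therefore Minkowski's inequality is used only for gauges over countable sets,
  weights are frozen at lattice points, and the continuous side is reached through step functions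
  and cell integrals. For orders below 1 the spaces need not be locally convex, so estimates cannot
  rest on duality; instead everything is first dominated by lattice sequences, where
  \<open>p\<close>-th powers are subadditive, and then raised to the power \<open>p\<close>.
  Finally, the pairing between \<open>M\<^sup>\<infinity>\<close> and \<open>M\<^sup>1\<close> is
  defined through limits along approximating sequences and has a determined value only once the
  Pilipovic space is known to be dense; density is shown with finite combinations of shifted
  Gaussians that imitate a Riemann sum of the reproducing formula. Numerical factors such as 4 and
  16 are those lost in Minkowski's inequality, once per variable.\<close>

type_synonym 'n phase = "(real, 'n) vec \<times> (real, 'n) vec"

abbreviation lint :: "('a::euclidean_space => ennreal) => ennreal" (binder "LI " 10) where
 "lint f \<equiv> nn_integral lborel f"

abbreviation V :: "'n::finite hermite_series => 'n phase => complex" where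
 "V \<equiv> stft_gaussian"

abbreviation (input) en :: "real => ennreal" where
 "en \<equiv> ennreal"

abbreviation flat_dual :: "'n::finite hermite_series set" where
 "flat_dual \<equiv> pilipovic_flat_dual"

section \<open>Star-shaped gauges and their Luxemburg functionals\<close>

lemmas borel_continuous = borel_measurable_continuous_onI

text \<open>A strict sublevel set of a monotone function is closed downwards, hence in a complete
  linear order an initial segment ending at its supremum, with or without the endpoint.\<close>

lemma borel_measurable_mono_ennreal:
 fixes P :: "ennreal => ennreal"
 assumes "mono P"
 shows "P \<in> borel_measurable borel"
proof (rule borel_measurableI_less)
 fix y
 let ?S = "{x. P x < y}"
 have down: "x \<in> ?S" if "x \<le> z" "z \<in> ?S" for x z using monoD[OF assms that(1)] that(2) by auto
 have "?S = {..<Sup ?S} \<or> ?S = {..Sup ?S}"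
 proof (cases "Sup ?S \<in> ?S")
  case True
  have "?S = {..Sup ?S}"
  proof (rule set_eqI)
   fix x show "x \<in> ?S \<longleftrightarrow> x \<in> {..Sup ?S}" using Sup_upper[of x ?S] down[OF _ True, of x] by auto
  qed
  then show ?thesis ..
 next
  case False
  have "?S = {..<Sup ?S}"
  proof (rule set_eqI)
   fix x show "x \<in> ?S \<longleftrightarrow> x \<in> {..<Sup ?S}"
   proof
    assume "x \<in> ?S"
    then have "x \<le> Sup ?S" "x \<noteq> Sup ?S" using False by (auto intro: Sup_upper)
    then show "x \<in> {..<Sup ?S}" by simp
   next
    assume "x \<in> {..<Sup ?S}"
    then obtain z where "z \<in> ?S" "x < z" by (metis (no_types, lifting) less_Sup_iff lessThan_iff)
    then show "x \<in> ?S" using down by (meson less_imp_le)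
   qed
  qed
  then show ?thesis ..
 qed
 then show "{x \<in> space borel. P x < y} \<in> sets borel"
  by (metis (no_types, lifting) Collect_cong UNIV_I borel_closed borel_open closed_atMost open_lessThan space_borel)
qed

lemma ennreal_posE:
 fixes x :: ennreal
 assumes "x \<noteq> 0" "x \<noteq> top"
 obtains r where "x = en r" "r > 0" using assms by (cases x) (auto simp: less_le)

text \<open>The inequality for \<open>u \<le> 1\<close> is star-shapedness, the consequence of
  convexity and vanishing at 0 on which all later estimates rest. The argument ranges over extended
  reals because an inner norm, possibly infinite, is inserted into the outer gauge. The last clause
  stands for growth to infinity and keeps the Luxemburg functional from being trivial.\<close>

definition star_gauge :: "(ennreal => ennreal) => bool" where
 "star_gauge P \<longleftrightarrow> P \<infinity> = \<infinity> \<and> (\<forall>u x. u \<le> 1 \<longrightarrow> P (u * x) \<le> u * P x) \<and> (\<exists>x<\<infinity>. 1 < P x)"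

text \<open>The Luxemburg functional of \<open>P\<close>. Scaling by \<open>inverse a\<close> keeps
  all rearrangements inside commutative multiplication of extended reals.\<close>

definition lux :: "'a measure => (ennreal => ennreal) => ('a => ennreal) => ennreal" where
 "lux M P g = Inf {en a | a. a > 0 \<and> (\<integral>\<^sup>+ x. P (en (inverse a) * g x) \<partial>M) \<le> 1}"

lemma star_gaugeD:
 assumes "star_gauge P"
 shows "P \<infinity> = \<infinity>" "u \<le> 1 ==> P (u * x) \<le> u * P x" using assms unfolding star_gauge_def by auto

lemma star_gauge_0: "star_gauge P ==> P 0 = 0" using star_gaugeD(2)[of P 0 0] by simp

text \<open>Write \<open>x\<close> as \<open>(x / y) * y\<close>: the quotient is at most 1, so
  star-shapedness gives \<open>P x \<le> (x / y) * P y\<close>. The values 0 and infinity of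
  \<open>y\<close> are excluded because the quotient then loses its meaning.\<close>

lemma star_gauge_mono:
 assumes "star_gauge P"
 shows "mono P"
proof
 fix x y :: ennreal assume "x \<le> y"
 show "P x \<le> P y"
 proof (cases "y = \<infinity> \<or> y = 0")
  case True then show ?thesis using star_gaugeD(1)[OF assms] \<open>x \<le> y\<close> by auto
 next
  case False
  then have y: "y \<noteq> 0" "y < top" by (auto simp: top.not_eq_extremum)
  have "x / y \<le> 1" using y \<open>x \<le> y\<close> by (metis divide_right_mono_ennreal ennreal_divide_self)
  moreover have "x / y * y = x" using y by (metis ennreal_divide_times mult.comm_neutral ennreal_divide_self)
  ultimately have "P x \<le> x / y * P y" using star_gaugeD(2)[OF assms, of "x/y" y] by metis
  also have "... \<le> 1 * P y" using \<open>x / y \<le> 1\<close> by (intro mult_right_mono) auto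
  finally show ?thesis by simp
 qed
qed

lemma star_gauge_measurable [measurable_dest]:
 "star_gauge P ==> P \<in> borel_measurable borel" by (intro borel_measurable_mono_ennreal star_gauge_mono)

lemma lux_le:
 assumes "a > 0" "(\<integral>\<^sup>+ x. P (en (inverse a) * g x) \<partial>M) \<le> 1"
 shows "lux M P g \<le> en a" unfolding lux_def using assms by (intro Inf_lower) auto

text \<open>The infimum need not be attained, so the modular bound is available only strictly above
  the functional; this is why \<open>2 * r\<close> appears in the proof of Minkowski's
  inequality.\<close>

lemma lux_less:
 assumes "star_gauge P" "lux M P g < en a"
 shows "(\<integral>\<^sup>+ x. P (en (inverse a) * g x) \<partial>M) \<le> 1"
proof -
 obtain b where b: "b > 0" "(\<integral>\<^sup>+ x. P (en (inverse b) * g x) \<partial>M) \<le> 1" "en b < en a"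
  using assms(2) unfolding lux_def Inf_less_iff by auto
 have "b < a" using b by (simp add: ennreal_less_iff)
 have "(\<integral>\<^sup>+ x. P (en (inverse a) * g x) \<partial>M) \<le> (\<integral>\<^sup>+ x. P (en (inverse b) * g x) \<partial>M)"
  using \<open>b < a\<close> b(1) by (intro nn_integral_mono monoD[OF star_gauge_mono[OF assms(1)]] mult_right_mono)
    (auto intro!: ennreal_leI le_imp_inverse_le)
 then show ?thesis using b by simp
qed

lemma lux_greatest:
 assumes "\<And>a. a > 0 ==> (\<integral>\<^sup>+ x. P (en (inverse a) * g x) \<partial>M) \<le> 1 ==> z \<le> en a"
 shows "z \<le> lux M P g" unfolding lux_def using assms by (intro Inf_greatest) auto

lemma lux_mono:
 assumes "star_gauge P" "\<And>x. x \<in> space M ==> g x \<le> h x"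
 shows "lux M P g \<le> lux M P h"
proof (rule lux_greatest)
 fix a :: real assume a: "a > 0" "(\<integral>\<^sup>+ x. P (en (inverse a) * h x) \<partial>M) \<le> 1"
 have "(\<integral>\<^sup>+ x. P (en (inverse a) * g x) \<partial>M) \<le> (\<integral>\<^sup>+ x. P (en (inverse a) * h x) \<partial>M)"
  by (intro nn_integral_mono monoD[OF star_gauge_mono[OF assms(1)]] mult_left_mono assms(2)) auto
 then show "lux M P g \<le> en a" using a by (intro lux_le) auto
qed

lemma ennreal_le_cmult_iff:
 assumes "c > 0" shows "z \<le> en c * y \<longleftrightarrow> en (inverse c) * z \<le> y"
proof -
 have 1: "en c * en (inverse c) = 1" using assms by (simp add: ennreal_mult[symmetric])
 show ?thesis
 proof
  assume "z \<le> en c * y"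
  then have "en (inverse c) * z \<le> en (inverse c) * (en c * y)" by (intro mult_left_mono) auto
  also have "... = (en c * en (inverse c)) * y" by (simp only: mult_ac)
  finally show "en (inverse c) * z \<le> y" using 1 by simp
 next
  assume "en (inverse c) * z \<le> y"
  then have "en c * (en (inverse c) * z) \<le> en c * y" by (intro mult_left_mono) auto
  then show "z \<le> en c * y" using 1 by (simp add: mult.assoc[symmetric])
 qed
qed

text \<open>A modular bound \<open>K\<close> instead of 1 costs a factor \<open>K\<close> in the
  functional, because shrinking the argument by \<open>K\<close> shrinks \<open>P\<close> at least
  by \<open>K\<close>. Transfers between lattice and continuous gauges reduce to comparing modulars
  in this way.\<close>

lemma lux_modular_le:
 assumes "star_gauge P" "K \<ge> 1" "c > 0"
  and "\<And>a. a > 0 ==> (\<integral>\<^sup>+ x. P (en (inverse a) * h x) \<partial>N) \<le> 1 ==>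
   (\<integral>\<^sup>+ x. P (en (inverse (c * a)) * g x) \<partial>M) \<le> en K"
  and "g \<in> borel_measurable M"
 shows "lux M P g \<le> en (K * c) * lux N P h"
proof -
 have "en (inverse (K * c)) * lux M P g \<le> lux N P h"
 proof (rule lux_greatest)
  fix a :: real assume a: "a > 0" "(\<integral>\<^sup>+ x. P (en (inverse a) * h x) \<partial>N) \<le> 1"
  have invK: "en (inverse K) \<le> 1" using assms(2) by (metis ennreal_1 ennreal_leI inverse_1 le_imp_inverse_le zero_less_one)
  have "(\<integral>\<^sup>+ x. P (en (inverse (K * c * a)) * g x) \<partial>M)
    \<le> (\<integral>\<^sup>+ x. en (inverse K) * P (en (inverse (c * a)) * g x) \<partial>M)"
  proof (rule nn_integral_mono)
   fix x
   have "en (inverse (K * c * a)) * g x = en (inverse K) * (en (inverse (c * a)) * g x)"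
    using assms a by (simp add: mult.assoc[symmetric] ennreal_mult[symmetric])
   then show "P (en (inverse (K * c * a)) * g x)
     \<le> en (inverse K) * P (en (inverse (c * a)) * g x)"
    using star_gaugeD(2)[OF assms(1), of "en (inverse K)"] invK by metis
  qed
  also have "... \<le> en (inverse K) * en K" using assms(4)[OF a] assms(5) star_gauge_measurable[OF assms(1)]
   by (subst nn_integral_cmult) (auto intro!: mult_left_mono)
  also have "... = 1" using assms(2) by (simp add: ennreal_mult[symmetric])
  finally have "lux M P g \<le> en (K * c * a)" using assms a by (intro lux_le) auto
  then have "lux M P g \<le> en (K * c) * en a" using assms a by (simp add: ennreal_mult[symmetric])
  then show "en (inverse (K * c)) * lux M P g \<le> en a" using assms by (subst ennreal_le_cmult_iff[symmetric]) auto
 qed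
 then show ?thesis using assms by (subst ennreal_le_cmult_iff) auto
qed

lemma lux_cmult_le:
 assumes "star_gauge P" "c > 0"
 shows "lux M P (\<lambda>x. en c * g x) \<le> en c * lux M P g"
proof -
 have "en (inverse c) * lux M P (\<lambda>x. en c * g x) \<le> lux M P g"
 proof (rule lux_greatest)
  fix a :: real assume a: "a > 0" "(\<integral>\<^sup>+ x. P (en (inverse a) * g x) \<partial>M) \<le> 1"
  have "inverse (c * a) * c = inverse a" using assms a by (simp add: field_simps)
  then have "en (inverse (c * a)) * (en c * g x) = en (inverse a) * g x" for x
   using assms a by (metis ennreal_mult inverse_nonnegative_iff_nonnegative less_eq_real_def mult.assoc mult_nonneg_nonneg)
  then have "lux M P (\<lambda>x. en c * g x) \<le> en (c * a)" using assms a by (intro lux_le) auto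
  then have "lux M P (\<lambda>x. en c * g x) \<le> en c * en a" using assms a by (simp add: ennreal_mult[symmetric])
  then show "en (inverse c) * lux M P (\<lambda>x. en c * g x) \<le> en a"
   using assms by (subst ennreal_le_cmult_iff[symmetric]) auto
 qed
 then show ?thesis using assms by (subst ennreal_le_cmult_iff) auto
qed

lemma lux_mono_cmult:
 assumes "star_gauge P" "c > 0" "\<And>x. x \<in> space M ==> g x \<le> en c * h x"
 shows "lux M P g \<le> en c * lux M P h" using lux_mono[OF assms(1,3)] lux_cmult_le[OF assms(1,2), of M h] by (rule order_trans)

text \<open>Each point has mass 1: if \<open>g k\<close> reached \<open>T\<close> times an
  admissible \<open>a\<close>, its single term would already push the modular above 1. Sequences of
  finite gauge are therefore bounded.\<close>

lemma lux_point_le: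
 assumes "star_gauge P" "1 < P (en T)" "T > 0" "k \<in> A"
 shows "g k \<le> en T * lux (count_space A) P g"
proof -
 have "en (inverse T) * g k \<le> lux (count_space A) P g"
 proof (rule lux_greatest)
  fix a :: real assume a: "a > 0" "(\<integral>\<^sup>+ x. P (en (inverse a) * g x) \<partial>count_space A) \<le> 1"
  have "P (en (inverse a) * g k) \<le> 1"
   using nn_integral_ge_point[OF assms(4), of "\<lambda>k. P (en (inverse a) * g k)"] a(2) by (rule order_trans)
  then have "\<not> en T \<le> en (inverse a) * g k"
   using assms(2) monoD[OF star_gauge_mono[OF assms(1)], of "en T"] by (meson leD order_trans)
  then have "en (inverse a) * g k \<le> en T" by simp
  then have "g k \<le> en a * en T" using a by (subst ennreal_le_cmult_iff) auto
  then have "g k \<le> en T * en a" by (simp add: mult.commute)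
  then show "en (inverse T) * g k \<le> en a" using assms by (subst ennreal_le_cmult_iff[symmetric]) auto
 qed
 then show ?thesis using assms by (subst ennreal_le_cmult_iff) auto
qed

lemma star_gauge_large:
 assumes "star_gauge P"
 obtains T :: real where "T > 0" "1 < P (en T)"
proof -
 obtain x where x: "x < \<infinity>" "1 < P x" using assms unfolding star_gauge_def by auto
 then obtain T where T: "x = en T" "T \<ge> 0" by (cases x) auto
 have "T \<noteq> 0" using x T star_gauge_0[OF assms] by auto
 then show ?thesis using that[of T] T x by auto
qed

lemma borel_measurable_nn_integral_count_space:
 fixes f :: "'i => 'a => ennreal"
 assumes "countable A" "\<And>k. k \<in> A ==> f k \<in> borel_measurable M"
 shows "(\<lambda>i. \<integral>\<^sup>+ k. f k i \<partial>count_space A) \<in> borel_measurable M"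
proof -
 interpret sigma_finite_measure "count_space A" using assms(1) by (rule sigma_finite_measure_count_space_countable)
 have "(\<lambda>(k, i). f k i) \<in> borel_measurable (count_space A \<Otimes>\<^sub>M M)"
  using assms by (intro measurable_pair_measure_countable1) auto
 from measurable_pair_swap[OF this] show ?thesis by (intro borel_measurable_nn_integral) (simp add: split_def)
qed

text \<open>The sublevel set is a countable union over rational scalings \<open>a\<close>, and for
  each \<open>a\<close> the modular is a countable sum, measurable in the parameter. Countability of
  \<open>A\<close> is what makes an inner gauge an admissible integrand of iterated norms.\<close>

lemma borel_measurable_lux:
 assumes "star_gauge P" "countable A" "\<And>k. k \<in> A ==> f k \<in> borel_measurable M"
 shows "(\<lambda>i. lux (count_space A) P (\<lambda>k. f k i)) \<in> borel_measurable M"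
proof (rule borel_measurableI_less)
 fix y
 note [measurable] = star_gauge_measurable[OF assms(1)] assms(3)
 have "{i \<in> space M. lux (count_space A) P (\<lambda>k. f k i) < y} =
  (\<Union>a\<in>{a\<in>\<rat>. a > 0 \<and> en a < y}. {i \<in> space M. (\<integral>\<^sup>+ k. P (en (inverse a) * f k i) \<partial>count_space A) \<le> 1})"
  (is "?L = ?R")
 proof safe
  fix i assume i: "i \<in> space M" "lux (count_space A) P (\<lambda>k. f k i) < y"
  then obtain a0 where a0: "a0 > 0" "lux (count_space A) P (\<lambda>k. f k i) \<le> en a0" "en a0 < y"
   unfolding lux_def Inf_less_iff by (auto intro: Inf_lower)
  have "\<exists>a. a \<in> \<rat> \<and> a0 < a \<and> en a < y"
  proof (cases y)
   case (real r)
   then have "a0 < r" using a0 by (simp add: ennreal_less_iff)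
   then obtain q where "q \<in> \<rat>" "a0 < q" "q < r" using Rats_dense_in_real by blast
   then show ?thesis using real a0 by (auto simp: ennreal_less_iff)
  next
   case top
   then show ?thesis using Rats_dense_in_real[of a0 "a0 + 1"] by auto
  qed
  then obtain a where a: "a \<in> \<rat>" "a0 < a" "en a < y" by auto
  have "lux (count_space A) P (\<lambda>k. f k i) < en a"
   using a0 a by (meson ennreal_less_iff less_eq_real_def order.strict_trans1 order_less_imp_le)
  from lux_less[OF assms(1) this] show "i \<in> ?R" using i a a0 by auto
 next
  fix i a assume *: "i \<in> space M" "a > 0" "en a < y"
   "(\<integral>\<^sup>+ k. P (en (inverse a) * f k i) \<partial>count_space A) \<le> 1"
  from lux_le[OF *(2,4)] *(3) show "lux (count_space A) P (\<lambda>k. f k i) < y" by (rule order.strict_trans1)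
 qed
 also have "... \<in> sets M"
 proof (rule sets.countable_UN'')
  show "countable {a\<in>\<rat>. a > 0 \<and> en a < y}" by (rule countable_subset[OF _ countable_rat]) auto
  fix a :: real
  have [measurable]: "(\<lambda>i. \<integral>\<^sup>+ k. P (en (inverse a) * f k i) \<partial>count_space A) \<in> borel_measurable M"
   by (rule borel_measurable_nn_integral_count_space) (use assms in auto)
  show "{i \<in> space M. (\<integral>\<^sup>+ k. P (en (inverse a) * f k i) \<partial>count_space A) \<le> 1} \<in> sets M"
   by measurable
 qed
 finally show "?L \<in> sets M" .
qed

text \<open>Jensen's inequality up to the factor \<open>1/2\<close>, which needs no convexity: for \<open>0 < m < \<infinity>\<close> and
 \<open>p * m \<le> P m\<close> the line \<open>x \<mapsto> p * (x - m)\<close> lies below \<open>P\<close>.\<close>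

lemma star_gauge_line:
 assumes "star_gauge P" "p * m \<le> P m" "0 < m"
 shows "p * x \<le> P x + p * m"
proof (cases "x \<le> m")
 case True
 then have "p * x \<le> p * m" by (rule mult_left_mono) auto
 then show ?thesis by (simp add: add_increasing)
next
 case False
 show ?thesis
 proof (cases "x = \<infinity>")
  case True then show ?thesis using star_gaugeD(1)[OF assms(1)] by simp
 next
  case fin: False
  define u where "u = m / x"
  have x: "0 < x" "x < top" using False fin assms(3) by (auto simp: top.not_eq_extremum)
  have u: "u \<le> 1" unfolding u_def using False x by (metis divide_right_mono_ennreal ennreal_divide_self less_irrefl linear)
  have ux: "u * x = m" unfolding u_def using x by (metis ennreal_divide_times less_irrefl mult.comm_neutral ennreal_divide_self)
  have "0 < u" using assms(3) ux by (metis gr_zeroI mult_zero_left less_irrefl)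
  have "u < top" using u by (metis ennreal_one_less_top order.strict_trans1)
  have "u * (p * x) = p * m" using ux by (metis mult.left_commute)
  also have "... \<le> P (u * x)" using assms(2) ux by simp
  also have "... \<le> u * P x" using star_gaugeD(2)[OF assms(1) u] .
  finally have "p * x \<le> P x" using \<open>0 < u\<close> \<open>u < top\<close>
   by (subst (asm) ennreal_mult_le_mult_iff) auto
  then show ?thesis by (simp add: add_increasing2)
 qed
qed

lemma weak_jensen:
 assumes "star_gauge P" "X \<in> borel_measurable M" "w \<in> borel_measurable M"
  and w: "(\<integral>\<^sup>+ x. w x \<partial>M) = 1"
 shows "P (en (1/2) * (\<integral>\<^sup>+ x. X x * w x \<partial>M)) \<le> (\<integral>\<^sup>+ x. P (X x) * w x \<partial>M)"
proof -
 note [measurable] = star_gauge_measurable[OF assms(1)] assms(2,3)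
 let ?I = "\<integral>\<^sup>+ x. X x * w x \<partial>M" and ?R = "\<integral>\<^sup>+ x. P (X x) * w x \<partial>M"
 have line: "p * ?I \<le> ?R + p * m" if "p * m \<le> P m" "0 < m" for p m
 proof -
  have "p * ?I = (\<integral>\<^sup>+ x. (p * X x) * w x \<partial>M)" by (subst nn_integral_cmult[symmetric]) (auto simp: mult.assoc)
  also have "... \<le> (\<integral>\<^sup>+ x. (P (X x) + p * m) * w x \<partial>M)"
   by (intro nn_integral_mono mult_right_mono star_gauge_line[OF assms(1) that]) auto
  also have "... = ?R + p * m" by (simp add: distrib_right nn_integral_add nn_integral_cmult w)
  finally show ?thesis .
 qed
 define m where "m = en (1/2) * ?I"
 have I: "?I = 2 * m" unfolding m_def
 proof -
  have "(2::ennreal) * en (1/2) = en (2 * (1/2))" by (subst ennreal_mult) auto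
  then have "(2::ennreal) * en (1/2) = 1" by (simp del: ennreal_half)
  then show "?I = 2 * (en (1/2) * ?I)" by (metis mult.assoc mult_1)
 qed
 consider "m = 0" | "m = \<infinity>" | "0 < m" "m < \<infinity>" by (metis gr_zeroI infinity_ennreal_def top.not_eq_extremum)
 then have "P m \<le> ?R"
 proof cases
  case 1 then show ?thesis using star_gauge_0[OF assms(1)] by simp
 next
  \<comment> \<open>The line of slope \<open>inverse T\<close> at the point \<open>T\<close> forces
    the right side to be infinite together with the mean.\<close>
  case 2
  obtain T where T: "T > 0" "1 < P (en T)" using star_gauge_large[OF assms(1)] .
  have "en (inverse T) * en T = 1" using T by (simp add: ennreal_mult[symmetric])
  then have "en (inverse T) * ?I \<le> ?R + 1" using line[of "en (inverse T)" "en T"] T by simp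
  moreover have "en (inverse T) * ?I = \<infinity>" using I 2 T by (simp add: ennreal_mult_top)
  ultimately have "?R = \<infinity>" by (simp add: top_unique)
  then show ?thesis by simp
 next
  case 3
  \<comment> \<open>The mean is \<open>2 * m\<close>, so the line of slope \<open>p\<close> at
    \<open>m\<close> gives \<open>p * m + p * m \<le> R + p * m\<close>, and the finite summand
    cancels. The factor 1/2 of the statement is spent here.\<close>
  have key: "p * m \<le> ?R" if "p * m \<le> P m" "p < \<infinity>" for p
  proof -
   have "p * m + p * m \<le> ?R + p * m" using line[OF that(1) 3(1)] I by (metis (no_types, lifting) mult.left_commute mult_2)
   moreover have "p * m < top" using that 3 by (simp add: ennreal_mult_less_top)
   ultimately show ?thesis using ennreal_add_left_cancel_le[of "p * m" "p * m" ?R] by (auto simp: add.commute)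
  qed
  obtain m' where m': "m = en m'" "m' > 0" using ennreal_posE[of m] 3 by auto
  \<comment> \<open>For finite \<open>P m\<close> the slope is \<open>P m / m\<close>. If
    \<open>P m\<close> is infinite every finite slope is admissible, and a large one exceeds any
    finite right side.\<close>
  show ?thesis
  proof (cases "P m = \<infinity>")
   case False
   have "en (inverse m') * P m * m = P m * (en (inverse m') * en m')" using m' by (simp add: mult_ac)
   then have "en (inverse m') * P m * m = P m" using m' by (simp add: ennreal_mult[symmetric])
   then show ?thesis using key[of "en (inverse m') * P m"] False by (simp add: ennreal_mult_less_top top.not_eq_extremum)
  next
   case True
   have "?R = \<infinity>"
   proof (rule ccontr)
    assume "?R \<noteq> \<infinity>"
    then obtain R where R: "?R = en R" "R \<ge> 0" by (cases ?R) auto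
    have "en ((R+1) / m') * m \<le> ?R" using True R by (intro key) auto
    then show False using R m' by (simp add: ennreal_mult[symmetric])
   qed
   then show ?thesis by simp
  qed
 qed
 then show ?thesis unfolding m_def .
qed

lemma lux_zero: "star_gauge P ==> lux M P (\<lambda>_. 0) = 0"
proof -
 assume "star_gauge P"
 then have "lux M P (\<lambda>_. 0) \<le> en a" if "a > 0" for a using that by (intro lux_le) (auto simp: star_gauge_0)
 then show ?thesis by (metis ennreal_le_epsilon add.left_neutral ennreal_zero_less_top le_zero_eq)
qed

text \<open>Minkowski's integral inequality up to the factor 4: one factor 2 comes from
 \<open>weak_jensen\<close>, the other from the infimum in the definition of the norm, which need not be
 attained.\<close>

lemma lux_minkowski:
 assumes "star_gauge P" "countable A" "\<And>k. k \<in> A ==> f k \<in> borel_measurable \<nu>"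
 shows "lux (count_space A) P (\<lambda>k. \<integral>\<^sup>+ i. f k i \<partial>\<nu>)
  \<le> 4 * (\<integral>\<^sup>+ i. lux (count_space A) P (\<lambda>k. f k i) \<partial>\<nu>)"
proof -
 define n where "n i = lux (count_space A) P (\<lambda>k. f k i)" for i
 have [measurable]: "n \<in> borel_measurable \<nu>" unfolding n_def using assms by (rule borel_measurable_lux)
 note [measurable] = star_gauge_measurable[OF assms(1)] assms(3)
 obtain T where T: "T > 0" "1 < P (en T)" using star_gauge_large[OF assms(1)] .
 have pt: "f k i \<le> en T * n i" if "k \<in> A" for k i unfolding n_def using lux_point_le[OF assms(1) T(2,1) that] .
 define D where "D = (\<integral>\<^sup>+ i. n i \<partial>\<nu>)"
 consider "D = \<infinity>" | "D = 0" | d where "D = en d" "d > 0" by (cases D) force+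
 then have "lux (count_space A) P (\<lambda>k. \<integral>\<^sup>+ i. f k i \<partial>\<nu>) \<le> 4 * D"
 proof cases
  case 1 then show ?thesis by (simp add: ennreal_mult_top)
 next
  case 2
  then have "AE i in \<nu>. n i = 0" unfolding D_def by (subst (asm) nn_integral_0_iff_AE) auto
  \<comment> \<open>By \<open>pt\<close> each \<open>f k\<close> is bounded by a multiple of
    \<open>n\<close>, which vanishes almost everywhere in this case.\<close>
  then have "(\<integral>\<^sup>+ i. f k i \<partial>\<nu>) \<le> 0" if "k \<in> A" for k
   using that pt[OF that] by (subst nn_integral_0_iff_AE[THEN iffD2]) (auto elim!: eventually_mono intro!: assms, metis le_zero_eq mult_zero_right)
  then have "lux (count_space A) P (\<lambda>k. \<integral>\<^sup>+ i. f k i \<partial>\<nu>) \<le> lux (count_space A) P (\<lambda>_. 0)"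
   by (intro lux_mono assms) auto
  then show ?thesis using lux_zero[OF assms(1), of "count_space A"] by simp
 next
  case 3
  \<comment> \<open>Divided by its total \<open>d\<close>, the inner gauge \<open>n\<close> becomes
    a probability density \<open>w\<close>, and \<open>X k i\<close> is \<open>f k i\<close> divided
    by \<open>2 * n i\<close>, the 2 keeping the radius strictly above the gauge. Jensen for
    \<open>w\<close> turns the modular of the integral into an average of modulars that are at most
    1.\<close>
  define w where "w i = en (inverse d) * n i" for i
  define X where "X k i = en (1/2) * (f k i * inverse (n i))" for k i
  have [measurable]: "w \<in> borel_measurable \<nu>" unfolding w_def by simp
  have [measurable]: "X k \<in> borel_measurable \<nu>" if "k \<in> A" for k unfolding X_def using that by measurable
  have w1: "(\<integral>\<^sup>+ i. w i \<partial>\<nu>) = 1" unfolding w_def using 3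
   by (simp add: nn_integral_cmult D_def[symmetric] ennreal_mult[symmetric])
  have fin: "AE i in \<nu>. n i \<noteq> \<infinity>" using 3 by (intro nn_integral_PInf_AE) (auto simp: D_def)
  have XW: "en (inverse (4 * d)) * f k i = en (1/2) * (X k i * w i)"
   if "k \<in> A" and ni: "n i \<noteq> \<infinity>" for k i
  proof (cases "n i = 0")
   case True then show ?thesis using pt[OF that(1), of i] by (simp add: w_def)
  next
   case False
   then obtain r where r: "n i = en r" "r > 0" using ennreal_posE[of "n i"] ni by auto
   have "en (1/2) * (X k i * w i) =
     (en (1/2) * en (1/2) * en (inverse r) * en (inverse d) * en r) * f k i"
    unfolding X_def w_def r(1) using r by (simp add: inverse_ennreal mult_ac del: ennreal_half)
   also have "en (1/2) * en (1/2) * en (inverse r) * en (inverse d) * en r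
     = en (1/2 * (1/2) * inverse r * inverse d * r)" using r 3 by (simp add: ennreal_mult[symmetric] del: ennreal_half)
   also have "1/2 * (1/2) * inverse r * inverse d * r = inverse (4 * d)" using r 3 by (simp add: field_simps)
   finally show ?thesis by simp
  qed
  have "(\<integral>\<^sup>+ k. P (en (inverse (4 * d)) * (\<integral>\<^sup>+ i. f k i \<partial>\<nu>)) \<partial>count_space A)
   \<le> (\<integral>\<^sup>+ k. (\<integral>\<^sup>+ i. P (X k i) * w i \<partial>\<nu>) \<partial>count_space A)"
  proof (rule nn_integral_mono)
   fix k assume "k \<in> space (count_space A)"
   then have k[simp]: "k \<in> A" by simp
   have "en (inverse (4 * d)) * (\<integral>\<^sup>+ i. f k i \<partial>\<nu>) = (\<integral>\<^sup>+ i. en (inverse (4 * d)) * f k i \<partial>\<nu>)"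
    by (subst nn_integral_cmult) auto
   also have "... = (\<integral>\<^sup>+ i. en (1/2) * (X k i * w i) \<partial>\<nu>)"
    by (rule nn_integral_cong_AE, use fin in \<open>elim eventually_mono\<close>) (rule XW[OF k])
   also have "... = en (1/2) * (\<integral>\<^sup>+ i. X k i * w i \<partial>\<nu>)" by (subst nn_integral_cmult) auto
   finally show "P (en (inverse (4 * d)) * (\<integral>\<^sup>+ i. f k i \<partial>\<nu>)) \<le> (\<integral>\<^sup>+ i. P (X k i) * w i \<partial>\<nu>)"
    using weak_jensen[OF assms(1) _ _ w1, of "X k"] by (simp del: ennreal_half)
  qed
  also have "... = (\<integral>\<^sup>+ i. (\<integral>\<^sup>+ k. P (X k i) * w i \<partial>count_space A) \<partial>\<nu>)"
   by (intro nn_integral_count_space_nn_integral[symmetric] assms) measurable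
  also have "... \<le> (\<integral>\<^sup>+ i. w i \<partial>\<nu>)"
  proof (rule nn_integral_mono_AE, use fin in \<open>elim eventually_mono\<close>)
   fix i assume i: "n i \<noteq> \<infinity>"
   show "(\<integral>\<^sup>+ k. P (X k i) * w i \<partial>count_space A) \<le> w i"
   proof (cases "n i = 0")
    case True then show ?thesis by (simp add: w_def)
   next
    case False
    then obtain r where r: "n i = en r" "r > 0" using ennreal_posE[of "n i"] i by auto
    have "X k i = en (inverse (2 * r)) * f k i" for k
    proof -
     have "X k i = (en (1/2) * en (inverse r)) * f k i"
      unfolding X_def r(1) using r by (simp add: inverse_ennreal mult_ac del: ennreal_half)
     also have "en (1/2) * en (inverse r) = en (inverse (2 * r))" using r by (subst ennreal_mult[symmetric]) auto
     finally show ?thesis .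
    qed
    moreover have "lux (count_space A) P (\<lambda>k. f k i) < en (2 * r)"
     using r unfolding n_def[symmetric] by (simp add: ennreal_less_iff)
    ultimately have "(\<integral>\<^sup>+ k. P (X k i) \<partial>count_space A) \<le> 1"
     using lux_less[OF assms(1), of "count_space A" "\<lambda>k. f k i" "2 * r"] by simp
    then have "(\<integral>\<^sup>+ k. P (X k i) \<partial>count_space A) * w i \<le> 1 * w i" by (rule mult_right_mono) auto
    then show ?thesis by (subst nn_integral_multc) auto
   qed
  qed
  finally have "lux (count_space A) P (\<lambda>k. \<integral>\<^sup>+ i. f k i \<partial>\<nu>) \<le> en (4 * d)"
   using 3 w1 by (intro lux_le) auto
  then show ?thesis using 3 by (simp add: ennreal_mult)
 qed
 then show ?thesis unfolding D_def n_def .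
qed

section \<open>Sums as integrals with respect to counting measure\<close>

lemma nn_integral_count_space_summable:
 fixes f :: "'a => real"
 assumes "\<And>x. x \<in> A ==> f x \<ge> 0"
 shows "(\<integral>\<^sup>+ x. en (f x) \<partial>count_space A) < \<infinity> \<longleftrightarrow> f summable_on A"
  and "f summable_on A ==> (\<integral>\<^sup>+ x. en (f x) \<partial>count_space A) = en (infsum f A)"
proof -
 have n: "(\<integral>\<^sup>+ x. en (norm (f x)) \<partial>count_space A) = (\<integral>\<^sup>+ x. en (f x) \<partial>count_space A)"
  using assms by (intro nn_integral_cong) simp
 have abs: "Infinite_Set_Sum.abs_summable_on f A \<longleftrightarrow> f summable_on A"
 proof -
  have "Infinite_Set_Sum.abs_summable_on f A \<longleftrightarrow> (\<lambda>x. norm (f x)) summable_on A"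
   by (rule abs_summable_equivalent[symmetric])
  also have "... \<longleftrightarrow> f summable_on A" using assms by (intro summable_on_cong) simp
  finally show ?thesis .
 qed
 have "integrable (count_space A) f \<longleftrightarrow> (\<integral>\<^sup>+ x. en (f x) \<partial>count_space A) < \<infinity>"
  unfolding integrable_iff_bounded n by simp
 then show "(\<integral>\<^sup>+ x. en (f x) \<partial>count_space A) < \<infinity> \<longleftrightarrow> f summable_on A"
  using abs unfolding abs_summable_on_def by simp
 assume s: "f summable_on A"
 then have i: "integrable (count_space A) f" using abs unfolding abs_summable_on_def by simp
 have "(\<integral>\<^sup>+ x. en (f x) \<partial>count_space A) = en (LINT x|count_space A. f x)"
  using assms by (intro nn_integral_eq_integral i) (simp add: AE_count_space)
 also have "(LINT x|count_space A. f x) = infsum f A" using infsetsum_infsum[of f A] abs s unfolding infsetsum_def by simp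
 finally show "(\<integral>\<^sup>+ x. en (f x) \<partial>count_space A) = en (infsum f A)" .
qed

text \<open>A finite total makes \<open>f\<close> real valued, and the tail off a finite set is then
  the total minus a partial sum; its convergence along finite sets is summability itself.\<close>

lemma nn_integral_count_space_tail:
 fixes f :: "'a => ennreal"
 assumes fin: "(\<integral>\<^sup>+ x. f x \<partial>count_space A) < \<infinity>"
 shows "((\<lambda>F. \<integral>\<^sup>+ x. f x * indicator (- F) x \<partial>count_space A) \<longlongrightarrow> 0) (finite_subsets_at_top A)"
proof -
 have ftop: "f x < top" if "x \<in> A" for x
  using nn_integral_ge_point[OF that, of f] fin by (simp add: less_top[symmetric] top_unique) (metis top_unique)
 define g where "g x = enn2real (f x)" for x
 have g: "f x = en (g x)" if "x \<in> A" for x using ftop[OF that] by (simp add: g_def)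
 have g0: "g x \<ge> 0" for x by (simp add: g_def)
 have "(\<integral>\<^sup>+ x. en (g x) \<partial>count_space A) = (\<integral>\<^sup>+ x. f x \<partial>count_space A)"
  by (intro nn_integral_cong) (simp add: g)
 then have s: "g summable_on A" using nn_integral_count_space_summable(1)[of A g] g0 fin by simp
 have eq: "(\<integral>\<^sup>+ x. f x * indicator (- F) x \<partial>count_space A) = en (infsum g A - sum g F)" if F: "finite F" "F \<subseteq> A" for F
 proof -
  have "(\<integral>\<^sup>+ x. f x * indicator (- F) x \<partial>count_space A) = (\<integral>\<^sup>+ x. en (g x) \<partial>count_space (A - F))"
   by (subst (1 2) nn_integral_count_space_indicator) (auto intro!: nn_integral_cong simp: g split: split_indicator)
  also have "... = en (infsum g (A - F))"
   by (rule nn_integral_count_space_summable(2)) (use g0 summable_on_subset_banach[OF s] in auto)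
  also have "infsum g (A - F) = infsum g A - sum g F" using infsum_Diff[OF s _ F(2)] F by simp
  finally show ?thesis .
 qed
 have "((\<lambda>F. en (infsum g A - sum g F)) \<longlongrightarrow> en (infsum g A - infsum g A)) (finite_subsets_at_top A)"
  using has_sum_infsum[OF s] unfolding has_sum_def by (intro tendsto_intros) auto
 then have "((\<lambda>F. en (infsum g A - sum g F)) \<longlongrightarrow> 0) (finite_subsets_at_top A)" by simp
 then show ?thesis by (rule Lim_transform_eventually) (rule eventually_finite_subsets_at_top_weakI, simp add: eq)
qed

lemma norm_has_sum_le:
 fixes f :: "'a => complex"
 assumes "(f has_sum b) A"
 shows "en (cmod b) \<le> (\<integral>\<^sup>+ i. en (cmod (f i)) \<partial>count_space A)"
proof (cases "(\<lambda>i. cmod (f i)) summable_on A")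
 case True
 then show ?thesis using norm_infsum_bound[OF True] infsumI[OF assms]
  by (subst nn_integral_count_space_summable(2)) (auto intro: ennreal_leI)
next
 case False
 then show ?thesis using nn_integral_count_space_summable(1)[of A "\<lambda>i. cmod (f i)"] by (simp add: less_top[symmetric])
qed

lemma norm_has_sum_diff_le:
 fixes f :: "'a => complex"
 assumes "(f has_sum b) A" "finite S" "S \<subseteq> A"
 shows "en (cmod (b - sum f S)) \<le> (\<integral>\<^sup>+ i. en (cmod (f i)) * indicator (- S) i \<partial>count_space A)"
proof -
 have "(f has_sum (b - sum f S)) (A - S)" using assms by (intro has_sum_Diff has_sum_finite) auto
 then have "en (cmod (b - sum f S)) \<le> (\<integral>\<^sup>+ i. en (cmod (f i)) \<partial>count_space (A - S))" by (rule norm_has_sum_le)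
 also have "... = (\<integral>\<^sup>+ i. en (cmod (f i)) * indicator (- S) i \<partial>count_space A)"
  by (subst (1 2) nn_integral_count_space_indicator) (auto intro!: nn_integral_cong split: split_indicator)
 finally show ?thesis .
qed

text \<open>Unordered sums converge along the net of finite subsets, to which dominated convergence
  for sequences does not apply. The error after a finite set is instead bounded by the integral of
  the termwise tail, which Tonelli turns into the tail of a convergent numerical series.\<close>

lemma has_sum_lebesgue_integral:
 fixes f :: "'i => 'a => complex"
 assumes A: "countable A" and f: "\<And>i. i \<in> A ==> integrable M (f i)" and F: "F \<in> borel_measurable M"
  and sum: "\<And>x. x \<in> space M ==> ((\<lambda>i. f i x) has_sum F x) A"
  and fin: "(\<integral>\<^sup>+ i. \<integral>\<^sup>+ x. en (cmod (f i x)) \<partial>M \<partial>count_space A) < \<infinity>"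
 shows "integrable M F" and "((\<lambda>i. integral\<^sup>L M (f i)) has_sum integral\<^sup>L M F) A"
proof -
 let ?t = "\<lambda>S. \<integral>\<^sup>+ i. (\<integral>\<^sup>+ x. en (cmod (f i x)) \<partial>M) * indicator (- S) i \<partial>count_space A"
 let ?d = "\<lambda>S. (\<Sum>i\<in>S. integral\<^sup>L M (f i)) - integral\<^sup>L M F"
 have fm: "(\<lambda>x. en (cmod (f i x))) \<in> borel_measurable M" if "i \<in> A" for i
  by (rule measurable_compose[OF measurable_compose[OF borel_measurable_integrable[OF f[OF that]] borel_measurable_norm] measurable_ennreal])
 have "(\<integral>\<^sup>+ x. en (norm (F x)) \<partial>M) \<le> (\<integral>\<^sup>+ x. \<integral>\<^sup>+ i. en (cmod (f i x)) \<partial>count_space A \<partial>M)"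
  by (intro nn_integral_mono norm_has_sum_le sum)
 also have "... = (\<integral>\<^sup>+ i. \<integral>\<^sup>+ x. en (cmod (f i x)) \<partial>M \<partial>count_space A)"
  by (rule nn_integral_count_space_nn_integral[OF A fm])
 finally show Fi: "integrable M F" using F fin unfolding integrable_iff_bounded by (auto intro: le_less_trans)
 have bd: "en (norm (?d S)) \<le> ?t S" if S: "finite S" "S \<subseteq> A" for S
 proof -
  have si: "integrable M (\<lambda>x. \<Sum>i\<in>S. f i x)" using S f by (intro Bochner_Integration.integrable_sum) auto
  have "(\<Sum>i\<in>S. integral\<^sup>L M (f i)) = (LINT x|M. (\<Sum>i\<in>S. f i x))"
   by (rule Bochner_Integration.integral_sum[symmetric]) (use S f in auto)
  then have "norm (?d S) = norm (LINT x|M. F x - (\<Sum>i\<in>S. f i x))"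
   using Bochner_Integration.integral_diff[OF Fi si] by (simp add: norm_minus_commute)
  then have "en (norm (?d S)) \<le> (\<integral>\<^sup>+ x. en (norm (F x - (\<Sum>i\<in>S. f i x))) \<partial>M)"
   using integral_norm_bound_ennreal[OF Bochner_Integration.integrable_diff[OF Fi si]] by simp
  also have "... \<le> (\<integral>\<^sup>+ x. \<integral>\<^sup>+ i. en (cmod (f i x)) * indicator (- S) i \<partial>count_space A \<partial>M)"
   by (intro nn_integral_mono norm_has_sum_diff_le sum S)
  also have "... = (\<integral>\<^sup>+ i. \<integral>\<^sup>+ x. en (cmod (f i x)) * indicator (- S) i \<partial>M \<partial>count_space A)"
   by (rule nn_integral_count_space_nn_integral[OF A]) (intro borel_measurable_times_ennreal fm borel_measurable_const)
  also have "... = ?t S" by (intro nn_integral_cong nn_integral_multc fm) simp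
  finally show ?thesis .
 qed
 have "((\<lambda>S. en (norm (?d S))) \<longlongrightarrow> 0) (finite_subsets_at_top A)"
  by (rule tendsto_sandwich[OF _ _ tendsto_const nn_integral_count_space_tail[OF fin]])
   (simp, rule eventually_finite_subsets_at_top_weakI, rule bd)
 then have "((\<lambda>S. norm (?d S)) \<longlongrightarrow> 0) (finite_subsets_at_top A)"
  unfolding ennreal_0[symmetric] by (subst (asm) tendsto_ennreal_iff) auto
 then show "((\<lambda>i. integral\<^sup>L M (f i)) has_sum integral\<^sup>L M F) A"
  unfolding has_sum_def by (rule LIM_zero_cancel[OF tendsto_norm_zero_cancel])
qed

section \<open>Lattice cells\<close>

lemma countable_lattice: "countable (lattice E)" unfolding lattice_def by (rule countable_image) auto

lemma lattice_add: "j \<in> lattice E ==> k \<in> lattice E ==> j + k \<in> lattice E"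
proof -
 assume "j \<in> lattice E" "k \<in> lattice E"
 then obtain a b where "j = grid E a" "k = grid E b" unfolding lattice_def by auto
 then have "j + k = grid E (\<chi> i. a $ i + b $ i)" by (auto simp: grid_def vec_eq_iff algebra_simps)
 then show ?thesis unfolding lattice_def by auto
qed

lemma lattice_minus: "j \<in> lattice E ==> - j \<in> lattice E"
proof -
 assume "j \<in> lattice E"
 then obtain a where "j = grid E a" unfolding lattice_def by auto
 then have "- j = grid E (\<chi> i. - a $ i)" by (auto simp: grid_def vec_eq_iff algebra_simps)
 then show ?thesis unfolding lattice_def by auto
qed

lemma lattice_diff: "j \<in> lattice E ==> k \<in> lattice E ==> j - k \<in> lattice E"
 using lattice_add[OF _ lattice_minus, of j E k] by simp

lemma lattice_0: "0 \<in> lattice E"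
proof -
 have "0 = grid E 0" by (simp add: grid_def vec_eq_iff)
 then show ?thesis unfolding lattice_def by blast
qed

text \<open>Lower corner of the half-open lattice cube containing \<open>x\<close>. A corner, unlike
  an integer index, can be subtracted from \<open>x\<close> and inserted into a weight.\<close>

definition cell :: "real => real^'n => real^'n" where
 "cell E x = grid E (\<chi> i. \<lfloor>x $ i / E\<rfloor>)"

lemma cell_in_lattice [simp]: "cell E x \<in> lattice E" unfolding cell_def lattice_def by auto

lemma cell_add_lattice:
 assumes "E > 0" "j \<in> lattice E"
 shows "cell E (j + x) = j + cell E x"
proof -
 obtain a where a: "j = grid E a" using assms unfolding lattice_def by auto
 have "\<lfloor>(E * real_of_int (a $ i) + x $ i) / E\<rfloor> = a $ i + \<lfloor>x $ i / E\<rfloor>" for i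
 proof -
  have "(E * real_of_int (a $ i) + x $ i) / E = of_int (a $ i) + x $ i / E" using assms by (simp add: field_simps)
  then show ?thesis by (simp add: add.commute)
 qed
 then show ?thesis by (simp add: cell_def a grid_def vec_eq_iff algebra_simps)
qed

lemma cell_eq_iff:
 assumes "E > 0" "j \<in> lattice E"
 shows "cell E x = j \<longleftrightarrow> (\<forall>i. j $ i \<le> x $ i \<and> x $ i < j $ i + E)"
proof -
 obtain a where a: "j = grid E a" using assms unfolding lattice_def by auto
 have "\<lfloor>x $ i / E\<rfloor> = a $ i \<longleftrightarrow> E * a $ i \<le> x $ i \<and> x $ i < E * a $ i + E" for i
  using assms by (subst floor_eq_iff) (auto simp: field_simps)
 then show ?thesis using assms(1) by (simp add: cell_def a grid_def vec_eq_iff)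
qed

lemma cell_eq_0_iff: "E > 0 ==> cell E (x::real^'n) = 0 \<longleftrightarrow> (\<forall>i. 0 \<le> x $ i \<and> x $ i < E)"
 using cell_eq_iff[of E "0::real^'n" x, OF _ lattice_0] by simp

lemma cell_minus_cell: "E > 0 ==> cell E (x - cell E x) = 0"
 using cell_add_lattice[of E "- cell E x" x] lattice_minus[of "cell E x"] by simp

definition cube :: "real => (real^'n) set" where
 "cube E = {u. \<forall>i. 0 \<le> u $ i \<and> u $ i < E}"

lemma cube_iff: "E > 0 ==> u \<in> cube E \<longleftrightarrow> cell E u = 0"
 using cell_eq_0_iff[of E u] by (auto simp: cube_def)

lemma cube_borel [measurable]: "cube E \<in> sets borel"
proof -
 have "cube E = (\<Inter>i\<in>UNIV. {u. 0 \<le> u $ i} \<inter> {u. u $ i < E})" unfolding cube_def by auto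
 also have "... \<in> sets borel" by (intro sets.countable_INT'' sets.Int borel_closed borel_open closed_Collect_le open_Collect_less)
    (auto intro!: continuous_intros)
 finally show ?thesis .
qed

lemma emeasure_cube:
 assumes "E > 0"
 shows "0 < emeasure lborel (cube E :: (real^'n) set)" "emeasure lborel (cube E :: (real^'n) set) < \<infinity>"
proof -
 let ?e = "(\<chi> i. E) :: real^'n"
 have "box 0 ?e \<subseteq> cube E" by (auto simp: cube_def mem_box_cart intro: less_imp_le)
 moreover have "0 < emeasure lborel (box 0 ?e)"
  using assms by (subst emeasure_lborel_box_eq) (auto simp: Basis_vec_def inner_axis intro!: prod_pos)
 ultimately show "0 < emeasure lborel (cube E :: (real^'n) set)"
  using emeasure_mono[of "box 0 ?e" "cube E" lborel] by (auto intro: less_le_trans)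
 have "cube E \<subseteq> cbox 0 ?e" by (simp add: cube_def mem_box_cart subset_iff less_imp_le)
 then have "emeasure lborel (cube E :: (real^'n) set) \<le> emeasure lborel (cbox 0 ?e)" by (intro emeasure_mono) auto
 also have "... < \<infinity>" by (rule emeasure_lborel_cbox_finite)
 finally show "emeasure lborel (cube E :: (real^'n) set) < \<infinity>" .
qed

definition cube_vol :: "real => 'n::finite itself => real" where
 "cube_vol E _ = measure lborel (cube E :: (real^'n) set)"

lemma cube_vol:
 assumes "E > 0"
 shows "cube_vol E TYPE('n) > 0" "emeasure lborel (cube E :: (real^'n) set) = en (cube_vol E TYPE('n))"
 using emeasure_cube[OF assms, where 'n='n] unfolding cube_vol_def measure_def by (simp_all add: enn2real_positive_iff)

lemma borel_measurable_cell [measurable]: "cell E \<in> borel \<rightarrow>\<^sub>M borel"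
proof -
 have [measurable]: "(\<lambda>x::real^'n. x $ i) \<in> borel_measurable borel" for i
  by (rule borel_continuous) (auto intro!: continuous_intros)
 have "(\<lambda>x. \<Sum>i\<in>UNIV. (E * of_int \<lfloor>x $ i / E\<rfloor>) *\<^sub>R axis i 1 :: real^'n) \<in> borel_measurable borel"
  by measurable
 also have "(\<lambda>x. \<Sum>i\<in>UNIV. (E * of_int \<lfloor>x $ i / E\<rfloor>) *\<^sub>R axis i 1 :: real^'n) = cell E"
  by (auto simp: fun_eq_iff cell_def grid_def vec_eq_iff axis_def if_distrib sum.If_cases cong: if_cong)
 finally show ?thesis .
qed

lemma borel_measurable_step [measurable]:
 fixes s :: "real^'n => 'b::topological_space"
 shows "(\<lambda>x. s (cell E x)) \<in> borel_measurable borel"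
proof -
 have "cell E \<in> borel \<rightarrow>\<^sub>M count_space (lattice E :: (real^'n) set)"
 proof (subst measurable_count_space_eq_countable[OF countable_lattice], safe)
  fix j :: "real^'n"
  have "cell E -` {j} \<in> sets borel" using measurable_sets[OF borel_measurable_cell, of "{j}" E] by simp
  then show "cell E -` {j} \<inter> space borel \<in> sets borel" by simp
 qed auto
 from measurable_compose[OF this, of s borel] show ?thesis by simp
qed

lemma nn_integral_translate_lborel:
 fixes c :: "'a::euclidean_space"
 assumes "f \<in> borel_measurable borel"
 shows "(LI x. f (c + x)) = (LI x. f x)"
proof -
 have "(LI x. f x) = (\<integral>\<^sup>+ x. f x \<partial>distr lborel borel ((+) c))" by (simp add: lborel_distr_plus)
 also have "... = (LI x. f (c + x))" using assms by (subst nn_integral_distr) auto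
 finally show ?thesis by simp
qed

lemma nn_integral_count_space_delta:
 fixes f :: "'a => ennreal"
 assumes "k \<in> A"
 shows "(\<integral>\<^sup>+ j. (if j = k then f j else 0) \<partial>count_space A) = f k"
 by (subst nn_integral_count_space'[where A="{k}"]) (use assms in auto)

lemma nn_integral_cells:
 fixes f :: "real^'n => ennreal"
 assumes [measurable]: "f \<in> borel_measurable borel" and e: "E > 0"
 shows "(LI x. f x) =
  (\<integral>\<^sup>+ j. (LI u. f (j + u) * indicator (cube E) u) \<partial>count_space (lattice E))"
proof -
 have "(LI x. f x) =
  (LI x. (\<integral>\<^sup>+ j. (if j = cell E x then f x else 0) \<partial>count_space (lattice E)))"
  by (intro nn_integral_cong, subst nn_integral_count_space_delta) auto
 also have "... = (\<integral>\<^sup>+ j. (LI x. (if j = cell E x then f x else 0)) \<partial>count_space (lattice E))"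
  by (intro nn_integral_count_space_nn_integral countable_lattice) measurable
 also have "... = (\<integral>\<^sup>+ j. (LI u. f (j + u) * indicator (cube E) u) \<partial>count_space (lattice E))"
 proof (rule nn_integral_cong)
  fix j :: "real^'n" assume "j \<in> space (count_space (lattice E))"
  then have j: "j \<in> lattice E" by simp
  have "(LI x. (if j = cell E x then f x else 0))
    = (LI x. (if j = cell E (j + x) then f (j + x) else 0))" by (subst nn_integral_translate_lborel[symmetric, where c=j]) auto
  also have "... = (LI u. f (j + u) * indicator (cube E) u)"
   by (intro nn_integral_cong) (auto simp: cell_add_lattice[OF e j] cube_iff[OF e] split: split_indicator)
  finally show "(LI x. (if j = cell E x then f x else 0))
    = (LI u. f (j + u) * indicator (cube E) u)" .
 qed
 finally show ?thesis .
qed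

lemma nn_integral_step:
 fixes s :: "real^'n => ennreal"
 assumes e: "E > 0"
 shows "(LI x. s (cell E x)) = en (cube_vol E TYPE('n)) * (\<integral>\<^sup>+ j. s j \<partial>count_space (lattice E))"
proof -
 have [measurable]: "(\<lambda>x. s (cell E x)) \<in> borel_measurable borel" by (rule borel_measurable_step)
 have "(LI x. s (cell E x)) =
  (\<integral>\<^sup>+ j. (LI u. s (cell E (j + u)) * indicator (cube E) u) \<partial>count_space (lattice E))"
  by (rule nn_integral_cells[OF _ e]) measurable
 also have "... = (\<integral>\<^sup>+ j. (\<integral>\<^sup>+ u. s j * indicator (cube E) u \<partial>(lborel :: (real^'n) measure)) \<partial>count_space (lattice E))"
  by (intro nn_integral_cong)
    (auto simp: cell_add_lattice[OF e] cube_iff[OF e] split: split_indicator)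
 also have "... = (\<integral>\<^sup>+ j. en (cube_vol E TYPE('n)) * s j \<partial>count_space (lattice E :: (real^'n) set))"
  using cube_vol[OF e, where 'n='n] by (simp add: nn_integral_cmult_indicator mult.commute)
 finally show ?thesis by (simp add: nn_integral_cmult)
qed

section \<open>Comparing gauges on the lattice and on the whole space\<close>

lemma lux_lebesgue: "lux lebesgue P g = lux lborel P g" unfolding lux_def by (simp add: nn_integral_completion)

text \<open>Jensen's inequality on each cell with normalised volume bounds the modular of the cell
  integrals by that of \<open>g\<close> divided by the cell volume \<open>m\<close>. The factor 2 is
  the one lost in \<open>weak_jensen\<close>, and \<open>K\<close> absorbs \<open>inverse m\<close>
  when cells are small.\<close>

lemma lux_lattice_average_le:
 fixes g :: "real^'n => ennreal"
 assumes "star_gauge P" "E > 0"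
 obtains C where "C > 0" "\<And>g::real^'n => ennreal. g \<in> borel_measurable borel ==>
  lux (count_space (lattice E)) P (\<lambda>j. (LI u. g (j + u) * indicator (cube E) u))
  \<le> en C * lux lborel P g"
proof -
 let ?A = "\<lambda>g j. (LI u. g (j + u) * indicator (cube E) u)"
 define m where "m = cube_vol E TYPE('n)"
 have m: "m > 0" "emeasure lborel (cube E :: (real^'n) set) = en m" using cube_vol[OF assms(2), where 'n='n] by (auto simp: m_def)
 define K where "K = max 1 (inverse m)"
 have K: "K \<ge> 1" "inverse m \<le> K" unfolding K_def by auto
 note [measurable] = star_gauge_measurable[OF assms(1)]
 have "lux (count_space (lattice E)) P (?A g)
  \<le> en (K * (2 * m)) * lux lborel P g"
  if [measurable]: "g \<in> borel_measurable borel" for g :: "real^'n => ennreal"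
 proof (rule lux_modular_le[OF assms(1) K(1)])
  fix a :: real assume a: "a > 0" "(LI x. P (en (inverse a) * g x)) \<le> 1"
  let ?w = "\<lambda>u::real^'n. en (inverse m) * indicator (cube E) u"
  have w1: "(LI u. ?w u) = 1" using m by (simp add: nn_integral_cmult_indicator ennreal_mult[symmetric])
  have "(\<integral>\<^sup>+ j. P (en (inverse (2 * m * a)) *
    ?A g j) \<partial>count_space (lattice E))
   \<le> (\<integral>\<^sup>+ j. (LI u. P (en (inverse a) * g (j + u)) * ?w u) \<partial>count_space (lattice E))"
  proof (rule nn_integral_mono)
   fix j :: "real^'n"
   have "inverse (2 * m * a) = 1/2 * (inverse a * inverse m)" using m a by (simp add: field_simps)
   then have "en (inverse (2 * m * a)) = en (1/2) * (en (inverse a) * en (inverse m))"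
    using m a by (simp add: ennreal_mult[symmetric] del: ennreal_half)
   then have "en (inverse (2 * m * a)) * ?A g j
     = en (1/2) * ((en (inverse a) * en (inverse m)) * ?A g j)" by (simp only: mult.assoc)
   also have "(en (inverse a) * en (inverse m)) * ?A g j
     = (LI u. (en (inverse a) * g (j + u)) * ?w u)" by (subst nn_integral_cmult[symmetric]) (auto simp: mult_ac)
   also have "P (en (1/2) * ...) \<le> (LI u. P (en (inverse a) * g (j + u)) * ?w u)"
    by (rule weak_jensen[OF assms(1) _ _ w1]) measurable
   finally show "P (en (inverse (2 * m * a)) * ?A g j)
     \<le> (LI u. P (en (inverse a) * g (j + u)) * ?w u)" .
  qed
  also have "... = (\<integral>\<^sup>+ j. en (inverse m) * (LI u. P (en (inverse a) * g (j + u)) * indicator (cube E) u) \<partial>count_space (lattice E))"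
   by (intro nn_integral_cong, subst nn_integral_cmult[symmetric]) (auto simp: mult_ac)
  also have "... = en (inverse m) * (LI x. P (en (inverse a) * g x))"
   by (subst nn_integral_cmult) (auto simp: nn_integral_cells[OF _ assms(2), of "\<lambda>x. P (en (inverse a) * g x)"])
  also have "... \<le> en (inverse m) * 1" by (intro mult_left_mono a) auto
  also have "... \<le> en K" using K by (simp add: ennreal_leI)
  finally show "(\<integral>\<^sup>+ j. P (en (inverse (2 * m * a)) *
    ?A g j) \<partial>count_space (lattice E)) \<le> en K" .
 qed (use m in auto)
 then show ?thesis using that[of "K * (2 * m)"] m K by auto
qed

text \<open>The modular of a step function is the cell volume \<open>m\<close> times that of its
  sequence; \<open>K\<close> absorbs a volume above 1.\<close>

lemma lux_step_le:
 assumes "star_gauge P" "E > 0"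
 obtains C where "C > 0" "\<And>s::real^'n => ennreal.
  lux lborel P (\<lambda>x. s (cell E x)) \<le> en C * lux (count_space (lattice E)) P s"
proof -
 define m where "m = cube_vol E TYPE('n)"
 have m: "m > 0" using cube_vol[OF assms(2), where 'n='n] by (auto simp: m_def)
 define K where "K = max 1 m"
 have K: "K \<ge> 1" "m \<le> K" unfolding K_def by auto
 have "lux lborel P (\<lambda>x. s (cell E x)) \<le> en (K * 1) * lux (count_space (lattice E)) P s"
  for s :: "real^'n => ennreal"
 proof (rule lux_modular_le[OF assms(1) K(1)])
  fix a :: real assume a: "a > 0" "(\<integral>\<^sup>+ x. P (en (inverse a) * s x) \<partial>count_space (lattice E)) \<le> 1"
  have "(LI x. P (en (inverse (1 * a)) * s (cell E x))) =
    en m * (\<integral>\<^sup>+ x. P (en (inverse a) * s x) \<partial>count_space (lattice E))"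
   using nn_integral_step[OF assms(2), of "\<lambda>x. P (en (inverse a) * s x)"] by (simp add: m_def)
  also have "... \<le> en m * 1" by (intro mult_left_mono a) auto
  also have "... \<le> en K" using K by (simp add: ennreal_leI)
  finally show "(LI x. P (en (inverse (1 * a)) * s (cell E x))) \<le> en K" .
 qed auto
 then show ?thesis using that[of K] K by auto
qed

section \<open>Mixed gauges in two variables\<close>

definition mlux :: "'a measure => (ennreal => ennreal) => (ennreal => ennreal) => ('a \<times> 'a => ennreal) => ennreal" where
 "mlux M P Q g = lux M Q (\<lambda>\<xi>. lux M P (\<lambda>x. g (x, \<xi>)))"

abbreviation slux :: "real => (ennreal => ennreal) => (ennreal => ennreal) => ('n::finite phase => ennreal) => ennreal" where
 "slux E \<equiv> mlux (count_space (lattice E))"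

lemma mlux_lebesgue: "mlux lebesgue P Q g = mlux lborel P Q g" unfolding mlux_def lux_lebesgue ..

lemma mlux_mono:
 assumes "star_gauge P" "star_gauge Q"
  and "\<And>x \<xi>. x \<in> space M ==> \<xi> \<in> space M ==> g (x, \<xi>) \<le> h (x, \<xi>)"
 shows "mlux M P Q g \<le> mlux M P Q h" unfolding mlux_def using assms by (intro lux_mono)

lemma mlux_mono_cmult:
 assumes "star_gauge P" "star_gauge Q" "c > 0"
  and "\<And>x \<xi>. x \<in> space M ==> \<xi> \<in> space M ==> g (x, \<xi>) \<le> en c * h (x, \<xi>)"
 shows "mlux M P Q g \<le> en c * mlux M P Q h" unfolding mlux_def using assms by (intro lux_mono_cmult) auto

text \<open>Minkowski's inequality is applied in the first variable and then in the second, which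
  squares the factor 4. In between, the inner gauge has to be measurable in \<open>i\<close>, which
  \<open>borel_measurable_lux\<close> supplies.\<close>

lemma mlux_minkowski:
 fixes A :: "'a set"
 assumes "star_gauge P" "star_gauge Q" "countable A"
  and meas: "\<And>k. k \<in> A \<times> A ==> f k \<in> borel_measurable \<nu>"
 shows "mlux (count_space A) P Q (\<lambda>k. \<integral>\<^sup>+ i. f k i \<partial>\<nu>)
  \<le> 16 * (\<integral>\<^sup>+ i. mlux (count_space A) P Q (\<lambda>k. f k i) \<partial>\<nu>)"
proof -
 have "mlux (count_space A) P Q (\<lambda>k. \<integral>\<^sup>+ i. f k i \<partial>\<nu>)
  \<le> en 4 * lux (count_space A) Q (\<lambda>l. \<integral>\<^sup>+ i. lux (count_space A) P (\<lambda>k. f (k, l) i) \<partial>\<nu>)"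
  unfolding mlux_def by (rule lux_mono_cmult[OF assms(2)]) (use lux_minkowski[OF assms(1,3), of "\<lambda>k. f (k, _)" \<nu>] meas in auto)
 also have "... \<le> en 4 * (4 * (\<integral>\<^sup>+ i. lux (count_space A) Q (\<lambda>l. lux (count_space A) P (\<lambda>k. f (k, l) i)) \<partial>\<nu>))"
  by (intro mult_left_mono lux_minkowski borel_measurable_lux assms) auto
 also have "... = 16 * (\<integral>\<^sup>+ i. mlux (count_space A) P Q (\<lambda>k. f k i) \<partial>\<nu>)"
  by (simp add: mlux_def mult.assoc[symmetric])
 finally show ?thesis .
qed

lemma mlux_point_le:
 assumes "star_gauge P" "star_gauge Q"
 obtains T where "T > 0" "\<And>A k g. k \<in> A \<times> A ==> g k \<le> en T * mlux (count_space A) P Q g"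
proof -
 obtain T1 where T1: "T1 > 0" "1 < P (en T1)" using star_gauge_large[OF assms(1)] .
 obtain T2 where T2: "T2 > 0" "1 < Q (en T2)" using star_gauge_large[OF assms(2)] .
 have "g k \<le> en (T1 * T2) * mlux (count_space A) P Q g" if kA: "k \<in> A \<times> A" for A k and g :: "'a \<times> 'a => ennreal"
 proof -
  obtain x \<xi> where k: "k = (x, \<xi>)" "x \<in> A" "\<xi> \<in> A" using kA by auto
  have "g k \<le> en T1 * lux (count_space A) P (\<lambda>x. g (x, \<xi>))"
   unfolding k(1) by (rule lux_point_le[OF assms(1) T1(2,1) k(2)])
  also have "... \<le> en T1 * (en T2 * mlux (count_space A) P Q g)"
   unfolding mlux_def by (intro mult_left_mono lux_point_le[OF assms(2) T2(2,1) k(3)]) auto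
  finally show ?thesis using T1 T2 by (simp add: ennreal_mult mult.assoc)
 qed
 then show ?thesis using that[of "T1 * T2"] T1 T2 by auto
qed

lemma nn_integral_lattice_translate:
 assumes "j \<in> lattice E"
 shows "(\<integral>\<^sup>+ k. f (k + j) \<partial>count_space (lattice E)) = (\<integral>\<^sup>+ k. f k \<partial>count_space (lattice E))"
proof (rule nn_integral_bij_count_space)
 show "bij_betw (\<lambda>k. k + j) (lattice E) (lattice E)"
 proof (rule bij_betwI[where g="\<lambda>k. k - j"])
  show "(\<lambda>k. k + j) \<in> lattice E \<rightarrow> lattice E" using lattice_add[OF _ assms] by auto
  show "(\<lambda>k. k - j) \<in> lattice E \<rightarrow> lattice E" using lattice_diff[OF _ assms] by auto
 qed auto
qed

lemma lux_lattice_translate: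
 assumes "j \<in> lattice E"
 shows "lux (count_space (lattice E)) P (\<lambda>k. f (k + j)) = lux (count_space (lattice E)) P f"
 unfolding lux_def using nn_integral_lattice_translate[OF assms, of "\<lambda>k. P (en (inverse _) * f k)"] by simp

lemma mlux_lattice_translate:
 assumes "j \<in> lattice E \<times> lattice E"
 shows "slux E P Q (\<lambda>k. f (k + j)) = slux E P Q f"
proof -
 obtain a b where j: "j = (a, b)" "a \<in> lattice E" "b \<in> lattice E" using assms by auto
 show ?thesis unfolding mlux_def j(1) add_Pair using lux_lattice_translate[OF j(2), of P "\<lambda>x. f (x, _ + b)"]
   lux_lattice_translate[OF j(3), of Q "\<lambda>l. lux (count_space (lattice E)) P (\<lambda>x. f (x, l))"] by simp
qed

section \<open>Hermite functions\<close>

text \<open>The physicists' Hermite polynomials; \<open>pCons 0\<close> is multiplication by the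
  variable. Polymorphic coefficients let the real Hermite functions and the complex Gaussian
  integrals share one recursion.\<close>

fun hermite_poly :: "nat => 'a::idom poly" where
 "hermite_poly 0 = 1"
| "hermite_poly (Suc n) = pCons 0 (smult 2 (hermite_poly n)) - pderiv (hermite_poly n)"

lemma pderiv_hermite_poly:
 "pderiv (hermite_poly (Suc n) :: 'a::idom poly) = smult (2 * of_nat (Suc n)) (hermite_poly n)"
proof (induction n)
 case (Suc n)
 let ?H = "hermite_poly :: nat => 'a poly"
 have "pderiv (?H (Suc (Suc n))) = smult 2 (?H (Suc n)) + pCons 0 (smult 2 (pderiv (?H (Suc n))))
   - pderiv (pderiv (?H (Suc n)))" by (simp add: pderiv_diff pderiv_pCons pderiv_smult)
 also have "... = smult 2 (?H (Suc n)) + smult (2 * of_nat (Suc n)) (pCons 0 (smult 2 (?H n)) - pderiv (?H n))"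
  unfolding Suc.IH by (simp add: pderiv_smult smult_diff_right mult.commute)
 also have "... = smult (2 * of_nat (Suc (Suc n))) (?H (Suc n))" by (simp add: algebra_simps smult_add_left[symmetric])
 finally show ?case .
qed (simp add: pderiv_pCons)

lemma map_poly_of_real_hermite_poly: "map_poly complex_of_real (hermite_poly n) = hermite_poly n"
proof (induction n)
 case (Suc n)
 have "coeff (map_poly complex_of_real (hermite_poly (Suc n))) i = coeff (hermite_poly (Suc n)) i" for i
  using Suc[symmetric] by (auto simp: coeff_map_poly coeff_pCons coeff_pderiv split: nat.splits)
 then show ?case by (intro poly_eqI)
qed simp

lemma poly_map_poly_of_real: "poly (map_poly complex_of_real p) (of_real t) = of_real (poly p t)"
 by (induction p) (auto simp: map_poly_pCons)

lemma poly_hermite_of_real: "poly (hermite_poly n) (complex_of_real t) = of_real (poly (hermite_poly n) t)"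
 using poly_map_poly_of_real[of "hermite_poly n" t] by (simp add: map_poly_of_real_hermite_poly)

lemma deriv_funpow_gauss:
 "(deriv ^^ n) (\<lambda>s::real. exp (- s\<^sup>2)) = (\<lambda>s. (-1) ^ n * poly (hermite_poly n) s * exp (- s\<^sup>2))"
proof (induction n)
 case (Suc n)
 show ?case
 proof
  fix s :: real
  have "((\<lambda>s. (-1) ^ n * poly (hermite_poly n) s * exp (- s\<^sup>2)) has_real_derivative
    (-1) ^ Suc n * poly (hermite_poly (Suc n)) s * exp (- s\<^sup>2)) (at s)" by (auto intro!: derivative_eq_intros simp: algebra_simps)
  from DERIV_imp_deriv[OF this]
  show "(deriv ^^ Suc n) (\<lambda>s. exp (- s\<^sup>2)) s = (-1) ^ Suc n * poly (hermite_poly (Suc n)) s * exp (- s\<^sup>2)"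
   using Suc by simp
 qed
qed simp

lemma hermite1_eq:
 "hermite1 n t = poly (hermite_poly n) t * exp (- t\<^sup>2 / 2) / sqrt (2 ^ n * fact n * sqrt pi)"
proof -
 have "exp (t\<^sup>2 / 2) * exp (- t\<^sup>2) = exp (- t\<^sup>2 / 2)" by (simp add: exp_add[symmetric])
 moreover have "((-1) ^ n * (-1) ^ n :: real) = 1" by (simp flip: power_add)
 ultimately show ?thesis unfolding hermite1_def deriv_funpow_gauss by (simp add: field_simps)
qed

section \<open>Gaussian integrals of Hermite polynomials\<close>

definition gauss_kernel :: "complex => complex poly => real => complex" where
 "gauss_kernel z q t = poly q (of_real t) * exp (- (of_real t)\<^sup>2 + of_real t * z)"

text \<open>Carries all Hermite integrals at once: \<open>z = 0\<close> gives the orthogonality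
  relations, \<open>z = Complex x \<xi>\<close> the coefficients of a shifted and modulated
  Gaussian.\<close>

definition gauss_functional :: "complex => complex poly => complex" where
 "gauss_functional z q = (LINT t|lborel. gauss_kernel z q t)"

lemma norm_poly_le_exp: "\<exists>C\<ge>0. \<forall>t. norm (poly (q :: complex poly) (of_real t)) \<le> C * exp \<bar>t\<bar>"
proof -
 define C where "C = (\<Sum>i\<le>degree q. norm (coeff q i) * fact i)"
 have "norm (poly q (of_real t)) \<le> C * exp \<bar>t\<bar>" for t
 proof -
  have pw: "\<bar>t\<bar> ^ i \<le> fact i * exp \<bar>t\<bar>" for i
  proof -
   have "(\<Sum>k\<in>{i}. \<bar>t\<bar> ^ k /\<^sub>R fact k) \<le> exp \<bar>t\<bar>"
    unfolding exp_def by (intro sum_le_suminf summable_exp_generic) auto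
   then show ?thesis by (simp add: field_simps)
  qed
  have "norm (poly q (of_real t)) \<le> (\<Sum>i\<le>degree q. norm (coeff q i) * \<bar>t\<bar> ^ i)"
   unfolding poly_altdef by (intro order_trans[OF norm_sum] sum_mono) (simp add: norm_mult norm_power)
  also have "... \<le> (\<Sum>i\<le>degree q. norm (coeff q i) * (fact i * exp \<bar>t\<bar>))"
   by (intro sum_mono mult_left_mono pw) auto
  also have "... = C * exp \<bar>t\<bar>" unfolding C_def by (simp add: sum_distrib_right mult.assoc)
  finally show ?thesis .
 qed
 moreover have "C \<ge> 0" unfolding C_def by (intro sum_nonneg) auto
 ultimately show ?thesis by blast
qed

lemma gauss_kernel_bound: "\<exists>C. \<forall>t. norm (gauss_kernel z q t) \<le> C * exp (- t\<^sup>2 / 2)"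
proof -
 obtain C where C: "C \<ge> 0" "\<And>t. norm (poly q (of_real t)) \<le> C * exp \<bar>t\<bar>" using norm_poly_le_exp[of q] by auto
 \<comment> \<open>The 1 absorbs the bound of the polynomial by \<open>exp \<bar>t\<bar>\<close>;
   completing the square then leaves half of the Gaussian exponent.\<close>
 define a where "a = 1 + \<bar>Re z\<bar>"
 have "norm (gauss_kernel z q t) \<le> C * exp (a\<^sup>2 / 2) * exp (- t\<^sup>2 / 2)" for t
 proof -
  have "0 \<le> (\<bar>t\<bar> - a)\<^sup>2" by simp
  then have 1: "\<bar>t\<bar> * a - t\<^sup>2 \<le> a\<^sup>2 / 2 - t\<^sup>2 / 2" by (simp add: power2_diff)
  have "t * Re z \<le> \<bar>t\<bar> * \<bar>Re z\<bar>" by (metis abs_ge_self abs_mult)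
  then have "\<bar>t\<bar> + (- t\<^sup>2 + t * Re z) \<le> \<bar>t\<bar> * a - t\<^sup>2" unfolding a_def by (simp add: algebra_simps)
  then have 2: "\<bar>t\<bar> + (- t\<^sup>2 + t * Re z) \<le> a\<^sup>2 / 2 + - t\<^sup>2 / 2" using 1 by simp
  have "norm (gauss_kernel z q t) = norm (poly q (of_real t)) * exp (- t\<^sup>2 + t * Re z)"
   unfolding gauss_kernel_def norm_mult norm_exp_eq_Re by (simp add: power2_eq_square)
  also have "... \<le> C * exp \<bar>t\<bar> * exp (- t\<^sup>2 + t * Re z)" by (intro mult_right_mono C) auto
  also have "... = C * exp (\<bar>t\<bar> + (- t\<^sup>2 + t * Re z))" by (simp add: exp_add)
  also have "... \<le> C * exp (a\<^sup>2 / 2 + - t\<^sup>2 / 2)" using 2 C by (intro mult_left_mono) auto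
  also have "... = C * exp (a\<^sup>2 / 2) * exp (- t\<^sup>2 / 2)" by (simp only: exp_add mult.assoc)
  finally show ?thesis .
 qed
 then show ?thesis by blast
qed

lemma integrable_exp_neg_sq_half: "integrable lborel (\<lambda>t::real. exp (- t\<^sup>2 / 2))"
proof -
 have "integrable lborel (\<lambda>t. sqrt (2 * pi) * std_normal_density t)" by (intro integrable_mult_right) auto
 then show ?thesis by (simp add: std_normal_density_def)
qed

lemma gauss_kernel_continuous: "continuous_on UNIV (gauss_kernel z q)" unfolding gauss_kernel_def by (intro continuous_intros)

lemma gauss_kernel_measurable [measurable]: "gauss_kernel z q \<in> borel_measurable borel"
 by (rule borel_continuous[OF gauss_kernel_continuous])

lemma gauss_kernel_integrable: "integrable lborel (gauss_kernel z q)"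
proof -
 obtain C where C: "\<And>t. norm (gauss_kernel z q t) \<le> C * exp (- t\<^sup>2 / 2)" using gauss_kernel_bound by blast
 have "integrable lborel (\<lambda>t::real. C * exp (- t\<^sup>2 / 2))" by (intro integrable_mult_right integrable_exp_neg_sq_half)
 then show ?thesis by (rule Bochner_Integration.integrable_bound) (use C in \<open>auto intro: order_trans[OF _ abs_ge_self]\<close>)
qed

lemma exp_neg_sq_half_tendsto:
 "((\<lambda>t::real. C * exp (- t\<^sup>2 / 2)) \<longlongrightarrow> 0) at_top" "((\<lambda>t::real. C * exp (- t\<^sup>2 / 2)) \<longlongrightarrow> 0) at_bot"
 by real_asymp+

text \<open>The integrand is the derivative of \<open>gauss_kernel z q\<close>, which vanishes at
  both ends.\<close>

lemma gauss_functional_IBP: "gauss_functional z (pderiv q + q * [:z, -2:]) = 0"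
proof -
 obtain C where C: "\<And>t. norm (gauss_kernel z q t) \<le> C * exp (- t\<^sup>2 / 2)" using gauss_kernel_bound by blast
 have lim: "(gauss_kernel z q \<longlongrightarrow> 0) F" if "((\<lambda>t::real. C * exp (- t\<^sup>2 / 2)) \<longlongrightarrow> 0) F" for F
  by (rule Lim_null_comparison[OF _ that]) (use C in auto)
 have "(LBINT t=-\<infinity>..\<infinity>. gauss_kernel z (pderiv q + q * [:z, -2:]) t) = 0 - 0"
 proof (rule interval_integral_FTC_integrable[where F="gauss_kernel z q"])
  fix t :: real
  show "(gauss_kernel z q has_vector_derivative gauss_kernel z (pderiv q + q * [:z, -2:]) t) (at t)" unfolding gauss_kernel_def
   by (auto intro!: derivative_eq_intros has_vector_derivative_real_field simp: algebra_simps has_real_derivative_iff_has_vector_derivative)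
  show "isCont (gauss_kernel z (pderiv q + q * [:z, -2:])) t" using gauss_kernel_continuous by (simp add: continuous_on_eq_continuous_at)
  show "set_integrable lborel (einterval (-\<infinity>) \<infinity>) (gauss_kernel z (pderiv q + q * [:z, -2:]))"
   using gauss_kernel_integrable by (simp add: set_integrable_def)
  show "((gauss_kernel z q \<circ> real_of_ereal) \<longlongrightarrow> 0) (at_right (-\<infinity>))"
   unfolding ereal_tendsto_simps by (rule lim[OF exp_neg_sq_half_tendsto(2)])
  show "((gauss_kernel z q \<circ> real_of_ereal) \<longlongrightarrow> 0) (at_left \<infinity>)"
   unfolding ereal_tendsto_simps by (rule lim[OF exp_neg_sq_half_tendsto(1)])
 qed auto
 then show ?thesis unfolding gauss_functional_def by (simp add: interval_lebesgue_integral_def set_lebesgue_integral_def)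
qed

lemma gauss_functional_add: "gauss_functional z (p + q) = gauss_functional z p + gauss_functional z q" unfolding gauss_functional_def
 by (subst Bochner_Integration.integral_add[symmetric]) (auto simp: gauss_kernel_integrable gauss_kernel_def algebra_simps intro!: Bochner_Integration.integral_cong)

lemma gauss_functional_smult: "gauss_functional z (smult c q) = c * gauss_functional z q"
proof -
 have "gauss_kernel z (smult c q) = (\<lambda>t. c * gauss_kernel z q t)" by (auto simp: gauss_kernel_def)
 then show ?thesis unfolding gauss_functional_def by simp
qed

text \<open>By the recursion the two sides differ by the functional of an exact derivative. Lowering
  the index in this way yields \<open>z ^ n\<close> for \<open>p = 1\<close> and orthogonality for
  \<open>z = 0\<close>.\<close>

lemma gauss_functional_hermite_Suc:
 "gauss_functional z (hermite_poly (Suc n) * p) =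
  gauss_functional z (hermite_poly n * pderiv p) + z * gauss_functional z (hermite_poly n * p)"
proof -
 let ?H = "hermite_poly :: nat => complex poly"
 have "?H n * pderiv p + smult z (?H n * p)
   = ?H (Suc n) * p + (pderiv (?H n * p) + (?H n * p) * [:z, -2:])" by (simp add: pderiv_mult algebra_simps)
 then have "gauss_functional z (?H n * pderiv p + smult z (?H n * p)) = gauss_functional z (?H (Suc n) * p)"
  by (simp only: gauss_functional_add[of z "?H (Suc n) * p" "pderiv (?H n * p) + ?H n * p * [:z, -2:]"]
    gauss_functional_IBP add_0_right)
 then show ?thesis by (simp add: gauss_functional_add gauss_functional_smult)
qed

lemma gauss_functional_hermite: "gauss_functional z (hermite_poly n) = z ^ n * gauss_functional z 1"
proof (induction n)
 case (Suc n)
 then show ?case using gauss_functional_hermite_Suc[of z n 1] by (simp add: pderiv_1 gauss_functional_def gauss_kernel_def)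
qed simp

lemma gauss_functional_1: "gauss_functional (Complex x \<xi>) 1 = sqrt pi * exp ((Complex x \<xi>)\<^sup>2 / 4)"
proof -
 define z where "z = Complex x \<xi>"
 have s2: "complex_of_real (sqrt 2) * complex_of_real (sqrt 2) = 2" by (simp flip: of_real_mult)
 \<comment> \<open>The substitution \<open>t = x / 2 + u / sqrt 2\<close> leaves a standard normal
   exponent, an imaginary linear term and a constant, so the integral becomes the normal
   characteristic function at \<open>\<xi> / sqrt 2\<close>.\<close>
 have exponent: "- (of_real (x / 2 + 1 / sqrt 2 * u))\<^sup>2 + of_real (x / 2 + 1 / sqrt 2 * u) * z =
   of_real (- u\<^sup>2 / 2) + \<i> * of_real (\<xi> / sqrt 2 * u) + (z\<^sup>2 + of_real (\<xi>\<^sup>2)) / 4" for u :: real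
  unfolding z_def by (simp add: complex_eq_iff power2_eq_square field_simps)
 have "gauss_functional z 1 = (LINT t|lborel. exp (- (of_real t)\<^sup>2 + of_real t * z))"
  by (simp add: gauss_functional_def gauss_kernel_def)
 also have "... = \<bar>1 / sqrt 2\<bar> *\<^sub>R (LINT u|lborel. exp (- (of_real (x / 2 + 1 / sqrt 2 * u))\<^sup>2 + of_real (x / 2 + 1 / sqrt 2 * u) * z))"
  by (rule lborel_integral_real_affine) auto
 also have "(LINT u|lborel. exp (- (of_real (x / 2 + 1 / sqrt 2 * u))\<^sup>2 + of_real (x / 2 + 1 / sqrt 2 * u) * z))
  = (LINT u|lborel. (of_real (sqrt (2 * pi)) * exp ((z\<^sup>2 + of_real (\<xi>\<^sup>2)) / 4)) * (std_normal_density u *\<^sub>R iexp (\<xi> / sqrt 2 * u)))"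
  unfolding exponent exp_add
  by (intro Bochner_Integration.integral_cong) (auto simp: std_normal_density_def scaleR_conv_of_real exp_of_real[symmetric] field_simps)
 also have "... = of_real (sqrt (2 * pi)) * exp ((z\<^sup>2 + of_real (\<xi>\<^sup>2)) / 4) * char std_normal_distribution (\<xi> / sqrt 2)"
  unfolding char_def integral_mult_right_zero by (subst integral_density) auto
 also have "... = of_real (sqrt (2 * pi)) * (exp ((z\<^sup>2 + of_real (\<xi>\<^sup>2)) / 4) * exp (of_real (- (\<xi> / sqrt 2)\<^sup>2 / 2)))"
  by (simp only: char_std_normal_distribution exp_of_real[symmetric] mult.assoc)
 also have "exp ((z\<^sup>2 + of_real (\<xi>\<^sup>2)) / 4) * exp (of_real (- (\<xi> / sqrt 2)\<^sup>2 / 2)) = exp (z\<^sup>2 / 4)"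
  unfolding exp_add[symmetric] by (simp add: field_simps power_divide)
 finally show ?thesis unfolding z_def by (simp add: real_sqrt_mult scaleR_conv_of_real)
qed

text \<open>With \<open>z = 0\<close> each lowering step moves a derivative onto the second factor,
  where it produces \<open>2 * m\<close> times the preceding polynomial. Unequal degrees end at the
  functional of a nonconstant Hermite polynomial, which is 0.\<close>

lemma gauss_functional_orthogonal:
 "gauss_functional 0 (hermite_poly n * hermite_poly m) = (if n = m then sqrt pi * 2 ^ n * fact n else 0)"
proof (induction n arbitrary: m)
 case 0
 have "gauss_functional 0 1 = sqrt pi" using gauss_functional_1[of 0 0] by (simp add: Complex_eq)
 then show ?case using gauss_functional_hermite[of 0 m] by (auto simp: power_0_left)
next
 case (Suc n)
 show ?case
 proof (cases m)
  case 0
  then show ?thesis using gauss_functional_hermite[of 0 "Suc n"] by (simp del: hermite_poly.simps(2))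
 next
  case m: (Suc m')
  have "gauss_functional 0 (hermite_poly (Suc n) * hermite_poly m) =
   gauss_functional 0 (hermite_poly n * smult (2 * of_nat (Suc m')) (hermite_poly m'))"
   using gauss_functional_hermite_Suc[of 0 n "hermite_poly m"] unfolding m pderiv_hermite_poly by simp
  also have "... = 2 * of_nat (Suc m') * gauss_functional 0 (hermite_poly n * hermite_poly m')" by (simp add: gauss_functional_smult)
  finally show ?thesis unfolding Suc.IH m by (auto simp: algebra_simps)
 qed
qed

lemma hermite1_orthonormal:
 "integrable lborel (\<lambda>t. hermite1 n t * hermite1 m t)"
 "(LINT t|lborel. hermite1 n t * hermite1 m t) = (if n = m then 1 else 0)"
proof -
 define c where "c n = sqrt (2 ^ n * fact n * sqrt pi)" for n
 have c: "c n > 0" "c n * c n = 2 ^ n * fact n * sqrt pi" for n unfolding c_def by auto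
 have eq: "complex_of_real (hermite1 n t * hermite1 m t) =
   of_real (1 / (c n * c m)) * gauss_kernel 0 (hermite_poly n * hermite_poly m) t" for t
 proof -
  have "exp (- t\<^sup>2 / 2) * exp (- t\<^sup>2 / 2) = exp (- t\<^sup>2)" by (simp add: exp_add[symmetric])
  then have "hermite1 n t * hermite1 m t = 1 / (c n * c m) * (poly (hermite_poly n) t * poly (hermite_poly m) t * exp (- t\<^sup>2))"
   unfolding hermite1_eq c_def[symmetric] using c(1)[of n] c(1)[of m] by (simp add: field_simps)
  then show ?thesis by (simp add: gauss_kernel_def poly_hermite_of_real exp_of_real[symmetric])
 qed
 have int: "integrable lborel (\<lambda>t. complex_of_real (hermite1 n t * hermite1 m t))"
  unfolding eq by (intro integrable_mult_right gauss_kernel_integrable)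
 then show "integrable lborel (\<lambda>t. hermite1 n t * hermite1 m t)" using integrable_Re by fastforce
 have "complex_of_real (LINT t|lborel. hermite1 n t * hermite1 m t) =
   of_real (1 / (c n * c m)) * gauss_functional 0 (hermite_poly n * hermite_poly m)"
  unfolding integral_complex_of_real[symmetric] eq gauss_functional_def by (rule integral_mult_right_zero)
 also have "... = complex_of_real (if n = m then 1 else 0)"
 proof -
  have "complex_of_real (c n) * of_real (c n) = of_real (2 ^ n * fact n * sqrt pi)" by (simp only: of_real_mult[symmetric] c)
  then show ?thesis using c(1)[of n] by (auto simp: gauss_functional_orthogonal field_simps)
 qed
 finally show "(LINT t|lborel. hermite1 n t * hermite1 m t) = (if n = m then 1 else 0)" using of_real_eq_iff by blast
qed

text \<open>The \<open>n\<close>-th Hermite coefficient of the normalised one-dimensional Gaussian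
  shifted by \<open>x\<close> and modulated by \<open>\<xi>\<close>. Its form, a Gaussian times a
  monomial in \<open>Complex x \<xi>\<close>, is the origin of the Bargmann transform.\<close>

definition gauss_coeff :: "real => real => nat => complex" where
 "gauss_coeff x \<xi> n = exp ((Complex x \<xi>)\<^sup>2 / 4 - of_real (x\<^sup>2 / 2)) * (Complex x \<xi>) ^ n / of_real (sqrt (2 ^ n * fact n))"

lemma gauss_coeff_integral:
 fixes x \<xi> :: real and n :: nat
 defines "g \<equiv> \<lambda>t. cis (t * \<xi>) * of_real (pi powr (- (1/4)) * exp (- (t - x)\<^sup>2 / 2)) * of_real (hermite1 n t)"
 shows "integrable lborel g" "(LINT t|lborel. g t) = gauss_coeff x \<xi> n"
proof -
 define z where "z = Complex x \<xi>"
 define c where "c = sqrt (2 ^ n * fact n * sqrt pi)"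
 have eq: "g t = (of_real (pi powr (- (1/4)) / c) * exp (- of_real (x\<^sup>2 / 2))) * gauss_kernel z (hermite_poly n) t" for t
 proof -
  have "cis (t * \<xi>) * exp (of_real (- (t - x)\<^sup>2 / 2)) * exp (of_real (- t\<^sup>2 / 2)) =
    exp (- of_real (x\<^sup>2 / 2)) * exp (- (of_real t)\<^sup>2 + of_real t * z)" unfolding cis_conv_exp exp_add[symmetric] z_def
   by (intro arg_cong[where f=exp]) (simp add: complex_eq_iff power2_eq_square field_simps)
  then show ?thesis unfolding g_def hermite1_eq c_def[symmetric] gauss_kernel_def
   by (simp add: poly_hermite_of_real exp_of_real[symmetric] field_simps)
 qed
 show "integrable lborel g" unfolding eq by (intro integrable_mult_right gauss_kernel_integrable)
 have "(LINT t|lborel. g t) = (of_real (pi powr (- (1/4)) / c) * exp (- of_real (x\<^sup>2 / 2))) * gauss_functional z (hermite_poly n)"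
  unfolding eq gauss_functional_def by (rule integral_mult_right_zero)
 also have "... = of_real (pi powr (- (1/4)) * sqrt pi / c) * (exp (- of_real (x\<^sup>2 / 2)) * exp (z\<^sup>2 / 4)) * z ^ n"
  unfolding gauss_functional_hermite unfolding z_def gauss_functional_1 by simp
 also have "exp (- of_real (x\<^sup>2 / 2)) * exp (z\<^sup>2 / 4) = exp (z\<^sup>2 / 4 - of_real (x\<^sup>2 / 2))"
  by (simp add: exp_add[symmetric])
 also have "pi powr (- (1/4)) * sqrt pi / c = 1 / sqrt (2 ^ n * fact n)"
 proof -
  have "sqrt pi = pi powr (1/2)" by (simp add: powr_half_sqrt)
  then have "pi powr (- (1/4)) * sqrt pi = pi powr (1/4)" by (simp add: powr_add[symmetric])
  moreover have "sqrt (sqrt pi) = pi powr (1/4)" by (simp add: powr_half_sqrt[symmetric] powr_powr)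
  ultimately have "pi powr (- (1/4)) * sqrt pi = sqrt (sqrt pi)" by simp
  then show ?thesis unfolding c_def by (simp add: real_sqrt_mult)
 qed
 finally show "(LINT t|lborel. g t) = gauss_coeff x \<xi> n" unfolding gauss_coeff_def z_def by simp
qed

section \<open>Tensor products over the coordinates\<close>

lemma lborel_vec:
 assumes int: "\<And>i. integrable lborel (f i :: real => 'b::{real_normed_field,banach,second_countable_topology})"
 shows "integrable lborel (\<lambda>y::real^'n. \<Prod>i\<in>UNIV. f i (y $ i))"
  and "(LINT y|lborel. (\<Prod>i\<in>UNIV. f i ((y::real^'n) $ i))) = (\<Prod>i\<in>UNIV. LINT t|lborel. f i t)"
proof -
 \<comment> \<open>The product form of Lebesgue measure is indexed by \<open>Basis\<close>, the
   integrand by coordinates; \<open>ix\<close> translates between them.\<close>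
 define ix :: "real^'n => 'n" where "ix b = (THE i. b = axis i 1)" for b
 have ix: "ix (axis i 1) = i" for i unfolding ix_def by (auto simp: axis_eq_axis)
 have B: "(Basis :: (real^'n) set) = range (\<lambda>i. axis i 1)" by (auto simp: Basis_vec_def)
 have inj: "inj (\<lambda>i::'n. axis i (1::real))" by (auto simp: inj_def axis_eq_axis)
 interpret product_sigma_finite "\<lambda>_::real^'n. lborel :: real measure" ..
 let ?T = "\<lambda>g. \<Sum>b\<in>Basis. g b *\<^sub>R b :: real^'n"
 have T: "?T g $ i = g (axis i 1)" for g i
 proof -
  have "?T g $ i = ?T g \<bullet> axis i 1" by (simp add: inner_axis)
  also have "... = g (axis i 1)" using B by (subst inner_sum_left_Basis) auto
  finally show ?thesis .
 qed
 have [measurable]: "f i \<in> borel_measurable borel" for i using int[of i] by auto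
 have [measurable]: "(\<lambda>y::real^'n. y $ i) \<in> borel_measurable borel" for i
  by (rule borel_continuous) (auto intro!: continuous_intros)
 have eq: "(\<Prod>i\<in>UNIV. f i (?T g $ i)) = (\<Prod>b\<in>Basis. f (ix b) (g b))" for g
  unfolding T unfolding B by (subst prod.reindex[OF inj]) (simp add: ix)
 have meas: "(\<lambda>y::real^'n. \<Prod>i\<in>UNIV. f i (y $ i)) \<in> borel_measurable borel" by measurable
 have Tm: "?T \<in> (\<Pi>\<^sub>M b\<in>Basis. lborel) \<rightarrow>\<^sub>M borel" by measurable
 show "integrable lborel (\<lambda>y::real^'n. \<Prod>i\<in>UNIV. f i (y $ i))"
  by (subst lborel_eq, subst integrable_distr_eq[OF Tm meas], subst eq)
    (auto intro!: product_integrable_prod int)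
 have "(LINT y|lborel. (\<Prod>i\<in>UNIV. f i ((y::real^'n) $ i))) = (\<Prod>b\<in>Basis. LINT t|lborel. f (ix b) t)"
  by (subst lborel_eq, subst integral_distr[OF Tm meas], subst eq)
    (auto intro!: product_integral_prod int)
 also have "... = (\<Prod>i\<in>UNIV. LINT t|lborel. f i t)" unfolding B by (subst prod.reindex[OF inj]) (simp add: ix)
 finally show "(LINT y|lborel. (\<Prod>i\<in>UNIV. f i ((y::real^'n) $ i))) = (\<Prod>i\<in>UNIV. LINT t|lborel. f i t)" .
qed

lemma has_sum_prod_multi:
 fixes a :: "'n::finite => nat => real"
 assumes "\<And>i n. a i n \<ge> 0" "\<And>i. (a i) sums (s i)"
 shows "((\<lambda>J. \<Prod>i\<in>UNIV. a i (J i)) has_sum (\<Prod>i\<in>UNIV. s i)) UNIV"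
proof -
 have hs: "(a i has_sum s i) UNIV" for i using sums_nonneg_imp_has_sum[of "a i" "s i"] assms by auto
 have abs: "(\<lambda>n. norm (a i n)) summable_on UNIV" for i using hs[of i] assms(1) by (auto simp: summable_on_def)
 have "Infinite_Set_Sum.abs_summable_on (\<lambda>J. \<Prod>i\<in>UNIV. a i (J i)) (PiE UNIV (\<lambda>_. UNIV))"
  by (rule abs_summable_on_prod_PiE, simp, simp, rule abs_summable_equivalent[THEN iffD1, OF abs])
 then have "Infinite_Set_Sum.abs_summable_on (\<lambda>J. \<Prod>i\<in>UNIV. a i (J i)) UNIV" by (simp add: PiE_UNIV_domain)
 then have "(\<lambda>J. \<Prod>i\<in>UNIV. a i (J i)) summable_on UNIV" using abs_summable_equivalent abs_summable_summable by blast
 moreover have "(\<Sum>\<^sub>\<infinity>J. \<Prod>i\<in>UNIV. a i (J i)) = (\<Prod>i\<in>UNIV. s i)"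
 proof -
  have "(\<Sum>\<^sub>\<infinity>J\<in>PiE UNIV (\<lambda>_. UNIV). \<Prod>i\<in>UNIV. a i (J i)) = (\<Prod>i\<in>UNIV. infsum (a i) UNIV)"
   by (rule infsum_prod_PiE_abs) (use abs in auto)
  then show ?thesis using infsumI[OF hs] by (simp add: PiE_UNIV_domain)
 qed
 ultimately show ?thesis by (metis has_sum_infsum)
qed

definition cpoint :: "'n::finite phase => 'n => complex" where
 "cpoint z i = Complex (fst z $ i) (snd z $ i)"

definition gauss_coeffs :: "'n::finite phase => ('n::finite => nat) => complex" where
 "gauss_coeffs z = hermite_coeffs (tf_shift (fst z) (snd z) gaussian)"

lemma hermite1_continuous: "continuous_on UNIV (hermite1 n)" unfolding hermite1_eq by (intro continuous_intros) auto

lemma hermite_continuous: "continuous_on UNIV (hermite J)" unfolding hermite_def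
 by (intro continuous_intros continuous_on_compose2[OF hermite1_continuous]) auto

lemma hermite_measurable [measurable]: "hermite J \<in> borel_measurable borel"
 by (rule borel_continuous[OF hermite_continuous])

lemma hermite_orthonormal:
 "integrable lborel (\<lambda>y. hermite J y * hermite \<beta> y)"
 "(LINT y|lborel. hermite J y * hermite \<beta> y) = (if J = \<beta> then 1 else 0)"
proof -
 have eq: "hermite J y * hermite \<beta> y = (\<Prod>i\<in>UNIV. hermite1 (J i) (y $ i) * hermite1 (\<beta> i) (y $ i))" for y
  by (simp add: hermite_def prod.distrib)
 show "integrable lborel (\<lambda>y. hermite J y * hermite \<beta> y)" unfolding eq by (rule lborel_vec(1)) (rule hermite1_orthonormal)
 have "(LINT y|lborel. hermite J y * hermite \<beta> y) = (\<Prod>i\<in>UNIV. if J i = \<beta> i then 1 else 0)"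
  unfolding eq by (subst lborel_vec(2)) (auto simp: hermite1_orthonormal)
 also have "... = (if J = \<beta> then 1 else 0)" by (auto simp: fun_eq_iff prod_zero)
 finally show "(LINT y|lborel. hermite J y * hermite \<beta> y) = (if J = \<beta> then 1 else 0)" .
qed

lemma gaussian_eq_prod: "gaussian y = (\<Prod>i\<in>UNIV. of_real (pi powr (- (1/4)) * exp (- (y $ i)\<^sup>2 / 2)))"
proof -
 have "(\<Prod>i\<in>(UNIV::'a set). pi powr (- (1/4)) * exp (- (y $ i)\<^sup>2 / 2))
   = (pi powr (- (1/4))) ^ CARD('a) * exp (\<Sum>i\<in>UNIV. - (y $ i)\<^sup>2 / 2)" by (simp add: prod.distrib exp_sum)
 also have "(pi powr (- (1/4))) ^ CARD('a) = pi powr (- (real CARD('a) / 4))" by (simp add: powr_realpow[symmetric] powr_powr mult.commute)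
 also have "(\<Sum>i\<in>UNIV. - (y $ i)\<^sup>2 / 2) = - (norm y)\<^sup>2 / 2"
  by (simp add: norm_vec_def L2_set_def sum_nonneg sum_negf sum_divide_distrib)
 finally have *: "(\<Prod>i\<in>(UNIV::'a set). pi powr (- (1/4)) * exp (- (y $ i)\<^sup>2 / 2)) =
  pi powr (- (real CARD('a) / 4)) * exp (- (norm y)\<^sup>2 / 2)" .
 show ?thesis unfolding gaussian_def of_real_prod[symmetric] * ..
qed

lemma gaussian_eq_hermite: "gaussian y = of_real (hermite (\<lambda>_. 0) y)"
proof -
 have "sqrt (sqrt pi) = pi powr (1/4)" by (simp add: powr_half_sqrt[symmetric] powr_powr)
 then have "hermite1 0 t = pi powr (- (1/4)) * exp (- t\<^sup>2 / 2)" for t unfolding hermite1_eq by (simp add: powr_minus divide_simps)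
 then show ?thesis unfolding gaussian_eq_prod hermite_def by simp
qed

lemma tf_shift_gaussian_continuous: "continuous_on UNIV (tf_shift x \<xi> gaussian)" unfolding tf_shift_def gaussian_eq_hermite cis_conv_exp
 by (intro continuous_intros continuous_on_compose2[OF hermite_continuous]) auto

lemma tf_shift_gaussian_measurable [measurable]: "tf_shift x \<xi> gaussian \<in> borel_measurable borel"
 by (rule borel_continuous[OF tf_shift_gaussian_continuous])

lemma gauss_coeffs_eq: "gauss_coeffs z J = (\<Prod>i\<in>UNIV. gauss_coeff (fst z $ i) (snd z $ i) (J i))"
proof -
 obtain x \<xi> where z: "z = (x, \<xi>)" by force
 define g where "g i t = cis (t * (\<xi> $ i)) * of_real (pi powr (- (1/4)) * exp (- (t - x $ i)\<^sup>2 / 2)) * complex_of_real (hermite1 (J i) t)" for i t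
 have cis: "cis (y \<bullet> \<xi>) = (\<Prod>i\<in>UNIV. cis (y $ i * \<xi> $ i))" for y
  by (simp add: inner_vec_def cis_conv_exp sum_distrib_left exp_sum[symmetric])
 have eq: "tf_shift x \<xi> gaussian y * of_real (hermite J y) = (\<Prod>i\<in>UNIV. g i (y $ i))" for y
  unfolding tf_shift_def gaussian_eq_prod hermite_def g_def cis prod.distrib by simp
 have "gauss_coeffs z J = (LINT y|lborel. tf_shift x \<xi> gaussian y * of_real (hermite J y))"
  unfolding gauss_coeffs_def hermite_coeffs_def z by (simp add: integral_completion)
 also have "... = (\<Prod>i\<in>UNIV. gauss_coeff (x $ i) (\<xi> $ i) (J i))"
 proof -
  have "integrable lborel (\<lambda>t. g i t)" "(LINT t|lborel. g i t) = gauss_coeff (x $ i) (\<xi> $ i) (J i)" for i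
   unfolding g_def by (rule gauss_coeff_integral)+
  then show ?thesis unfolding eq by (subst lborel_vec(2)) auto
 qed
 finally show ?thesis by (simp add: z)
qed

lemma norm_gauss_coeff:
 "norm (gauss_coeff x \<xi> n) = exp (- (x\<^sup>2 + \<xi>\<^sup>2) / 4) * (norm (Complex x \<xi>) ^ n / sqrt (2 ^ n * fact n))"
proof -
 have "Re ((Complex x \<xi>)\<^sup>2 / 4 - of_real (x\<^sup>2 / 2)) = - (x\<^sup>2 + \<xi>\<^sup>2) / 4"
  by (simp add: power2_eq_square field_simps)
 then show ?thesis unfolding gauss_coeff_def by (simp add: norm_mult norm_divide norm_power)
qed

lemma norm_sq_pair: "(norm (z :: 'n::finite phase))\<^sup>2 = (\<Sum>i\<in>UNIV. (cmod (cpoint z i))\<^sup>2)"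
proof -
 have "(norm z)\<^sup>2 = (norm (fst z))\<^sup>2 + (norm (snd z))\<^sup>2"
  by (metis norm_Pair prod.collapse real_sqrt_pow2 sum_power2_ge_zero)
 also have "... = (\<Sum>i\<in>UNIV. (cmod (cpoint z i))\<^sup>2)"
  by (simp add: norm_vec_def L2_set_def sum_nonneg cpoint_def cmod_power2 sum.distrib)
 finally show ?thesis .
qed

lemma norm_gauss_coeffs:
 "norm (gauss_coeffs z J) = exp (- (norm z)\<^sup>2 / 4) * (\<Prod>i\<in>UNIV. cmod (cpoint z i) ^ J i / sqrt (2 ^ J i * fact (J i)))"
proof -
 have "norm (gauss_coeffs z J) = (\<Prod>i\<in>UNIV. exp (- (cmod (cpoint z i))\<^sup>2 / 4)) * (\<Prod>i\<in>UNIV. cmod (cpoint z i) ^ J i / sqrt (2 ^ J i * fact (J i)))"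
  unfolding gauss_coeffs_eq prod_norm[symmetric] norm_gauss_coeff prod.distrib by (simp add: cpoint_def cmod_power2)
 also have "(\<Prod>i\<in>UNIV. exp (- (cmod (cpoint z i))\<^sup>2 / 4)) = exp (- (norm z)\<^sup>2 / 4)"
  unfolding norm_sq_pair by (simp add: exp_sum[symmetric] sum_negf sum_divide_distrib)
 finally show ?thesis .
qed

text \<open>In each coordinate the squared moduli are the Poisson probabilities with mean
  \<open>(cmod (cpoint z i))\<^sup>2 / 2\<close>, so the product distribution has total mass 1, the
  squared norm of the shifted Gaussian.\<close>

lemma gauss_coeffs_sq_sum: "((\<lambda>J. (norm (gauss_coeffs z J))\<^sup>2) has_sum 1) UNIV"
proof -
 define b where "b i = (cmod (cpoint z i))\<^sup>2 / 2" for i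
 define a where "a i n = exp (- b i) * (b i ^ n / fact n)" for i and n :: nat
 have "(a i) sums (exp (- b i) * exp (b i))" for i
  unfolding a_def using exp_converges[of "b i"] by (intro sums_mult) (simp add: divide_inverse_commute)
 then have *: "(a i) sums 1" for i by (simp add: exp_add[symmetric])
 have "((\<lambda>J. \<Prod>i\<in>UNIV. a i (J i)) has_sum (\<Prod>i\<in>(UNIV::'a set). 1)) UNIV"
  by (rule has_sum_prod_multi[OF _ *]) (simp add: a_def b_def)
 moreover have "(norm (gauss_coeffs z J))\<^sup>2 = (\<Prod>i\<in>UNIV. a i (J i))" for J
 proof -
  have "exp (- (norm z)\<^sup>2 / 4) ^ 2 = exp (- (norm z)\<^sup>2 / 2)" by (simp add: exp_double[symmetric])
  also have "... = (\<Prod>i\<in>UNIV. exp (- b i))"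
   unfolding norm_sq_pair b_def by (simp add: exp_sum[symmetric] sum_negf sum_divide_distrib)
  finally have 1: "exp (- (norm z)\<^sup>2 / 4) ^ 2 = (\<Prod>i\<in>UNIV. exp (- b i))" .
  have 2: "(cmod (cpoint z i) ^ n / sqrt (2 ^ n * fact n))\<^sup>2 = b i ^ n / fact n" for i n
   by (simp add: b_def power_divide power_mult[symmetric] mult.commute)
  show ?thesis unfolding norm_gauss_coeffs power_mult_distrib 1 prod_power_distrib 2 a_def by (simp only: prod.distrib)
 qed
 ultimately show ?thesis by simp
qed

section \<open>Square integrable functions\<close>

lemma borel_measurable_cnj [measurable]: "cnj \<in> borel_measurable borel"
 using borel_continuous[OF continuous_on_cnj[OF continuous_on_id]] by simp

definition ip :: "('a::euclidean_space => complex) => ('a => complex) => complex" where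
 "ip f g = (LINT y|lebesgue. f y * cnj (g y))"

lemma square_integrable_borel:
 assumes "f \<in> borel_measurable borel" "integrable lborel (\<lambda>x. (cmod (f x))\<^sup>2)"
 shows "f \<in> square_integrable"
proof -
 have "(\<lambda>x. (cmod (f x))\<^sup>2) \<in> borel_measurable lborel" using assms(1) by simp
 then have "integrable lebesgue (\<lambda>x. (cmod (f x))\<^sup>2)" using assms(2) by (rule integrable_completion[THEN iffD2])
 moreover have "f \<in> borel_measurable lebesgue" by (rule measurable_completion) (use assms(1) in simp)
 ultimately show ?thesis unfolding square_integrable_def by blast
qed

lemma square_integrable_mult:
 assumes "f \<in> square_integrable" "g \<in> square_integrable"
 shows "integrable lebesgue (\<lambda>y. f y * cnj (g y))"
proof -
 have fg: "f \<in> borel_measurable lebesgue" "g \<in> borel_measurable lebesgue" using assms by (auto simp: square_integrable_def)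
 have m: "(\<lambda>y. f y * cnj (g y)) \<in> borel_measurable lebesgue"
  by (rule borel_measurable_times[OF fg(1) measurable_compose[OF fg(2) borel_measurable_cnj]])
 have "integrable lebesgue (\<lambda>y. (cmod (f y))\<^sup>2 + (cmod (g y))\<^sup>2)"
  using assms by (intro Bochner_Integration.integrable_add) (auto simp: square_integrable_def)
 then show ?thesis
 proof (rule Bochner_Integration.integrable_bound)
  have "norm (f y * cnj (g y)) \<le> norm ((cmod (f y))\<^sup>2 + (cmod (g y))\<^sup>2)" for y
  proof -
   have "2 * (cmod (f y) * cmod (g y)) \<le> (cmod (f y))\<^sup>2 + (cmod (g y))\<^sup>2"
    using sum_squares_bound[of "cmod (f y)" "cmod (g y)"] by simp
   moreover have "0 \<le> cmod (f y) * cmod (g y)" by simp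
   ultimately show ?thesis unfolding norm_mult complex_mod_cnj real_norm_def by linarith
  qed
  then show "AE y in lebesgue. norm (f y * cnj (g y)) \<le> norm ((cmod (f y))\<^sup>2 + (cmod (g y))\<^sup>2)" by simp
 qed (rule m)
qed

lemma square_integrable_add:
 assumes "f \<in> square_integrable" "g \<in> square_integrable"
 shows "(\<lambda>y. f y + g y) \<in> square_integrable"
proof -
 have fg: "f \<in> borel_measurable lebesgue" "g \<in> borel_measurable lebesgue" using assms by (auto simp: square_integrable_def)
 have m: "(\<lambda>y. f y + g y) \<in> borel_measurable lebesgue" using fg by (rule borel_measurable_add)
 have q: "(\<lambda>z. (cmod z)\<^sup>2) \<in> borel_measurable borel" by measurable
 have "integrable lebesgue (\<lambda>y. 2 * (cmod (f y))\<^sup>2 + 2 * (cmod (g y))\<^sup>2)"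
  using assms by (intro Bochner_Integration.integrable_add integrable_mult_right) (auto simp: square_integrable_def)
 then have "integrable lebesgue (\<lambda>y. (cmod (f y + g y))\<^sup>2)"
 proof (rule Bochner_Integration.integrable_bound)
  have "(cmod (f y + g y))\<^sup>2 \<le> 2 * (cmod (f y))\<^sup>2 + 2 * (cmod (g y))\<^sup>2" for y
  proof -
   have "(cmod (f y + g y))\<^sup>2 \<le> (cmod (f y) + cmod (g y))\<^sup>2" by (intro power_mono norm_triangle_ineq) auto
   also have "... \<le> 2 * (cmod (f y))\<^sup>2 + 2 * (cmod (g y))\<^sup>2"
    using sum_squares_bound[of "cmod (f y)" "cmod (g y)"] by (simp add: power2_sum)
   finally show ?thesis .
  qed
  then show "AE y in lebesgue. norm ((cmod (f y + g y))\<^sup>2) \<le> norm (2 * (cmod (f y))\<^sup>2 + 2 * (cmod (g y))\<^sup>2)" by simp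
 qed (rule measurable_compose[OF m q])
 then show ?thesis using m by (simp add: square_integrable_def)
qed

lemma square_integrable_cmult: "f \<in> square_integrable ==> (\<lambda>y. c * f y) \<in> square_integrable"
proof -
 assume f: "f \<in> square_integrable"
 then have "(\<lambda>y. c * f y) \<in> borel_measurable lebesgue"
  by (intro borel_measurable_times borel_measurable_const) (simp add: square_integrable_def)
 moreover have "integrable lebesgue (\<lambda>y. (cmod c)\<^sup>2 * (cmod (f y))\<^sup>2)"
  using f by (intro integrable_mult_right) (simp add: square_integrable_def)
 ultimately show ?thesis by (simp only: square_integrable_def mem_Collect_eq norm_mult power_mult_distrib simp_thms)
qed

lemma square_integrable_sum:
 "(\<And>i. i \<in> F ==> f i \<in> square_integrable) ==> (\<lambda>y. \<Sum>i\<in>F. f i y) \<in> square_integrable"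
proof (induction F rule: infinite_finite_induct)
 case (insert i F)
 then show ?case using square_integrable_add[of "f i" "\<lambda>y. \<Sum>i\<in>F. f i y"] by simp
qed (simp_all add: square_integrable_def)

lemma square_integrable_diff:
 assumes "f \<in> square_integrable" "g \<in> square_integrable"
 shows "(\<lambda>y. f y - g y) \<in> square_integrable"
 using square_integrable_add[OF assms(1) square_integrable_cmult[OF assms(2), of "-1"]] by simp

lemma ip_cauchy_schwarz:
 assumes "f \<in> square_integrable" "g \<in> square_integrable"
 shows "cmod (ip f g) \<le> L2_norm f * L2_norm g"
proof -
 have [measurable]: "f \<in> borel_measurable lebesgue" "g \<in> borel_measurable lebesgue"
  using assms by (auto simp: square_integrable_def)
 have nn: "(\<integral>\<^sup>+x. (en (cmod (h x)))\<^sup>2 \<partial>lebesgue) = en ((L2_norm h)\<^sup>2)" if "h \<in> square_integrable" for h :: "'a => complex"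
  using that unfolding L2_norm_def square_integrable_def by (simp add: ennreal_power nn_integral_eq_integral)
 have int: "integrable lebesgue (\<lambda>y. cmod (f y) * cmod (g y))"
  using integrable_norm[OF square_integrable_mult[OF assms]] by (simp add: norm_mult)
 let ?I = "LINT y|lebesgue. cmod (f y) * cmod (g y)"
 have I0: "?I \<ge> 0" by (intro Bochner_Integration.integral_nonneg) auto
 have "(\<integral>\<^sup>+x. en (cmod (f x)) * en (cmod (g x)) \<partial>lebesgue)\<^sup>2
   \<le> (\<integral>\<^sup>+x. (en (cmod (f x)))\<^sup>2 \<partial>lebesgue) * (\<integral>\<^sup>+x. (en (cmod (g x)))\<^sup>2 \<partial>lebesgue)"
  by (rule Cauchy_Schwarz_nn_integral) measurable
 moreover have "(\<integral>\<^sup>+x. en (cmod (f x)) * en (cmod (g x)) \<partial>lebesgue) = en ?I"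
  using int by (simp add: ennreal_mult[symmetric] nn_integral_eq_integral)
 ultimately have "en (?I\<^sup>2) \<le> en ((L2_norm f)\<^sup>2 * (L2_norm g)\<^sup>2)"
  by (simp only: nn[OF assms(1)] nn[OF assms(2)] ennreal_power[OF I0] ennreal_mult[OF zero_le_power2 zero_le_power2])
 then have "?I\<^sup>2 \<le> (L2_norm f)\<^sup>2 * (L2_norm g)\<^sup>2" by (rule ennreal_le_iff[THEN iffD1, rotated]) simp
 then have "?I\<^sup>2 \<le> (L2_norm f * L2_norm g)\<^sup>2" by (simp only: power_mult_distrib)
 then have "?I \<le> L2_norm f * L2_norm g" by (rule power2_le_imp_le) (auto simp: L2_norm_def)
 moreover have "cmod (ip f g) \<le> ?I"
  unfolding ip_def using integral_norm_bound[of lebesgue "\<lambda>y. f y * cnj (g y)"] by (simp add: norm_mult)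
 ultimately show ?thesis by simp
qed

lemma ip_diff_left: "f \<in> square_integrable ==> f' \<in> square_integrable ==> g \<in> square_integrable ==>
  ip (\<lambda>y. f y - f' y) g = ip f g - ip f' g"
 unfolding ip_def left_diff_distrib by (rule Bochner_Integration.integral_diff; rule square_integrable_mult)

lemma ip_cmult_left: "ip (\<lambda>y. c * f y) g = c * ip f g" unfolding ip_def by (simp add: mult.assoc)

lemma ip_sum_left:
 assumes "\<And>i. i \<in> F ==> f i \<in> square_integrable" "g \<in> square_integrable"
 shows "ip (\<lambda>y. \<Sum>i\<in>F. f i y) g = (\<Sum>i\<in>F. ip (f i) g)" unfolding ip_def sum_distrib_right
 by (rule Bochner_Integration.integral_sum) (rule square_integrable_mult[OF assms])

lemma ip_cnj: "ip g f = cnj (ip f g)" unfolding ip_def by (subst Bochner_Integration.integral_cnj[symmetric]) (simp add: mult.commute)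

lemma L2_norm_sq: "of_real ((L2_norm f)\<^sup>2) = ip f f"
proof -
 have "ip f f = (LINT y|lebesgue. complex_of_real ((cmod (f y))\<^sup>2))" unfolding ip_def complex_norm_square ..
 also have "... = complex_of_real (LINT y|lebesgue. (cmod (f y))\<^sup>2)" by (rule integral_complex_of_real)
 also have "(LINT y|lebesgue. (cmod (f y))\<^sup>2) = (L2_norm f)\<^sup>2"
  unfolding L2_norm_def by (rule real_sqrt_pow2[symmetric]) (auto intro: Bochner_Integration.integral_nonneg)
 finally show ?thesis ..
qed

lemma L2_has_sum_ip:
 assumes "L2_has_sum u f A" "\<And>i. i \<in> A ==> u i \<in> square_integrable" "f \<in> square_integrable" "g \<in> square_integrable"
 shows "((\<lambda>i. ip (u i) g) has_sum ip f g) A" unfolding has_sum_def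
proof (rule LIM_zero_cancel, rule Lim_null_comparison)
 show "\<forall>\<^sub>F F in finite_subsets_at_top A. norm ((\<Sum>i\<in>F. ip (u i) g) - ip f g) \<le> L2_norm (\<lambda>x. f x - (\<Sum>i\<in>F. u i x)) * L2_norm g"
 proof (rule eventually_finite_subsets_at_top_weakI)
  fix F assume F: "finite F" "F \<subseteq> A"
  then have *: "(\<lambda>x. \<Sum>i\<in>F. u i x) \<in> square_integrable" by (intro square_integrable_sum assms) auto
  have "ip f g - (\<Sum>i\<in>F. ip (u i) g) = ip (\<lambda>x. f x - (\<Sum>i\<in>F. u i x)) g"
   using * F assms by (subst ip_diff_left) (auto simp: ip_sum_left subset_iff)
  then have "norm ((\<Sum>i\<in>F. ip (u i) g) - ip f g) = norm (ip (\<lambda>x. f x - (\<Sum>i\<in>F. u i x)) g)"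
   by (subst norm_minus_commute) simp
  then show "norm ((\<Sum>i\<in>F. ip (u i) g) - ip f g) \<le> L2_norm (\<lambda>x. f x - (\<Sum>i\<in>F. u i x)) * L2_norm g"
   using ip_cauchy_schwarz[OF square_integrable_diff[OF assms(3) *] assms(4)] by simp
 qed
 show "((\<lambda>F. L2_norm (\<lambda>x. f x - (\<Sum>i\<in>F. u i x)) * L2_norm g) \<longlongrightarrow> 0) (finite_subsets_at_top A)"
  using assms(1) unfolding L2_has_sum_def by (rule tendsto_mult_left_zero)
qed

lemma lebesgue_translation:
 fixes c :: "'a::euclidean_space"
 shows "(\<lambda>x. c + x) \<in> lebesgue \<rightarrow>\<^sub>M lebesgue" "distr lebesgue lebesgue (\<lambda>x. c + x) = lebesgue"
proof -
 have T: "(\<lambda>x. c + (\<Sum>j\<in>Basis. (1 * (x \<bullet> j)) *\<^sub>R j)) = (\<lambda>x. c + x)"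
  by (simp add: euclidean_representation)
 show "(\<lambda>x. c + x) \<in> lebesgue \<rightarrow>\<^sub>M lebesgue"
  using lebesgue_affine_measurable[of "\<lambda>_. 1" c] unfolding T by simp
 show "distr lebesgue lebesgue (\<lambda>x. c + x) = lebesgue"
  using lebesgue_affine_euclidean[of "\<lambda>_. 1" c] unfolding T by (simp add: density_1)
qed

lemma lebesgue_integral_translation:
 fixes f :: "'a::euclidean_space => 'b::{banach, second_countable_topology}"
 assumes "f \<in> borel_measurable lebesgue"
 shows "(LINT x|lebesgue. f (c + x)) = (LINT x|lebesgue. f x)"
  and "integrable lebesgue (\<lambda>x. f (c + x)) \<longleftrightarrow> integrable lebesgue f"
 using integral_distr[OF lebesgue_translation(1) assms, of c] integrable_distr_eq[OF lebesgue_translation(1) assms, of c]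
 unfolding lebesgue_translation(2) by simp_all

lemma square_integrable_tf_shift:
 assumes "f \<in> square_integrable"
 shows "tf_shift x \<xi> f \<in> square_integrable"
proof -
 have f: "f \<in> borel_measurable lebesgue" "integrable lebesgue (\<lambda>x. (cmod (f x))\<^sup>2)"
  using assms by (auto simp: square_integrable_def)
 have "(\<lambda>y. f (-x + y)) \<in> borel_measurable lebesgue" by (rule measurable_compose[OF lebesgue_translation(1) f(1)])
 moreover have "(\<lambda>y. cis (y \<bullet> \<xi>)) \<in> borel_measurable lebesgue"
  by (intro measurable_completion borel_continuous) (auto simp: cis_conv_exp intro!: continuous_intros)
 ultimately have "tf_shift x \<xi> f \<in> borel_measurable lebesgue" unfolding tf_shift_def by (simp add: algebra_simps)
 moreover have "integrable lebesgue (\<lambda>y. (cmod (f (-x + y)))\<^sup>2)"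
  using f by (subst lebesgue_integral_translation(2)[where f="\<lambda>y. (cmod (f y))\<^sup>2"]) auto
 ultimately show ?thesis unfolding square_integrable_def by (simp add: tf_shift_def norm_mult algebra_simps)
qed

text \<open>Substituting \<open>a + y\<close> for \<open>y\<close> removes the first shift and
  leaves a unimodular phase. All translation covariance in phase space below comes from this
  identity.\<close>

lemma ip_tf_shift:
 assumes "f \<in> square_integrable" "g \<in> square_integrable"
 shows "ip (tf_shift a b f) (tf_shift x \<xi> g) = cis (a \<bullet> (b - \<xi>)) * ip f (tf_shift (x - a) (\<xi> - b) g)"
proof -
 have "ip (tf_shift a b f) (tf_shift x \<xi> g) = (LINT y|lebesgue. tf_shift a b f (a + y) * cnj (tf_shift x \<xi> g (a + y)))"
  unfolding ip_def
  by (rule lebesgue_integral_translation(1)[symmetric, where f="\<lambda>y. tf_shift a b f y * cnj (tf_shift x \<xi> g y)"])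
   (use square_integrable_mult[OF square_integrable_tf_shift[OF assms(1)] square_integrable_tf_shift[OF assms(2)]] in auto)
 also have "... = (LINT y|lebesgue. cis (a \<bullet> (b - \<xi>)) * (f y * cnj (tf_shift (x - a) (\<xi> - b) g y)))"
 proof (rule Bochner_Integration.integral_cong[OF refl])
  fix y
  have "cis ((a + y) \<bullet> b) * cnj (cis ((a + y) \<bullet> \<xi>)) = cis (a \<bullet> (b - \<xi>)) * cnj (cis (y \<bullet> (\<xi> - b)))"
   by (simp add: cis_cnj cis_mult inner_diff_right inner_add_left algebra_simps)
  moreover have "a + y - x = y - (x - a)" by simp
  moreover have "tf_shift a b f (a + y) * cnj (tf_shift x \<xi> g (a + y)) =
    (cis ((a + y) \<bullet> b) * cnj (cis ((a + y) \<bullet> \<xi>))) * (f y * cnj (g (a + y - x)))"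
   unfolding tf_shift_def complex_cnj_mult by (simp only: mult_ac add_diff_cancel_left')
  ultimately show "tf_shift a b f (a + y) * cnj (tf_shift x \<xi> g (a + y)) = cis (a \<bullet> (b - \<xi>)) * (f y * cnj (tf_shift (x - a) (\<xi> - b) g y))"
   by (simp only: tf_shift_def complex_cnj_mult mult_ac)
 qed
 also have "... = cis (a \<bullet> (b - \<xi>)) * ip f (tf_shift (x - a) (\<xi> - b) g)"
  unfolding ip_def by (rule integral_mult_right_zero)
 finally show ?thesis .
qed

section \<open>Short-time Fourier transforms of square integrable functions\<close>

definition stft_const :: "'n::finite itself => real" where
 "stft_const _ = (2 * pi) powr (- (real CARD('n) / 2))"

lemma stft_const_pos: "stft_const T > 0" by (simp add: stft_const_def)

text \<open>The power of \<open>2 * pi\<close> is the squared phase space norm of every function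
  \<open>gauss_coeffs _ J\<close>; the identity is what normalises the inversion formula.\<close>

lemma stft_const_sq: "stft_const TYPE('n::finite) ^ 2 * (2 * pi) ^ CARD('n) = 1"
proof -
 have "stft_const TYPE('n) ^ 2 = (2 * pi) powr (- real CARD('n))" by (simp add: stft_const_def power2_eq_square powr_add[symmetric])
 moreover have "(2 * pi) powr (- real CARD('n)) = inverse ((2 * pi) ^ CARD('n))" by (simp only: powr_minus) (subst powr_realpow; simp)
 moreover have "(2 * pi) ^ CARD('n) \<noteq> (0::real)" by simp
 ultimately show ?thesis by (metis left_inverse)
qed

lemma V_eq:
 fixes f :: "'n::finite hermite_series"
 shows "V f z = of_real (stft_const TYPE('n)) * (\<Sum>\<^sub>\<infinity>J. f J * cnj (gauss_coeffs z J))"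
 unfolding stft_gaussian_def l2_form_def gauss_coeffs_def stft_const_def by (simp add: split_def)

lemma hermite_coeffs_eq_ip: "hermite_coeffs g J = ip g (\<lambda>y. of_real (hermite J y))" by (simp add: hermite_coeffs_def ip_def)

lemma square_integrable_hermite: "(\<lambda>y. complex_of_real (hermite J y)) \<in> square_integrable"
 by (rule square_integrable_borel) (use hermite_orthonormal(1)[of J J] in \<open>auto simp: power2_eq_square\<close>)

lemma ip_hermite: "ip (\<lambda>y. complex_of_real (hermite J y)) (\<lambda>y. of_real (hermite \<beta> y)) = (if J = \<beta> then 1 else 0)"
proof -
 have "ip (\<lambda>y. complex_of_real (hermite J y)) (\<lambda>y. of_real (hermite \<beta> y)) =
   (LINT y|lborel. complex_of_real (hermite J y * hermite \<beta> y))" unfolding ip_def by (subst integral_completion) auto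
 then show ?thesis unfolding integral_complex_of_real by (simp add: hermite_orthonormal)
qed

lemma L2_norm_hermite: "L2_norm (\<lambda>y. complex_of_real (hermite J y)) = 1"
proof -
 have "complex_of_real ((L2_norm (\<lambda>y. complex_of_real (hermite J y)))\<^sup>2) = of_real 1" unfolding L2_norm_sq ip_hermite by simp
 then have "(L2_norm (\<lambda>y. complex_of_real (hermite J y)))\<^sup>2 = 1" using of_real_eq_iff by blast
 moreover have "0 \<le> L2_norm (\<lambda>y. complex_of_real (hermite J y))"
  unfolding L2_norm_def by (intro real_sqrt_ge_zero Bochner_Integration.integral_nonneg) auto
 ultimately show ?thesis by (simp add: power2_eq_1_iff)
qed

lemma gaussian_hermite_abs: "gaussian = (\<lambda>y. complex_of_real (hermite (\<lambda>_. 0) y))" using gaussian_eq_hermite by auto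

lemma square_integrable_gaussian: "gaussian \<in> square_integrable" unfolding gaussian_hermite_abs by (rule square_integrable_hermite)

lemma ip_tf_gaussian_self:
 fixes x \<xi> :: "real^'n"
 shows "ip (tf_shift x \<xi> gaussian) (tf_shift x \<xi> gaussian) = 1"
proof -
 have "tf_shift 0 0 gaussian = (gaussian :: real^'n => complex)" by (simp add: tf_shift_def)
 moreover have "ip gaussian (gaussian :: real^'n => complex) = 1" by (simp add: gaussian_hermite_abs ip_hermite)
 ultimately show ?thesis using ip_tf_shift[OF square_integrable_gaussian square_integrable_gaussian, of x \<xi> x \<xi>] by simp
qed

lemma norm_hermite_coeffs_le: "g \<in> square_integrable ==> cmod (hermite_coeffs g J) \<le> L2_norm g"
 unfolding hermite_coeffs_eq_ip using ip_cauchy_schwarz[OF _ square_integrable_hermite, of g J] by (simp add: L2_norm_hermite)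

text \<open>Boundedness suffices for every \<open>r\<close> because
  \<open>1 \<le> exp (inverse (r\<^sup>2)) * (r ^ n)\<^sup>2 * fact n\<close>, which is one term of
  the exponential series; \<open>K\<close> collects one such constant per coordinate.\<close>

lemma bounded_in_flat_dual:
 fixes c :: "'n::finite hermite_series"
 assumes "\<And>J. cmod (c J) \<le> L"
 shows "c \<in> flat_dual" unfolding pilipovic_flat_dual_def
proof safe
 fix r :: real assume r: "r > 0"
 define K where "K = (\<Prod>i\<in>(UNIV::'n set). exp (inverse (r\<^sup>2)))"
 have K: "K > 0" unfolding K_def by (intro prod_pos) auto
 have L: "L \<ge> 0" using assms[of undefined] norm_ge_zero order_trans by blast
 have key: "1 \<le> K * (r ^ (\<Sum>i\<in>UNIV. J i))\<^sup>2 * multi_fact J" for J :: "'n => nat"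
 proof -
  have one: "1 \<le> exp (inverse (r\<^sup>2)) * (r ^ n)\<^sup>2 * fact n" for n
  proof -
   have "(\<Sum>k\<in>{n}. inverse (r\<^sup>2) ^ k /\<^sub>R fact k) \<le> exp (inverse (r\<^sup>2))"
    unfolding exp_def by (intro sum_le_suminf summable_exp_generic) auto
   then show ?thesis using r by (simp add: field_simps power_mult[symmetric] mult.commute)
  qed
  have "(\<Prod>i\<in>(UNIV::'n set). 1) \<le> (\<Prod>i\<in>UNIV. exp (inverse (r\<^sup>2)) * (r ^ J i)\<^sup>2 * fact (J i))"
   by (rule prod_mono) (use one in auto)
  then show ?thesis unfolding K_def multi_fact_def power_sum prod.distrib prod_power_distrib by simp
 qed
 have "cmod (c J) \<le> L * sqrt K * r ^ (\<Sum>i\<in>UNIV. J i) * sqrt (multi_fact J)" for J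
 proof -
  have "1 \<le> sqrt (K * (r ^ (\<Sum>i\<in>UNIV. J i))\<^sup>2 * multi_fact J)" using key[of J] by simp
  also have "... = sqrt K * r ^ (\<Sum>i\<in>UNIV. J i) * sqrt (multi_fact J)" using r by (simp add: real_sqrt_mult)
  finally have "L * 1 \<le> L * (sqrt K * r ^ (\<Sum>i\<in>UNIV. J i) * sqrt (multi_fact J))" using L by (rule mult_left_mono)
  then show ?thesis using assms[of J] by (simp add: mult.assoc)
 qed
 then show "\<exists>C. \<forall>J. cmod (c J) \<le> C * r ^ (\<Sum>i\<in>UNIV. J i) * sqrt (multi_fact J)" by blast
qed

lemma hermite_coeffs_in_flat_dual: "g \<in> square_integrable ==> hermite_coeffs g \<in> flat_dual"
 using bounded_in_flat_dual[OF norm_hermite_coeffs_le] .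

text \<open>Only orthonormality of the Hermite functions is used: the Hermite coefficients of a
 time-frequency shifted Gaussian have \<open>\<ell>\<^sup>2\<close>-norm 1, so its Hermite series converges in \<open>L\<^sup>2\<close>.\<close>

lemma hermite_expansion_gaussian:
 "L2_has_sum (\<lambda>J y. gauss_coeffs z J * of_real (hermite J y)) (tf_shift (fst z) (snd z) gaussian) UNIV"
proof -
 let ?u = "tf_shift (fst z) (snd z) gaussian" and ?h = "\<lambda>J y. complex_of_real (hermite J y)"
 let ?N = "\<lambda>F. \<Sum>J\<in>F. (norm (gauss_coeffs z J))\<^sup>2"
 have u: "?u \<in> square_integrable" by (rule square_integrable_tf_shift[OF square_integrable_gaussian])
 have uh: "ip ?u (?h J) = gauss_coeffs z J" for J unfolding gauss_coeffs_def hermite_coeffs_eq_ip ..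
 \<comment> \<open>Bessel's identity: the squared distance to a partial sum is the squared norm 1
   minus the squares of the coefficients used.\<close>
 have main: "(L2_norm (\<lambda>y. ?u y - (\<Sum>J\<in>F. gauss_coeffs z J * ?h J y)))\<^sup>2 = 1 - ?N F"
  if F: "finite F" for F
 proof -
  define S where "S = (\<lambda>y. \<Sum>J\<in>F. gauss_coeffs z J * ?h J y)"
  have S: "S \<in> square_integrable" unfolding S_def by (intro square_integrable_sum square_integrable_cmult square_integrable_hermite)
  have ipS: "ip S g = (\<Sum>J\<in>F. gauss_coeffs z J * ip (?h J) g)" if "g \<in> square_integrable" for g
   unfolding S_def by (subst ip_sum_left) (auto intro!: square_integrable_cmult square_integrable_hermite that simp: ip_cmult_left)
  have "ip S (?h \<beta>) = (if \<beta> \<in> F then gauss_coeffs z \<beta> else 0)" for \<beta>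
   unfolding ipS[OF square_integrable_hermite] ip_hermite using F by (simp add: if_distrib sum.delta' cong: if_cong)
  then have "ip (?h J) S = cnj (gauss_coeffs z J)" if "J \<in> F" for J using ip_cnj[of "?h J" S] that by simp
  then have SS: "ip S S = of_real (?N F)"
   unfolding ipS[OF S] by (simp add: complex_norm_square[symmetric])
  let ?d = "\<lambda>y. ?u y - S y"
  have "ip (?h J) ?u = cnj (gauss_coeffs z J)" for J using ip_cnj[of "?h J" ?u] uh by simp
  then have Su: "ip S ?u = of_real (?N F)"
   unfolding ipS[OF u] by (simp add: complex_norm_square[symmetric])
  have uS: "ip ?u S = of_real (?N F)" using ip_cnj[of ?u S] Su by simp
  have d: "?d \<in> square_integrable" by (rule square_integrable_diff[OF u S])
  have "ip ?d ?d = ip ?u ?d - ip S ?d"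
   by (rule ip_diff_left[OF u S d])
  also have "ip ?u ?d = cnj (ip ?u ?u - ip S ?u)"
   using ip_cnj[of ?u ?d] ip_diff_left[OF u S u] by simp
  also have "ip S ?d = cnj (ip ?u S - ip S S)"
   using ip_cnj[of S ?d] ip_diff_left[OF u S S] by simp
  finally have "ip ?d ?d = of_real (1 - ?N F)"
   unfolding SS Su uS ip_tf_gaussian_self by simp
  then have "(L2_norm ?d)\<^sup>2 = 1 - ?N F"
   unfolding L2_norm_sq[symmetric] of_real_eq_iff .
  then show ?thesis by (simp only: S_def)
 qed
 have "((\<lambda>F. sqrt (1 - ?N F)) \<longlongrightarrow> sqrt (1 - 1)) (finite_subsets_at_top UNIV)"
  using gauss_coeffs_sq_sum[of z] unfolding has_sum_def by (intro tendsto_intros)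
 moreover have "\<forall>\<^sub>F F in finite_subsets_at_top UNIV. sqrt (1 - ?N F)
   = L2_norm (\<lambda>y. ?u y - (\<Sum>J\<in>F. gauss_coeffs z J * ?h J y))"
  by (rule eventually_finite_subsets_at_top_weakI, subst main[symmetric])
   (auto simp: L2_norm_def intro!: Bochner_Integration.integral_nonneg)
 ultimately show ?thesis unfolding L2_has_sum_def by (auto dest: Lim_transform_eventually)
qed

text \<open>Parseval with a shifted Gaussian as one factor, obtained by pairing its norm convergent
  Hermite series with \<open>g\<close>. It reconciles the coefficientwise definition of
  \<open>V\<close> with the classical integral.\<close>

lemma hermite_coeffs_ip_gaussian:
 assumes g: "g \<in> square_integrable"
 shows "((\<lambda>J. hermite_coeffs g J * cnj (gauss_coeffs z J)) has_sum ip g (tf_shift (fst z) (snd z) gaussian)) UNIV"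
proof -
 have "((\<lambda>J. ip (\<lambda>y. gauss_coeffs z J * of_real (hermite J y)) g) has_sum ip (tf_shift (fst z) (snd z) gaussian) g) UNIV"
  by (rule L2_has_sum_ip[OF hermite_expansion_gaussian])
    (intro square_integrable_cmult square_integrable_hermite square_integrable_tf_shift square_integrable_gaussian g)+
 then have "((\<lambda>J. cnj (ip (\<lambda>y. gauss_coeffs z J * of_real (hermite J y)) g)) has_sum cnj (ip (tf_shift (fst z) (snd z) gaussian) g)) UNIV"
  by (subst has_sum_cnj_iff)
 then show ?thesis unfolding ip_cmult_left by (simp add: ip_cnj[symmetric] hermite_coeffs_eq_ip mult.commute)
qed

lemma V_L2:
 fixes g :: "real^'n => complex"
 assumes "g \<in> square_integrable"
 shows "V (hermite_coeffs g) z = of_real (stft_const TYPE('n)) * ip g (tf_shift (fst z) (snd z) gaussian)"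
 unfolding V_eq using infsumI[OF hermite_coeffs_ip_gaussian[OF assms]] by simp

lemma V_tf_shift:
 fixes g :: "real^'n => complex"
 assumes "g \<in> square_integrable"
 shows "V (hermite_coeffs (tf_shift (fst w) (snd w) g)) z =
  cis (fst w \<bullet> (snd w - snd z)) * V (hermite_coeffs g) (z - w)"
 unfolding V_L2[OF assms] V_L2[OF square_integrable_tf_shift[OF assms]] by (subst ip_tf_shift[OF assms square_integrable_gaussian]) simp

lemma norm_V_tf_shift:
 "g \<in> square_integrable ==>
  cmod (V (hermite_coeffs (tf_shift (fst w) (snd w) g)) z) = cmod (V (hermite_coeffs g) (z - w))" by (simp add: V_tf_shift norm_mult)

text \<open>The transform at \<open>z\<close> of the Gaussian centred at \<open>w\<close>; up to the
  factor \<open>stft_const\<close> it is the reproducing kernel of the range of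
  \<open>V\<close>.\<close>

definition kern :: "'n::finite phase => 'n phase => complex" where
 "kern w z = V (gauss_coeffs w) z"

lemma kern_eq:
 fixes w z :: "'n::finite phase"
 shows "kern w z = of_real (stft_const TYPE('n)) * ip (tf_shift (fst w) (snd w) gaussian) (tf_shift (fst z) (snd z) gaussian)"
 unfolding kern_def gauss_coeffs_def by (rule V_L2) (rule square_integrable_tf_shift[OF square_integrable_gaussian])

lemma kern_cnj: "kern w z = cnj (kern z w)"
 unfolding kern_eq using ip_cnj[of "tf_shift (fst w) (snd w) gaussian" "tf_shift (fst z) (snd z) gaussian"] by simp

text \<open>Covariance moves \<open>w\<close> to the origin, where the Gaussian is the Hermite
  function of index 0 and a single coefficient survives.\<close>

lemma norm_kern:
 fixes w z :: "'n::finite phase"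
 shows "cmod (kern w z) = stft_const TYPE('n) * exp (- (norm (z - w))\<^sup>2 / 4)"
proof -
 have "cmod (kern w z) = cmod (V (hermite_coeffs gaussian) (z - w))"
  unfolding kern_def gauss_coeffs_def by (rule norm_V_tf_shift[OF square_integrable_gaussian])
 also have "hermite_coeffs gaussian = (\<lambda>J::'n => nat. if J = (\<lambda>_. 0) then 1 else 0)"
  unfolding gaussian_hermite_abs hermite_coeffs_eq_ip[abs_def] by (auto simp: ip_hermite fun_eq_iff)
 also have "V (\<lambda>J::'n => nat. if J = (\<lambda>_. 0) then 1 else 0) (z - w)
   = of_real (stft_const TYPE('n)) * cnj (gauss_coeffs (z - w) (\<lambda>_. 0))"
 proof -
  have "(\<Sum>\<^sub>\<infinity>J::'n => nat. (if J = (\<lambda>_. 0) then 1 else 0) * cnj (gauss_coeffs (z - w) J)) =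
    (\<Sum>\<^sub>\<infinity>J\<in>{\<lambda>_::'n. 0}. (if J = (\<lambda>_. 0) then 1 else 0) * cnj (gauss_coeffs (z - w) J))"
   by (rule infsum_cong_neutral) auto
  then show ?thesis unfolding V_eq by simp
 qed
 finally show ?thesis using stft_const_pos[of "TYPE('n)"] by (simp add: norm_mult norm_gauss_coeffs)
qed

section \<open>The Bargmann transform\<close>

text \<open>Term of the Bargmann power series; the powers of 2 come from evaluating the normalised
  monomials at \<open>w / sqrt 2\<close>.\<close>

definition bterm :: "'n::finite hermite_series => ('n => complex) => ('n => nat) => complex" where
 "bterm f w J = f J * (\<Prod>i\<in>UNIV. w i ^ J i / of_real (sqrt (2 ^ J i * fact (J i))))"

definition bargmann :: "'n::finite hermite_series => ('n => complex) => complex" where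
 "bargmann f w = (\<Sum>\<^sub>\<infinity>J. bterm f w J)"

lemma real_sqrt_prod: "(\<And>i. i \<in> A ==> f i \<ge> 0) ==> sqrt (prod f A) = (\<Prod>i\<in>A. sqrt (f i))"
 by (induction A rule: infinite_finite_induct) (auto simp: real_sqrt_mult)

text \<open>The dual condition permits every rate \<open>r\<close>. For
  \<open>r = 1 / (2 * (\<bar>R\<bar> + 1))\<close> the factorials cancel, and on the polydisc of
  radius \<open>R\<close> the series is dominated by a convergent geometric product.\<close>

lemma bterm_majorant:
 fixes f :: "'n::finite hermite_series"
 assumes f: "f \<in> flat_dual"
 obtains M where "M summable_on UNIV" "\<And>w J. (\<And>i. cmod (w i) \<le> R) ==> cmod (bterm f w J) \<le> M J"
proof -
 define r where "r = 1 / (2 * (\<bar>R\<bar> + 1))"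
 have r: "r > 0" "\<bar>R\<bar> * r \<le> 1 / 2" unfolding r_def by (auto simp: field_simps)
 obtain C where C: "\<And>J. cmod (f J) \<le> C * r ^ (\<Sum>i\<in>UNIV. J i) * sqrt (multi_fact J)"
  using f r unfolding pilipovic_flat_dual_def by blast
 have "0 \<le> cmod (f (\<lambda>_. 0))" by simp
 also have "... \<le> C" using C[of "\<lambda>_. 0"] by (simp add: multi_fact_def)
 finally have C0: "C \<ge> 0" .
 have "((\<lambda>J. \<Prod>i\<in>(UNIV::'n set). (1/2::real) ^ J i) has_sum (\<Prod>i\<in>(UNIV::'n set). 2)) UNIV"
  by (rule has_sum_prod_multi) (auto intro: power_half_series[THEN sums_unique2] simp: geometric_sums[of "1/2::real", simplified])
 then have sm: "(\<lambda>J. C * (\<Prod>i\<in>(UNIV::'n set). (1/2::real) ^ J i)) summable_on UNIV"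
  by (intro summable_on_cmult_right) (auto simp: summable_on_def)
 have "cmod (bterm f w J) \<le> C * (\<Prod>i\<in>UNIV. (1/2) ^ J i)" if w: "\<And>i. cmod (w i) \<le> R" for w J
 proof -
  have "cmod (bterm f w J) = cmod (f J) * (\<Prod>i\<in>UNIV. cmod (w i) ^ J i / sqrt (2 ^ J i * fact (J i)))"
   unfolding bterm_def norm_mult prod_norm[symmetric] by (simp add: norm_divide norm_power)
  also have "... \<le> (C * r ^ (\<Sum>i\<in>UNIV. J i) * sqrt (multi_fact J)) * (\<Prod>i\<in>UNIV. cmod (w i) ^ J i / sqrt (2 ^ J i * fact (J i)))"
   by (intro mult_right_mono C prod_nonneg) auto
  also have "... = C * (\<Prod>i\<in>UNIV. r ^ J i * sqrt (fact (J i)) * (cmod (w i) ^ J i / sqrt (2 ^ J i * fact (J i))))"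
  proof -
   have "sqrt (multi_fact J) = (\<Prod>i\<in>UNIV. sqrt (fact (J i)))" unfolding multi_fact_def by (rule real_sqrt_prod) simp
   then show ?thesis by (simp only: power_sum prod.distrib mult.assoc)
  qed
  also have "... \<le> C * (\<Prod>i\<in>UNIV. (1/2) ^ J i)"
  proof (intro mult_left_mono prod_mono C0 conjI)
   fix i
   show "0 \<le> r ^ J i * sqrt (fact (J i)) * (cmod (w i) ^ J i / sqrt (2 ^ J i * fact (J i)))" using r by simp
   have "r ^ J i * sqrt (fact (J i)) * (cmod (w i) ^ J i / sqrt (2 ^ J i * fact (J i))) = (cmod (w i) * r) ^ J i / sqrt (2 ^ J i)"
    by (simp add: real_sqrt_mult power_mult_distrib)
   also have "... \<le> (cmod (w i) * r) ^ J i"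
   proof -
    have "(cmod (w i) * r) ^ J i / sqrt (2 ^ J i) \<le> (cmod (w i) * r) ^ J i / 1" using r by (intro divide_left_mono) auto
    then show ?thesis by simp
   qed
   also have "... \<le> (1/2) ^ J i"
   proof (rule power_mono)
    have "cmod (w i) * r \<le> \<bar>R\<bar> * r" using w[of i] r by (intro mult_right_mono) auto
    then show "cmod (w i) * r \<le> 1/2" using r(2) by linarith
   qed (use r in \<open>simp add: less_imp_le\<close>)
   finally show "r ^ J i * sqrt (fact (J i)) * (cmod (w i) ^ J i / sqrt (2 ^ J i * fact (J i))) \<le> (1/2) ^ J i" .
  qed
  finally show ?thesis .
 qed
 then show ?thesis using that[OF sm] by blast
qed

lemma bterm_abs_summable:
 assumes "f \<in> flat_dual"
 shows "(\<lambda>J. norm (bterm f w J)) summable_on UNIV"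
proof -
 define R where "R = Max (range (\<lambda>i. cmod (w i)))"
 obtain M where M: "M summable_on UNIV" "\<And>w J. (\<And>i. cmod (w i) \<le> R) ==> cmod (bterm f w J) \<le> M J"
  using bterm_majorant[OF assms, of R] by blast
 have "cmod (w i) \<le> R" for i unfolding R_def by (intro Max_ge) auto
 then have "cmod (bterm f w J) \<le> M J" for J using M(2)[of w] by blast
 then show ?thesis by (intro summable_on_comparison_test[OF M(1)]) auto
qed

lemma bargmann_has_sum: "f \<in> flat_dual ==> (bterm f w has_sum bargmann f w) UNIV"
 unfolding bargmann_def by (rule has_sum_infsum[OF abs_summable_summable[OF bterm_abs_summable]])

lemma bargmann_uniform_limit:
 fixes f :: "'n::finite hermite_series" and u :: "'b => 'n => complex"
 assumes "f \<in> flat_dual" "\<And>y i. y \<in> Y ==> cmod (u y i) \<le> R"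
 shows "uniform_limit Y (\<lambda>X y. \<Sum>J\<in>X. bterm f (u y) J) (\<lambda>y. bargmann f (u y)) (finite_subsets_at_top UNIV)"
proof -
 obtain M where M: "M summable_on UNIV" "\<And>w J. (\<And>i. cmod (w i) \<le> R) ==> cmod (bterm f w J) \<le> M J"
  using bterm_majorant[OF assms(1), of R] by blast
 show ?thesis unfolding bargmann_def by (rule Weierstrass_m_test_general[OF _ M(1)]) (use M(2) assms(2) in auto)
qed

lemma bargmann_continuous:
 fixes f :: "'n::finite hermite_series" and u :: "'b::euclidean_space => 'n => complex"
 assumes f: "f \<in> flat_dual" and u: "\<And>i. continuous_on UNIV (\<lambda>y. u y i)"
 shows "continuous_on UNIV (\<lambda>y. bargmann f (u y))"
proof -
 have "continuous_on (cball 0 \<rho>) (\<lambda>y. bargmann f (u y))" for \<rho>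
 proof -
  have "\<exists>B. \<forall>y\<in>cball 0 \<rho>. cmod (u y i) \<le> B" for i
  proof -
   have "compact ((\<lambda>y. u y i) ` cball 0 \<rho>)" by (intro compact_continuous_image continuous_on_subset[OF u]) auto
   then show ?thesis by (auto dest!: compact_imp_bounded simp: bounded_iff)
  qed
  then obtain B where B: "\<And>i y. y \<in> cball 0 \<rho> ==> cmod (u y i) \<le> B i" by metis
  have bd: "cmod (u y i) \<le> Max (range B)" if "y \<in> cball 0 \<rho>" for y i by (rule order_trans[OF B[OF that]]) (auto intro: Max_ge)
  have ul: "uniform_limit (cball 0 \<rho>) (\<lambda>X y. \<Sum>J\<in>X. bterm f (u y) J) (\<lambda>y. bargmann f (u y)) (finite_subsets_at_top UNIV)"
   by (rule bargmann_uniform_limit[OF f bd])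
  show ?thesis
  proof (rule uniform_limit_theorem[OF _ ul])
   show "\<forall>\<^sub>F X in finite_subsets_at_top UNIV. continuous_on (cball 0 \<rho>) (\<lambda>y. \<Sum>J\<in>X. bterm f (u y) J)"
    unfolding bterm_def by (intro always_eventually allI continuous_intros continuous_on_subset[OF u]) auto
  qed simp
 qed
 then have "continuous_on (\<Union>n. ball 0 (real n)) (\<lambda>y. bargmann f (u y))"
  by (intro continuous_on_open_UN) (auto intro: continuous_on_subset[OF _ ball_subset_cball])
 moreover have "(UNIV :: 'b set) = (\<Union>n. ball 0 (real n))" by (auto simp: reals_Archimedean2)
 ultimately show ?thesis by simp
qed

text \<open>Circle averages run along one complex line, so holomorphy in one variable is the form
  required. It passes to the limit from the partial sums, which converge uniformly on bounded
  sets.\<close>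

lemma bargmann_holomorphic_line:
 assumes f: "f \<in> flat_dual"
 shows "(\<lambda>\<zeta>. bargmann f (\<lambda>i. a i + \<zeta> * b i)) holomorphic_on UNIV"
proof -
 have "(\<lambda>\<zeta>. bargmann f (\<lambda>i. a i + \<zeta> * b i)) holomorphic_on ball 0 \<rho>" for \<rho>
 proof -
  define R where "R = Max (range (\<lambda>i. cmod (a i) + \<bar>\<rho>\<bar> * cmod (b i)))"
  have bd: "cmod (a i + \<zeta> * b i) \<le> R" if "\<zeta> \<in> cball 0 \<rho>" for \<zeta> i
  proof -
   have "cmod (a i + \<zeta> * b i) \<le> cmod (a i) + cmod \<zeta> * cmod (b i)"
    using norm_triangle_ineq[of "a i" "\<zeta> * b i"] by (simp add: norm_mult)
   also have "... \<le> cmod (a i) + \<bar>\<rho>\<bar> * cmod (b i)" using that by (intro add_left_mono mult_right_mono) auto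
   also have "... \<le> R" unfolding R_def by (intro Max_ge) auto
   finally show ?thesis .
  qed
  have "\<forall>\<^sub>F X in finite_subsets_at_top UNIV.
    continuous_on (cball 0 \<rho>) (\<lambda>\<zeta>. \<Sum>J\<in>X. bterm f (\<lambda>i. a i + \<zeta> * b i) J) \<and>
    (\<lambda>\<zeta>. \<Sum>J\<in>X. bterm f (\<lambda>i. a i + \<zeta> * b i) J) holomorphic_on ball 0 \<rho>"
   unfolding bterm_def by (intro always_eventually allI conjI continuous_intros holomorphic_intros) auto
  from holomorphic_uniform_limit[OF this bargmann_uniform_limit[OF f bd]] show ?thesis by auto
 qed
 moreover have "(UNIV :: complex set) = (\<Union>n. ball 0 (real n))" by (auto simp: reals_Archimedean2)
 ultimately show ?thesis by (metis (no_types, lifting) holomorphic_on_UN_open open_ball)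
qed

section \<open>Mean value inequalities in phase space\<close>

lemma entire_mean_value:
 fixes g :: "complex => complex"
 assumes "g holomorphic_on UNIV"
 shows "en (2 * pi) * en (cmod (g 0)) \<le> (LI t. en (cmod (g (cis t))) * indicator {0..2*pi} t)"
proof -
 have "continuous_on {0..2*pi} cis" unfolding cis_conv_exp[abs_def] by (intro continuous_intros)
 then have cont: "continuous_on {0..2*pi} (\<lambda>t. cmod (g (cis t)))" using holomorphic_on_imp_continuous_on[OF assms]
  by (intro continuous_on_norm) (rule continuous_on_compose2[of UNIV g], auto)
 have "((\<lambda>u. g u / (u - 0)) has_contour_integral 2 * of_real pi * \<i> * g 0) (circlepath 0 1)"
  by (rule Cauchy_integral_circlepath_simple) (use assms holomorphic_on_subset in auto)
 then have "((\<lambda>t. g (cis t) * \<i>) has_integral 2 * of_real pi * \<i> * g 0) {0..2*pi}"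
  unfolding circlepath_def by (subst (asm) has_contour_integral_part_circlepath_iff) (auto simp: mult_ac)
 from has_integral_mult_left[OF this, of "-\<i>"]
 have hi: "((\<lambda>t. g (cis t)) has_integral 2 * of_real pi * g 0) {0..2*pi}" by (simp add: mult_ac)
 have "cmod (2 * of_real pi * g 0) \<le> integral {0..2*pi} (\<lambda>t. cmod (g (cis t)))" unfolding integral_unique[OF hi, symmetric]
  by (rule integral_norm_bound_integral) (use hi cont in \<open>auto intro: integrable_continuous_interval\<close>)
 then have le: "2 * pi * cmod (g 0) \<le> integral {0..2*pi} (\<lambda>t. cmod (g (cis t)))" by (simp add: norm_mult)
 have int: "set_integrable lborel {0..2*pi} (\<lambda>t. cmod (g (cis t)))" by (rule borel_integrable_atLeastAtMost') (rule cont)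
 have "integral {0..2*pi} (\<lambda>t. cmod (g (cis t))) = (LBINT t:{0..2*pi}. cmod (g (cis t)))"
  using set_borel_integral_eq_integral(2)[OF int] by simp
 also have "en ... = (LI t. en (cmod (g (cis t))) * indicator {0..2*pi} t)"
  using int unfolding set_lebesgue_integral_def set_integrable_def
  by (subst nn_integral_eq_integral[symmetric]) (auto intro!: nn_integral_cong split: split_indicator)
 finally have eq: "en (integral {0..2*pi} (\<lambda>t. cmod (g (cis t)))) = (LI t. en (cmod (g (cis t))) * indicator {0..2*pi} t)" .
 have "en (2 * pi) * en (cmod (g 0)) = en (2 * pi * cmod (g 0))" by (rule ennreal_mult[symmetric]) auto
 also note ennreal_leI[OF le]
 finally show ?thesis unfolding eq .
qed

definition gauss_factor :: "'n::finite phase => complex" where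
 "gauss_factor z = (\<Prod>i\<in>UNIV. exp ((cpoint z i)\<^sup>2 / 4 - of_real ((fst z $ i)\<^sup>2 / 2)))"

lemma gauss_coeffs_factor:
 "gauss_coeffs z J = gauss_factor z * (\<Prod>i\<in>UNIV. cpoint z i ^ J i / of_real (sqrt (2 ^ J i * fact (J i))))"
 unfolding gauss_coeffs_eq gauss_factor_def gauss_coeff_def prod.distrib[symmetric] cpoint_def by simp

lemma norm_gauss_factor: "cmod (gauss_factor z) = exp (- (norm z)\<^sup>2 / 4)"
 using norm_gauss_coeffs[of z "\<lambda>_. 0"] by (simp add: gauss_coeffs_factor)

lemma bterm_gauss_coeffs: "f J * cnj (gauss_coeffs z J) = bterm f (\<lambda>i. cnj (cpoint z i)) J * cnj (gauss_factor z)"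
 unfolding bterm_def gauss_coeffs_factor by simp

lemma V_has_sum:
 assumes "f \<in> flat_dual"
 shows "((\<lambda>J. f J * cnj (gauss_coeffs z J)) has_sum bargmann f (\<lambda>i. cnj (cpoint z i)) * cnj (gauss_factor z)) UNIV"
 unfolding bterm_gauss_coeffs by (rule has_sum_cmult_left[OF bargmann_has_sum[OF assms]])

lemma V_bargmann:
 fixes f :: "'n::finite hermite_series"
 assumes "f \<in> flat_dual"
 shows "V f z = of_real (stft_const TYPE('n)) * (bargmann f (\<lambda>i. cnj (cpoint z i)) * cnj (gauss_factor z))"
 unfolding V_eq infsumI[OF V_has_sum[OF assms]] ..

lemma cpoint_continuous [continuous_intros]:
 fixes g :: "'b::topological_space => 'n::finite phase"
 assumes "continuous_on S g"
 shows "continuous_on S (\<lambda>y. cpoint (g y) i)" unfolding cpoint_def Complex_eq by (intro continuous_intros assms)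

lemma V_continuous:
 fixes f :: "'n::finite hermite_series"
 assumes "f \<in> flat_dual"
 shows "continuous_on UNIV (V f)" unfolding V_bargmann[OF assms, abs_def] gauss_factor_def
 by (intro continuous_intros bargmann_continuous[OF assms]) auto

lemma V_borel:
 "f \<in> flat_dual ==> V f \<in> borel_measurable borel" by (rule borel_continuous[OF V_continuous])

lemma V_powr_borel:
 assumes "f \<in> flat_dual"
 shows "(\<lambda>z. en (cmod (V f z) powr r)) \<in> borel_measurable borel"
proof -
 have "(\<lambda>z::complex. en (cmod z powr r)) \<in> borel_measurable borel" by measurable
 from measurable_compose[OF V_borel[OF assms(1)] this] show ?thesis .
qed

text \<open>Multiplies the complex coordinate \<open>cpoint z i\<close> by
  \<open>cis (\<theta> i)\<close>. Equal angles serve the circle averages, separate ones the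
  orthogonality of monomials.\<close>

definition rot :: "('n => real) => 'n::finite phase => 'n phase" where
 "rot \<theta> z = ((\<chi> i. cos (\<theta> i) * fst z $ i - sin (\<theta> i) * snd z $ i),
   (\<chi> i. sin (\<theta> i) * fst z $ i + cos (\<theta> i) * snd z $ i))"

lemma cpoint_rot: "cpoint (rot \<theta> z) i = cis (\<theta> i) * cpoint z i" by (simp add: cpoint_def rot_def complex_eq_iff)

lemma norm_rot: "norm (rot \<theta> z) = norm z"
proof -
 have "(norm (rot \<theta> z))\<^sup>2 = (norm z)\<^sup>2" unfolding norm_sq_pair cpoint_rot by (simp add: norm_mult)
 then show ?thesis by simp
qed

lemma rot_continuous: "continuous_on UNIV (rot \<theta>)" unfolding rot_def by (intro continuous_intros)

text \<open>For a fixed value of the variable that is left alone, a shear is a translation in the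
  other one.\<close>

lemma nn_integral_shear:
 fixes l :: "real^'n => real^'n" and h :: "'n phase => ennreal"
 assumes l: "continuous_on UNIV l" and [measurable]: "h \<in> borel_measurable borel"
 shows "(LI z. h (fst z + l (snd z), snd z)) = (LI z. h z)"
  and "(LI z. h (fst z, snd z + l (fst z))) = (LI z. h z)"
proof -
 have [measurable]: "l \<in> borel_measurable borel" by (rule borel_continuous[OF l])
 have h2: "h \<in> borel_measurable (lborel \<Otimes>\<^sub>M lborel)" by (simp add: lborel_prod)
 have m1: "(\<lambda>z. h (fst z + l (snd z), snd z)) \<in> borel_measurable (lborel \<Otimes>\<^sub>M lborel)"
  by (rule measurable_compose[OF _ assms(2)]) (simp add: borel_prod[symmetric], measurable)
 have m2: "(\<lambda>z. h (fst z, snd z + l (fst z))) \<in> borel_measurable (lborel \<Otimes>\<^sub>M lborel)"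
  by (rule measurable_compose[OF _ assms(2)]) (simp add: borel_prod[symmetric], measurable)
 have hx: "(\<lambda>x. h (x, \<xi>)) \<in> borel_measurable borel" "(\<lambda>x. h (\<xi>, x)) \<in> borel_measurable borel" for \<xi>
  by (rule measurable_compose[OF _ assms(2)], simp add: borel_prod[symmetric])+
 have t1: "(LI x. h (x + l \<xi>, \<xi>)) = (LI x. h (x, \<xi>))" for \<xi>
  using nn_integral_translate_lborel[OF hx(1)[of \<xi>], of "l \<xi>"] by (simp add: add.commute)
 have t2: "(LI \<xi>. h (x, \<xi> + l x)) = (LI \<xi>. h (x, \<xi>))" for x
  using nn_integral_translate_lborel[OF hx(2)[of x], of "l x"] by (simp add: add.commute)
 have "(LI z. h (fst z + l (snd z), snd z)) = (LI \<xi>. (LI x. h (x + l \<xi>, \<xi>)))"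
  using lborel_pair.nn_integral_snd[OF m1] by (simp add: lborel_prod)
 also have "... = (LI \<xi>. (LI x. h (x, \<xi>)))" by (simp only: t1)
 also have "... = (LI z. h z)" using lborel_pair.nn_integral_snd[OF h2] by (simp add: lborel_prod)
 finally show "(LI z. h (fst z + l (snd z), snd z)) = (LI z. h z)" .
 have "(LI z. h (fst z, snd z + l (fst z))) = (LI x. (LI \<xi>. h (x, \<xi> + l x)))"
  using lborel.nn_integral_fst[OF m2] by (simp add: lborel_prod)
 also have "... = (LI x. (LI \<xi>. h (x, \<xi>)))" by (simp only: t2)
 also have "... = (LI z. h z)" using lborel.nn_integral_fst[OF h2] by (simp add: lborel_prod)
 finally show "(LI z. h (fst z, snd z + l (fst z))) = (LI z. h z)" .
qed

text \<open>A rotation is a product of three shears, \<open>t = tan (\<theta>/2)\<close>.\<close>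

lemma nn_integral_rot_aux:
 fixes h :: "'n::finite phase => ennreal"
 assumes h: "h \<in> borel_measurable borel" and c: "\<And>i. cos (\<theta> i / 2) \<noteq> 0"
 shows "(LI z. h (rot \<theta> z)) = (LI z. h z)"
proof -
 define t where "t i = tan (\<theta> i / 2)" for i
 define T where "T x = (\<chi> i. - t i * x $ i)" for x :: "real^'n"
 define S where "S x = (\<chi> i. sin (\<theta> i) * x $ i)" for x :: "real^'n"
 have cont: "continuous_on UNIV T" "continuous_on UNIV S" unfolding T_def S_def by (intro continuous_intros)+
 define A where "A z = (fst z + T (snd z), snd z)" for z
 define B where "B z = (fst z, snd z + S (fst z))" for z
 have AB: "continuous_on UNIV A" "continuous_on UNIV B" unfolding A_def B_def
  by (intro continuous_intros continuous_on_compose2[OF cont(1)] continuous_on_compose2[OF cont(2)]; simp)+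
 have sc: "sin (\<theta> i) = 2 * sin (\<theta> i / 2) * cos (\<theta> i / 2)" "cos (\<theta> i) = 1 - 2 * (sin (\<theta> i / 2))\<^sup>2" for i
  using sin_double[of "\<theta> i / 2"] cos_double_sin[of "\<theta> i / 2"] by auto
 have 1: "1 - sin (\<theta> i) * t i = cos (\<theta> i)" for i using c[of i] unfolding sc t_def tan_def by (simp add: power2_eq_square)
 have 2: "t i * (1 + cos (\<theta> i)) = sin (\<theta> i)" for i
 proof -
  have "1 + cos (\<theta> i) = 2 * (cos (\<theta> i / 2))\<^sup>2" unfolding sc(2) by (simp add: cos_squared_eq)
  then show ?thesis using c[of i] unfolding sc(1) t_def tan_def by (simp add: power2_eq_square)
 qed
 have rot: "rot \<theta> z = A (B (A z))" for z
 proof -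
  have "cos (\<theta> i) * x - sin (\<theta> i) * y = (x - t i * y) - t i * (y + sin (\<theta> i) * (x - t i * y))" for x y i
  proof -
   have "(x - t i * y) - t i * (y + sin (\<theta> i) * (x - t i * y)) = x * (1 - sin (\<theta> i) * t i) - y * (t i * (1 + (1 - sin (\<theta> i) * t i)))"
    by (simp add: algebra_simps)
   then show ?thesis unfolding 1 2 by (simp add: mult.commute)
  qed
  moreover have "sin (\<theta> i) * x + cos (\<theta> i) * y = y + sin (\<theta> i) * (x - t i * y)" for x y i
   unfolding 1[symmetric] by (simp add: algebra_simps)
  ultimately show ?thesis unfolding rot_def A_def B_def T_def S_def by (simp add: vec_eq_iff)
 qed
 note bm = borel_continuous[OF AB(1)] borel_continuous[OF AB(2)]
 have m1: "(\<lambda>z. h (A z)) \<in> borel_measurable borel" by (rule measurable_compose[OF bm(1) h])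
 have m2: "(\<lambda>z. h (A (B z))) \<in> borel_measurable borel" by (rule measurable_compose[OF bm(2) m1])
 have "(LI z. h (A (B (A z)))) = (LI z. h (A (B z)))" using nn_integral_shear(1)[OF cont(1) m2] unfolding A_def[symmetric] .
 also have "... = (LI z. h (A z))" using nn_integral_shear(2)[OF cont(2) m1] unfolding B_def[symmetric] .
 also have "... = (LI z. h z)" using nn_integral_shear(1)[OF cont(1) h] unfolding A_def[symmetric] .
 finally show ?thesis unfolding rot .
qed

text \<open>The decomposition into shears breaks down at the angle \<pi>. Composing two rotations by
  half the angle covers everything short of a full turn.\<close>

lemma nn_integral_rot:
 fixes h :: "'n::finite phase => ennreal"
 assumes h: "h \<in> borel_measurable borel" and c: "\<And>i. \<bar>\<theta> i\<bar> < 2 * pi"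
 shows "(LI z. h (rot \<theta> z)) = (LI z. h z)"
proof -
 let ?\<theta> = "\<lambda>i. \<theta> i / 2"
 have pos: "cos (?\<theta> i / 2) \<noteq> 0" for i using cos_gt_zero_pi[of "?\<theta> i / 2"] c[of i] by (simp add: abs_less_iff)
 have "rot ?\<theta> (rot ?\<theta> z) = rot \<theta> z" for z
 proof -
  have "cpoint (rot ?\<theta> (rot ?\<theta> z)) i = cpoint (rot \<theta> z) i" for i
   unfolding cpoint_rot by (simp add: mult.assoc[symmetric] cis_mult)
  then show ?thesis by (simp add: cpoint_def prod_eq_iff vec_eq_iff)
 qed
 moreover have "(\<lambda>z. h (rot ?\<theta> z)) \<in> borel_measurable borel"
  by (rule measurable_compose[OF borel_continuous[OF rot_continuous] h])
 ultimately show ?thesis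
  using nn_integral_rot_aux[of "\<lambda>z. h (rot ?\<theta> z)" ?\<theta>, OF _ pos] nn_integral_rot_aux[of h ?\<theta>, OF h pos] by simp
qed

text \<open>On the circle around \<open>z0\<close> through \<open>w\<close> the Gaussian factor of
  \<open>V\<close> varies with \<open>Re (cis t * s)\<close>. Multiplying the Bargmann transform by
  \<open>exp (- \<zeta> * s / 2)\<close> compensates exactly this, so \<open>V\<close> on the circle
  has, up to constants, the modulus of an entire function of \<open>\<zeta>\<close>. The rotation is
  by \<open>- t\<close> because \<open>V\<close> depends on the conjugate coordinates.\<close>

lemma V_circle_mean:
 fixes f :: "'n::finite hermite_series" and z0 w :: "'n phase"
 assumes f: "f \<in> flat_dual"
 shows "en (2 * pi) * en (cmod (V f z0)) \<le>
  en (exp ((norm w)\<^sup>2 / 4)) * (LI t. en (cmod (V f (z0 + rot (\<lambda>_. - t) w))) * indicator {0..2*pi} t)"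
proof -
 let ?c = "stft_const TYPE('n)"
 define s where "s = (\<Sum>i\<in>UNIV. cpoint z0 i * cnj (cpoint w i))"
 define g where "g \<zeta> = of_real ?c * bargmann f (\<lambda>i. cnj (cpoint z0 i) + \<zeta> * cnj (cpoint w i)) * exp (- \<zeta> * s / 2)" for \<zeta>
 have hol: "g holomorphic_on UNIV" unfolding g_def by (intro holomorphic_intros bargmann_holomorphic_line[OF f]) auto
 let ?K = "exp ((norm z0)\<^sup>2 / 4)" and ?W = "exp ((norm w)\<^sup>2 / 4)"
 have eq: "cmod (g (cis t)) = ?K * ?W * cmod (V f (z0 + rot (\<lambda>_. - t) w))" for t
 proof -
  let ?u = "z0 + rot (\<lambda>_. - t) w"
  have cu: "cpoint ?u i = cpoint z0 i + cis (- t) * cpoint w i" for i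
   using cpoint_rot[of "\<lambda>_. - t" w i] by (simp add: cpoint_def complex_eq_iff)
  have "(cmod (cpoint ?u i))\<^sup>2 = (cmod (cpoint z0 i))\<^sup>2 + (cmod (cpoint w i))\<^sup>2 + 2 * Re (cis t * (cpoint z0 i * cnj (cpoint w i)))" for i
  proof -
   have "(cmod (a + b))\<^sup>2 = (cmod a)\<^sup>2 + (cmod b)\<^sup>2 + 2 * Re (a * cnj b)" for a b :: complex
    unfolding cmod_power2 by (simp add: power2_eq_square algebra_simps)
   from this[of "cpoint z0 i" "cis (- t) * cpoint w i"] show ?thesis unfolding cu by (simp add: norm_mult cis_cnj mult_ac)
  qed
  then have "(norm ?u)\<^sup>2 = (norm z0)\<^sup>2 + (norm w)\<^sup>2 + 2 * Re (cis t * s)"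
   unfolding norm_sq_pair s_def sum_distrib_left Re_sum by (simp add: sum.distrib sum_distrib_left)
  then have e: "- (norm ?u)\<^sup>2 / 4 + ((norm z0)\<^sup>2 / 4 + (norm w)\<^sup>2 / 4) = Re (- cis t * s / 2)" by (simp add: field_simps)
  have "cmod (V f ?u) = ?c * cmod (bargmann f (\<lambda>i. cnj (cpoint z0 i) + cis t * cnj (cpoint w i))) * exp (- (norm ?u)\<^sup>2 / 4)"
   unfolding V_bargmann[OF f] norm_mult norm_gauss_factor complex_mod_cnj cu using stft_const_pos[of "TYPE('n)"] by (simp add: cis_cnj)
  then have "?K * ?W * cmod (V f ?u) = ?c * cmod (bargmann f (\<lambda>i. cnj (cpoint z0 i) + cis t * cnj (cpoint w i))) * exp (- (norm ?u)\<^sup>2 / 4 + ((norm z0)\<^sup>2 / 4 + (norm w)\<^sup>2 / 4))"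
   unfolding exp_add by (simp only: mult_ac)
  also have "... = cmod (g (cis t))" unfolding e g_def norm_mult norm_exp_eq_Re using stft_const_pos[of "TYPE('n)"] by simp
  finally show ?thesis ..
 qed
 have g0: "cmod (g 0) = ?K * cmod (V f z0)" unfolding g_def V_bargmann[OF f] norm_mult norm_gauss_factor complex_mod_cnj
  by (simp add: exp_minus)
 have "en ?K * (en (2 * pi) * en (cmod (V f z0))) = en (2 * pi) * en (cmod (g 0))"
  unfolding g0 by (simp add: ennreal_mult mult_ac)
 also have "... \<le> (LI t. en (cmod (g (cis t))) * indicator {0..2*pi} t)" by (rule entire_mean_value[OF hol])
 also have "... = (LI t. en (?K * ?W) * (en (cmod (V f (z0 + rot (\<lambda>_. - t) w))) * indicator {0..2*pi} t))"
  unfolding eq by (intro nn_integral_cong) (simp add: ennreal_mult mult_ac)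
 also have "... = en (?K * ?W) * (LI t. en (cmod (V f (z0 + rot (\<lambda>_. - t) w))) * indicator {0..2*pi} t)"
 proof (rule nn_integral_cmult)
  have "continuous_on UNIV (\<lambda>t. V f (z0 + rot (\<lambda>_. - t) w))" unfolding rot_def
   by (intro continuous_on_compose2[OF V_continuous[OF f]] continuous_intros) auto
  from borel_continuous[OF this]
  have [measurable]: "(\<lambda>t. V f (z0 + rot (\<lambda>_. - t) w)) \<in> borel_measurable borel" .
  show "(\<lambda>t. en (cmod (V f (z0 + rot (\<lambda>_. - t) w))) * indicator {0..2*pi} t) \<in> borel_measurable lborel"
   by measurable
 qed
 also have "... = en ?K * (en ?W * (LI t. en (cmod (V f (z0 + rot (\<lambda>_. - t) w))) * indicator {0..2*pi} t))"
  by (simp add: ennreal_mult mult.assoc)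
 finally show ?thesis by (subst (asm) ennreal_mult_le_mult_iff) auto
qed

text \<open>The circle inequality is integrated over \<open>w\<close> in the ball. After exchanging
  the integrals, each angle contributes a rotated copy of one and the same integral.\<close>

lemma V_ball_mean:
 fixes f :: "'n::finite hermite_series" and z0 :: "'n phase"
 assumes f: "f \<in> flat_dual" and \<rho>: "\<rho> > 0"
 shows "en (cmod (V f z0)) * emeasure lborel (ball (0 :: 'n phase) \<rho>)
  \<le> en (exp (\<rho>\<^sup>2 / 4)) * (LI z. en (cmod (V f z)) * indicator (ball z0 \<rho>) z)"
proof -
 let ?V = "\<lambda>z. en (cmod (V f z))" and ?E = "en (exp (\<rho>\<^sup>2 / 4))"
 let ?B = "ball (0 :: 'n phase) \<rho>" and ?T = "{0..2*pi::real}"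
 let ?K = "\<lambda>t w. ?V (z0 + rot (\<lambda>_. - t) w) * indicator ?T t * indicator ?B w"
 define G where "G w = ?V (z0 + w) * indicator ?B w" for w
 have "continuous_on UNIV (\<lambda>w. z0 + w)" by (intro continuous_intros)
 from measurable_compose[OF borel_continuous[OF this] V_borel[OF f]]
 have [measurable]: "(\<lambda>w. V f (z0 + w)) \<in> borel_measurable borel" .
 have ball [measurable]: "ball z r \<in> sets borel" for z :: "'n phase" and r by simp
 have Gm: "G \<in> borel_measurable borel" unfolding G_def by measurable
 define J where "J = (LI w. G w)"
 have jm: "(\<lambda>p. ?V (z0 + rot (\<lambda>_. - snd p) (fst p)) * indicator ?T (snd p) * indicator ?B (fst p)) \<in> borel_measurable (lborel \<Otimes>\<^sub>M lborel)"
 proof -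
  have "continuous_on UNIV (\<lambda>p :: 'n phase \<times> real. V f (z0 + rot (\<lambda>_. - snd p) (fst p)))" unfolding rot_def
   by (intro continuous_on_compose2[OF V_continuous[OF f]] continuous_intros) auto
  from borel_continuous[OF this]
  have [measurable]: "(\<lambda>p. V f (z0 + rot (\<lambda>_. - snd p) (fst p))) \<in> borel_measurable (lborel \<Otimes>\<^sub>M lborel)"
   by (simp add: lborel_prod)
  show ?thesis by measurable
 qed
 have "en (2 * pi) * (?V z0 * emeasure lborel ?B) = (LI w. (en (2 * pi) * ?V z0) * indicator ?B w)"
  by (subst nn_integral_cmult_indicator) (auto simp: mult.assoc)
 also have "... \<le> (LI w. ?E * (LI t. ?K t w))"
 proof (rule nn_integral_mono)
  fix w :: "'n phase"
  have "en (exp ((norm w)\<^sup>2 / 4)) \<le> ?E" if "norm w < \<rho>" using that by (intro ennreal_leI) (simp add: power_mono)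
  then show "(en (2 * pi) * ?V z0) * indicator ?B w \<le> ?E * (LI t. ?K t w)"
   using V_circle_mean[OF f, of z0 w] by (auto split: split_indicator elim!: order_trans intro!: mult_right_mono)
 qed
 also have "... = ?E * (LI w. (LI t. ?K t w))"
  using lborel.borel_measurable_nn_integral_fst[OF jm] by (intro nn_integral_cmult) simp
 also have "(LI w. (LI t. ?K t w))
   = (LI t. (LI w. ?K t w))" using lborel_pair.Fubini[OF jm] by simp
 also have "... = (LI t. J * indicator ?T t)"
 proof (rule nn_integral_cong_AE)
  \<comment> \<open>The endpoint of the interval is discarded because rotation invariance is stated
    for angles below a full turn.\<close>
  show "AE t in lborel. (LI w. ?K t w) = J * indicator ?T t"
   using AE_lborel_singleton[of "2*pi"]
  proof eventually_elim
   fix t :: real assume "t \<noteq> 2 * pi"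
   show "(LI w. ?K t w) = J * indicator ?T t"
   proof (cases "t \<in> ?T")
    case True
    then have "\<bar>- t\<bar> < 2 * pi" using \<open>t \<noteq> 2 * pi\<close> by auto
    have "(LI w. ?K t w) = (LI w. G (rot (\<lambda>_. - t) w))"
     using True by (intro nn_integral_cong) (auto simp: G_def norm_rot split: split_indicator)
    also have "... = J" unfolding J_def by (rule nn_integral_rot[OF Gm]) fact
    finally show ?thesis using True by simp
   qed simp
  qed
 qed
 also have "... = en (2 * pi) * J" by (subst nn_integral_cmult_indicator) (auto simp: mult.commute)
 finally have "en (2 * pi) * (?V z0 * emeasure lborel ?B) \<le> en (2 * pi) * (?E * J)" by (simp add: mult_ac)
 then have "?V z0 * emeasure lborel ?B \<le> ?E * J" by (subst (asm) ennreal_mult_le_mult_iff) auto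
 moreover have "J = (LI z. ?V z * indicator (ball z0 \<rho>) z)"
 proof -
  have "J = (LI w. ?V (z0 + w) * indicator (ball z0 \<rho>) (z0 + w))"
   unfolding J_def G_def by (intro nn_integral_cong) (auto simp: dist_norm split: split_indicator)
  moreover have [measurable]: "V f \<in> borel_measurable borel" by (rule V_borel[OF f])
  ultimately show ?thesis using nn_integral_translate_lborel[where f="\<lambda>z. ?V z * indicator (ball z0 \<rho>) z"] by simp
 qed
 ultimately show ?thesis by simp
qed

text \<open>The argument of Hardy and Littlewood: for \<open>r < 1\<close> the mean value inequality is applied at a
 maximum of \<open>|V z| (R - |z - z0|)\<^sup>m\<close>, which allows to trade \<open>|V|\<close> for \<open>|V|\<^sup>r\<close> under the integral.\<close>

lemma V_local_bound:
 assumes r: "0 < r" "r \<le> 1" and R: "R > 0"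
 obtains C where "C > 0"
  "\<And>f :: 'n::finite hermite_series. \<And>z0. f \<in> flat_dual ==>
   en (cmod (V f z0) powr r) \<le>
   en C * (LI z. en (cmod (V f z) powr r) * indicator (ball z0 R) z)"
proof -
 define D where "D = DIM('n phase)"
 define v where "v = unit_ball_vol (real D)"
 have v: "v > 0" unfolding v_def by simp
 define C1 where "C1 = exp (R\<^sup>2 / 4) / v"
 have C1: "C1 > 0" unfolding C1_def using v by simp
 \<comment> \<open>Chosen so that \<open>m * r \<ge> D\<close>: in the final comparison the leftover
   power \<open>m * r - D\<close> of the radius \<open>\<rho>\<close> is then nonnegative, and
   \<open>\<rho>\<close> may be replaced by \<open>R\<close>.\<close>
 define m where "m = nat \<lceil>D / r\<rceil>"
 have "D / r \<le> real m" unfolding m_def by linarith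
 then have mr: "real D \<le> m * r" using r by (simp add: divide_le_eq)
 define C where "C = 2 ^ m * C1 / R ^ D"
 have C: "C > 0" unfolding C_def using C1 R by simp
 have "en (cmod (V f z0) powr r) \<le>
   en C * (LI z. en (cmod (V f z) powr r) * indicator (ball z0 R) z)"
  if f: "f \<in> flat_dual" for f :: "'n::finite hermite_series" and z0
 proof (cases "V f z0 = 0")
  case False
  let ?V = "\<lambda>z. cmod (V f z)"
  define I where "I = (LI z. en (?V z powr r) * indicator (ball z0 R) z)"
  \<comment> \<open>The distance to the boundary of the ball. Its power in \<open>H\<close> vanishes
    there, so the maximum lies in the interior and controls \<open>V\<close> in a
    neighbourhood.\<close>
  define t where "t z = R - norm (z - z0)" for z
  define H where "H z = ?V z * t z ^ m" for z
  have "continuous_on (cball z0 R) H" unfolding H_def t_def by (intro continuous_intros continuous_on_subset[OF V_continuous[OF f]]) auto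
  then obtain z1 where z1: "z1 \<in> cball z0 R" "\<And>z. z \<in> cball z0 R ==> H z \<le> H z1"
   using continuous_attains_sup[of "cball z0 R" H] R by auto
  define M where "M = H z1"
  have "0 < ?V z0 * R ^ m" using False R by simp
  also have HR: "?V z0 * R ^ m \<le> M" using z1(2)[of z0] R by (simp add: H_def t_def M_def)
  finally have M: "M > 0" .
  have t0: "t z1 \<ge> 0" using z1(1) by (simp add: t_def dist_norm norm_minus_commute)
  have m0: "m > 0" using mr r by (cases m) (auto simp: D_def)
  have t1: "t z1 > 0" using M t0 m0 unfolding M_def H_def by (cases "t z1 = 0") (auto simp: zero_power)
  define \<rho> where "\<rho> = t z1 / 2"
  have "t z1 \<le> R" by (simp add: t_def)
  then have "\<rho> \<le> R" using t1 by (simp add: \<rho>_def)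
  then have \<rho>: "\<rho> > 0" "\<rho> \<le> R" using t1 by (simp_all add: \<rho>_def)
  define Q where "Q = M / \<rho> ^ m"
  have Q: "Q > 0" unfolding Q_def using M \<rho> by simp
  have V1: "?V z1 = Q / 2 ^ m" using t1 unfolding Q_def M_def H_def \<rho>_def by (simp add: power_divide)
  \<comment> \<open>Within half the boundary distance of the maximum \<open>t\<close> is at least
    \<open>\<rho>\<close>, so \<open>V\<close> is at most \<open>Q\<close> there. The part of
    \<open>V\<close> beyond the power \<open>r\<close> is therefore bounded by a power of
    \<open>Q\<close>.\<close>
  have sub: "?V w \<le> ?V w powr r * Q powr (1 - r) \<and> w \<in> ball z0 R" if w: "w \<in> ball z1 \<rho>" for w
  proof -
   have tw: "t w \<ge> \<rho>" using w norm_triangle_ineq[of "w - z1" "z1 - z0"] unfolding \<rho>_def t_def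
    by (simp add: dist_norm norm_minus_commute field_simps)
   then have "w \<in> ball z0 R" using \<rho> by (simp add: t_def dist_norm norm_minus_commute)
   then have "?V w * t w ^ m \<le> M" using z1(2)[of w] by (auto simp: H_def M_def)
   moreover have "?V w * \<rho> ^ m \<le> ?V w * t w ^ m" using tw \<rho> by (intro mult_left_mono power_mono) auto
   ultimately have "?V w \<le> Q" unfolding Q_def using \<rho> by (simp add: pos_le_divide_eq)
   then have "?V w powr (1 - r) \<le> Q powr (1 - r)" using r by (intro powr_mono2) auto
   then have "?V w powr r * ?V w powr (1 - r) \<le> ?V w powr r * Q powr (1 - r)" by (intro mult_left_mono) auto
   moreover have "?V w powr r * ?V w powr (1 - r) = ?V w" by (simp add: powr_add[symmetric])
   ultimately show ?thesis using \<open>w \<in> ball z0 R\<close> by simp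
  qed
  have "en (?V z1) * en (v * \<rho> ^ D) \<le> en (exp (\<rho>\<^sup>2 / 4)) * (LI z. en (?V z) * indicator (ball z1 \<rho>) z)"
   using V_ball_mean[OF f \<rho>(1), of z1] \<rho> unfolding emeasure_ball[OF less_imp_le[OF \<rho>(1)]] v_def D_def by simp
  also have "... \<le> en (exp (R\<^sup>2 / 4)) * (LI z. en (Q powr (1 - r)) * (en (?V z powr r) * indicator (ball z0 R) z))"
  proof (rule mult_mono[OF _ nn_integral_mono])
   show "en (exp (\<rho>\<^sup>2 / 4)) \<le> en (exp (R\<^sup>2 / 4))" using \<rho> by (intro ennreal_leI) (simp add: power_mono)
   fix z
   show "en (?V z) * indicator (ball z1 \<rho>) z \<le> en (Q powr (1 - r)) * (en (?V z powr r) * indicator (ball z0 R) z)"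
   proof (cases "z \<in> ball z1 \<rho>")
    case True
    then show ?thesis using sub[OF True] by (auto simp: ennreal_mult[symmetric] mult.commute intro!: ennreal_leI split: split_indicator)
   qed simp
  qed auto
  also have "... = en (exp (R\<^sup>2 / 4) * Q powr (1 - r)) * I"
  proof -
   have "(\<lambda>z. en (?V z powr r) * indicator (ball z0 R) z) \<in> borel_measurable lborel" unfolding measurable_lborel2
    by (rule borel_measurable_times_ennreal[OF V_powr_borel[OF f]
      borel_measurable_indicator[OF borel_open[OF open_ball]]])
   from nn_integral_cmult[OF this] show ?thesis unfolding I_def by (simp only: ennreal_mult[OF exp_ge_zero powr_ge_zero] mult.assoc)
  qed
  finally have main: "en (?V z1 * (v * \<rho> ^ D)) \<le> en (exp (R\<^sup>2 / 4) * Q powr (1 - r)) * I"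
   using v \<rho> by (simp add: ennreal_mult)
  show ?thesis unfolding I_def[symmetric]
  proof (cases I)
   case top then show "en (?V z0 powr r) \<le> en C * I" using C by (simp add: ennreal_mult_top)
  next
   case (real i)
   have "?V z1 * (v * \<rho> ^ D) \<le> exp (R\<^sup>2 / 4) * Q powr (1 - r) * i"
    using main real by (simp add: ennreal_mult[symmetric] ennreal_le_iff)
   then have "Q * \<rho> ^ D * v \<le> 2 ^ m * (exp (R\<^sup>2 / 4) * Q powr (1 - r) * i)" unfolding V1 by (simp add: field_simps)
   then have "Q * \<rho> ^ D \<le> 2 ^ m * C1 * Q powr (1 - r) * i" unfolding C1_def using v by (simp add: field_simps)
   moreover have "Q = Q powr r * Q powr (1 - r)" using Q by (simp add: powr_add[symmetric])
   ultimately have "(Q powr r * \<rho> ^ D) * Q powr (1 - r) \<le> (2 ^ m * C1 * i) * Q powr (1 - r)" by (simp add: mult_ac)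
   then have Qr: "Q powr r * \<rho> ^ D \<le> 2 ^ m * C1 * i" using Q by (subst (asm) mult_le_cancel_right) auto
   have "(?V z0 * R ^ m) powr r \<le> M powr r" using HR r R by (intro powr_mono2) auto
   also have "M = Q * \<rho> ^ m" unfolding Q_def using \<rho> by simp
   also have "(Q * \<rho> ^ m) powr r = Q powr r * \<rho> powr (m * r)"
    using Q \<rho> by (simp add: powr_mult powr_realpow[symmetric] powr_powr)
   also have "\<rho> powr (m * r) = \<rho> ^ D * \<rho> powr (m * r - D)"
    using \<rho> by (simp add: powr_realpow[symmetric] powr_add[symmetric])
   also have "Q powr r * (\<rho> ^ D * \<rho> powr (m * r - D)) \<le> (2 ^ m * C1 * i) * R powr (m * r - D)"
    unfolding mult.assoc[symmetric] using \<rho> mr C1 real by (intro mult_mono Qr powr_mono2) auto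
   finally have "(?V z0 * R ^ m) powr r \<le> (2 ^ m * C1 * i) * R powr (m * r - D)" .
   moreover have "(?V z0 * R ^ m) powr r = ?V z0 powr r * R powr (m * r)" using R by (simp add: powr_mult powr_realpow[symmetric] powr_powr)
   moreover have "R powr (m * r) = R ^ D * R powr (m * r - D)" using R by (simp add: powr_realpow[symmetric] powr_add[symmetric])
   ultimately have "(?V z0 powr r * R ^ D) * R powr (m * r - D) \<le> (2 ^ m * C1 * i) * R powr (m * r - D)" by (simp add: mult.assoc)
   then have "?V z0 powr r * R ^ D \<le> 2 ^ m * C1 * i" using R by (subst (asm) mult_le_cancel_right) auto
   then have "?V z0 powr r \<le> C * i" unfolding C_def using R by (simp add: field_simps)
   then show "en (?V z0 powr r) \<le> en C * I" using real C by (simp add: ennreal_mult[symmetric] ennreal_leI)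
  qed
 qed (use r in simp)
 then show ?thesis using that[OF C] by blast
qed

section \<open>The pairing as an integral over phase space\<close>

lemma gbinomial_minus_half:
 "((-1/2::real) gchoose k) = (-1/4) ^ k * (fact (2 * k) / (fact k * fact k))"
proof (induction k)
 case (Suc k)
 have "(-1/2::real) * ((-1/2) gchoose k) = of_nat k * ((-1/2) gchoose k) + of_nat (Suc k) * ((-1/2) gchoose Suc k)"
  by (rule gbinomial_mult_1)
 then have "((-1/2::real) gchoose Suc k) = (-1/2 - real k) / real (Suc k) * ((-1/2) gchoose k)" by (simp add: field_simps)
 also have "... = (-1/2 - real k) / real (Suc k) * ((-1/4) ^ k * (fact (2 * k) / (fact k * fact k)))" unfolding Suc.IH ..
 also have "... = (-1/4) ^ Suc k * (fact (2 * Suc k) / (fact (Suc k) * fact (Suc k)))"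
 proof -
  have f: "fact (2 * Suc k) = (2 * real k + 2) * (2 * real k + 1) * fact (2 * k)" "fact (Suc k) = (real k + 1) * fact k"
   by (simp_all add: algebra_simps)
  have "(0::real) < fact k" "real k + 1 > 0" by auto
  then show ?thesis unfolding f power_Suc by (simp add: divide_simps) (simp add: algebra_simps)
 qed
 finally show ?case .
qed simp

text \<open>Coefficient comparison in the square of \<open>(1 - 4 * x) powr (-1/2)\<close>, carried
  out as Vandermonde's identity for the exponent -1/2.\<close>

lemma sum_central_binomial:
 "(\<Sum>k\<le>n. (fact (2 * k) / (fact k * fact k)) * (fact (2 * (n - k)) / (fact (n - k) * fact (n - k))) :: real) = 4 ^ n"
  (is "(\<Sum>k\<le>n. ?b k * ?b (n - k)) = _")
proof -
 have "(\<Sum>k\<le>n. ((-1/2::real) gchoose k) * ((-1/2) gchoose (n - k))) = (-1/2 + -1/2) gchoose n"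
  using gbinomial_Vandermonde[of "-1/2::real" "-1/2" n] by (simp add: atMost_atLeast0)
 also have "... = (-1) ^ n" using gbinomial_minus[of "1::real" n] by (simp add: binomial_gbinomial[symmetric])
 also have "(\<Sum>k\<le>n. ((-1/2::real) gchoose k) * ((-1/2) gchoose (n - k))) = (\<Sum>k\<le>n. (-1/4) ^ n * (?b k * ?b (n - k)))"
 proof (rule sum.cong[OF refl])
  fix k assume "k \<in> {..n}"
  then have "(-1/4::real) ^ k * (-1/4) ^ (n - k) = (-1/4) ^ n" by (simp flip: power_add)
  then show "((-1/2::real) gchoose k) * ((-1/2) gchoose (n - k)) = (-1/4) ^ n * (?b k * ?b (n - k))"
  proof -
   have "((-1/4) ^ k * ?b k) * ((-1/4) ^ (n - k) * ?b (n - k)) = ((-1/4) ^ k * (-1/4) ^ (n - k)) * (?b k * ?b (n - k))"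
    by (simp only: mult_ac)
   then show ?thesis unfolding gbinomial_minus_half by (simp only: \<open>(-1/4::real) ^ k * (-1/4) ^ (n - k) = (-1/4) ^ n\<close>)
  qed
 qed
 finally have "(-1/4) ^ n * (\<Sum>k\<le>n. ?b k * ?b (n - k)) = (-1) ^ n" by (simp add: sum_distrib_left)
 then have "(-4) ^ n * ((-1/4) ^ n * (\<Sum>k\<le>n. ?b k * ?b (n - k))) = (-4) ^ n * (-1) ^ n" by simp
 then show ?thesis unfolding mult.assoc[symmetric] power_mult_distrib[symmetric] by simp
qed

text \<open>The binomial expansion of \<open>(x\<^sup>2 + \<xi>\<^sup>2) ^ n\<close> leaves products
  of even normal moments, which \<open>sum_central_binomial\<close> adds up. That the value is the
  same for all \<open>n\<close> makes the passage to phase space isometric after scaling.\<close>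

lemma gauss_coeff_norm_integral:
 "(LI \<xi>. en ((cmod (gauss_coeff x \<xi> n))\<^sup>2)) < \<infinity>"
 "(LI x. (LI \<xi>. en ((cmod (gauss_coeff x \<xi> n))\<^sup>2))) = en (2 * pi)"
proof -
 let ?g = "\<lambda>x \<xi>. (cmod (gauss_coeff x \<xi> n))\<^sup>2"
 define \<phi> where "\<phi> = std_normal_density"
 define m where "m k = fact (2 * k) / (2 ^ k * fact k :: real)" for k
 have m0: "m k \<ge> 0" for k unfolding m_def by simp
 have mom: "(LI x. en (\<phi> x * x ^ (2 * k))) = en (m k)" for k unfolding \<phi>_def m_def using std_normal_moment_even[of k]
  by (subst nn_integral_eq_integral) (auto simp: has_bochner_integral_iff)
 define c where "c = 2 * pi / (2 ^ n * fact n)"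
 have c: "c > 0" unfolding c_def by simp
 have eq: "?g x \<xi> = (\<Sum>k\<le>n. (c * real (n choose k) * (\<phi> x * x ^ (2 * k))) * (\<phi> \<xi> * \<xi> ^ (2 * (n - k))))" for x \<xi>
 proof -
  have e: "exp (- (x\<^sup>2 + \<xi>\<^sup>2) / 4) ^ 2 = 2 * pi * (\<phi> x * \<phi> \<xi>)"
  proof -
   have "exp (- (x\<^sup>2 + \<xi>\<^sup>2) / 4) ^ 2 = exp (- x\<^sup>2 / 2) * exp (- \<xi>\<^sup>2 / 2)"
    by (simp add: exp_double[symmetric] exp_add[symmetric] add_divide_distrib)
   then show ?thesis unfolding \<phi>_def std_normal_density_def by (simp add: field_simps)
  qed
  have "?g x \<xi> = 2 * pi * (\<phi> x * \<phi> \<xi>) * ((x\<^sup>2 + \<xi>\<^sup>2) ^ n / (2 ^ n * fact n))"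
   unfolding norm_gauss_coeff power_mult_distrib e
   by (simp add: power_divide power_mult[symmetric] mult.commute[of n 2]) (simp add: power_mult cmod_power2)
  also have "(x\<^sup>2 + \<xi>\<^sup>2) ^ n = (\<Sum>k\<le>n. real (n choose k) * x ^ (2 * k) * \<xi> ^ (2 * (n - k)))"
   by (subst binomial_ring) (simp add: power_mult)
  finally show ?thesis unfolding c_def by (simp add: sum_distrib_left sum_distrib_right sum_divide_distrib mult_ac)
 qed
 have gen: "en (A * p) * en M = en (A * M) * en p" if "0 \<le> A" "0 \<le> p" "0 \<le> M" for A p M
  using that by (simp add: ennreal_mult mult_ac)
 have inner: "(LI \<xi>. en (?g x \<xi>))
   = (\<Sum>k\<le>n. en (c * real (n choose k) * m (n - k)) * en (\<phi> x * x ^ (2 * k)))" for x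
 proof -
  have "(LI \<xi>. en (?g x \<xi>)) =
   (LI \<xi>. (\<Sum>k\<le>n. en (c * real (n choose k) * (\<phi> x * x ^ (2 * k))) * en (\<phi> \<xi> * \<xi> ^ (2 * (n - k)))))"
   unfolding eq using c by (intro nn_integral_cong, subst sum_ennreal[symmetric]) (auto simp: \<phi>_def ennreal_mult[symmetric])
  also have "... = (\<Sum>k\<le>n. en (c * real (n choose k) * (\<phi> x * x ^ (2 * k))) * en (m (n - k)))"
   by (subst nn_integral_sum) (auto simp: \<phi>_def nn_integral_cmult mom[unfolded \<phi>_def])
  also have "... = (\<Sum>k\<le>n. en (c * real (n choose k) * m (n - k)) * en (\<phi> x * x ^ (2 * k)))"
   using c m0 by (intro sum.cong refl gen) (auto simp: \<phi>_def)
  finally show ?thesis .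
 qed
 then show "(LI \<xi>. en (?g x \<xi>)) < \<infinity>" by (simp add: ennreal_mult_less_top)
 have "(LI x. (LI \<xi>. en (?g x \<xi>)))
   = (\<Sum>k\<le>n. en (c * real (n choose k) * m (n - k)) * en (m k))"
  unfolding inner by (subst nn_integral_sum) (auto simp: \<phi>_def nn_integral_cmult mom[unfolded \<phi>_def])
 also have "... = en (\<Sum>k\<le>n. c * real (n choose k) * m (n - k) * m k)"
  using c m0 by (subst sum_ennreal[symmetric]) (auto simp: ennreal_mult[symmetric])
 also have "(\<Sum>k\<le>n. c * real (n choose k) * m (n - k) * m k) =
   (\<Sum>k\<le>n. 2 * pi / 4 ^ n * ((fact (2 * k) / (fact k * fact k)) * (fact (2 * (n - k)) / (fact (n - k) * fact (n - k)))))"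
 proof (rule sum.cong[OF refl])
  fix k assume k: "k \<in> {..n}"
  have "real (n choose k) = fact n / (fact k * fact (n - k))" using k by (simp add: binomial_fact)
  moreover have "(2::real) ^ k * 2 ^ (n - k) = 2 ^ n" using k by (simp flip: power_add)
  moreover have "(4::real) ^ n = 2 ^ n * 2 ^ n" by (simp flip: power_mult_distrib)
  moreover have "(fact n :: real) > 0" "(fact k :: real) > 0" "(fact (n - k) :: real) > 0" "(2::real) ^ n > 0" "(2::real) ^ k > 0" "(2::real) ^ (n - k) > 0" by auto
  ultimately show "c * real (n choose k) * m (n - k) * m k = 2 * pi / 4 ^ n * ((fact (2 * k) / (fact k * fact k)) * (fact (2 * (n - k)) / (fact (n - k) * fact (n - k))))"
   unfolding c_def m_def by (simp add: divide_simps) (simp add: mult_ac)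
 qed
 also have "... = 2 * pi" unfolding sum_distrib_left[symmetric] sum_central_binomial by simp
 finally show "(LI x. (LI \<xi>. en (?g x \<xi>))) = en (2 * pi)" .
qed

lemma nn_integral_pair_lborel:
 fixes h :: "'a::euclidean_space \<times> 'b::euclidean_space => ennreal"
 assumes "h \<in> borel_measurable borel"
 shows "(LI z. h z) = (LI x. (LI y. h (x, y)))" using lborel.nn_integral_fst[of h lborel] assms by (simp add: lborel_prod)

lemma nn_integral_lborel_vec:
 fixes f :: "'n::finite => real => real"
 assumes "\<And>i. f i \<in> borel_measurable borel" "\<And>i t. f i t \<ge> 0" "\<And>i. (LI t. en (f i t)) < \<infinity>"
 shows "(LI y. en (\<Prod>i\<in>UNIV. f i ((y::real^'n) $ i))) = (\<Prod>i\<in>UNIV. (LI t. en (f i t)))"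
proof -
 have int: "integrable lborel (f i)" for i using assms by (intro integrableI_nonneg) auto
 have "(LI y. en (\<Prod>i\<in>UNIV. f i ((y::real^'n) $ i))) = en (LINT y|lborel. (\<Prod>i\<in>UNIV. f i ((y::real^'n) $ i)))"
  by (rule nn_integral_eq_integral) (auto intro!: lborel_vec(1) int prod_nonneg assms)
 also have "... = en (\<Prod>i\<in>UNIV. LINT t|lborel. f i t)" by (subst lborel_vec(2)) (auto intro: int)
 also have "... = (\<Prod>i\<in>UNIV. en (LINT t|lborel. f i t))"
  by (rule prod_ennreal[symmetric]) (auto intro!: Bochner_Integration.integral_nonneg assms)
 also have "... = (\<Prod>i\<in>UNIV. (LI t. en (f i t)))"
  by (intro prod.cong refl nn_integral_eq_integral[symmetric] int) (auto simp: assms)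
 finally show ?thesis .
qed

lemma gauss_coeffs_continuous: "continuous_on UNIV (\<lambda>z. gauss_coeffs z J)"
 unfolding gauss_coeffs_factor gauss_factor_def by (intro continuous_intros) auto

lemma gauss_coeffs_borel [measurable]: "(\<lambda>z. gauss_coeffs z J) \<in> borel_measurable borel"
 by (rule borel_continuous[OF gauss_coeffs_continuous])

lemma gauss_coeffs_norm_integral:
 "(LI z. en ((cmod (gauss_coeffs (z :: 'n::finite phase) J))\<^sup>2)) = en ((2 * pi) ^ CARD('n))"
proof -
 define g where "g i x \<xi> = (cmod (gauss_coeff x \<xi> (J i)))\<^sup>2" for i x \<xi>
 have cont: "continuous_on UNIV (\<lambda>p. g i (fst p) (snd p))" for i
  unfolding g_def norm_gauss_coeff by (intro continuous_intros) (auto simp: Complex_eq intro!: continuous_intros)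
 have m2: "(\<lambda>p. g i (fst p) (snd p)) \<in> borel_measurable (lborel \<Otimes>\<^sub>M lborel)" for i
  using borel_continuous[OF cont] by (simp add: lborel_prod)
 have m1: "(\<lambda>\<xi>. g i x \<xi>) \<in> borel_measurable borel" for i x
  using measurable_compose_Pair1[of x lborel, OF _ m2[of i]] by simp
 have m0: "(\<lambda>x. (LI \<xi>. en (g i x \<xi>))) \<in> borel_measurable borel" for i
  using lborel.borel_measurable_nn_integral_fst[of "\<lambda>p. en (g i (fst p) (snd p))" lborel] m2[of i] by simp
 have tot: "(LI x. (LI \<xi>. en (g i x \<xi>))) = en (2 * pi)" for i unfolding g_def by (rule gauss_coeff_norm_integral)
 define G where "G i x = enn2real (LI \<xi>. en (g i x \<xi>))" for i x
 have Gm [measurable]: "G i \<in> borel_measurable borel" for i unfolding G_def using m0[of i] by simp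
 have fin: "(LI \<xi>. en (g i x \<xi>)) < \<infinity>" for i x unfolding g_def by (rule gauss_coeff_norm_integral)
 have Gnn: "G i x \<ge> 0" for i x by (simp add: G_def)
 have Gint: "(LI x. en (G i x)) = en (2 * pi)" for i unfolding tot[of i, symmetric]
  by (rule nn_integral_cong) (use fin in \<open>simp add: G_def\<close>)
 have sq: "(cmod (gauss_coeffs (x, \<xi>) J))\<^sup>2 = (\<Prod>i\<in>UNIV. g i (x $ i) (\<xi> $ i))" for x \<xi> :: "real^'n"
  unfolding gauss_coeffs_eq g_def by (simp add: prod_norm[symmetric] prod_power_distrib)
 have "(LI z. en ((cmod (gauss_coeffs (z :: 'n phase) J))\<^sup>2))
   = (\<integral>\<^sup>+ x. \<integral>\<^sup>+ \<xi>. en (\<Prod>i\<in>UNIV. g i (x $ i) (\<xi> $ i)) \<partial>(lborel :: (real^'n) measure) \<partial>(lborel :: (real^'n) measure))"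
  by (subst nn_integral_pair_lborel) (auto simp: sq)
 also have "... = (\<integral>\<^sup>+ x. en (\<Prod>i\<in>UNIV. G i (x $ i)) \<partial>(lborel :: (real^'n) measure))"
 proof (rule nn_integral_cong)
  fix x :: "real^'n"
  have "(\<integral>\<^sup>+ \<xi>. en (\<Prod>i\<in>UNIV. g i (x $ i) (\<xi> $ i)) \<partial>(lborel :: (real^'n) measure)) = (\<Prod>i\<in>UNIV. (LI t. en (g i (x $ i) t)))"
   by (rule nn_integral_lborel_vec) (use m1 fin in \<open>auto simp: g_def\<close>)
  also have "... = en (\<Prod>i\<in>UNIV. G i (x $ i))"
   unfolding G_def by (subst prod_ennreal[symmetric]) (use fin in \<open>auto simp: less_top\<close>)
  finally show "(\<integral>\<^sup>+ \<xi>. en (\<Prod>i\<in>UNIV. g i (x $ i) (\<xi> $ i)) \<partial>(lborel :: (real^'n) measure)) = en (\<Prod>i\<in>UNIV. G i (x $ i))" .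
 qed
 also have "... = (\<Prod>i\<in>(UNIV::'n set). en (2 * pi))" by (subst nn_integral_lborel_vec) (simp_all add: Gint Gnn Gm)
 finally show ?thesis by (simp add: ennreal_power)
qed

section \<open>Gaussian decay against exponential growth\<close>

lemma integrable_exp_neg_sq:
 assumes a: "a > 0"
 shows "integrable lborel (\<lambda>z::'n::finite phase. exp (- a * (norm z)\<^sup>2))"
proof -
 have one: "integrable lborel (\<lambda>t. exp (- a * t\<^sup>2))"
 proof -
  define \<sigma> where "\<sigma> = 1 / sqrt (2 * a)"
  have "integrable lborel (\<lambda>t. sqrt (2 * pi * \<sigma>\<^sup>2) * normal_density 0 \<sigma> t)"
   by (intro integrable_mult_right integrable_normal_density) (use a in \<open>simp add: \<sigma>_def\<close>)
  moreover have "sqrt (2 * pi * \<sigma>\<^sup>2) * normal_density 0 \<sigma> t = exp (- a * t\<^sup>2)" for t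
   using a unfolding normal_density_def \<sigma>_def by (simp add: power_divide)
  ultimately show ?thesis by simp
 qed
 have norm: "(norm x)\<^sup>2 = (\<Sum>i\<in>UNIV. (x $ i)\<^sup>2)" for x :: "real^'n" by (simp add: norm_vec_def L2_set_def sum_nonneg)
 have vec: "integrable lborel (\<lambda>x::real^'n. exp (- a * (norm x)\<^sup>2))"
  using lborel_vec(1)[of "\<lambda>_ t. exp (- a * t\<^sup>2)", OF one] by (simp add: norm exp_sum[symmetric] sum_distrib_left)
 have split: "exp (- a * (norm (x, \<xi>))\<^sup>2) = exp (- a * (norm x)\<^sup>2) * exp (- a * (norm \<xi>)\<^sup>2)" for x \<xi> :: "real^'n"
  by (simp add: norm_Pair exp_add[symmetric] algebra_simps)
 show ?thesis
 proof (rule integrableI_nonneg)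
  show "(\<lambda>z::'n phase. exp (- a * (norm z)\<^sup>2)) \<in> borel_measurable lborel"
   unfolding measurable_lborel2 by (intro borel_continuous continuous_intros)
  then have m: "(\<lambda>z::'n phase. en (exp (- a * (norm z)\<^sup>2))) \<in> borel_measurable borel" by simp
  let ?I = "\<integral>\<^sup>+ x. en (exp (- a * (norm x)\<^sup>2)) \<partial>(lborel :: (real^'n) measure)"
  have "(LI z. en (exp (- a * (norm (z::'n phase))\<^sup>2))) = ?I * ?I" unfolding nn_integral_pair_lborel[OF m] split
   by (simp add: ennreal_mult nn_integral_cmult nn_integral_multc)
  moreover have "?I < \<infinity>" using vec by (simp add: integrable_iff_bounded)
  ultimately show "(LI z. en (exp (- a * (norm (z::'n phase))\<^sup>2))) < \<infinity>" by (simp add: ennreal_mult_less_top)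
 qed simp
qed

lemma exp_linear_le_square:
 assumes "a > 0" shows "exp (r * t - a * t\<^sup>2) \<le> exp (r\<^sup>2 / (2 * a)) * exp (- (a / 2) * t\<^sup>2 :: real)"
proof -
 have "0 \<le> (a * t - r)\<^sup>2" by simp
 then have "2 * a * (r * t) \<le> 2 * a * (r\<^sup>2 / (2 * a) + a / 2 * t\<^sup>2)"
  using assms by (simp add: power2_eq_square algebra_simps)
 then have "r * t \<le> r\<^sup>2 / (2 * a) + a / 2 * t\<^sup>2" using assms by (subst (asm) mult_le_cancel_left_pos) auto
 then show ?thesis by (simp add: exp_add[symmetric] algebra_simps)
qed

lemma integrable_exp_gauss:
 assumes a: "a > 0"
 shows "integrable lborel (\<lambda>z::'n::finite phase. exp (r * norm z - a * (norm z)\<^sup>2))"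
proof (rule Bochner_Integration.integrable_bound)
 show "integrable lborel (\<lambda>z::'n phase. exp (r\<^sup>2 / (2 * a)) * exp (- (a / 2) * (norm z)\<^sup>2))"
  using a by (intro integrable_mult_right integrable_exp_neg_sq) simp
 show "(\<lambda>z::'n phase. exp (r * norm z - a * (norm z)\<^sup>2)) \<in> borel_measurable lborel"
  unfolding measurable_lborel2 by (intro borel_continuous continuous_intros)
qed (use exp_linear_le_square[OF a] in simp)

lemma norm_cpoint_le: "cmod (cpoint z i) \<le> norm z"
proof -
 have "(cmod (cpoint z i))\<^sup>2 \<le> (norm z)\<^sup>2" unfolding norm_sq_pair by (rule member_le_sum) auto
 then show ?thesis by (rule power2_le_imp_le) simp
qed

lemma power_le_fact_exp: "0 \<le> x ==> x ^ n \<le> fact n * exp (x::real)"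
proof -
 assume "0 \<le> x"
 then have "(\<Sum>k\<in>{n}. x ^ k /\<^sub>R fact k) \<le> exp x" unfolding exp_def by (intro sum_le_suminf summable_exp_generic) auto
 then show ?thesis by (simp add: field_simps)
qed

text \<open>The growth that moderate weights allow for \<open>V f\<close> with \<open>f\<close> in
  \<open>M\<^sup>\<infinity>\<close>; multiplication by a Gaussian makes it integrable.\<close>

definition exp_bounded :: "('n::finite phase => complex) => bool" where
 "exp_bounded F \<longleftrightarrow> (\<exists>C r. \<forall>z. cmod (F z) \<le> C * exp (r * norm z))"

lemma distr_rot:
 assumes "\<And>i. \<bar>\<theta> i\<bar> < 2 * pi"
 shows "distr lborel borel (rot \<theta>) = (lborel :: 'n::finite phase measure)"
proof (rule measure_eqI)
 fix A :: "'n phase set" assume "A \<in> sets (distr lborel borel (rot \<theta>))"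
 then have A: "A \<in> sets borel" by simp
 note rm = borel_continuous[OF rot_continuous[of \<theta>]]
 have "emeasure (distr lborel borel (rot \<theta>)) A = (\<integral>\<^sup>+ z. indicator A z \<partial>distr lborel borel (rot \<theta>))"
  using A by simp
 also have "... = (LI z. indicator A (rot \<theta> z))" using rm A by (subst nn_integral_distr) auto
 also have "... = (LI z. indicator A z)" by (rule nn_integral_rot[OF borel_measurable_indicator[OF A] assms])
 finally show "emeasure (distr lborel borel (rot \<theta>)) A = emeasure lborel A" using A by simp
qed simp

text \<open>Distinct monomials are orthogonal on balls: a rotation by \<open>\<pi> / (\<beta> i - J i)\<close> in a coordinate with
 \<open>J i \<noteq> \<beta> i\<close> changes the sign of the integrand.\<close>

lemma gauss_coeffs_orthogonal_ball:
 fixes J \<beta> :: "'n::finite => nat"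
 assumes "J \<noteq> \<beta>"
 shows "(LINT z|lborel. indicator (ball 0 R) z *\<^sub>R (cnj (gauss_coeffs z J) * gauss_coeffs z \<beta>)) = 0"
proof -
 define G where "G z = indicator (ball 0 R) z *\<^sub>R (cnj (gauss_coeffs z J) * gauss_coeffs z \<beta>)" for z
 have [measurable]: "(\<lambda>z. cnj (gauss_coeffs z J)) \<in> borel_measurable borel"
  by (rule measurable_compose[OF gauss_coeffs_borel borel_measurable_cnj])
 have Gm: "G \<in> borel_measurable borel" unfolding G_def
  by (intro borel_measurable_scaleR borel_measurable_times borel_measurable_indicator borel_open open_ball) (simp_all)
 obtain j where j: "J j \<noteq> \<beta> j" using assms by auto
 let ?q = "\<lambda>i. complex_of_real (sqrt (2 ^ J i * fact (J i)) * sqrt (2 ^ \<beta> i * fact (\<beta> i)))"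
 define t where "t = pi / (real (\<beta> j) - real (J j))"
 define \<theta> where "\<theta> i = (if i = j then t else 0)" for i
 have "\<bar>t\<bar> \<le> pi"
 proof -
  have "1 \<le> \<bar>real (\<beta> j) - real (J j)\<bar>" using j by linarith
  then have "pi * 1 \<le> pi * \<bar>real (\<beta> j) - real (J j)\<bar>" by (intro mult_left_mono) auto
  then show ?thesis unfolding t_def using j by (simp add: abs_divide divide_le_eq)
 qed
 then have \<theta>: "\<bar>\<theta> i\<bar> < 2 * pi" for i unfolding \<theta>_def using pi_gt_zero by (cases "i = j") (auto intro: le_less_trans simp del: pi_gt_zero)
 have fac: "cnj (gauss_coeffs z J) * gauss_coeffs z \<beta> = of_real ((cmod (gauss_factor z))\<^sup>2) *
   (\<Prod>i\<in>UNIV. cnj (cpoint z i ^ J i) * cpoint z i ^ \<beta> i / ?q i)" for z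
  unfolding gauss_coeffs_factor complex_norm_square by (simp add: prod_dividef prod.distrib)
 have one: "cnj (cpoint (rot \<theta> z) i ^ J i) * cpoint (rot \<theta> z) i ^ \<beta> i = (if i = j then -1 else 1) * (cnj (cpoint z i ^ J i) * cpoint z i ^ \<beta> i)" for z i
 proof (cases "i = j")
  case True
  have "cnj (cis t) ^ J j * cis t ^ \<beta> j = cis (real (\<beta> j) * t - real (J j) * t)"
   unfolding cis_cnj Complex.DeMoivre cis_mult by (rule arg_cong[where f=cis]) simp
  also have "real (\<beta> j) * t - real (J j) * t = pi" unfolding t_def left_diff_distrib[symmetric] using j by simp
  finally have s: "cnj (cis t) ^ J j * cis t ^ \<beta> j = -1" by simp
  have "cnj (cpoint (rot \<theta> z) i ^ J i) * cpoint (rot \<theta> z) i ^ \<beta> i = (cnj (cis t) ^ J j * cis t ^ \<beta> j) * (cnj (cpoint z i ^ J i) * cpoint z i ^ \<beta> i)"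
   unfolding cpoint_rot True \<theta>_def by (simp add: power_mult_distrib mult_ac)
  then show ?thesis unfolding s using True by simp
 qed (simp add: cpoint_rot \<theta>_def)
 have "G (rot \<theta> z) = - G z" for z
 proof -
  have "(\<Prod>i\<in>UNIV. cnj (cpoint (rot \<theta> z) i ^ J i) * cpoint (rot \<theta> z) i ^ \<beta> i / ?q i)
   = (\<Prod>i\<in>UNIV. (if i = j then -1 else 1) * (cnj (cpoint z i ^ J i) * cpoint z i ^ \<beta> i / ?q i))"
   unfolding one by simp
  also have "... = - (\<Prod>i\<in>UNIV. cnj (cpoint z i ^ J i) * cpoint z i ^ \<beta> i / ?q i)"
   by (subst prod.distrib) (simp add: prod.delta)
  finally show ?thesis unfolding G_def fac norm_gauss_factor norm_rot by (simp add: norm_rot split: split_indicator)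
 qed
 then have "(LINT z|lborel. G z) = - (LINT z|lborel. G (rot \<theta> z))" by simp
 also have "(LINT z|lborel. G (rot \<theta> z)) = (LINT z|distr lborel borel (rot \<theta>). G z)"
  by (rule integral_distr[symmetric]) (use borel_continuous[OF rot_continuous] Gm in auto)
 also have "distr lborel borel (rot \<theta>) = lborel" by (rule distr_rot[OF \<theta>])
 finally show ?thesis unfolding G_def by simp
qed

lemma norm_gauss_coeffs_le:
 fixes z :: "'n::finite phase"
 shows "cmod (gauss_coeffs z J) \<le> multi_fact J * exp (real CARD('n) * norm z - 1/4 * (norm z)\<^sup>2)"
proof -
 have "(\<Prod>i\<in>UNIV. cmod (cpoint z i) ^ J i / sqrt (2 ^ J i * fact (J i))) \<le> (\<Prod>i\<in>UNIV. fact (J i) * exp (norm z))"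
 proof (intro prod_mono conjI)
  fix i
  have "1 \<le> (2::real) ^ J i * fact (J i)" using mult_mono[of 1 "(2::real) ^ J i" 1 "fact (J i)"] by (simp add: fact_ge_1)
  then have "cmod (cpoint z i) ^ J i / sqrt (2 ^ J i * fact (J i)) \<le> cmod (cpoint z i) ^ J i / 1" by (intro divide_left_mono) auto
  also have "... \<le> norm z ^ J i" using norm_cpoint_le[of z i] by (simp add: power_mono)
  also have "... \<le> fact (J i) * exp (norm z)" by (rule power_le_fact_exp) simp
  finally show "cmod (cpoint z i) ^ J i / sqrt (2 ^ J i * fact (J i)) \<le> fact (J i) * exp (norm z)" .
 qed auto
 also have "... = multi_fact J * exp (real CARD('n) * norm z)" by (simp add: multi_fact_def prod.distrib exp_of_nat_mult)
 finally have "cmod (gauss_coeffs z J) \<le> exp (- (norm z)\<^sup>2 / 4) * (multi_fact J * exp (real CARD('n) * norm z))"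
  unfolding norm_gauss_coeffs by (intro mult_left_mono) auto
 also have "... = multi_fact J * exp (real CARD('n) * norm z - 1/4 * (norm z)\<^sup>2)"
 proof -
  have "exp (real CARD('n) * norm z - 1/4 * (norm z)\<^sup>2) = exp (real CARD('n) * norm z) * exp (- (norm z)\<^sup>2 / 4)"
   unfolding exp_add[symmetric] by simp
  then show ?thesis by simp
 qed
 finally show ?thesis .
qed

lemma multi_fact_ge_0: "multi_fact J \<ge> 0" unfolding multi_fact_def by (intro prod_nonneg) auto

lemma exp_bounded_gauss_integrable:
 fixes F G :: "'n::finite phase => complex"
 assumes "exp_bounded F" "F \<in> borel_measurable borel" "G \<in> borel_measurable borel"
  and G: "\<And>z. cmod (G z) \<le> K * exp (s * norm z - 1/4 * (norm z)\<^sup>2)"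
 shows "integrable lborel (\<lambda>z. F z * G z)"
proof -
 obtain C r where F: "\<And>z. cmod (F z) \<le> C * exp (r * norm z)" using assms(1) unfolding exp_bounded_def by auto
 show ?thesis
 proof (rule Bochner_Integration.integrable_bound)
  show "integrable lborel (\<lambda>z::'n phase. C * K * exp ((r + s) * norm z - 1/4 * (norm z)\<^sup>2))"
   by (intro integrable_mult_right integrable_exp_gauss) simp
  show "(\<lambda>z. F z * G z) \<in> borel_measurable lborel" unfolding measurable_lborel2 by (rule borel_measurable_times[OF assms(2,3)])
  have "cmod (F z * G z) \<le> C * K * exp ((r + s) * norm z - 1/4 * (norm z)\<^sup>2)" for z
  proof -
   have "cmod (F z * G z) \<le> (C * exp (r * norm z)) * (K * exp (s * norm z - 1/4 * (norm z)\<^sup>2))"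
    unfolding norm_mult by (intro mult_mono F G) (use order_trans[OF norm_ge_zero F] in auto)
   also have "... = C * K * (exp (r * norm z) * exp (s * norm z - 1/4 * (norm z)\<^sup>2))" by simp
   finally show ?thesis by (simp add: exp_add[symmetric] algebra_simps)
  qed
  then show "AE z in lborel. norm (F z * G z) \<le> norm (C * K * exp ((r + s) * norm z - 1/4 * (norm z)\<^sup>2))"
   unfolding real_norm_def by (intro AE_I2) (rule order_trans[OF _ abs_ge_self])
 qed
qed

lemma gauss_coeffs_exp_bounded: "exp_bounded (\<lambda>z. cnj (gauss_coeffs z J))"
 unfolding exp_bounded_def
proof (intro exI allI)
 fix z :: "'a::finite phase"
 have "multi_fact J * exp (real CARD('a) * norm z - 1/4 * (norm z)\<^sup>2) \<le> multi_fact J * exp (real CARD('a) * norm z)"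
  by (intro mult_left_mono multi_fact_ge_0) simp
 then show "cmod (cnj (gauss_coeffs z J)) \<le> multi_fact J * exp (real CARD('a) * norm z)"
  using norm_gauss_coeffs_le[of z J] by simp
qed

lemma gauss_coeffs_prod_integrable: "integrable lborel (\<lambda>z. cnj (gauss_coeffs z J) * gauss_coeffs z \<beta>)"
 by (rule exp_bounded_gauss_integrable[OF gauss_coeffs_exp_bounded _ gauss_coeffs_borel norm_gauss_coeffs_le])
  (rule measurable_compose[OF gauss_coeffs_borel borel_measurable_cnj])

text \<open>The majorant of the Hermite series of \<open>V f\<close> is uniform on bounded sets,
  hence the restriction to a ball. Orthogonality on balls leaves the single term
  \<open>\<beta>\<close>.\<close>

lemma stft_gauss_coeffs_ball:
 fixes f :: "'n::finite hermite_series"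
 assumes f: "f \<in> flat_dual"
 shows "(LINT z|lborel. indicator (ball 0 R) z *\<^sub>R (V f z * gauss_coeffs z \<beta>)) =
  of_real (stft_const TYPE('n)) * f \<beta> * (LINT z|lborel. indicator (ball 0 R) z *\<^sub>R (cnj (gauss_coeffs z \<beta>) * gauss_coeffs z \<beta>))"
  (is "?L = ?c * f \<beta> * ?N")
proof (cases "R > 0")
 case R: True
 let ?B = "ball (0 :: 'n phase) R"
 define q where "q J z = indicator ?B z *\<^sub>R (cnj (gauss_coeffs z J) * gauss_coeffs z \<beta>)" for J z
 let ?F = "\<lambda>z. indicator ?B z *\<^sub>R (V f z * gauss_coeffs z \<beta> / ?c)"
 have c: "?c \<noteq> 0" using stft_const_pos[of "TYPE('n)"] by simp
 obtain M where M: "M summable_on UNIV" "\<And>w J. (\<And>i. cmod (w i) \<le> R) ==> cmod (bterm f w J) \<le> M J"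
  using bterm_majorant[OF f, of R] by blast
 have M0: "M J \<ge> 0" for J using order_trans[OF norm_ge_zero M(2)[of "\<lambda>_. 0" J]] R by simp
 have qint: "integrable lborel (q J)" for J unfolding q_def by (intro integrable_mult_indicator gauss_coeffs_prod_integrable) simp
 have "exp_bounded (\<lambda>_ :: 'n phase. 1)" unfolding exp_bounded_def by (intro exI[of _ 1] exI[of _ 0]) simp
 from exp_bounded_gauss_integrable[OF this _ gauss_coeffs_borel norm_gauss_coeffs_le[of _ \<beta>]]
 have gint: "integrable lborel (\<lambda>z :: 'n phase. gauss_coeffs z \<beta>)" by simp
 have fq: "cmod (f J * q J z) \<le> M J * cmod (gauss_coeffs z \<beta>)" for J z
 proof (cases "z \<in> ?B")
  case True
  then have "norm z \<le> R" by simp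
  then have "cmod (cnj (cpoint z i)) \<le> R" for i using norm_cpoint_le[of z i] by simp
  then have "cmod (bterm f (\<lambda>i. cnj (cpoint z i)) J) \<le> M J" by (rule M(2))
  moreover have "cmod (f J * cnj (gauss_coeffs z J)) \<le> cmod (bterm f (\<lambda>i. cnj (cpoint z i)) J) * 1"
   unfolding bterm_gauss_coeffs norm_mult[of _ "cnj (gauss_factor z)"] by (intro mult_left_mono) (auto simp: norm_gauss_factor)
  ultimately have "cmod (f J * cnj (gauss_coeffs z J)) * cmod (gauss_coeffs z \<beta>) \<le> M J * cmod (gauss_coeffs z \<beta>)"
   by (intro mult_right_mono) auto
  then show ?thesis using True by (simp add: q_def norm_mult mult.assoc)
 qed (simp add: q_def M0)
 have "((\<lambda>J. LINT z|lborel. f J * q J z) has_sum (LINT z|lborel. ?F z)) UNIV"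
 proof (rule has_sum_lebesgue_integral(2))
  show "?F \<in> borel_measurable lborel"
   unfolding measurable_lborel2 by (rule borel_measurable_scaleR[OF borel_measurable_indicator[OF borel_open[OF open_ball]]
     borel_measurable_divide[OF borel_measurable_times[OF V_borel[OF f] gauss_coeffs_borel] borel_measurable_const]])
  show "((\<lambda>J. f J * q J z) has_sum ?F z) UNIV" for z
   using has_sum_cmult_left[OF V_has_sum[OF f, of z], of "indicator ?B z *\<^sub>R gauss_coeffs z \<beta>"] c
   by (simp add: q_def V_bargmann[OF f] scaleR_conv_of_real mult_ac)
  have "(\<integral>\<^sup>+ J. (LI z. en (cmod (f J * q J z))) \<partial>count_space UNIV) \<le> (\<integral>\<^sup>+ J. en (M J) * en (LINT z|lborel. cmod (gauss_coeffs (z :: 'n phase) \<beta>)) \<partial>count_space UNIV)"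
  proof (rule nn_integral_mono)
   fix J
   have "(LI z. en (cmod (f J * q J z))) \<le> (LI z. en (M J * cmod (gauss_coeffs (z :: 'n phase) \<beta>)))"
    by (intro nn_integral_mono ennreal_leI fq)
   also have "... = en (LINT z|lborel. M J * cmod (gauss_coeffs (z :: 'n phase) \<beta>))"
    using M0 by (intro nn_integral_eq_integral integrable_mult_right integrable_norm gint) auto
   finally show "(LI z. en (cmod (f J * q J z))) \<le> en (M J) * en (LINT z|lborel. cmod (gauss_coeffs (z :: 'n phase) \<beta>))"
    using M0 by (simp add: ennreal_mult)
  qed
  also have "... < \<infinity>"
   using nn_integral_count_space_summable(1)[of UNIV M] M(1) M0 by (simp add: nn_integral_multc ennreal_mult_less_top)
  finally show "(\<integral>\<^sup>+ J. (LI z. en (cmod (f J * q J z))) \<partial>count_space UNIV) < \<infinity>" .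
 qed (use qint in \<open>auto intro: integrable_mult_right\<close>)
 moreover have "((\<lambda>J. LINT z|lborel. f J * q J z) has_sum f \<beta> * ?N) UNIV"
  unfolding integral_mult_right_zero by (rule has_sum_finite_neutralI[of "{\<beta>}"]) (auto simp: q_def gauss_coeffs_orthogonal_ball)
 ultimately have "f \<beta> * ?N = (LINT z|lborel. ?F z)" by (rule has_sum_unique[rotated])
 also have "... = ?L / ?c" unfolding scaleR_conv_of_real times_divide_eq_right by (rule integral_divide_zero)
 finally show ?thesis using c by (simp add: field_simps)
qed (simp add: not_less ball_empty)

text \<open>The inversion formula, from the balls by letting the radius tend to infinity;
  \<open>stft_const_sq\<close> cancels the norm of \<open>gauss_coeffs\<close>. It shows that
  \<open>V f\<close> determines \<open>f\<close>.\<close>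

lemma hermite_coeff_integral:
 fixes f :: "'n::finite hermite_series"
 assumes f: "f \<in> flat_dual" and eb: "exp_bounded (V f)"
 shows "integrable lborel (\<lambda>z. V f z * gauss_coeffs z \<beta>)"
  and "f \<beta> = of_real (stft_const TYPE('n)) * (LINT z|lborel. V f z * gauss_coeffs z \<beta>)"
proof -
 let ?c = "complex_of_real (stft_const TYPE('n))"
 show int: "integrable lborel (\<lambda>z. V f z * gauss_coeffs z \<beta>)"
  by (rule exp_bounded_gauss_integrable[OF eb V_borel[OF f] gauss_coeffs_borel norm_gauss_coeffs_le])
 have sq: "integrable lborel (\<lambda>z. (cmod (gauss_coeffs (z :: 'n phase) \<beta>))\<^sup>2)"
  by (rule integrableI_nonneg) (auto simp: gauss_coeffs_norm_integral)
 have N: "(LINT z|lborel. cnj (gauss_coeffs z \<beta>) * gauss_coeffs z \<beta>) = of_real ((2 * pi) ^ CARD('n))"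
  and int2: "integrable lborel (\<lambda>z :: 'n phase. cnj (gauss_coeffs z \<beta>) * gauss_coeffs z \<beta>)"
 proof -
  have eq: "cnj (gauss_coeffs z \<beta>) * gauss_coeffs z \<beta> = of_real ((cmod (gauss_coeffs z \<beta>))\<^sup>2)" for z :: "'n phase"
   unfolding complex_norm_square by (rule mult.commute)
  show "integrable lborel (\<lambda>z :: 'n phase. cnj (gauss_coeffs z \<beta>) * gauss_coeffs z \<beta>)"
   unfolding eq by (rule integrable_of_real[OF sq])
  have "en (LINT z|lborel. (cmod (gauss_coeffs (z :: 'n phase) \<beta>))\<^sup>2) = en ((2 * pi) ^ CARD('n))"
   unfolding gauss_coeffs_norm_integral[of \<beta>, symmetric] by (rule nn_integral_eq_integral[symmetric, OF sq]) simp
  then have "(LINT z|lborel. (cmod (gauss_coeffs (z :: 'n phase) \<beta>))\<^sup>2) = (2 * pi) ^ CARD('n)"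
   by (subst (asm) ennreal_inj) (auto intro: Bochner_Integration.integral_nonneg)
  then show "(LINT z|lborel. cnj (gauss_coeffs z \<beta>) * gauss_coeffs z \<beta>) = of_real ((2 * pi) ^ CARD('n))"
   unfolding eq integral_complex_of_real by simp
 qed
 have lim: "(\<lambda>k. LINT z|lborel. indicator (ball 0 (real k)) z *\<^sub>R F z) \<longlonglongrightarrow> (LINT z|lborel. F z)"
  if F: "integrable lborel F" for F :: "'n phase => complex"
 proof (rule integral_dominated_convergence[where w="\<lambda>z. norm (F z)"])
  show "F \<in> borel_measurable lborel" using F by (rule borel_measurable_integrable)
  then show "(\<lambda>z. indicator (ball 0 (real k)) z *\<^sub>R F z) \<in> borel_measurable lborel" for k
   by (intro borel_measurable_scaleR borel_measurable_indicator) auto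
  show "integrable lborel (\<lambda>z. norm (F z))" using F by (rule integrable_norm)
  show "AE z in lborel. norm (indicator (ball 0 (real k)) z *\<^sub>R F z) \<le> norm (F z)" for k by (auto split: split_indicator)
  show "AE z in lborel. (\<lambda>k. indicator (ball 0 (real k)) z *\<^sub>R F z) \<longlonglongrightarrow> F z"
  proof (rule AE_I2)
   fix z :: "'n phase"
   obtain k0 where "norm z < real k0" using reals_Archimedean2 by blast
   then have "\<forall>\<^sub>F k in sequentially. F z = indicator (ball 0 (real k)) z *\<^sub>R F z"
    unfolding eventually_sequentially by (intro exI[of _ k0]) auto
   then show "(\<lambda>k. indicator (ball 0 (real k)) z *\<^sub>R F z) \<longlonglongrightarrow> F z"
    by (rule Lim_transform_eventually[OF tendsto_const])
  qed
 qed
 have "(\<lambda>k. LINT z|lborel. indicator (ball 0 (real k)) z *\<^sub>R (V f z * gauss_coeffs z \<beta>)) \<longlonglongrightarrow> ?c * f \<beta> * of_real ((2 * pi) ^ CARD('n))"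
  unfolding stft_gauss_coeffs_ball[OF f] N[symmetric] by (intro tendsto_mult tendsto_const lim int2)
 from LIMSEQ_unique[OF lim[OF int] this]
 have "?c * (LINT z|lborel. V f z * gauss_coeffs z \<beta>) = of_real (stft_const TYPE('n) ^ 2 * (2 * pi) ^ CARD('n)) * f \<beta>"
  by (simp add: power2_eq_square)
 then show "f \<beta> = ?c * (LINT z|lborel. V f z * gauss_coeffs z \<beta>)" unfolding stft_const_sq by simp
qed

lemma flat_bound:
 fixes h :: "'n::finite hermite_series"
 assumes "h \<in> pilipovic_flat"
 obtains C r where "C \<ge> 0" "r > 0" "\<And>J. cmod (h J) \<le> C * (\<Prod>i\<in>UNIV. r ^ J i / sqrt (fact (J i)))"
proof -
 obtain r C where rC: "r > 0" "\<And>J. cmod (h J) \<le> C * r ^ (\<Sum>i\<in>UNIV. J i) / sqrt (multi_fact J)"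
  using assms unfolding pilipovic_flat_def by blast
 have eq: "C * r ^ (\<Sum>i\<in>UNIV. J i) / sqrt (multi_fact J) = C * (\<Prod>i\<in>UNIV. r ^ J i / sqrt (fact (J i)))" for J :: "'n => nat"
  unfolding multi_fact_def by (subst real_sqrt_prod) (auto simp: power_sum prod_dividef)
 have "0 \<le> C" using order_trans[OF norm_ge_zero rC(2)[of "\<lambda>_. 0"]] by (simp add: multi_fact_def)
 then show ?thesis using that[of C r] rC unfolding eq by blast
qed

lemma flat_subset_flat_dual:
 fixes h :: "'n::finite hermite_series"
 assumes "h \<in> pilipovic_flat"
 shows "h \<in> flat_dual"
proof -
 obtain C r where C: "C \<ge> 0" "r > 0" "\<And>J. cmod (h J) \<le> C * (\<Prod>i\<in>UNIV. r ^ J i / sqrt (fact (J i)))"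
  using flat_bound[OF assms] by blast
 have one: "r ^ n / sqrt (fact n) \<le> sqrt (exp (r\<^sup>2))" for n
 proof -
  have "(r ^ n / sqrt (fact n))\<^sup>2 \<le> exp (r\<^sup>2)"
   using power_le_fact_exp[of "r\<^sup>2" n] by (simp add: power_divide power_mult[symmetric] divide_le_eq mult.commute)
  then show ?thesis by (rule real_le_rsqrt)
 qed
 have "cmod (h J) \<le> C * (\<Prod>i\<in>(UNIV::'n set). sqrt (exp (r\<^sup>2)))" for J
  using one C by (intro order_trans[OF C(3)] mult_left_mono prod_mono) auto
 then show ?thesis by (rule bounded_in_flat_dual)
qed

text \<open>The Hermite series of \<open>h\<close> is dominated, termwise in phase space, by a Gaussian of subquadratic
 perturbation; this is where the coefficient growth of the Pilipovi\'c space enters.\<close>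

lemma flat_gauss_bound:
 fixes h :: "'n::finite hermite_series"
 assumes "h \<in> pilipovic_flat"
 obtains K s where "K \<ge> 0" "\<And>z. (\<integral>\<^sup>+ J. en (cmod (h J * cnj (gauss_coeffs z J))) \<partial>count_space UNIV) \<le> en (K * exp (s * norm z - 1/4 * (norm z)\<^sup>2))"
proof -
 obtain C r where C: "C \<ge> 0" "r > 0" "\<And>J. cmod (h J) \<le> C * (\<Prod>i\<in>UNIV. r ^ J i / sqrt (fact (J i)))"
  using flat_bound[OF assms] by blast
 have "(\<integral>\<^sup>+ J. en (cmod (h J * cnj (gauss_coeffs z J))) \<partial>count_space UNIV) \<le> en (C * exp (real CARD('n) * r * norm z - 1/4 * (norm z)\<^sup>2))" for z
 proof -
  define a where "a i n = (r * cmod (cpoint z i)) ^ n / fact n" for i n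
  let ?D = "C * exp (- (norm z)\<^sup>2 / 4)"
  have a0: "a i n \<ge> 0" for i n unfolding a_def using C by simp
  have p0: "(\<Prod>i\<in>UNIV. a i (J i)) \<ge> 0" for J by (intro prod_nonneg ballI a0)
  have "(a i) sums exp (r * cmod (cpoint z i))" for i
   unfolding a_def using exp_converges[of "r * cmod (cpoint z i)"] by (simp add: divide_inverse_commute)
  then have hs: "((\<lambda>J. \<Prod>i\<in>UNIV. a i (J i)) has_sum (\<Prod>i\<in>UNIV. exp (r * cmod (cpoint z i)))) UNIV"
   by (intro has_sum_prod_multi a0)
  have tm: "cmod (h J) * cmod (gauss_coeffs z J) \<le> ?D * (\<Prod>i\<in>UNIV. a i (J i))" for J
  proof -
   have "cmod (h J) * cmod (gauss_coeffs z J) \<le> (C * (\<Prod>i\<in>UNIV. r ^ J i / sqrt (fact (J i)))) *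
     (exp (- (norm z)\<^sup>2 / 4) * (\<Prod>i\<in>UNIV. cmod (cpoint z i) ^ J i / sqrt (2 ^ J i * fact (J i))))"
    unfolding norm_gauss_coeffs by (intro mult_right_mono C mult_nonneg_nonneg prod_nonneg) auto
   also have "... = ?D * (\<Prod>i\<in>UNIV. (r ^ J i / sqrt (fact (J i))) * (cmod (cpoint z i) ^ J i / sqrt (2 ^ J i * fact (J i))))"
    unfolding prod.distrib by (simp only: mult_ac)
   also have "... \<le> ?D * (\<Prod>i\<in>UNIV. a i (J i))"
   proof (intro mult_left_mono prod_mono conjI)
    fix i
    have "(r ^ J i / sqrt (fact (J i))) * (cmod (cpoint z i) ^ J i / sqrt (2 ^ J i * fact (J i))) = a i (J i) / sqrt (2 ^ J i)"
     unfolding a_def by (simp add: real_sqrt_mult power_mult_distrib)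
    also have "... \<le> a i (J i) / 1" using a0 by (intro divide_left_mono) auto
    finally show "(r ^ J i / sqrt (fact (J i))) * (cmod (cpoint z i) ^ J i / sqrt (2 ^ J i * fact (J i))) \<le> a i (J i)" by simp
   qed (use C in auto)
   finally show ?thesis .
  qed
  have "(\<integral>\<^sup>+ J. en (cmod (h J * cnj (gauss_coeffs z J))) \<partial>count_space UNIV) \<le> (\<integral>\<^sup>+ J. en ?D * en (\<Prod>i\<in>UNIV. a i (J i)) \<partial>count_space UNIV)"
   using tm C(1) p0 by (intro nn_integral_mono) (simp add: norm_mult ennreal_mult[symmetric] ennreal_leI)
  also have "... = en (?D * (\<Prod>i\<in>UNIV. exp (r * cmod (cpoint z i))))"
   using nn_integral_count_space_summable(2)[OF p0 has_sum_imp_summable[OF hs]] infsumI[OF hs] C(1)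
   by (simp add: nn_integral_cmult ennreal_mult prod_nonneg)
  also have "... \<le> en (C * exp (real CARD('n) * r * norm z - 1/4 * (norm z)\<^sup>2))"
  proof (rule ennreal_leI)
   have "(\<Prod>i\<in>UNIV. exp (r * cmod (cpoint z i))) \<le> (\<Prod>i\<in>(UNIV::'n set). exp (r * norm z))"
    using C norm_cpoint_le[of z] by (intro prod_mono) auto
   also have "... = exp (real CARD('n) * r * norm z)" by (simp add: exp_of_nat_mult[symmetric] mult.assoc)
   finally have "?D * (\<Prod>i\<in>UNIV. exp (r * cmod (cpoint z i))) \<le> ?D * exp (real CARD('n) * r * norm z)"
    using C by (intro mult_left_mono) auto
   also have "... = C * exp (real CARD('n) * r * norm z - 1/4 * (norm z)\<^sup>2)" unfolding mult.assoc exp_add[symmetric] by simp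
   finally show "?D * (\<Prod>i\<in>UNIV. exp (r * cmod (cpoint z i))) \<le> C * exp (real CARD('n) * r * norm z - 1/4 * (norm z)\<^sup>2)" .
  qed
  finally show ?thesis .
 qed
 then show ?thesis using that[OF C(1)] by blast
qed

lemma flat_stft_bound:
 fixes h :: "'n::finite hermite_series"
 assumes "h \<in> pilipovic_flat"
 obtains K s where "\<And>z. cmod (V h z) \<le> K * exp (s * norm z - 1/4 * (norm z)\<^sup>2)"
proof -
 let ?c = "stft_const TYPE('n)"
 have c: "?c > 0" by (rule stft_const_pos)
 obtain K s where K: "K \<ge> 0" "\<And>z. (\<integral>\<^sup>+ J. en (cmod (h J * cnj (gauss_coeffs z J))) \<partial>count_space UNIV) \<le> en (K * exp (s * norm z - 1/4 * (norm z)\<^sup>2))"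
  by (rule flat_gauss_bound[OF assms]) (rule that)
 have "cmod (V h z) \<le> (?c * K) * exp (s * norm z - 1/4 * (norm z)\<^sup>2)" for z
 proof -
  note hs = V_has_sum[OF flat_subset_flat_dual[OF assms], of z]
  have "cmod (bargmann h (\<lambda>i. cnj (cpoint z i)) * cnj (gauss_factor z)) \<le> K * exp (s * norm z - 1/4 * (norm z)\<^sup>2)"
   using order_trans[OF norm_has_sum_le[OF hs] K(2)[of z]] K(1) by (simp add: norm_mult)
  from mult_left_mono[OF this less_imp_le[OF c]] show ?thesis
   unfolding V_bargmann[OF flat_subset_flat_dual[OF assms]] using c by (simp add: norm_mult mult.assoc)
 qed
 then show ?thesis by (rule that)
qed

text \<open>Moyal's identity in duality form. Each coefficient of \<open>f\<close> is a phase space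
  integral, and the sum over Hermite indices moves inside because the series of \<open>h\<close> is
  absolutely summable with Gaussian decay, against which \<open>V f\<close> is integrable.\<close>

theorem l2_form_integral:
 fixes f h :: "'n::finite hermite_series"
 assumes f: "f \<in> flat_dual" "exp_bounded (V f)" and h: "h \<in> pilipovic_flat"
 shows "integrable lborel (\<lambda>z. V f z * cnj (V h z))"
  and "l2_form f h = (LINT z|lborel. V f z * cnj (V h z))"
proof -
 let ?c = "stft_const TYPE('n)"
 have c: "?c > 0" by (rule stft_const_pos)
 note hd = flat_subset_flat_dual[OF h]
 note Vm = V_borel[OF f(1)]
 let ?g = "\<lambda>J z. (?c * cnj (h J)) * (V f z * gauss_coeffs z J)"
 obtain K s where K: "K \<ge> 0" "\<And>z. (\<integral>\<^sup>+ J. en (cmod (h J * cnj (gauss_coeffs z J))) \<partial>count_space UNIV) \<le> en (K * exp (s * norm z - 1/4 * (norm z)\<^sup>2))"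
  by (rule flat_gauss_bound[OF h]) (rule that)
 let ?e = "\<lambda>z :: 'n phase. K * exp (s * norm z - 1/4 * (norm z)\<^sup>2)"
 have int: "integrable lborel (?g J)" for J by (intro integrable_mult_right hermite_coeff_integral f)
 have Fm: "(\<lambda>z. V f z * cnj (V h z)) \<in> borel_measurable lborel"
  unfolding measurable_lborel2 by (rule borel_measurable_times[OF Vm measurable_compose[OF V_borel[OF hd] borel_measurable_cnj]])
 have sums: "((\<lambda>J. ?g J z) has_sum V f z * cnj (V h z)) UNIV" for z
 proof -
  have "((\<lambda>J. cnj (h J * cnj (gauss_coeffs z J))) has_sum cnj (bargmann h (\<lambda>i. cnj (cpoint z i)) * cnj (gauss_factor z))) UNIV"
   unfolding has_sum_cnj_iff by (rule V_has_sum[OF hd])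
  from has_sum_cmult_right[OF this, of "?c * V f z"] show ?thesis unfolding V_bargmann[OF hd] by (simp add: mult_ac)
 qed
 have gm: "(\<lambda>z. en (cmod (?g J z))) \<in> borel_measurable lborel" for J
  by (rule measurable_compose[OF measurable_compose[OF borel_measurable_integrable[OF int] borel_measurable_norm] measurable_ennreal])
 have "(\<integral>\<^sup>+ J. (LI z. en (cmod (?g J z))) \<partial>count_space UNIV) = (LI z. (\<integral>\<^sup>+ J. en (cmod (?g J z)) \<partial>count_space UNIV))"
  by (rule nn_integral_count_space_nn_integral[OF _ gm, symmetric]) simp
 also have "... \<le> (LI z. en (cmod (V f z * of_real (?c * ?e z))))"
 proof (rule nn_integral_mono)
  fix z
  have "(\<integral>\<^sup>+ J. en (cmod (?g J z)) \<partial>count_space UNIV) = en (?c * cmod (V f z)) * (\<integral>\<^sup>+ J. en (cmod (h J * cnj (gauss_coeffs z J))) \<partial>count_space UNIV)"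
   using c by (subst nn_integral_cmult[symmetric]) (simp_all add: norm_mult ennreal_mult[symmetric] mult_ac)
  also have "... \<le> en (?c * cmod (V f z)) * en (?e z)" by (intro mult_left_mono K) simp
  also have "... = en (cmod (V f z * of_real (?c * ?e z)))"
   using c K(1) unfolding norm_mult norm_of_real by (simp add: ennreal_mult[symmetric] mult_ac)
  finally show "(\<integral>\<^sup>+ J. en (cmod (?g J z)) \<partial>count_space UNIV) \<le> en (cmod (V f z * of_real (?c * ?e z)))" .
 qed
 also have "... < \<infinity>"
 proof -
  have "integrable lborel (\<lambda>z. V f z * of_real (?c * ?e z))"
  proof (rule exp_bounded_gauss_integrable[OF f(2) Vm])
   show "(\<lambda>z. complex_of_real (?c * ?e z)) \<in> borel_measurable borel" by (intro borel_continuous continuous_intros)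
   show "cmod (of_real (?c * ?e z)) \<le> (?c * K) * exp (s * norm z - 1/4 * (norm z)\<^sup>2)" for z :: "'n phase"
    unfolding norm_of_real using c K(1) by (simp add: abs_mult mult.assoc)
  qed
  then show ?thesis unfolding integrable_iff_bounded by blast
 qed
 finally have fin: "(\<integral>\<^sup>+ J. (LI z. en (cmod (?g J z))) \<partial>count_space UNIV) < \<infinity>" .
 note * = has_sum_lebesgue_integral[OF _ int Fm sums fin]
 show "integrable lborel (\<lambda>z. V f z * cnj (V h z))" by (rule *(1)) simp
 have "(LINT z|lborel. ?g J z) = f J * cnj (h J)" for J
  unfolding integral_mult_right_zero by (simp add: hermite_coeff_integral(2)[OF f, of J])
 from infsumI[OF *(2)[unfolded this]] show "l2_form f h = (LINT z|lborel. V f z * cnj (V h z))" by (simp add: l2_form_def)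
qed

lemma gauss_coeffs_in_flat: "gauss_coeffs z \<in> pilipovic_flat"
proof -
 have "cmod (gauss_coeffs z J) \<le> 1 * (norm z + 1) ^ (\<Sum>i\<in>UNIV. J i) / sqrt (multi_fact J)" for J
 proof -
  have "(\<Prod>i\<in>UNIV. cmod (cpoint z i) ^ J i / sqrt (2 ^ J i * fact (J i))) \<le> (\<Prod>i\<in>UNIV. (norm z + 1) ^ J i / sqrt (fact (J i)))"
  proof (intro prod_mono conjI)
   fix i
   have "sqrt (fact (J i)) \<le> sqrt (2 ^ J i * fact (J i))" by simp
   moreover have "cmod (cpoint z i) ^ J i \<le> (norm z + 1) ^ J i" using norm_cpoint_le[of z i] by (intro power_mono) auto
   ultimately show "cmod (cpoint z i) ^ J i / sqrt (2 ^ J i * fact (J i)) \<le> (norm z + 1) ^ J i / sqrt (fact (J i))"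
    by (intro frac_le) auto
  qed auto
  also have "... = 1 * (norm z + 1) ^ (\<Sum>i\<in>UNIV. J i) / sqrt (multi_fact J)"
   unfolding multi_fact_def by (subst real_sqrt_prod) (auto simp: power_sum prod_dividef)
  finally have "(\<Prod>i\<in>UNIV. cmod (cpoint z i) ^ J i / sqrt (2 ^ J i * fact (J i))) \<le> 1 * (norm z + 1) ^ (\<Sum>i\<in>UNIV. J i) / sqrt (multi_fact J)" .
  moreover have "cmod (gauss_coeffs z J) \<le> 1 * (\<Prod>i\<in>UNIV. cmod (cpoint z i) ^ J i / sqrt (2 ^ J i * fact (J i)))"
   unfolding norm_gauss_coeffs by (intro mult_right_mono prod_nonneg) auto
  ultimately show ?thesis by simp
 qed
 then show ?thesis unfolding pilipovic_flat_def by (intro CollectI exI[of _ "norm z + 1"] conjI exI[of _ 1]) (auto simp: add_nonneg_pos)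
qed

text \<open>The coefficients of a shifted Gaussian lie in the Pilipovic space, and pairing with them
  evaluates \<open>V f\<close> at the shift.\<close>

lemma V_reproducing:
 fixes f :: "'n::finite hermite_series"
 assumes "f \<in> flat_dual" "exp_bounded (V f)"
 shows "integrable lborel (\<lambda>z. V f z * kern z w)"
  and "V f w = of_real (stft_const TYPE('n)) * (LINT z|lborel. V f z * kern z w)"
proof -
 note * = l2_form_integral[OF assms gauss_coeffs_in_flat[of w]]
 have k: "cnj (V (gauss_coeffs w) z) = kern z w" for z using kern_cnj[of z w] by (simp add: kern_def)
 show "integrable lborel (\<lambda>z. V f z * kern z w)" using *(1) unfolding k .
 show "V f w = of_real (stft_const TYPE('n)) * (LINT z|lborel. V f z * kern z w)"
  unfolding *(2)[unfolded k, symmetric] by (simp only: V_eq l2_form_def)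
qed

section \<open>Moderate weights\<close>

lemma AE_in_ball_exists:
 fixes z :: "'a::euclidean_space"
 assumes "AE y in lebesgue. y \<in> ball z R \<longrightarrow> P y" "R > 0"
 obtains y where "y \<in> ball z R" "P y"
proof -
 have "\<exists>y\<in>ball z R. P y"
 proof (rule ccontr)
  assume "\<not> (\<exists>y\<in>ball z R. P y)"
  then have "AE y in lebesgue. y \<notin> ball z R" using assms(1) by (auto elim: eventually_mono)
  then have "ball z R \<in> null_sets lebesgue" by (subst (asm) AE_iff_null) (auto simp: Collect_neg_eq ball_def)
  then have "emeasure lborel (ball z R) = 0" by (auto simp: null_sets_def)
  then show False using assms(2) unit_ball_vol_pos[of "real DIM('a)"] by (simp add: emeasure_ball)
 qed
 then show ?thesis using that by blast
qed

lemma AE_lebesgue_translation: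
 assumes "AE y in lebesgue. P (y :: 'a::euclidean_space)"
 shows "AE y in lebesgue. P (c + y)" using assms by (intro AE_distrD[OF lebesgue_translation(1)]) (subst lebesgue_translation(2))

text \<open>Local bounds for a weight hold almost everywhere only. Splitting
  \<open>x = (x - y) + y\<close> with \<open>y\<close> outside two exceptional null sets turns them
  into a bound at every point.\<close>

lemma submultiplicative_locally_bounded:
 fixes v :: "'a::euclidean_space => real"
 assumes v: "weight v" "submultiplicative v" and R: "R > 0"
 obtains M where "\<And>x. norm x < R ==> v x \<le> M"
proof -
 obtain c where c: "c > 0" "\<And>x y. v (x + y) \<le> c * v x * v y" and even: "\<And>x. v (- x) = v x"
  using v(2) unfolding submultiplicative_def by auto
 have pos: "v x > 0" for x using v(1) unfolding weight_def by blast
 obtain C where C: "AE x in lebesgue. x \<in> cball 0 (2 * R) \<longrightarrow> v x \<le> C"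
  using v(1) unfolding weight_def by (meson compact_cball)
 have "v x \<le> c * (C * C)" if x: "norm x < R" for x
 proof -
  have "AE y in lebesgue. (- x + y) \<in> cball 0 (2 * R) \<longrightarrow> v (- x + y) \<le> C" by (rule AE_lebesgue_translation[OF C])
  with C have "AE y in lebesgue. y \<in> ball 0 R \<longrightarrow> v y \<le> C \<and> v (- x + y) \<le> C"
  proof eventually_elim
   case (elim y)
   show ?case
   proof
    assume "y \<in> ball 0 R"
    then have "norm y < R" by simp
    then have "norm (- x + y) < 2 * R" using x norm_triangle_ineq[of "- x" y] by simp
    then show "v y \<le> C \<and> v (- x + y) \<le> C" using elim \<open>norm y < R\<close> R by auto
   qed
  qed
  from AE_in_ball_exists[OF this R] obtain y where "v y \<le> C \<and> v (- x + y) \<le> C" .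
  then have y: "v y \<le> C" "v (- x + y) \<le> C" by auto
  have "v x \<le> c * v (x - y) * v y" using c(2)[of "x - y" y] by simp
  also have "v (x - y) = v (- x + y)" using even[of "- x + y"] by simp
  also have "c * v (- x + y) * v y \<le> c * C * C"
   using y c(1) less_imp_le[OF pos[of y]] less_imp_le[OF pos[of "- x + y"]] by (intro mult_mono) auto
  finally show ?thesis by simp
 qed
 then show ?thesis using that by blast
qed

text \<open>One constant \<open>c\<close> serves all inequalities, which hold at every point. The
  exponential bound \<open>v_exp\<close> is what makes the weights compatible with Gaussian
  integrals.\<close>

locale weights =
 fixes \<omega> v :: "'n::finite phase => real" and c r :: real
 assumes \<omega>_pos: "\<And>z. \<omega> z > 0" and v_pos: "\<And>z. v z > 0"
  and c_ge_1: "c \<ge> 1" and r_ge_0: "r \<ge> 0"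
  and \<omega>_moderate: "\<And>x y. \<omega> (x + y) \<le> c * \<omega> x * v y"
  and v_even: "\<And>x. v (- x) = v x"
  and v_exp: "\<And>z. v z \<le> c * exp (r * norm z)"
  and v_moderate: "\<And>x y. v (x + y) \<le> c * v x * v y"

text \<open>For the exponential bound, \<open>z\<close> is \<open>Suc n\<close> times a vector from
  a fixed ball, with \<open>n\<close> the integer part of \<open>norm z\<close>. Iterating
  submultiplicativity costs \<open>B ^ n\<close>, at most
  \<open>exp (ln B * norm z)\<close>.\<close>

lemma weights_exist:
 fixes \<omega> v :: "'n::finite phase => real"
 assumes "weight \<omega>" "weight v" "submultiplicative v" "moderate v \<omega>"
 obtains c r where "weights \<omega> v c r"
proof -
 obtain c1 where c1: "c1 > 0" "\<And>x y. v (x + y) \<le> c1 * v x * v y" and even: "\<And>x. v (- x) = v x"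
  using assms(3) unfolding submultiplicative_def by auto
 obtain c2 where c2: "c2 > 0" "\<And>x y. \<omega> (x + y) \<le> c2 * \<omega> x * v y" using assms(4) unfolding moderate_def by auto
 have pos: "v x > 0" "\<omega> x > 0" for x using assms(1,2) unfolding weight_def by blast+
 obtain M where M: "\<And>x. norm x < 2 ==> v x \<le> M" using submultiplicative_locally_bounded[OF assms(2,3), of 2] by auto
 define B where "B = max 1 (c1 * M)"
 define L where "L = max 1 M"
 have powr: "v (real (Suc n) *\<^sub>R w) \<le> L * B ^ n" if w: "norm w < 2" for n w
 proof (induction n)
  case 0 then show ?case using M[OF w] by (simp add: L_def)
 next
  case (Suc n)
  have "real (Suc (Suc n)) *\<^sub>R w = real (Suc n) *\<^sub>R w + w" by (simp only: of_nat_Suc scaleR_add_left scaleR_one add_ac)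
  then have "v (real (Suc (Suc n)) *\<^sub>R w) \<le> c1 * v (real (Suc n) *\<^sub>R w) * v w" using c1(2) by metis
  also have "... = v (real (Suc n) *\<^sub>R w) * (c1 * v w)" by simp
  also have "... \<le> (L * B ^ n) * B"
  proof (intro mult_mono Suc.IH)
   have "c1 * v w \<le> c1 * M" using M[OF w] c1 by (intro mult_left_mono) auto
   then show "c1 * v w \<le> B" by (simp add: B_def)
  qed (use c1(1) less_imp_le[OF pos(1)[of w]] in \<open>simp_all add: L_def B_def\<close>)
  finally show ?case by (simp add: mult_ac)
 qed
 have vexp: "v z \<le> L * exp (ln B * norm z)" for z
 proof -
  define n where "n = nat \<lfloor>norm z\<rfloor>"
  define w where "w = (1 / real (Suc n)) *\<^sub>R z"
  have n: "real n \<le> norm z" "norm z < real (Suc n)" unfolding n_def using norm_ge_zero[of z] by linarith+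
  have "norm w < 2" unfolding w_def using n by (simp add: divide_less_eq)
  moreover have "z = real (Suc n) *\<^sub>R w" unfolding w_def by simp
  ultimately have "v z \<le> L * B ^ n" using powr[of w n] by simp
  also have "B ^ n = exp (ln B * real n)" unfolding B_def by (simp add: exp_of_nat2_mult)
  also have "L * ... \<le> L * exp (ln B * norm z)" using n unfolding L_def B_def by (intro mult_left_mono) (auto intro: mult_left_mono)
  finally show ?thesis .
 qed
 define c where "c = max L (max c1 c2)"
 have cc: "c \<ge> L" "c \<ge> c1" "c \<ge> c2" "c \<ge> 1" unfolding c_def L_def by auto
 have "weights \<omega> v c (ln B)"
 proof
  show "v z \<le> c * exp (ln B * norm z)" for z using vexp[of z] cc by (meson exp_ge_zero mult_right_mono order_trans)
  show "v (x + y) \<le> c * v x * v y" for x y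
  proof -
   have "c1 * (v x * v y) \<le> c * (v x * v y)" using cc pos less_imp_le by (intro mult_right_mono mult_nonneg_nonneg) blast+
   then show ?thesis using c1(2)[of x y] by (simp add: mult.assoc)
  qed
  show "\<omega> (x + y) \<le> c * \<omega> x * v y" for x y
  proof -
   have "c2 * (\<omega> x * v y) \<le> c * (\<omega> x * v y)" using cc pos less_imp_le by (intro mult_right_mono mult_nonneg_nonneg) blast+
   then show ?thesis using c2(2)[of x y] by (simp add: mult.assoc)
  qed
  show "0 \<le> ln B" unfolding B_def by simp
 qed (use pos cc even in auto)
 then show ?thesis using that by blast
qed

definition cell2 :: "real => 'n::finite phase => 'n phase" where
 "cell2 E z = (cell E (fst z), cell E (snd z))"

abbreviation lattice2 :: "real => 'n::finite phase set" where
 "lattice2 E \<equiv> lattice E \<times> lattice E"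

abbreviation lsum :: "real => ('n::finite phase => ennreal) => ennreal" where
 "lsum E f \<equiv> nn_integral (count_space (lattice2 E)) f"

lemma cell2_in_lattice2 [simp]: "cell2 E z \<in> lattice2 E" by (simp add: cell2_def)

lemma countable_lattice2: "countable (lattice2 E)" by (intro countable_SIGMA countable_lattice)

lemma cell2_add_lattice2: "E > 0 ==> k \<in> lattice2 E ==> cell2 E (k + z) = k + cell2 E z"
 by (cases k) (simp add: cell2_def cell_add_lattice)

lemma cell2_diff_lattice2: "E > 0 ==> k \<in> lattice2 E ==> cell2 E (z - k) = cell2 E z - k"
proof -
 assume "E > 0" "k \<in> lattice2 E"
 moreover from this have "- k \<in> lattice2 E" by (cases k) (auto intro: lattice_minus)
 ultimately show ?thesis using cell2_add_lattice2[of E "- k" z] by simp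
qed

lemma norm_sub_cell2:
 fixes z :: "'n::finite phase"
 assumes "E > 0"
 shows "norm (z - cell2 E z) \<le> 2 * real CARD('n) * E"
proof -
 have one: "norm (x - cell E x) \<le> real CARD('n) * E" for x :: "real^'n"
 proof -
  have "cell E (x - cell E x) = 0" by (rule cell_minus_cell[OF assms])
  then have cu: "0 \<le> (x - cell E x) $ i \<and> (x - cell E x) $ i < E" for i unfolding cell_eq_0_iff[OF assms] by blast
  then have "\<bar>(x - cell E x) $ i\<bar> \<le> E" for i using cu[of i] by linarith
  then have "(\<Sum>i\<in>UNIV. \<bar>(x - cell E x) $ i\<bar>) \<le> (\<Sum>i\<in>(UNIV::'n set). E)" by (rule sum_mono)
  then show ?thesis using norm_le_l1_cart[of "x - cell E x"] by simp
 qed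
 have "norm (z - cell2 E z) \<le> norm (fst z - cell E (fst z)) + norm (snd z - cell E (snd z))"
  using norm_Pair_le[of "fst z - cell E (fst z)" "snd z - cell E (snd z)"] by (simp add: cell2_def minus_prod_def)
 also have "... \<le> real CARD('n) * E + real CARD('n) * E" by (intro add_mono one)
 finally show ?thesis by (simp add: mult_ac)
qed

lemma borel_measurable_step2:
 fixes s :: "'n::finite phase => 'b::topological_space"
 shows "(\<lambda>z. s (cell2 E z)) \<in> borel_measurable borel"
proof -
 have fs: "fst \<in> borel_measurable borel" "snd \<in> borel_measurable borel"
  by (intro borel_continuous continuous_intros)+
 have "cell2 E \<in> borel \<rightarrow>\<^sub>M count_space (lattice2 E :: 'n phase set)"
 proof (subst measurable_count_space_eq_countable[OF countable_lattice2], intro conjI ballI)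
  fix j :: "'n phase"
  have "(\<lambda>z. cell E (fst z)) -` {fst j} \<in> sets borel" "(\<lambda>z. cell E (snd z)) -` {snd j} \<in> sets borel"
   using measurable_sets[OF measurable_compose[OF fs(1) borel_measurable_cell[of E]], of "{fst j}"]
    measurable_sets[OF measurable_compose[OF fs(2) borel_measurable_cell[of E]], of "{snd j}"] by auto
  then have "(\<lambda>z. cell E (fst z)) -` {fst j} \<inter> (\<lambda>z. cell E (snd z)) -` {snd j} \<in> sets borel" by (rule sets.Int)
  also have "(\<lambda>z. cell E (fst z)) -` {fst j} \<inter> (\<lambda>z. cell E (snd z)) -` {snd j} = cell2 E -` {j}"
   by (auto simp: cell2_def prod_eq_iff)
  finally show "cell2 E -` {j} \<inter> space borel \<in> sets borel" by simp
 qed auto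
 from measurable_compose[OF this, of s borel] show ?thesis by simp
qed

context weights
begin

lemma \<omega>_moderate': "\<omega> x \<le> c * \<omega> (x + y) * v y" using \<omega>_moderate[of "x + y" "- y"] by (simp add: v_even)

lemma \<omega>_diff: "\<omega> x \<le> c * \<omega> y * v (x - y)" using \<omega>_moderate[of y "x - y"] by simp

lemma v_diff: "v x \<le> c * v y * v (x - y)" using v_moderate[of y "x - y"] by simp

lemma inv_\<omega>_le: "1 / \<omega> y \<le> c * v (x - y) / \<omega> x"
 using \<omega>_diff[of x y] \<omega>_pos[of x] \<omega>_pos[of y] by (simp add: field_simps)

lemma \<omega>_exp: "\<omega> z \<le> c * \<omega> 0 * (c * exp (r * norm z))"
proof -
 have "\<omega> z \<le> c * \<omega> 0 * v z" using \<omega>_diff[of z 0] by simp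
 also have "... \<le> c * \<omega> 0 * (c * exp (r * norm z))" using c_ge_1 \<omega>_pos[of 0] by (intro mult_left_mono v_exp) auto
 finally show ?thesis .
qed

lemma inv_\<omega>_exp: "1 / \<omega> z \<le> c * (c * exp (r * norm z)) / \<omega> 0"
proof -
 have "1 / \<omega> z \<le> c * v z / \<omega> 0" using inv_\<omega>_le[of z 0] by (simp add: v_even)
 also have "... \<le> c * (c * exp (r * norm z)) / \<omega> 0"
  using c_ge_1 \<omega>_pos[of 0] by (intro divide_right_mono mult_left_mono v_exp) auto
 finally show ?thesis .
qed

text \<open>Bounds \<open>c * v\<close> on differences within one cell; weights may be frozen at the
  lattice corner at the price of this factor, in either direction.\<close>

definition cellc :: "real => real" where
 "cellc E = c * (c * exp (r * (2 * real CARD('n) * E)))"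

lemma v_cell: "E > 0 ==> c * v (z - cell2 E z) \<le> cellc E"
proof -
 assume e: "E > 0"
 have "c * v (z - cell2 E z) \<le> c * (c * exp (r * norm (z - cell2 E z)))" using c_ge_1 by (intro mult_left_mono v_exp) auto
 also have "... \<le> cellc E" unfolding cellc_def
  using norm_sub_cell2[OF e, of z] c_ge_1 r_ge_0 by (intro mult_left_mono) (auto intro: mult_left_mono)
 finally show ?thesis .
qed

lemma \<omega>_cell:
 assumes "E > 0"
 shows "\<omega> z \<le> cellc E * \<omega> (cell2 E z)" "\<omega> (cell2 E z) \<le> cellc E * \<omega> z"
  "v z \<le> cellc E * v (cell2 E z)" "v (cell2 E z) \<le> cellc E * v z"
proof -
 have sym: "v (cell2 E z - z) = v (z - cell2 E z)" using v_even[of "z - cell2 E z"] by simp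
 have *: "c * x * v (z - cell2 E z) \<le> cellc E * x" if "x > 0" for x
  using mult_right_mono[OF v_cell[OF assms, of z], of x] that by (simp add: mult_ac)
 show "\<omega> z \<le> cellc E * \<omega> (cell2 E z)" using \<omega>_diff[of z "cell2 E z"] *[OF \<omega>_pos] by (rule order_trans)
 show "\<omega> (cell2 E z) \<le> cellc E * \<omega> z" using \<omega>_diff[of "cell2 E z" z] *[OF \<omega>_pos] unfolding sym by (rule order_trans)
 show "v z \<le> cellc E * v (cell2 E z)" using v_diff[of z "cell2 E z"] *[OF v_pos] by (rule order_trans)
 show "v (cell2 E z) \<le> cellc E * v z" using v_diff[of "cell2 E z" z] *[OF v_pos] unfolding sym by (rule order_trans)
qed

end

section \<open>Linearity\<close>

lemma flat_dual_add:
 assumes "f \<in> flat_dual" "g \<in> flat_dual"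
 shows "(\<lambda>J. f J + g J) \<in> flat_dual" unfolding pilipovic_flat_dual_def
proof safe
 fix r :: real assume "r > 0"
 then obtain C1 C2 where C: "\<And>J. cmod (f J) \<le> C1 * r ^ (\<Sum>i\<in>UNIV. J i) * sqrt (multi_fact J)"
  "\<And>J. cmod (g J) \<le> C2 * r ^ (\<Sum>i\<in>UNIV. J i) * sqrt (multi_fact J)" using assms unfolding pilipovic_flat_dual_def by blast
 have "cmod (f J + g J) \<le> (C1 + C2) * r ^ (\<Sum>i\<in>UNIV. J i) * sqrt (multi_fact J)" for J
  using norm_triangle_ineq[of "f J" "g J"] C(1)[of J] C(2)[of J] by (simp add: distrib_right)
 then show "\<exists>C. \<forall>J. cmod (f J + g J) \<le> C * r ^ (\<Sum>i\<in>UNIV. J i) * sqrt (multi_fact J)" by blast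
qed

lemma flat_dual_cmult:
 assumes "f \<in> flat_dual"
 shows "(\<lambda>J. a * f J) \<in> flat_dual" unfolding pilipovic_flat_dual_def
proof safe
 fix r :: real assume "r > 0"
 then obtain C1 where C: "\<And>J. cmod (f J) \<le> C1 * r ^ (\<Sum>i\<in>UNIV. J i) * sqrt (multi_fact J)"
  using assms unfolding pilipovic_flat_dual_def by blast
 have "cmod (a * f J) \<le> (cmod a * C1) * r ^ (\<Sum>i\<in>UNIV. J i) * sqrt (multi_fact J)" for J
  using mult_left_mono[OF C[of J], of "cmod a"] by (simp add: norm_mult mult.assoc)
 then show "\<exists>C. \<forall>J. cmod (a * f J) \<le> C * r ^ (\<Sum>i\<in>UNIV. J i) * sqrt (multi_fact J)" by blast
qed

lemma flat_dual_sum: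
 "(\<And>i. i \<in> F ==> f i \<in> flat_dual) ==> (\<lambda>J. \<Sum>i\<in>F. f i J) \<in> flat_dual"
proof (induction F rule: infinite_finite_induct)
 case (insert i F)
 then show ?case using flat_dual_add[of "f i" "\<lambda>J. \<Sum>i\<in>F. f i J"] by simp
qed (auto intro: bounded_in_flat_dual[of _ 0])

lemma flat_dual_diff:
 assumes "f \<in> flat_dual" "g \<in> flat_dual"
 shows "(\<lambda>J. f J - g J) \<in> flat_dual" using flat_dual_add[OF assms(1) flat_dual_cmult[OF assms(2), of "-1"]] by simp

lemma V_summable:
 "f \<in> flat_dual ==> (\<lambda>J. f J * cnj (gauss_coeffs z J)) summable_on UNIV"
 by (rule has_sum_imp_summable[OF V_has_sum])

lemma V_add:
 assumes "f \<in> flat_dual" "g \<in> flat_dual"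
 shows "V (\<lambda>J. f J + g J) z = V f z + V g z" unfolding V_eq distrib_right
  infsum_add[OF V_summable[OF assms(1)] V_summable[OF assms(2)]] distrib_left ..

lemma V_cmult: "V (\<lambda>J. a * f J) z = a * V f z" unfolding V_eq mult.assoc by (subst infsum_cmult_right') simp

lemma V_diff:
 assumes "f \<in> flat_dual" "g \<in> flat_dual"
 shows "V (\<lambda>J. f J - g J) z = V f z - V g z"
 using V_add[OF assms(1) flat_dual_cmult[OF assms(2), of "-1"], of z] V_cmult[of "-1" g z] by simp

lemma V_sum:
 "(\<And>i. i \<in> F ==> f i \<in> flat_dual) ==>
  V (\<lambda>J. \<Sum>i\<in>F. f i J) z = (\<Sum>i\<in>F. V (f i) z)"
proof (induction F rule: infinite_finite_induct)
 case (insert i F)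
 then show ?case using V_add[of "f i" "\<lambda>J. \<Sum>i\<in>F. f i J" z] by (simp add: flat_dual_sum)
qed (simp_all add: V_eq)

lemma flat_add:
 assumes "f \<in> pilipovic_flat" "g \<in> pilipovic_flat"
 shows "(\<lambda>J. f J + g J) \<in> pilipovic_flat"
proof -
 obtain r1 C1 r2 C2 where C: "r1 > 0" "r2 > 0" "\<And>J. cmod (f J) \<le> C1 * r1 ^ (\<Sum>i\<in>UNIV. J i) / sqrt (multi_fact J)"
  "\<And>J. cmod (g J) \<le> C2 * r2 ^ (\<Sum>i\<in>UNIV. J i) / sqrt (multi_fact J)" using assms unfolding pilipovic_flat_def by blast
 define r where "r = max r1 r2"
 have pw: "C' * s ^ n / sqrt (multi_fact J) \<le> \<bar>C'\<bar> * r ^ n / sqrt (multi_fact J)" if "0 < s" "s \<le> r" for C' s n and J :: "'a => nat"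
  using that multi_fact_ge_0[of J] by (intro divide_right_mono mult_mono power_mono) auto
 have "cmod (f J + g J) \<le> (\<bar>C1\<bar> + \<bar>C2\<bar>) * r ^ (\<Sum>i\<in>UNIV. J i) / sqrt (multi_fact J)" for J
 proof -
  have "cmod (f J + g J) \<le> cmod (f J) + cmod (g J)" by (rule norm_triangle_ineq)
  also have "... \<le> \<bar>C1\<bar> * r ^ (\<Sum>i\<in>UNIV. J i) / sqrt (multi_fact J) + \<bar>C2\<bar> * r ^ (\<Sum>i\<in>UNIV. J i) / sqrt (multi_fact J)"
   using C(1,2) by (intro add_mono order_trans[OF C(3) pw] order_trans[OF C(4) pw]) (auto simp: r_def)
  finally show ?thesis by (simp add: distrib_right add_divide_distrib)
 qed
 moreover have "r > 0" using C by (simp add: r_def)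
 ultimately show ?thesis unfolding pilipovic_flat_def by blast
qed

lemma flat_cmult:
 assumes "f \<in> pilipovic_flat" shows "(\<lambda>J. a * f J) \<in> pilipovic_flat"
proof -
 obtain r1 C1 where C: "r1 > 0" "\<And>J. cmod (f J) \<le> C1 * r1 ^ (\<Sum>i\<in>UNIV. J i) / sqrt (multi_fact J)"
  using assms unfolding pilipovic_flat_def by blast
 have "cmod (a * f J) \<le> (cmod a * C1) * r1 ^ (\<Sum>i\<in>UNIV. J i) / sqrt (multi_fact J)" for J
  using mult_left_mono[OF C(2)[of J], of "cmod a"] by (simp add: norm_mult mult.assoc)
 then show ?thesis using C(1) unfolding pilipovic_flat_def by blast
qed

lemma flat_sum: "finite F ==> (\<And>i. i \<in> F ==> f i \<in> pilipovic_flat) ==> (\<lambda>J. \<Sum>i\<in>F. f i J) \<in> pilipovic_flat"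
proof (induction F rule: finite_induct)
 case empty
 show ?case unfolding pilipovic_flat_def by (intro CollectI exI[of _ "1::real"] conjI exI[of _ "0::real"]) auto
next
 case (insert i F)
 then show ?case using flat_add[of "f i" "\<lambda>J. \<Sum>i\<in>F. f i J"] by simp
qed

section \<open>Density of the Pilipovi\'c space\<close>

lemma kern_shift:
 "kern z w = cis (fst z \<bullet> (snd z - snd w)) * kern 0 (w - z)"
proof -
 have "tf_shift 0 0 gaussian = (gaussian :: real^'a => complex)" by (simp add: tf_shift_def)
 then have "kern 0 (w - z) = V (hermite_coeffs gaussian) (w - z)" unfolding kern_def gauss_coeffs_def by simp
 then show ?thesis unfolding kern_def[of z] gauss_coeffs_def using V_tf_shift[OF square_integrable_gaussian, of z w] by simp
qed

lemma kern_continuous: "continuous_on UNIV (kern 0)"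
 unfolding kern_def[abs_def] by (rule V_continuous[OF flat_subset_flat_dual[OF gauss_coeffs_in_flat]])

text \<open>Distance between the kernel centred at \<open>u\<close>, corrected by a phase, and the
  one centred at 0. Without such a correction kernels with neighbouring centres would not be
  uniformly close far from the origin.\<close>

definition kern_diff :: "'n::finite phase => 'n phase => real" where
 "kern_diff u w = cmod (cis (- (fst u \<bullet> snd w)) * kern 0 (w - u) - kern 0 w)"

text \<open>The phase makes the error depend only on positions relative to \<open>k\<close>. It is
  therefore uniform over all lattice points, as a Riemann sum over the whole phase space
  requires.\<close>

lemma kern_phase_diff:
 "cmod (kern z w - cis (fst z \<bullet> (snd z - snd k)) * kern k w) = kern_diff (z - k) (w - k)"
proof -
 let ?p = "cis (fst z \<bullet> (snd z - snd k))" and ?q = "cis (fst k \<bullet> (snd k - snd w))"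
 have "cis (fst z \<bullet> (snd z - snd w)) = ?p * ?q * cis (- (fst (z - k) \<bullet> snd (w - k)))"
  unfolding cis_mult by (rule arg_cong[where f=cis]) (simp add: inner_diff_left inner_diff_right algebra_simps)
 then have "kern z w - ?p * kern k w = ?p * ?q * (cis (- (fst (z - k) \<bullet> snd (w - k))) * kern 0 ((w - k) - (z - k)) - kern 0 (w - k))"
  unfolding kern_shift[of z w] kern_shift[of k w] by (simp add: algebra_simps)
 then show ?thesis unfolding kern_diff_def by (simp add: norm_mult)
qed

lemma kern_diff_continuous: "continuous_on UNIV (\<lambda>p. kern_diff (fst p) (snd p))"
 unfolding kern_diff_def cis_conv_exp by (intro continuous_intros continuous_on_compose2[OF kern_continuous]) auto

text \<open>The Gaussians centred at 0 and at \<open>u\<close> are both dominated by a wider one,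
  since \<open>(norm w)\<^sup>2 \<le> 2 * (norm (w - u))\<^sup>2 + 2\<close> for
  \<open>norm u \<le> 1\<close>.\<close>

lemma kern_diff_bound:
 fixes u w :: "'n::finite phase"
 assumes "norm u \<le> 1"
 shows "kern_diff u w \<le> stft_const TYPE('n) * (2 * exp (1/4)) * exp (- (1/8) * (norm w)\<^sup>2)"
proof -
 have 1: "exp (- (norm w)\<^sup>2 / 4) \<le> exp (1/4) * exp (- (1/8) * (norm w)\<^sup>2)"
  unfolding exp_add[symmetric] exp_le_cancel_iff using zero_le_power2[of "norm w"] by linarith
 have "norm w \<le> norm (w - u) + 1" using norm_triangle_ineq[of "w - u" u] assms by simp
 then have "(norm w)\<^sup>2 \<le> (norm (w - u) + 1)\<^sup>2" by (intro power_mono) auto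
 also have "... \<le> 2 * (norm (w - u))\<^sup>2 + 2" using sum_squares_bound[of "norm (w - u)" 1] by (simp add: power2_sum)
 finally have 2: "exp (- (norm (w - u))\<^sup>2 / 4) \<le> exp (1/4) * exp (- (1/8) * (norm w)\<^sup>2)" by (simp add: exp_add[symmetric])
 have "kern_diff u w \<le> cmod (kern 0 (w - u)) + cmod (kern 0 w)"
  unfolding kern_diff_def by (rule order_trans[OF norm_triangle_ineq4]) (simp add: norm_mult)
 also have "... = stft_const TYPE('n) * (exp (- (norm (w - u))\<^sup>2 / 4) + exp (- (norm w)\<^sup>2 / 4))"
  by (simp add: norm_kern distrib_left)
 also have "... \<le> stft_const TYPE('n) * (exp (1/4) * exp (- (1/8) * (norm w)\<^sup>2) + exp (1/4) * exp (- (1/8) * (norm w)\<^sup>2))"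
  using stft_const_pos[of "TYPE('n)"] 1 2 by (intro mult_left_mono add_mono) auto
 finally show ?thesis by (simp add: mult.assoc)
qed

text \<open>Otherwise there is a sequence \<open>u n\<close> tending to 0 with large integrals,
  contradicting dominated convergence under the Gaussian bound for \<open>kern_diff\<close>.\<close>

lemma kern_diff_integral_small:
 fixes r :: real
 assumes e: "e > 0"
 obtains \<delta> where "\<delta> > 0" "\<And>u :: 'n::finite phase. norm u < \<delta> ==>
  (LI w. en (kern_diff u w * exp (r * norm w))) \<le> en e"
proof -
 let ?f = "\<lambda>u w :: 'n phase. kern_diff u w * exp (r * norm w)"
 let ?D = "\<lambda>w :: 'n phase. stft_const TYPE('n) * (2 * exp (1/4)) * exp (r * norm w - 1/8 * (norm w)\<^sup>2)"
 have Dint: "integrable lborel ?D" by (intro integrable_mult_right integrable_exp_gauss) simp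
 have cont: "continuous_on UNIV (?f u)" for u
 proof -
  have "continuous_on UNIV (\<lambda>w :: 'n phase. (u, w))" by (intro continuous_intros)
  from continuous_on_compose2[OF kern_diff_continuous this] have "continuous_on UNIV (kern_diff u)" by simp
  then show ?thesis by (intro continuous_intros)
 qed
 have meas: "?f u \<in> borel_measurable lborel" for u unfolding measurable_lborel2 by (rule borel_continuous[OF cont])
 have kd0: "kern_diff u w \<ge> 0" for u w :: "'n phase" by (simp add: kern_diff_def)
 have bd: "norm (?f u w) \<le> ?D w" if "norm u \<le> 1" for u w
 proof -
  have "?f u w \<le> stft_const TYPE('n) * (2 * exp (1/4)) * exp (- (1/8) * (norm w)\<^sup>2) * exp (r * norm w)"
   by (intro mult_right_mono kern_diff_bound that) auto
  also have "... = ?D w" unfolding mult.assoc exp_add[symmetric] by simp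
  finally show ?thesis using kd0[of u w] by simp
 qed
 have int: "integrable lborel (?f u)" if "norm u \<le> 1" for u
  by (rule Bochner_Integration.integrable_bound[OF Dint meas]) (use bd[OF that] in \<open>auto intro!: AE_I2 intro: order_trans[OF _ abs_ge_self]\<close>)
 have "\<exists>\<delta>>0. \<forall>u :: 'n phase. norm u < \<delta> \<longrightarrow> (LI w. en (?f u w)) \<le> en e"
 proof (rule ccontr)
  assume neg: "\<not> ?thesis"
  have "\<exists>u :: 'n phase. norm u < 1 / real (Suc n) \<and> \<not> (LI w. en (?f u w)) \<le> en e" for n
  proof -
   have "1 / real (Suc n) > 0" by simp
   with neg show ?thesis by blast
  qed
  then obtain u :: "nat => 'n phase" where u: "\<And>n. norm (u n) < 1 / real (Suc n)"
   "\<And>n. \<not> (LI w. en (?f (u n) w)) \<le> en e"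
   using choice[of "\<lambda>n u. norm u < 1 / real (Suc n) \<and> \<not> (LI w. en (?f u w)) \<le> en e"] by blast
  have u1: "norm (u n) \<le> 1" for n using u(1)[of n] by (rule order_trans[OF less_imp_le]) (simp add: divide_le_eq)
  have u0: "u \<longlonglongrightarrow> 0"
  proof (rule tendsto_norm_zero_cancel, rule tendsto_sandwich[OF _ _ tendsto_const])
   show "(\<lambda>n. 1 / real (Suc n)) \<longlonglongrightarrow> 0" using LIMSEQ_inverse_real_of_nat by (simp add: inverse_eq_divide)
   show "\<forall>\<^sub>F n in sequentially. norm (u n) \<le> 1 / real (Suc n)" using u(1) less_imp_le by (intro always_eventually) blast
  qed simp
  have "(\<lambda>n. LINT w|lborel. ?f (u n) w) \<longlonglongrightarrow> (LINT w :: 'n phase|lborel. (0::real))"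
  proof (rule integral_dominated_convergence[where w = ?D])
   show "?f (u n) \<in> borel_measurable lborel" for n by (rule meas)
   show "integrable lborel ?D" by (rule Dint)
   show "AE w in lborel. norm (?f (u n) w) \<le> ?D w" for n using bd[OF u1[of n]] by blast
   show "AE w in lborel. (\<lambda>n. ?f (u n) w) \<longlonglongrightarrow> 0"
   proof (rule AE_I2)
    fix w :: "'n phase"
    have "(\<lambda>n. (u n, w)) \<longlonglongrightarrow> (0, w)" by (intro tendsto_intros u0)
    moreover have "isCont (\<lambda>p. kern_diff (fst p) (snd p)) (0, w)"
     using kern_diff_continuous unfolding continuous_on_eq_continuous_at[OF open_UNIV] by (rule bspec) simp
    ultimately have "(\<lambda>n. kern_diff (u n) w) \<longlonglongrightarrow> kern_diff 0 w" using isCont_tendsto_compose by fastforce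
    moreover have "kern_diff 0 w = 0" by (simp add: kern_diff_def)
    ultimately show "(\<lambda>n. ?f (u n) w) \<longlonglongrightarrow> 0" by (simp add: tendsto_mult_left_zero)
   qed
  qed simp
  then have "(\<lambda>n. LINT w|lborel. ?f (u n) w) \<longlonglongrightarrow> 0" by simp
  from order_tendstoD(2)[OF this e] obtain n where "(LINT w|lborel. ?f (u n) w) < e" by (auto simp: eventually_sequentially)
  moreover have "(LI w. en (?f (u n) w)) = en (LINT w|lborel. ?f (u n) w)"
   by (rule nn_integral_eq_integral[OF int[OF u1]]) (simp add: kd0)
  ultimately show False using u(2)[of n] by (simp add: ennreal_leI)
 qed
 then show ?thesis using that by blast
qed

lemma nn_integral_lborel_swap:
 fixes f :: "'a::euclidean_space => 'b::euclidean_space => ennreal"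
 assumes "(\<lambda>p. f (fst p) (snd p)) \<in> borel_measurable borel"
 shows "(LI y. (LI x. f x y)) = (LI x. (LI y. f x y))"
proof -
 have "case_prod f \<in> borel_measurable (lborel \<Otimes>\<^sub>M lborel)"
  unfolding lborel_prod split_def measurable_lborel2 using assms .
 then show ?thesis by (rule lborel_pair.Fubini')
qed

lemma kern_pair_continuous: "continuous_on UNIV (\<lambda>p. kern (fst p) (snd p))"
proof -
 have "continuous_on UNIV (\<lambda>p :: 'n::finite phase \<times> 'n phase. kern 0 (snd p - fst p))"
  by (rule continuous_on_compose2[OF kern_continuous]) (auto intro!: continuous_intros)
 then show ?thesis unfolding kern_shift[of "fst _"] cis_conv_exp by (intro continuous_intros)
qed

text \<open>Abstracts what the density proof takes from the reciprocal weight: Borel measurability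
  and a Harnack type comparison at exponential cost.\<close>

locale exp_weight =
 fixes W :: "'n::finite phase => real" and K r :: real
 assumes W_pos: "\<And>z. W z > 0" and W_borel: "W \<in> borel_measurable borel" and r_nonneg: "r \<ge> 0"
  and W_le: "\<And>w z. W w \<le> K * exp (r * norm (w - z)) * W z"
begin

lemma K_ge_1: "K \<ge> 1" using W_le[of 0 0] W_pos[of 0] by (simp add: divide_le_eq)

lemma Vg_borel:
 assumes "g \<in> flat_dual"
 shows "(\<lambda>z. cmod (V g z) * W z) \<in> borel_measurable borel"
 by (intro borel_measurable_times W_borel measurable_compose[OF V_borel[OF assms] borel_measurable_norm])

text \<open>The local mean value bound with exponent 1, combined with comparability of the weight
  within unit distance, turns a finite integral into a bound at every point.\<close>

lemma V_point_bound:
 assumes g: "g \<in> flat_dual" and fin: "(LI z. en (cmod (V g z) * W z)) < \<infinity>"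
 obtains C where "\<And>z. cmod (V g z) * W z \<le> C"
proof -
 obtain C where C: "C > 0" "\<And>f :: 'n hermite_series. \<And>z0. f \<in> flat_dual ==>
   en (cmod (V f z0) powr 1) \<le>
   en C * (LI z. en (cmod (V f z) powr 1) * indicator (ball z0 1) z)" using V_local_bound[of 1 1] by auto
 let ?I = "(LI z. en (cmod (V g z) * W z))"
 have "en (cmod (V g z0) * W z0) \<le> en (C * (K * exp r)) * ?I" for z0
 proof -
  have m: "(\<lambda>z. en (cmod (V g z)) * indicator (ball z0 1) z) \<in> borel_measurable lborel" unfolding measurable_lborel2
   by (intro borel_measurable_times_ennreal borel_measurable_indicator[OF borel_open[OF open_ball]]
     measurable_compose[OF measurable_compose[OF V_borel[OF g] borel_measurable_norm] measurable_ennreal])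
  have "en (cmod (V g z0) * W z0) = en (cmod (V g z0)) * en (W z0)" using W_pos[of z0] by (intro ennreal_mult) auto
  also have "... \<le> (en C * (LI z. en (cmod (V g z)) * indicator (ball z0 1) z)) * en (W z0)"
   using C(2)[OF g, of z0] by (intro mult_right_mono) auto
  also have "... = en C * ((LI z. en (cmod (V g z)) * indicator (ball z0 1) z) * en (W z0))" by (simp only: mult.assoc)
  also have "(LI z. en (cmod (V g z)) * indicator (ball z0 1) z) * en (W z0)
    = (LI z. en (cmod (V g z)) * indicator (ball z0 1) z * en (W z0))" by (rule nn_integral_multc[symmetric, OF m])
  also have "... \<le> (LI z. en (K * exp r) * en (cmod (V g z) * W z))"
  proof (rule nn_integral_mono)
   fix z
   show "en (cmod (V g z)) * indicator (ball z0 1) z * en (W z0) \<le> en (K * exp r) * en (cmod (V g z) * W z)"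
   proof (cases "z \<in> ball z0 1")
    case True
    then have "norm (z0 - z) \<le> 1" by (simp add: dist_norm)
    then have "exp (r * norm (z0 - z)) \<le> exp r" using r_nonneg by (simp add: mult_left_le)
    then have "K * exp (r * norm (z0 - z)) * W z \<le> K * exp r * W z"
     using K_ge_1 W_pos[of z] by (intro mult_right_mono mult_left_mono) auto
    then have "W z0 \<le> K * exp r * W z" using W_le[of z0 z] by linarith
    from mult_left_mono[OF this norm_ge_zero[of "V g z"]]
    have "cmod (V g z) * W z0 \<le> K * exp r * (cmod (V g z) * W z)" by (simp only: mult_ac)
    from ennreal_leI[OF this] show ?thesis using True W_pos[of z0] W_pos[of z] K_ge_1 by (simp add: ennreal_mult)
   qed simp
  qed
  also have "... = en (K * exp r) * ?I"
   by (rule nn_integral_cmult) (simp only: measurable_lborel2, rule measurable_compose[OF Vg_borel[OF g] measurable_ennreal])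
  finally show ?thesis using C(1) K_ge_1 by (simp add: ennreal_mult mult.assoc mult_left_mono)
 qed
 then have le: "en (cmod (V g z) * W z) \<le> en (C * (K * exp r)) * ?I" for z .
 have "en (C * (K * exp r)) * ?I < \<infinity>" using fin by (simp add: ennreal_mult_less_top)
 then have "cmod (V g z) * W z \<le> enn2real (en (C * (K * exp r)) * ?I)" for z
  using enn2real_mono[OF le[of z]] W_pos[of z] by (simp add: less_top[symmetric])
 then show ?thesis using that by blast
qed

lemma inverse_W_le: "1 / W z \<le> K * exp (r * norm z) / W 0" using W_le[of 0 z] W_pos[of 0] W_pos[of z] by (simp add: field_simps)

lemma V_exp_bounded:
 assumes C: "\<And>z. cmod (V g z) * W z \<le> C"
 shows "exp_bounded (V g)" unfolding exp_bounded_def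
proof (intro exI allI)
 fix z
 have "C \<ge> 0" using C[of 0] W_pos[of 0] by (meson mult_nonneg_nonneg norm_ge_zero less_imp_le order_trans)
 have "cmod (V g z) \<le> C * (1 / W z)" using C[of z] W_pos[of z] by (simp add: field_simps)
 also have "... \<le> C * (K * exp (r * norm z) / W 0)" by (intro mult_left_mono inverse_W_le \<open>C \<ge> 0\<close>)
 also have "... = (C * K / W 0) * exp (r * norm z)" by simp
 finally show "cmod (V g z) \<le> (C * K / W 0) * exp (r * norm z)" .
qed

text \<open>The weight is moved from \<open>w\<close> to \<open>z\<close> at the cost
  \<open>exp (r * norm (w - z))\<close>, which the exponential moment of \<open>f\<close> absorbs;
  \<open>norm (z - k) \<le> 1\<close> accounts for the factor \<open>exp r\<close>.\<close>

lemma weighted_kernel_le: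
 fixes f :: "'n::finite phase => real"
 assumes f: "f \<in> borel_measurable borel" "\<And>u. f u \<ge> 0"
  and I: "(LI u. en (f u * exp (r * norm u))) \<le> en B"
  and k: "norm (z - k) \<le> 1" and B: "B \<ge> 0"
 shows "(LI w. en (f (w - k) * W w)) \<le> en (K * exp r * B * W z)"
proof -
 have m: "(\<lambda>u. en (f u * exp (r * norm u))) \<in> borel_measurable borel"
  by (intro measurable_compose[OF _ measurable_ennreal] borel_measurable_times f borel_continuous continuous_intros)
 have "(LI w. en (f (w - k) * W w)) \<le> (LI w. en (K * exp r * W z) * en (f (- k + w) * exp (r * norm (- k + w))))"
 proof (rule nn_integral_mono)
  fix w
  have "norm (w - z) \<le> norm (- k + w) + norm (z - k)" using norm_triangle_ineq4[of "- k + w" "z - k"] by simp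
  then have "norm (w - z) \<le> norm (- k + w) + 1" using k by linarith
  then have "r * norm (w - z) \<le> r * (norm (- k + w) + 1)" by (rule mult_left_mono[OF _ r_nonneg])
  then have "exp (r * norm (w - z)) \<le> exp r * exp (r * norm (- k + w))" by (simp add: exp_add[symmetric] distrib_left)
  then have "K * exp (r * norm (w - z)) * W z \<le> K * (exp r * exp (r * norm (- k + w))) * W z"
   using K_ge_1 W_pos[of z] by (intro mult_right_mono mult_left_mono) auto
  then have "W w \<le> K * (exp r * exp (r * norm (- k + w))) * W z" using W_le[of w z] by linarith
  from mult_left_mono[OF this f(2)[of "- k + w"]]
  have "f (w - k) * W w \<le> (K * exp r * W z) * (f (- k + w) * exp (r * norm (- k + w)))" by (simp add: mult_ac)
  from ennreal_leI[OF this]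
  show "en (f (w - k) * W w) \<le> en (K * exp r * W z) * en (f (- k + w) * exp (r * norm (- k + w)))"
   using K_ge_1 W_pos[of z] f(2)[of "- k + w"] by (simp add: ennreal_mult)
 qed
 also have "... = en (K * exp r * W z) * (LI w. en (f (- k + w) * exp (r * norm (- k + w))))"
 proof (rule nn_integral_cmult)
  show "(\<lambda>w. en (f (- k + w) * exp (r * norm (- k + w)))) \<in> borel_measurable lborel" unfolding measurable_lborel2
   by (rule measurable_compose[OF _ m, of "\<lambda>w. - k + w"]) (intro borel_continuous continuous_intros)
 qed
 also have "(LI w. en (f (- k + w) * exp (r * norm (- k + w)))) = (LI u. en (f u * exp (r * norm u)))"
  by (rule nn_integral_translate_lborel[OF m])
 also have "en (K * exp r * W z) * (LI u. en (f u * exp (r * norm u))) \<le> en (K * exp r * W z) * en B"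
  by (intro mult_left_mono I) simp
 also have "... = en (K * exp r * B * W z)" using K_ge_1 W_pos[of z] B by (simp add: ennreal_mult[symmetric] mult_ac)
 finally show ?thesis .
qed

text \<open>The reproducing formula writes \<open>V g\<close> as an integral of kernels. On each
  cell of a fine lattice the kernel is replaced, up to a phase, by the one at the corner, and the
  cells outside a finite set are dropped. The result is \<open>V h\<close> for a finite combination
  \<open>h\<close> of Gaussian coefficients.\<close>

lemma flat_dense:
 assumes g: "g \<in> flat_dual" and fin: "(LI z. en (cmod (V g z) * W z)) < \<infinity>"
  and e: "e > 0"
 obtains h where "h \<in> pilipovic_flat"
  "(LI z. en (cmod (V (\<lambda>J. h J - g J) z) * W z)) \<le> en e"
proof -
 define c where "c = stft_const TYPE('n)"
 have c: "c > 0" unfolding c_def by (rule stft_const_pos)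
 let ?V = "V g"
 let ?Q = "\<lambda>z. en (cmod (?V z) * W z)" and ?E = "\<lambda>h w. en (cmod (V (\<lambda>J. h J - g J) w) * W w)"
 let ?G = "(LI w. en (c * exp (- (norm (w :: 'n phase))\<^sup>2 / 4) * exp (r * norm w)))"
 have Vm: "(\<lambda>z. cmod (?V z)) \<in> borel_measurable borel" by (rule measurable_compose[OF V_borel[OF g] borel_measurable_norm])
 obtain C0 where C0: "\<And>z. cmod (?V z) * W z \<le> C0" using V_point_bound[OF g fin] by blast
 have eb: "exp_bounded ?V" by (rule V_exp_bounded[OF C0])
 note rep = V_reproducing[OF g eb]
 define I where "I = enn2real (LI z. ?Q z)"
 have I: "(LI z. ?Q z) = en I" "I \<ge> 0" using fin unfolding I_def by (simp_all add: less_top)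
 define N0 where "N0 = (LINT w|lborel. c * exp (r * norm (w :: 'n phase) - 1/4 * (norm w)\<^sup>2))"
 have N0: "?G \<le> en N0" "N0 \<ge> 0"
 proof -
  have "?G
    = (LI w. en (c * exp (r * norm (w :: 'n phase) - 1/4 * (norm w)\<^sup>2)))"
   by (intro nn_integral_cong arg_cong[where f=en]) (simp add: mult.assoc exp_add[symmetric])
  also have "... = en N0" unfolding N0_def
   by (rule nn_integral_eq_integral[OF integrable_mult_right[OF integrable_exp_gauss]]) (use c in auto)
  finally show "?G \<le> en N0" by simp
  show "N0 \<ge> 0" unfolding N0_def using c by (intro integral_nonneg_AE) auto
 qed
 define L where "L = c * K * exp r"
 have L: "L > 0" unfolding L_def using c K_ge_1 by auto
 \<comment> \<open>\<open>e1\<close> limits the error from freezing kernels and \<open>e2\<close>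
   the mass of the dropped cells. Each contributes at most \<open>e / 2\<close>; the added 1 keeps
   the denominators positive.\<close>
 define e1 where "e1 = e / (2 * L * (I + 1))"
 have e1: "e1 > 0" unfolding e1_def using e L I(2) by simp
 obtain \<delta>0 where \<delta>0: "\<delta>0 > 0" "\<And>u :: 'n phase. norm u < \<delta>0 ==>
  (LI w. en (kern_diff u w * exp (r * norm w))) \<le> en e1" using kern_diff_integral_small[OF e1, of r] by blast
 \<comment> \<open>Points of a cell lie within \<open>2 * real CARD('n) * \<delta>\<close> of its
   corner, hence within 1 and strictly within \<open>\<delta>0\<close>.\<close>
 define \<delta> where "\<delta> = min (\<delta>0 / 2) 1 / (2 * real CARD('n))"
 let ?d = "cell2 \<delta> :: 'n phase => 'n phase" and ?R = "\<lambda>F z. en (cmod (?V z) * W z) * indicator (- F) (cell2 \<delta> z)"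
 have \<delta>: "\<delta> > 0" unfolding \<delta>_def using \<delta>0(1) by simp
 have "2 * real CARD('n) * \<delta> = min (\<delta>0 / 2) 1" unfolding \<delta>_def by simp
 with norm_sub_cell2[OF \<delta>] have nz: "norm (z - ?d z) \<le> min (\<delta>0 / 2) 1" for z :: "'n phase" by metis
 have nz1: "norm (z - ?d z) \<le> 1" "norm (z - ?d z) < \<delta>0" for z :: "'n phase"
  using nz[of z] \<delta>0(1) by linarith+
 define e2 where "e2 = e / (2 * (L * N0 + 1))"
 have e2: "e2 > 0" unfolding e2_def using e L N0(2) by (simp add: add_nonneg_pos)
 \<comment> \<open>Finite sets exhausting the lattice along an enumeration: dominated convergence
   for sequences then makes the mass outside small.\<close>
 define P where "P n = from_nat_into (lattice2 \<delta> :: 'n phase set) ` {..<n}" for n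
 have Pin: "P n \<subseteq> lattice2 \<delta>" for n unfolding P_def using from_nat_into[of "lattice2 \<delta>"] cell2_in_lattice2[of \<delta>] by blast
 have cellm: "?d \<in> borel_measurable borel" using borel_measurable_step2[of "\<lambda>x. x" \<delta>] by simp
 have cellFm: "(\<lambda>z. indicator F (?d z) :: 'c::{topological_space,zero_neq_one}) \<in> borel_measurable borel" for F
  by (rule borel_measurable_step2)
 have m1: "(\<lambda>z. ?Q z * indicator F (?d z)) \<in> borel_measurable borel" for F
  by (intro borel_measurable_times_ennreal cellFm measurable_compose[OF Vg_borel[OF g] measurable_ennreal])
 have "(\<lambda>n. (LI z. ?R (P n) z)) \<longlonglongrightarrow> (\<integral>\<^sup>+ z. 0 \<partial>(lborel :: 'n phase measure))"
 proof (rule nn_integral_dominated_convergence[where w = "\<lambda>z. ?Q z"])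
  show "AE z in lborel. (\<lambda>n. ?R (P n) z) \<longlonglongrightarrow> 0"
  proof (rule AE_I2)
   fix z :: "'n phase"
   obtain N where N: "from_nat_into (lattice2 \<delta>) N = ?d z"
    using from_nat_into_surj[OF countable_lattice2 cell2_in_lattice2[of \<delta> z]] by blast
   have "indicator (- P n) (?d z) = (0::ennreal)" if "n > N" for n
    using that N unfolding P_def by (auto simp: indicator_def intro: rev_image_eqI)
   then have "\<forall>\<^sub>F n in sequentially. ?R (P n) z = 0"
    unfolding eventually_sequentially by (intro exI[of _ "Suc N"]) simp
   then show "(\<lambda>n. ?R (P n) z) \<longlonglongrightarrow> 0"
    by (rule tendsto_eventually)
  qed
  show "AE z in lborel. ?R (P n) z \<le> ?Q z" for n
   by (intro AE_I2) (simp split: split_indicator)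
  show "(\<lambda>z. ?R (P n) z) \<in> borel_measurable lborel" for n
   unfolding measurable_lborel2 by (rule m1)
  show "(\<lambda>z. ?Q z) \<in> borel_measurable lborel"
   unfolding measurable_lborel2 by (rule measurable_compose[OF Vg_borel[OF g] measurable_ennreal])
 qed (use fin in auto)
 then have "\<forall>\<^sub>F n in sequentially. (LI z. ?R (P n) z) < en e2"
  using e2 by (intro order_tendstoD(2)[where y = 0]) (simp_all add: ennreal_less_zero_iff)
 then obtain n where n: "(LI z. ?R (P n) z) < en e2"
  by (auto simp: eventually_sequentially)
 define F where "F = P n"
 have F: "finite F" "F \<subseteq> lattice2 \<delta>" "(LI z. ?R F z) \<le> en e2"
  using n Pin unfolding F_def by (auto simp: P_def)
 \<comment> \<open>The phase from \<open>kern_phase_diff\<close>. It is put into the coefficients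
   \<open>a\<close>, which are the phase corrected integrals of \<open>V g\<close> over the
   cells.\<close>
 define p where "p z = cis (fst z \<bullet> (snd z - snd (?d z)))" for z :: "'n phase"
 let ?u = "\<lambda>k z. ?V z * p z * indicator {k} (?d z)" and ?S = "\<lambda>w z. \<Sum>k\<in>F. ?V z * p z * indicator {k} (?d z) * kern k w"
 have pm: "p \<in> borel_measurable borel"
 proof -
  have "continuous_on UNIV (\<lambda>q :: 'n phase \<times> 'n phase. cis (fst (fst q) \<bullet> (snd (fst q) - snd (snd q))))"
   unfolding cis_conv_exp by (intro continuous_intros)
  from measurable_compose[OF borel_measurable_Pair[OF measurable_ident_sets[OF refl] cellm] borel_continuous[OF this]]
  show ?thesis unfolding p_def[abs_def] by simp
 qed
 define a where "a k = of_real c * (LINT z|lborel. ?u k z)" for k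
 have aint: "integrable lborel (\<lambda>z. ?u k z)" for k
 proof (rule Bochner_Integration.integrable_bound)
  show "integrable lborel (\<lambda>z. (cmod (?V z) * W z) * (K * exp r / W k))" using fin Vg_borel[OF g] W_pos
   by (intro integrable_mult_left) (simp add: integrable_iff_bounded abs_mult less_imp_le)
  show "(\<lambda>z. ?u k z) \<in> borel_measurable lborel"
   unfolding measurable_lborel2 by (intro borel_measurable_times cellFm pm V_borel g)
  show "AE z in lborel. norm (?u k z) \<le> norm ((cmod (?V z) * W z) * (K * exp r / W k))"
  proof (rule AE_I2)
   fix z
   show "norm (?u k z) \<le> norm ((cmod (?V z) * W z) * (K * exp r / W k))"
   proof (cases "?d z = k")
    case True
    have "norm (k - z) \<le> 1" using nz1(1)[of z] True norm_minus_commute by metis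
    then have "exp (r * norm (k - z)) \<le> exp r" using r_nonneg by (simp add: mult_left_le)
    then have "K * exp (r * norm (k - z)) * W z \<le> K * exp r * W z"
     using K_ge_1 W_pos[of z] by (intro mult_right_mono mult_left_mono) auto
    then have "W k \<le> K * exp r * W z" using W_le[of k z] by linarith
    then have "1 \<le> W z * (K * exp r / W k)" using W_pos[of k] by (simp add: field_simps)
    from mult_left_mono[OF this norm_ge_zero[of "?V z"]] show ?thesis
     using True W_pos K_ge_1 by (simp add: norm_mult p_def less_imp_le mult_ac abs_mult)
   qed (simp add: norm_mult)
  qed
 qed
 define h where "h = (\<lambda>J. \<Sum>k\<in>F. a k * gauss_coeffs k J)"
 have h: "h \<in> pilipovic_flat" unfolding h_def by (intro flat_sum F flat_cmult gauss_coeffs_in_flat)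
 have Vh: "V h w = (\<Sum>k\<in>F. a k * kern k w)" for w unfolding h_def kern_def
  by (subst V_sum) (simp_all add: V_cmult flat_dual_cmult flat_subset_flat_dual gauss_coeffs_in_flat)
 \<comment> \<open>The kernel error at \<open>z\<close>: frozen against true kernel in the chosen
   cells, the whole kernel in the dropped ones.\<close>
 define m where "m z w = (if ?d z \<in> F then kern_diff (z - ?d z) (w - ?d z) else cmod (kern z w))" for z w :: "'n phase"
 let ?M = "\<lambda>z w. c * (cmod (?V z) * m z w * W w)"
 have m0: "m z w \<ge> 0" for z w by (simp add: m_def kern_diff_def)
 have pt: "?E h w \<le> (LI z. en (?M z w))" for w
 proof -
  have sint: "integrable lborel (\<lambda>z. ?S w z)"
   by (intro Bochner_Integration.integrable_sum integrable_mult_left aint)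
  have "V h w = of_real c * (LINT z|lborel. ?S w z)"
   unfolding Vh a_def Bochner_Integration.integral_sum[OF integrable_mult_left[OF aint]] integral_mult_left_zero
   by (simp only: sum_distrib_left mult.assoc)
  then have "V h w - ?V w = of_real c * (LINT z|lborel. ?S w z - ?V z * kern z w)"
   using rep(2)[of w] unfolding Bochner_Integration.integral_diff[OF sint rep(1)[of w]] c_def by (simp add: right_diff_distrib)
  moreover have "V (\<lambda>J. h J - g J) w = V h w - ?V w" by (rule V_diff[OF flat_subset_flat_dual[OF h] g])
  ultimately have eq: "V (\<lambda>J. h J - g J) w = of_real c * (LINT z|lborel. ?S w z - ?V z * kern z w)" by simp
  have nm: "cmod (?S w z - ?V z * kern z w) = cmod (?V z) * m z w" for z
  proof (cases "?d z \<in> F")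
   case True
   have "?S w z = (\<Sum>k\<in>F. if k = ?d z then ?V z * p z * kern k w else 0)"
    by (intro sum.cong) (auto simp: indicator_def)
   also have "... = ?V z * p z * kern (?d z) w" using F(1) True by simp
   finally have "?S w z - ?V z * kern z w
    = - (?V z * (kern z w - cis (fst z \<bullet> (snd z - snd (?d z))) * kern (?d z) w))" by (simp add: p_def algebra_simps)
   then show ?thesis using True by (simp add: norm_mult m_def kern_phase_diff)
  next
   case False
   then have "?S w z = 0"
    by (intro sum.neutral) (auto simp: indicator_def)
   then show ?thesis using False by (simp add: norm_mult m_def)
  qed
  have int: "integrable lborel (\<lambda>z. cmod (?V z) * m z w)"
   using integrable_norm[OF Bochner_Integration.integrable_diff[OF sint rep(1)[of w]]] unfolding nm .
  have "cmod (V (\<lambda>J. h J - g J) w) \<le> c * (LINT z|lborel. cmod (?V z) * m z w)"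
   unfolding eq norm_mult nm[symmetric] using c by (simp add: integral_norm_bound)
  then have "cmod (V (\<lambda>J. h J - g J) w) * W w \<le> (c * (LINT z|lborel. cmod (?V z) * m z w)) * W w"
   using W_pos[of w] by (intro mult_right_mono) auto
  also have "... = (LINT z|lborel. ?M z w)" by simp
  finally have "?E h w \<le> en (LINT z|lborel. ?M z w)" by (rule ennreal_leI)
  also have "... = (LI z. en (?M z w))"
  proof (rule nn_integral_eq_integral[symmetric])
   show "integrable lborel (\<lambda>z. ?M z w)" by (intro integrable_mult_right integrable_mult_left int)
   show "AE z in lborel. 0 \<le> ?M z w"
    using c m0 W_pos[of w] by (intro AE_I2 mult_nonneg_nonneg) (auto simp: less_imp_le)
  qed
  finally show ?thesis .
 qed
 have mm: "(\<lambda>q. m (fst q) (snd q)) \<in> borel_measurable borel"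
 proof -
  have cf: "(\<lambda>q :: 'n phase \<times> 'n phase. ?d (fst q)) \<in> borel_measurable borel"
   by (rule measurable_compose[OF borel_continuous[OF continuous_on_fst[OF continuous_on_id]] cellm])
  have id: "(\<lambda>q :: 'n phase \<times> 'n phase. q) \<in> borel_measurable borel" by (rule measurable_ident_sets[OF refl])
  have "continuous_on UNIV (\<lambda>t :: ('n phase \<times> 'n phase) \<times> 'n phase.
    (fst (fst t) - snd t, snd (fst t) - snd t))" by (intro continuous_intros)
  from continuous_on_compose2[OF kern_diff_continuous this]
  have c1: "continuous_on UNIV (\<lambda>t :: ('n phase \<times> 'n phase) \<times> 'n phase.
    kern_diff (fst (fst t) - snd t) (snd (fst t) - snd t))" by simp
  from measurable_compose[OF borel_measurable_Pair[OF id cf] borel_continuous[OF c1]]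
  have 1: "(\<lambda>q :: 'n phase \<times> 'n phase. kern_diff (fst q - ?d (fst q)) (snd q - ?d (fst q))) \<in> borel_measurable borel" by simp
  have 2: "(\<lambda>q :: 'n phase \<times> 'n phase. cmod (kern (fst q) (snd q))) \<in> borel_measurable borel"
   by (intro borel_continuous continuous_on_norm kern_pair_continuous)
  have 3: "(\<lambda>q :: 'n phase \<times> 'n phase. indicator A (?d (fst q)) :: real) \<in> borel_measurable borel" for A
   by (rule measurable_compose[OF borel_continuous[OF continuous_on_fst[OF continuous_on_id]] cellFm])
  have "(\<lambda>q. m (fst q) (snd q)) = (\<lambda>q. indicator F (?d (fst q)) * kern_diff (fst q - ?d (fst q)) (snd q - ?d (fst q))
   + indicator (- F) (?d (fst q)) * cmod (kern (fst q) (snd q)))" by (auto simp: m_def indicator_def)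
  then show ?thesis using 1 2 3 by (simp only:) (intro borel_measurable_add borel_measurable_times)
 qed
 \<comment> \<open>The weight sits at \<open>w\<close>, but integrating the kernel error in
   \<open>w\<close> first returns \<open>W z\<close>. The total error is thus measured by the given
   finite integral of \<open>V g\<close>.\<close>
 have mW: "(LI w. en (m z w * W w)) \<le> en (K * exp r * e1 * W z) + en (K * exp r * N0 * W z) * indicator (- F) (?d z)" for z
 proof (cases "?d z \<in> F")
  case True
  have "continuous_on UNIV (\<lambda>w :: 'n phase. (z - ?d z, w))" by (intro continuous_intros)
  from continuous_on_compose2[OF kern_diff_continuous this] have "continuous_on UNIV (kern_diff (z - ?d z))" by simp
  from weighted_kernel_le[OF borel_continuous[OF this] _ \<delta>0(2)[OF nz1(2)] nz1(1)[of z]] e1 True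
  show ?thesis by (simp add: m_def kern_diff_def)
 next
  case False
  have "cmod (kern z w) = c * exp (- (norm (w - z))\<^sup>2 / 4)" for w by (simp add: norm_kern c_def)
  moreover have "(\<lambda>w :: 'n phase. c * exp (- (norm w)\<^sup>2 / 4)) \<in> borel_measurable borel"
   by (intro borel_continuous continuous_intros) auto
  from weighted_kernel_le[OF this _ N0(1), of z z]
  have "(LI w. en (c * exp (- (norm (w - z))\<^sup>2 / 4) * W w)) \<le> en (K * exp r * N0 * W z)" using c N0(2) by simp
  ultimately show ?thesis using False by (simp add: m_def add_increasing)
 qed
 have Vmm: "(\<lambda>q. en (c * (cmod (?V (fst q)) * m (fst q) (snd q) * W (snd q)))) \<in> borel_measurable borel"
  by (intro measurable_compose[OF _ measurable_ennreal] borel_measurable_times mm borel_measurable_const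
    measurable_compose[OF borel_continuous[OF continuous_on_fst[OF continuous_on_id]] Vm]
    measurable_compose[OF borel_continuous[OF continuous_on_snd[OF continuous_on_id]] W_borel])
 have "(LI w. ?E h w)
   \<le> (LI w. (LI z. en (?M z w)))" by (rule nn_integral_mono[OF pt])
 also have "... = (LI z. (LI w. en (?M z w)))" by (rule nn_integral_lborel_swap[OF Vmm])
 also have "... = (LI z. en (c * cmod (?V z)) * (LI w. en (m z w * W w)))"
 proof (rule nn_integral_cong)
  fix z :: "'n phase"
  have "continuous_on UNIV (\<lambda>w :: 'n phase. (z, w))" by (intro continuous_intros)
  from measurable_compose[OF borel_continuous[OF this] mm]
  have "(\<lambda>w. m z w) \<in> borel_measurable borel" by simp
  then have mz: "(\<lambda>w. en (m z w * W w)) \<in> borel_measurable lborel"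
   unfolding measurable_lborel2 by (intro measurable_compose[OF _ measurable_ennreal] borel_measurable_times W_borel)
  have "(LI w. en (?M z w)) = (LI w. en (c * cmod (?V z)) * en (m z w * W w))"
  proof (rule nn_integral_cong)
   fix w
   have eq: "?M z w = (c * cmod (?V z)) * (m z w * W w)" by (simp only: mult.assoc)
   show "en (?M z w) = en (c * cmod (?V z)) * en (m z w * W w)"
    unfolding eq using c m0 W_pos[of w] by (intro ennreal_mult mult_nonneg_nonneg) (auto simp: less_imp_le)
  qed
  also have "... = en (c * cmod (?V z)) * (LI w. en (m z w * W w))" by (rule nn_integral_cmult[OF mz])
  finally show "(LI w. en (?M z w)) = en (c * cmod (?V z)) * (LI w. en (m z w * W w))" .
 qed
 also have "... \<le> (LI z. en (L * e1) * ?Q z + en (L * N0) * (?R F z))"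
 proof (rule nn_integral_mono)
  fix z
  have q: "en (c * cmod (?V z)) * en (K * exp r * b * W z) = en (L * b) * ?Q z" if "b \<ge> 0" for b
   using that c K_ge_1 W_pos[of z] by (subst (1 2) ennreal_mult[symmetric]) (auto simp: L_def less_imp_le mult_ac)
  have "en (c * cmod (?V z)) * (LI w. en (m z w * W w))
   \<le> en (c * cmod (?V z)) * (en (K * exp r * e1 * W z) + en (K * exp r * N0 * W z) * indicator (- F) (?d z))"
   by (intro mult_left_mono mW) simp
  also have "... = en (L * e1) * ?Q z + en (L * N0) * (?R F z)"
   unfolding distrib_left mult.assoc[symmetric] using e1 N0(2) by (simp only: q less_imp_le)
  finally show "en (c * cmod (?V z)) * (LI w. en (m z w * W w))
   \<le> en (L * e1) * ?Q z + en (L * N0) * (?R F z)" .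
 qed
 also have "... = en (L * e1) * (LI z. ?Q z) + en (L * N0) * (LI z. ?R F z)"
 proof -
  have a: "(\<lambda>z. ?Q z) \<in> borel_measurable lborel"
   unfolding measurable_lborel2 by (rule measurable_compose[OF Vg_borel[OF g] measurable_ennreal])
  have b: "(\<lambda>z. ?R F z) \<in> borel_measurable lborel"
   unfolding measurable_lborel2 by (rule m1)
  show ?thesis unfolding nn_integral_cmult[OF a, symmetric] nn_integral_cmult[OF b, symmetric]
   by (rule nn_integral_add) (intro borel_measurable_times_ennreal a b borel_measurable_const)+
 qed
 also have "... \<le> en (L * e1) * en I + en (L * N0) * en e2"
  unfolding I(1) by (intro add_left_mono mult_left_mono F(3)) simp
 also have "... = en (L * e1 * I + L * N0 * e2)"
  using L e1 e2 I(2) N0(2) by (simp add: ennreal_mult[symmetric] ennreal_plus[symmetric] del: ennreal_plus)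
 also have "... \<le> en e"
 proof (rule ennreal_leI)
  have "L * e1 = e / (2 * (I + 1))" unfolding e1_def using L by (simp add: mult.assoc)
  then have "L * e1 * I = (e / 2) * (I / (I + 1))" by simp
  also have "... \<le> e / 2" using e I(2) by (intro mult_left_le) (auto simp: divide_le_eq)
  finally have 1: "L * e1 * I \<le> e / 2" .
  have "L * N0 * e2 = (e / 2) * (L * N0 / (L * N0 + 1))" unfolding e2_def by simp
  also have "... \<le> e / 2" using e L N0(2) by (intro mult_left_le) (auto simp: divide_le_eq add_nonneg_pos)
  finally show "L * e1 * I + L * N0 * e2 \<le> e" using 1 by linarith
 qed
 finally show ?thesis using h that by blast
qed

end

section \<open>The duality between \<open>M\<^sup>\<infinity>\<close> and \<open>M\<^sup>1\<close>\<close>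

context weights
begin

text \<open>A Borel measurable substitute for \<open>1 / \<omega>\<close>, which is only Lebesgue
  measurable: freezing at lattice corners changes it by a bounded factor.\<close>

definition inv_weight :: "'n::finite phase => real" where
 "inv_weight z = 1 / \<omega> (cell2 1 z)"

lemma inv_weight_pos: "inv_weight z > 0" using \<omega>_pos by (simp add: inv_weight_def)

lemma inv_weight_le: "inv_weight z \<le> cellc 1 / \<omega> z" "1 / \<omega> z \<le> cellc 1 * inv_weight z"
 using \<omega>_cell(1)[of 1 z] \<omega>_cell(2)[of 1 z] \<omega>_pos[of z] \<omega>_pos[of "cell2 1 z"]
 unfolding inv_weight_def by (simp_all add: field_simps)

lemma cellc_pos: "cellc E > 0" unfolding cellc_def using c_ge_1 by (intro mult_pos_pos) auto

lemma inv_weight_exp: "exp_weight inv_weight (cellc 1 * (c * c) * cellc 1) r"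
proof
 show "inv_weight \<in> borel_measurable borel"
  unfolding inv_weight_def[abs_def] by (rule borel_measurable_step2[of "\<lambda>k. 1 / \<omega> k"])
 show "inv_weight w \<le> cellc 1 * (c * c) * cellc 1 * exp (r * norm (w - z)) * inv_weight z" for w z
 proof -
  have "inv_weight w \<le> cellc 1 * (1 / \<omega> w)" using inv_weight_le(1)[of w] by simp
  also have "... \<le> cellc 1 * (c * v (z - w) * (1 / \<omega> z))"
   using inv_\<omega>_le[of w z] cellc_pos[of 1] by (intro mult_left_mono) auto
  also have "... \<le> cellc 1 * (c * (c * exp (r * norm (z - w))) * (cellc 1 * inv_weight z))"
   using inv_weight_le(2)[of z] v_exp[of "z - w"] v_pos[of "z - w"] \<omega>_pos[of z] cellc_pos[of 1] c_ge_1
   by (intro mult_left_mono mult_mono) (auto simp: less_imp_le)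
  finally show ?thesis by (simp add: mult_ac norm_minus_commute)
 qed
qed (use inv_weight_pos r_ge_0 in auto)

lemma inv_weight_borel: "inv_weight \<in> borel_measurable borel" using inv_weight_exp by (simp add: exp_weight_def)

definition M1_norm :: "'n hermite_series => ennreal" where
 "M1_norm g = (LI z. en (cmod (V g z) * inv_weight z))"

lemma modulation_L1_norm_eq:
 "modulation_Lp_norm 1 (\<lambda>z. 1 / \<omega> z) g = (LI z. en (cmod (V g z) * (1 / \<omega> z)))"
proof -
 have [simp]: "(cmod (V g z) * (1 / \<omega> z)) powr 1 = cmod (V g z) * (1 / \<omega> z)" for z using \<omega>_pos[of z] by simp
 show ?thesis unfolding modulation_Lp_norm_def Lp_norm_def Let_def nn_integral_completion
  by (simp only: enn2real_1 \<open>\<And>z. (cmod (V g z) * (1 / \<omega> z)) powr 1 = cmod (V g z) * (1 / \<omega> z)\<close>)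
   (simp add: less_top)
qed

lemma M1_norm_borel:
 "g \<in> flat_dual ==> (\<lambda>z. en (cmod (V g z) * inv_weight z)) \<in> borel_measurable lborel"
 unfolding measurable_lborel2 by (intro measurable_compose[OF _ measurable_ennreal] borel_measurable_times inv_weight_borel
   measurable_compose[OF V_borel borel_measurable_norm])

lemma modulation_L1_norm_le:
 assumes "g \<in> flat_dual"
 shows "modulation_Lp_norm 1 (\<lambda>z. 1 / \<omega> z) g \<le> en (cellc 1) * M1_norm g"
  and "M1_norm g \<le> en (cellc 1) * modulation_Lp_norm 1 (\<lambda>z. 1 / \<omega> z) g"
proof -
 have "modulation_Lp_norm 1 (\<lambda>z. 1 / \<omega> z) g \<le> (LI z. en (cellc 1) * en (cmod (V g z) * inv_weight z))"
  unfolding modulation_L1_norm_eq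
 proof (rule nn_integral_mono)
  fix z
  have "cmod (V g z) * (1 / \<omega> z) \<le> cellc 1 * (cmod (V g z) * inv_weight z)"
   using mult_left_mono[OF inv_weight_le(2)[of z] norm_ge_zero[of "V g z"]] by (simp only: mult_ac)
  from ennreal_leI[OF this]
  show "en (cmod (V g z) * (1 / \<omega> z)) \<le> en (cellc 1) * en (cmod (V g z) * inv_weight z)"
   using cellc_pos[of 1] inv_weight_pos[of z] by (simp add: ennreal_mult less_imp_le)
 qed
 also have "... = en (cellc 1) * M1_norm g" unfolding M1_norm_def by (rule nn_integral_cmult[OF M1_norm_borel[OF assms]])
 finally show "modulation_Lp_norm 1 (\<lambda>z. 1 / \<omega> z) g \<le> en (cellc 1) * M1_norm g" .
 have "en (1 / cellc 1) * M1_norm g = (LI z. en (1 / cellc 1) * en (cmod (V g z) * inv_weight z))"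
  unfolding M1_norm_def by (rule nn_integral_cmult[OF M1_norm_borel[OF assms], symmetric])
 also have "... \<le> modulation_Lp_norm 1 (\<lambda>z. 1 / \<omega> z) g" unfolding modulation_L1_norm_eq
 proof (rule nn_integral_mono)
  fix z
  have "1 / cellc 1 * (cmod (V g z) * inv_weight z) \<le> 1 / cellc 1 * (cmod (V g z) * (cellc 1 / \<omega> z))"
   using inv_weight_le(1)[of z] cellc_pos[of 1] by (intro mult_left_mono) auto
  also have "... = cmod (V g z) * (1 / \<omega> z)" using cellc_pos[of 1] by simp
  finally show "en (1 / cellc 1) * en (cmod (V g z) * inv_weight z) \<le> en (cmod (V g z) * (1 / \<omega> z))"
   using cellc_pos[of 1] inv_weight_pos[of z] by (subst ennreal_mult[symmetric]) (auto intro: ennreal_leI simp: less_imp_le)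
 qed
 finally have "en (cellc 1) * (en (1 / cellc 1) * M1_norm g) \<le> en (cellc 1) * modulation_Lp_norm 1 (\<lambda>z. 1 / \<omega> z) g"
  by (rule mult_left_mono) simp
 moreover have "en (cellc 1) * (en (1 / cellc 1) * M1_norm g) = M1_norm g"
  using cellc_pos[of 1] by (simp add: mult.assoc[symmetric] ennreal_mult[symmetric])
 ultimately show "M1_norm g \<le> en (cellc 1) * modulation_Lp_norm 1 (\<lambda>z. 1 / \<omega> z) g" by simp
qed

lemma modulation_L1_iff:
 "g \<in> modulation_Lp 1 (\<lambda>z. 1 / \<omega> z) \<longleftrightarrow> g \<in> flat_dual \<and> M1_norm g < \<infinity>"
proof (cases "g \<in> flat_dual")
 case True
 then show ?thesis using modulation_L1_norm_le[OF True] ennreal_mult_less_top[of "en (cellc 1)" "M1_norm g"]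
   ennreal_mult_less_top[of "en (cellc 1)" "modulation_Lp_norm 1 (\<lambda>z. 1 / \<omega> z) g"]
  unfolding modulation_Lp_def by (auto intro: le_less_trans)
qed (simp add: modulation_Lp_def)

text \<open>The bound is demanded at every point. Continuity of \<open>V f\<close> and moderateness
  of \<open>\<omega>\<close> make this agree with the essential supremum, and pointwise bounds are
  directly usable under sums and integrals.\<close>

definition Minf :: "'n hermite_series set" where
 "Minf = {f \<in> flat_dual. \<exists>C. \<forall>z. cmod (V f z) * \<omega> z \<le> C}"

text \<open>If the bound failed at \<open>z\<close>, continuity would make \<open>V f\<close> large
  on a small ball, which contains points where the almost everywhere bound holds. Moderateness
  compares the weights at distance at most 1 and yields the constant \<open>B\<close>.\<close>

lemma modulation_Linf_subset: "modulation_Lp \<infinity> \<omega> \<subseteq> Minf"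
proof
 fix f assume f: "f \<in> modulation_Lp \<infinity> \<omega>"
 then have fd: "f \<in> flat_dual"
  and es: "esssup lebesgue (\<lambda>z. en (cmod (V f z) * \<omega> z)) < \<infinity>"
  by (auto simp: modulation_Lp_def modulation_Lp_norm_def Lp_norm_def)
 define C where "C = enn2real (esssup lebesgue (\<lambda>z. en (cmod (V f z) * \<omega> z)))"
 have C: "C \<ge> 0" "esssup lebesgue (\<lambda>z. en (cmod (V f z) * \<omega> z)) = en C"
  using es by (simp_all add: C_def less_top)
 have "AE y in lebesgue. en (cmod (V f y) * \<omega> y) \<le> en C"
  using esssup_AE[of "\<lambda>z. en (cmod (V f z) * \<omega> z)" lebesgue] unfolding C(2) .
 then have AE: "AE y in lebesgue. cmod (V f y) * \<omega> y \<le> C" using C(1) by simp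
 define B where "B = C * (c * (c * exp r))"
 have "cmod (V f z) * \<omega> z \<le> B" for z
 proof (rule ccontr)
  assume "\<not> cmod (V f z) * \<omega> z \<le> B"
  then have gt: "cmod (V f z) > B / \<omega> z" using \<omega>_pos[of z] by (simp add: field_simps)
  have "open {y. B / \<omega> z < cmod (V f y)}" by (intro open_Collect_less continuous_on_const continuous_on_norm V_continuous[OF fd])
  then obtain d where d: "d > 0" "ball z d \<subseteq> {y. B / \<omega> z < cmod (V f y)}" using gt unfolding open_contains_ball by blast
  have "AE y in lebesgue. y \<in> ball z (min d 1) \<longrightarrow> cmod (V f y) * \<omega> y \<le> C" using AE by eventually_elim simp
  from AE_in_ball_exists[OF this] d(1) obtain y where y: "y \<in> ball z (min d 1)" "cmod (V f y) * \<omega> y \<le> C" by auto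
  have "cmod (V f y) \<le> C * (1 / \<omega> y)" using y(2) \<omega>_pos[of y] by (simp add: field_simps)
  also have "... \<le> C * (c * v (z - y) / \<omega> z)" by (intro mult_left_mono inv_\<omega>_le C)
  also have "... \<le> C * (c * (c * exp r) / \<omega> z)"
  proof (intro mult_left_mono divide_right_mono C)
   have "norm (z - y) \<le> 1" using y(1) by (simp add: dist_norm)
   then have "exp (r * norm (z - y)) \<le> exp r" using r_ge_0 by (simp add: mult_left_le)
   then have "c * exp (r * norm (z - y)) \<le> c * exp r" using c_ge_1 by (intro mult_left_mono) auto
   then show "v (z - y) \<le> c * exp r" using v_exp[of "z - y"] by linarith
  qed (use c_ge_1 \<omega>_pos[of z] in auto)
  also have "... = B / \<omega> z" by (simp add: B_def)
  finally show False using d(2) y(1) by auto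
 qed
 then show "f \<in> Minf" using fd unfolding Minf_def by blast
qed

lemma Minf_subset_modulation_Linf:
 assumes "\<omega> \<in> borel_measurable lebesgue"
 shows "Minf \<subseteq> modulation_Lp \<infinity> \<omega>"
proof
 fix f assume "f \<in> Minf"
 then obtain C where f: "f \<in> flat_dual" "\<And>z. cmod (V f z) * \<omega> z \<le> C" unfolding Minf_def by auto
 have "(\<lambda>z. cmod (V f z)) \<in> borel_measurable lebesgue"
  by (rule measurable_completion) (simp only: measurable_lborel2, rule measurable_compose[OF V_borel[OF f(1)] borel_measurable_norm])
 then have "(\<lambda>z. en (cmod (V f z) * \<omega> z)) \<in> borel_measurable lebesgue"
  by (intro measurable_compose[OF _ measurable_ennreal] borel_measurable_times assms)
 then have "esssup lebesgue (\<lambda>z. en (cmod (V f z) * \<omega> z)) \<le> en C"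
  by (rule esssup_I) (intro AE_I2 ennreal_leI f(2))
 then have "esssup lebesgue (\<lambda>z. en (cmod (V f z) * \<omega> z)) < \<infinity>" by (rule le_less_trans) simp
 then show "f \<in> modulation_Lp \<infinity> \<omega>" using f(1) by (simp add: modulation_Lp_def modulation_Lp_norm_def Lp_norm_def)
qed

lemma MinfE:
 assumes "f \<in> Minf"
 obtains C where "C \<ge> 0" "f \<in> flat_dual" "\<And>z. cmod (V f z) \<le> C * (1 / \<omega> z)"
  "\<And>z. cmod (V f z) \<le> C * cellc 1 * inv_weight z" "exp_bounded (V f)"
proof -
 obtain C where C: "f \<in> flat_dual" "\<And>z. cmod (V f z) * \<omega> z \<le> C" using assms unfolding Minf_def by auto
 have C0: "C \<ge> 0" using C(2)[of 0] \<omega>_pos[of 0] by (meson mult_nonneg_nonneg norm_ge_zero less_imp_le order_trans)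
 have 1: "cmod (V f z) \<le> C * (1 / \<omega> z)" for z using C(2)[of z] \<omega>_pos[of z] by (simp add: field_simps)
 have 2: "cmod (V f z) \<le> C * cellc 1 * inv_weight z" for z
  using order_trans[OF 1 mult_left_mono[OF inv_weight_le(2) C0]] by (simp add: mult.assoc)
 have "cmod (V f z) \<le> (C * (c * c / \<omega> 0)) * exp (r * norm z)" for z
  using order_trans[OF 1[of z] mult_left_mono[OF inv_\<omega>_exp[of z] C0]] by (simp add: mult_ac)
 then have "exp_bounded (V f)" unfolding exp_bounded_def by blast
 with C0 C(1) 1 2 show ?thesis using that by blast
qed

lemma Minf_M1_integrable:
 assumes f: "f \<in> Minf" and g: "g \<in> flat_dual" "M1_norm g < \<infinity>"
 shows "integrable lborel (\<lambda>z. V f z * cnj (V g z))"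
proof -
 obtain C where C: "C \<ge> 0" "f \<in> flat_dual" "\<And>z. cmod (V f z) \<le> C * cellc 1 * inv_weight z"
  using MinfE[OF f] by metis
 have "integrable lborel (\<lambda>z. cmod (V g z) * inv_weight z)" using g(2) inv_weight_pos unfolding M1_norm_def
  by (subst integrable_iff_bounded, intro conjI)
   (simp_all add: abs_mult less_imp_le measurable_lborel2, intro borel_measurable_times inv_weight_borel
   measurable_compose[OF V_borel[OF g(1)] borel_measurable_norm])
 then have "integrable lborel (\<lambda>z. C * cellc 1 * (cmod (V g z) * inv_weight z))" by (rule integrable_mult_right)
 then show ?thesis
 proof (rule Bochner_Integration.integrable_bound)
  show "(\<lambda>z. V f z * cnj (V g z)) \<in> borel_measurable lborel" unfolding measurable_lborel2
   by (intro borel_measurable_times V_borel C measurable_compose[OF V_borel[OF g(1)] borel_measurable_cnj])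
  show "AE z in lborel. norm (V f z * cnj (V g z)) \<le> norm (C * cellc 1 * (cmod (V g z) * inv_weight z))"
  proof (intro AE_I2)
   fix z
   have "norm (V f z * cnj (V g z)) \<le> (C * cellc 1 * inv_weight z) * cmod (V g z)"
    unfolding norm_mult complex_mod_cnj by (intro mult_right_mono C) simp
   also have "... = C * cellc 1 * (cmod (V g z) * inv_weight z)" by simp
   finally show "norm (V f z * cnj (V g z)) \<le> norm (C * cellc 1 * (cmod (V g z) * inv_weight z))"
    unfolding real_norm_def by (rule order_trans[OF _ abs_ge_self])
  qed
 qed
qed

lemma M1_diff_finite:
 assumes "g \<in> flat_dual" "M1_norm g < \<infinity>" "h \<in> flat_dual" "M1_norm h < \<infinity>"
 shows "M1_norm (\<lambda>J. h J - g J) < \<infinity>"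
proof -
 have "M1_norm (\<lambda>J. h J - g J) \<le> (LI z. en (cmod (V h z) * inv_weight z) + en (cmod (V g z) * inv_weight z))"
  unfolding M1_norm_def
 proof (rule nn_integral_mono)
  fix z
  have "cmod (V (\<lambda>J. h J - g J) z) * inv_weight z \<le> (cmod (V h z) + cmod (V g z)) * inv_weight z"
   unfolding V_diff[OF assms(3,1)] using inv_weight_pos[of z] by (intro mult_right_mono norm_triangle_ineq4) auto
  then have "en (cmod (V (\<lambda>J. h J - g J) z) * inv_weight z) \<le> en (cmod (V h z) * inv_weight z + cmod (V g z) * inv_weight z)"
   by (intro ennreal_leI) (simp add: distrib_right)
  also have "... = en (cmod (V h z) * inv_weight z) + en (cmod (V g z) * inv_weight z)"
   using inv_weight_pos[of z] by (intro ennreal_plus mult_nonneg_nonneg) auto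
  finally show "en (cmod (V (\<lambda>J. h J - g J) z) * inv_weight z) \<le> en (cmod (V h z) * inv_weight z) + en (cmod (V g z) * inv_weight z)" .
 qed
 also have "... = M1_norm h + M1_norm g" unfolding M1_norm_def by (rule nn_integral_add[OF M1_norm_borel M1_norm_borel]) (rule assms)+
 also have "... < \<infinity>" using assms by simp
 finally show ?thesis .
qed

lemma flat_M1:
 assumes "h \<in> pilipovic_flat"
 shows "M1_norm h < \<infinity>"
proof -
 note hd = flat_subset_flat_dual[OF assms]
 obtain K s where K: "\<And>z. cmod (V h z) \<le> K * exp (s * norm z - 1/4 * (norm z)\<^sup>2)" using flat_stft_bound[OF assms] by blast
 define B where "B = cellc 1 * (c * (c / \<omega> 0))"
 have iw: "inv_weight z \<le> B * exp (r * norm z)" for z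
 proof -
  have "inv_weight z \<le> cellc 1 * (1 / \<omega> z)" using inv_weight_le(1)[of z] by simp
  also have "... \<le> cellc 1 * (c * (c * exp (r * norm z)) / \<omega> 0)"
   using cellc_pos[of 1] by (intro mult_left_mono inv_\<omega>_exp) auto
  finally show ?thesis by (simp add: B_def mult_ac)
 qed
 have K0: "K \<ge> 0" using order_trans[OF norm_ge_zero K[of 0]] by simp
 have int: "integrable lborel (\<lambda>z::'n::finite phase. K * B * exp ((s + r) * norm z - 1/4 * (norm z)\<^sup>2))"
  by (intro integrable_mult_right integrable_exp_gauss) simp
 have "M1_norm h \<le> (\<integral>\<^sup>+ z. en (norm (K * B * exp ((s + r) * norm z - 1/4 * (norm z)\<^sup>2))) \<partial>(lborel :: 'n phase measure))"
  unfolding M1_norm_def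
 proof (rule nn_integral_mono, rule ennreal_leI)
  fix z :: "'n phase"
  have "cmod (V h z) * inv_weight z \<le> (K * exp (s * norm z - 1/4 * (norm z)\<^sup>2)) * (B * exp (r * norm z))"
   using K0 inv_weight_pos[of z] by (intro mult_mono K iw) auto
  also have "... = (K * B) * (exp (s * norm z - 1/4 * (norm z)\<^sup>2) * exp (r * norm z))" by (simp only: mult_ac)
  also have "... = K * B * exp ((s + r) * norm z - 1/4 * (norm z)\<^sup>2)"
   unfolding exp_add[symmetric] by (simp add: distrib_right algebra_simps)
  finally show "cmod (V h z) * inv_weight z \<le> norm (K * B * exp ((s + r) * norm z - 1/4 * (norm z)\<^sup>2))"
   unfolding real_norm_def by (rule order_trans[OF _ abs_ge_self])
 qed
 also have "... < \<infinity>" using int unfolding integrable_iff_bounded by blast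
 finally show ?thesis .
qed

text \<open>Along every approximating sequence the forms converge to the integral, by Moyal's
  identity and the bound of \<open>V f\<close> by the reciprocal weight. The description also
  requires such a sequence to exist, since otherwise every number would satisfy it vacuously;
  \<open>flat_dense\<close> provides one.\<close>

theorem dual_pairing_eq:
 assumes f: "f \<in> Minf" and g: "g \<in> flat_dual" "M1_norm g < \<infinity>"
 shows "dual_pairing \<omega> f g = (LINT z|lborel. V f z * cnj (V g z))"
proof -
 let ?D = "\<lambda>h J. h J - g J" and ?N = "\<lambda>h m. modulation_Lp_norm 1 (\<lambda>z. 1 / \<omega> z) (\<lambda>J. h m J - g J)"
 obtain C where C: "C \<ge> 0" "f \<in> flat_dual" "\<And>z. cmod (V f z) \<le> C * (1 / \<omega> z)"
  "exp_bounded (V f)" using MinfE[OF f] by metis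
 let ?p = "LINT z|lborel. V f z * cnj (V g z)"
 note gint = Minf_M1_integrable[OF f g]
 have lim: "(\<lambda>m. l2_form f (h m)) \<longlonglongrightarrow> ?p"
  if h: "\<And>m. h m \<in> pilipovic_flat" "?N h \<longlonglongrightarrow> 0" for h
 proof -
  have bd: "en (norm (l2_form f (h m) - ?p)) \<le> en C * (en (cellc 1) * M1_norm (?D (h m)))" for m
  proof -
   note hd = flat_subset_flat_dual[OF h(1)[of m]]
   note l = l2_form_integral[OF C(2,4) h(1)[of m]]
   have "l2_form f (h m) - ?p = (LINT z|lborel. V f z * cnj (V (?D (h m)) z))"
    unfolding l(2) Bochner_Integration.integral_diff[OF l(1) gint, symmetric] V_diff[OF hd g(1)] by (simp add: right_diff_distrib)
   moreover have "integrable lborel (\<lambda>z. V f z * cnj (V (?D (h m)) z))"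
    by (rule Minf_M1_integrable[OF f flat_dual_diff[OF hd g(1)] M1_diff_finite[OF g hd flat_M1[OF h(1)]]])
   ultimately have "en (norm (l2_form f (h m) - ?p)) \<le> (LI z. en (norm (V f z * cnj (V (?D (h m)) z))))"
    using integral_norm_bound_ennreal by auto
   also have "... \<le> (LI z. en C * (en (cellc 1) * en (cmod (V (?D (h m)) z) * inv_weight z)))"
   proof (rule nn_integral_mono)
    fix z
    have "norm (V f z * cnj (V (?D (h m)) z)) \<le> (C * (cellc 1 * inv_weight z)) * cmod (V (?D (h m)) z)"
     unfolding norm_mult complex_mod_cnj by (intro mult_right_mono order_trans[OF C(3) mult_left_mono[OF inv_weight_le(2) C(1)]]) simp
    also have "... = C * (cellc 1 * (cmod (V (?D (h m)) z) * inv_weight z))" by simp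
    finally have le: "norm (V f z * cnj (V (?D (h m)) z)) \<le> C * (cellc 1 * (cmod (V (?D (h m)) z) * inv_weight z))" .
    from ennreal_leI[OF le] show "en (norm (V f z * cnj (V (?D (h m)) z))) \<le> en C * (en (cellc 1) * en (cmod (V (?D (h m)) z) * inv_weight z))"
     using C(1) cellc_pos[of 1] inv_weight_pos[of z] by (simp only: ennreal_mult[symmetric] mult_nonneg_nonneg less_imp_le norm_ge_zero)
   qed
   also have "... = en C * (en (cellc 1) * M1_norm (?D (h m)))"
    unfolding M1_norm_def nn_integral_cmult[OF M1_norm_borel[OF flat_dual_diff[OF hd g(1)]], symmetric]
    by (rule nn_integral_cmult) (intro borel_measurable_times_ennreal borel_measurable_const M1_norm_borel[OF flat_dual_diff[OF hd g(1)]])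
   finally show ?thesis .
  qed
  also have "en C * (en (cellc 1) * M1_norm (?D (h m))) \<le> en (C * cellc 1 * cellc 1) * ?N h m" for m
   using mult_left_mono[OF modulation_L1_norm_le(2)[OF flat_dual_diff[OF flat_subset_flat_dual[OF h(1)] g(1)]], of "en (C * cellc 1)" m]
    C(1) cellc_pos[of 1] by (simp add: ennreal_mult less_imp_le mult.assoc)
  finally have bd: "en (norm (l2_form f (h m) - ?p)) \<le> en (C * cellc 1 * cellc 1) * ?N h m" for m .
  have "(\<lambda>m. en (C * cellc 1 * cellc 1) * ?N h m) \<longlonglongrightarrow> en (C * cellc 1 * cellc 1) * 0"
   by (rule ennreal_tendsto_cmult[OF _ h(2)]) simp
  then have "(\<lambda>m. en (norm (l2_form f (h m) - ?p))) \<longlonglongrightarrow> en 0"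
   by (intro tendsto_sandwich[OF _ always_eventually[OF allI[OF bd]] tendsto_const]) simp_all
  then have "(\<lambda>m. norm (l2_form f (h m) - ?p)) \<longlonglongrightarrow> 0" by (subst (asm) tendsto_ennreal_iff) auto
  then show ?thesis by (rule LIM_zero_cancel[OF tendsto_norm_zero_cancel])
 qed
 have "\<forall>m. \<exists>h. h \<in> pilipovic_flat \<and> M1_norm (?D h) \<le> en (1 / real (Suc m))"
 proof
  fix m
  have "1 / real (Suc m) > 0" by simp
  from exp_weight.flat_dense[OF inv_weight_exp g(1) g(2)[unfolded M1_norm_def] this]
  obtain h where "h \<in> pilipovic_flat" "M1_norm (?D h) \<le> en (1 / real (Suc m))" unfolding M1_norm_def .
  then show "\<exists>h. h \<in> pilipovic_flat \<and> M1_norm (?D h) \<le> en (1 / real (Suc m))" by blast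
 qed
 from choice[OF this] obtain h where h: "\<And>m. h m \<in> pilipovic_flat" "\<And>m. M1_norm (?D (h m)) \<le> en (1 / real (Suc m))"
  by blast
 have "?N h \<longlonglongrightarrow> 0"
 proof (rule tendsto_sandwich[OF _ _ tendsto_const])
  have "(\<lambda>m. en (cellc 1) * en (1 / real (Suc m))) \<longlonglongrightarrow> en (cellc 1) * en 0"
   using LIMSEQ_inverse_real_of_nat by (intro ennreal_tendsto_cmult tendsto_ennrealI) (auto simp: inverse_eq_divide)
  then show "(\<lambda>m. en (cellc 1) * en (1 / real (Suc m))) \<longlonglongrightarrow> 0" by simp
  show "\<forall>\<^sub>F m in sequentially. ?N h m \<le> en (cellc 1) * en (1 / real (Suc m))"
   by (intro always_eventually allI order_trans[OF modulation_L1_norm_le(1) mult_left_mono[OF h(2)]]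
     flat_dual_diff flat_subset_flat_dual h(1) g(1)) simp
 qed simp
 note ex = h(1) this
 show ?thesis unfolding dual_pairing_def
 proof (rule the_equality)
  fix z
  assume "\<forall>h. (\<forall>m. h m \<in> pilipovic_flat) \<and>
      ?N h \<longlonglongrightarrow> 0 \<longrightarrow>
      (\<lambda>m. l2_form f (h m)) \<longlonglongrightarrow> z"
  then have "(\<lambda>m. l2_form f (h m)) \<longlonglongrightarrow> z" using ex by blast
  then show "z = ?p" using lim[OF ex] by (rule LIMSEQ_unique)
 qed (use lim in blast)
qed

end

section \<open>Powers of extended nonnegative reals\<close>

text \<open>Infinity is kept fixed, so that \<open>epow r\<close> and \<open>epow (1 / r)\<close>
  are mutually inverse for \<open>r > 0\<close>.\<close>

definition epow :: "real => ennreal => ennreal" where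
 "epow r x = (if x = \<infinity> then \<infinity> else en (enn2real x powr r))"

lemma epow_ennreal: "x \<ge> 0 ==> epow r (en x) = en (x powr r)" by (simp add: epow_def)

lemma epow_top [simp]: "epow r \<infinity> = \<infinity>" "epow r top = top" by (simp_all add: epow_def)

lemma epow_0 [simp]: "epow r 0 = 0" by (simp add: epow_def)

lemma epow_less_top_iff: "epow r x < \<infinity> \<longleftrightarrow> x < \<infinity>" by (simp add: epow_def less_top)

lemma epow_mono:
 assumes "r > 0" "x \<le> y" shows "epow r x \<le> epow r y"
proof (cases y)
 case (real b)
 then obtain a where a: "x = en a" "a \<ge> 0" using assms(2) by (cases x) (auto simp: top_unique)
 then have "a \<le> b" using assms(2) real by simp
 then show ?thesis using a real assms(1) by (simp add: epow_ennreal ennreal_leI powr_mono2)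
qed simp

lemma epow_epow: "0 < r ==> epow (1 / r) (epow r x) = x" "0 < r ==> epow r (epow (1 / r) x) = x"
 by (cases x; simp add: epow_ennreal powr_powr)+

lemma epow_mult: "epow r (x * y) = epow r x * epow r y" if "r > 0"
proof (cases x; cases y)
 fix a b assume "x = en a" "a \<ge> 0" "y = en b" "b \<ge> 0"
 then show ?thesis by (simp add: ennreal_mult[symmetric] epow_ennreal powr_mult)
next
 fix a assume a: "x = en a" "a \<ge> 0" "y = \<top>"
 then show ?thesis by (cases "a = 0") (simp_all add: epow_ennreal ennreal_mult_top)
next
 fix b assume b: "y = en b" "b \<ge> 0" "x = \<top>"
 then show ?thesis by (cases "b = 0") (simp_all add: epow_ennreal ennreal_top_mult)
qed simp

lemma epow_le_iff: "0 < r ==> epow r x \<le> epow r y \<longleftrightarrow> x \<le> y"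
 using epow_mono[of r x y] epow_mono[of "1 / r" "epow r x" "epow r y"] by (auto simp: epow_epow)

text \<open>Subadditivity of the \<open>r\<close>-th power: with \<open>t\<close> the total of the
  powers, each term satisfies \<open>x \<le> x powr r * t powr (1 / r - 1)\<close>, and summation
  gives \<open>t powr (1 / r)\<close>.\<close>

lemma epow_nn_integral_count_space:
 assumes r: "0 < r" "r \<le> 1"
 shows "epow r (\<integral>\<^sup>+ k. x k \<partial>count_space A) \<le> (\<integral>\<^sup>+ k. epow r (x k) \<partial>count_space A)"
proof (cases "\<integral>\<^sup>+ k. epow r (x k) \<partial>count_space A")
 case (real t)
 have le: "epow r (x k) \<le> en t" if "k \<in> A" for k
  using nn_integral_ge_point[OF that, of "\<lambda>k. epow r (x k)"] real by simp
 have x: "x k \<le> epow r (x k) * en (t powr (1 / r - 1))" if k: "k \<in> A" for k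
 proof (cases "x k")
  case (real y)
  have yt: "y powr r \<le> t" using le[OF k] real \<open>0 \<le> t\<close> by (simp add: epow_ennreal)
  have "y = (y powr r) powr (1 / r)" using r real by (simp add: powr_powr)
  also have "... = (y powr r) * (y powr r) powr (1 / r - 1)" using powr_add[of "y powr r" 1 "1 / r - 1"] by simp
  also have "... \<le> (y powr r) * t powr (1 / r - 1)" using r by (intro mult_left_mono powr_mono2 yt) auto
  finally have "y \<le> (y powr r) * t powr (1 / r - 1)" .
  then show ?thesis using real by (simp add: epow_ennreal ennreal_mult[symmetric] ennreal_leI)
 next
  case top then show ?thesis using le[OF k] by (simp add: top_unique)
 qed
 have "(\<integral>\<^sup>+ k. x k \<partial>count_space A) \<le> (\<integral>\<^sup>+ k. epow r (x k) * en (t powr (1 / r - 1)) \<partial>count_space A)"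
  by (intro nn_integral_mono x) simp
 also have "... = en t * en (t powr (1 / r - 1))" by (simp add: nn_integral_multc real)
 also have "... = en (t * t powr (1 / r - 1))" using real by (simp add: ennreal_mult)
 also have "t * t powr (1 / r - 1) = t powr (1 / r)" using powr_add[of t 1 "1 / r - 1"] real by simp
 also have "en ... = epow (1 / r) (en t)" using real by (simp add: epow_ennreal)
 finally have "epow r (\<integral>\<^sup>+ k. x k \<partial>count_space A) \<le> epow r (epow (1 / r) (en t))" by (rule epow_mono[OF r(1)])
 then show ?thesis using r real by (simp add: epow_epow)
qed simp

section \<open>Sums and integrals over lattice cells\<close>

lemma finite_lattice2_ball:
 assumes "E > 0"
 shows "finite {k \<in> lattice2 E :: 'n::finite phase set. norm k \<le> R}"
proof -
 define I where "I = {- \<lceil>R / E\<rceil> .. \<lceil>R / E\<rceil>}"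
 define L where "L = (\<lambda>h. grid E (\<chi> i. h i) :: real^'n) ` (PiE UNIV (\<lambda>_. I))"
 have "finite L" unfolding L_def I_def by (intro finite_imageI finite_PiE) auto
 have one: "x \<in> L" if x: "x \<in> lattice E" "norm x \<le> R" for x
 proof -
  obtain j where j: "x = grid E j" using x(1) by (auto simp: lattice_def)
  have "j $ i \<in> I" for i
  proof -
   have "E * \<bar>of_int (j $ i)\<bar> = \<bar>x $ i\<bar>" using assms by (simp add: j grid_def abs_mult)
   also have "... \<le> R" using component_le_norm_cart[of x i] x(2) by simp
   finally have "\<bar>of_int (j $ i)\<bar> \<le> R / E" using assms by (simp add: field_simps)
   then show ?thesis unfolding I_def by (auto simp: abs_le_iff) linarith+
  qed
  then have "(\<lambda>i. j $ i) \<in> PiE UNIV (\<lambda>_. I)" by auto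
  moreover have "x = grid E (\<chi> i. j $ i)" using j by simp
  ultimately show ?thesis unfolding L_def by (intro image_eqI[where x = "\<lambda>i. j $ i"]) simp_all
 qed
 have "{k \<in> lattice2 E. norm k \<le> R} \<subseteq> L \<times> L"
 proof
  fix k :: "'n phase" assume k: "k \<in> {k \<in> lattice2 E. norm k \<le> R}"
  have "norm (fst k) \<le> norm k" "norm (snd k) \<le> norm k" using norm_fst_le[of "fst k" "snd k"] norm_snd_le[of "snd k" "fst k"] by simp_all
  moreover have "fst k \<in> lattice E" "snd k \<in> lattice E" "norm k \<le> R" using k by (simp_all add: mem_Times_iff)
  ultimately show "k \<in> L \<times> L" using one[of "fst k"] one[of "snd k"] by (simp add: mem_Times_iff)
 qed
 then show ?thesis by (rule finite_subset) (intro finite_cartesian_product \<open>finite L\<close>)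
qed

lemma lattice2_closed:
 "j \<in> lattice2 E ==> k \<in> lattice2 E ==> j + k \<in> lattice2 E"
 "j \<in> lattice2 E ==> k \<in> lattice2 E ==> j - k \<in> lattice2 E"
 "0 \<in> lattice2 E" unfolding mem_Times_iff by (simp_all add: lattice_add lattice_diff lattice_0)

lemma nn_integral_lattice2_reflect:
 assumes k: "k \<in> lattice2 E"
 shows "(lsum E (\<lambda>l. f (k - l))) = lsum E f"
proof (rule nn_integral_bij_count_space)
 show "bij_betw (\<lambda>l. k - l) (lattice2 E) (lattice2 E)"
  by (rule bij_betwI[where g = "\<lambda>l. k - l"]) (use lattice2_closed(2)[OF k] in auto)
qed

lemma nn_integral_lattice2_translate:
 assumes k: "k \<in> lattice2 E"
 shows "(lsum E (\<lambda>l. f (l + k))) = lsum E f"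
proof (rule nn_integral_bij_count_space)
 show "bij_betw (\<lambda>l. l + k) (lattice2 E) (lattice2 E)"
  by (rule bij_betwI[where g = "\<lambda>l. l - k"]) (use lattice2_closed(1)[OF _ k] lattice2_closed(2)[OF _ k] in auto)
qed

lemma nn_integral_cells2:
 fixes f :: "'n::finite phase => ennreal"
 assumes "f \<in> borel_measurable borel"
 shows "(LI z. f z) = (lsum E (\<lambda>k. (LI z. f z * indicator {k} (cell2 E z))))"
proof -
 have "(LI z. f z) = (LI z. (lsum E (\<lambda>k. f z * indicator {k} (cell2 E z))))"
 proof (rule nn_integral_cong)
  fix z :: "'n phase"
  have "(lsum E (\<lambda>k. f z * indicator {k} (cell2 E z))) = (lsum E (\<lambda>k. (if k = cell2 E z then f z else 0)))"
   by (intro nn_integral_cong) (auto simp: indicator_def)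
  also have "... = f z" by (rule nn_integral_count_space_delta) simp
  finally show "f z = (lsum E (\<lambda>k. f z * indicator {k} (cell2 E z)))" ..
 qed
 also have "... = (lsum E (\<lambda>k. (LI z. f z * indicator {k} (cell2 E z))))"
 proof (rule nn_integral_count_space_nn_integral[OF countable_lattice2])
  show "(\<lambda>z. f z * indicator {k} (cell2 E z)) \<in> borel_measurable lborel" for k
   unfolding measurable_lborel2 by (intro borel_measurable_times_ennreal assms borel_measurable_step2)
 qed
 finally show ?thesis .
qed

lemma nn_integral_step2:
 fixes s :: "'n::finite phase => ennreal"
 assumes e: "E > 0"
 shows "(LI z. s (cell2 E z)) = en ((cube_vol E TYPE('n))\<^sup>2) * lsum E s"
proof -
 let ?q = "en (cube_vol E TYPE('n))"
 have "(LI z. s (cell2 E z)) = (LI x. (LI y. s (cell E x, cell E y)))"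
  by (subst nn_integral_pair_lborel[OF borel_measurable_step2]) (simp add: cell2_def)
 also have "... = ?q * (\<integral>\<^sup>+ j. ?q * (\<integral>\<^sup>+ k. s (j, k) \<partial>count_space (lattice E)) \<partial>count_space (lattice E))"
  by (subst (1 2) nn_integral_step[OF e]) (rule refl)
 also have "... = ?q * ?q * (\<integral>\<^sup>+ j. \<integral>\<^sup>+ k. s (j, k) \<partial>count_space (lattice E) \<partial>count_space (lattice E))"
  by (simp add: nn_integral_cmult mult.assoc)
 also have "(\<integral>\<^sup>+ j. \<integral>\<^sup>+ k. s (j, k) \<partial>count_space (lattice E) \<partial>count_space (lattice E)) = (\<integral>\<^sup>+ k. s k \<partial>(count_space (lattice E) \<Otimes>\<^sub>M count_space (lattice E)))"
  using sigma_finite_measure_count_space_countable[OF countable_lattice]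
  by (intro sigma_finite_measure.nn_integral_fst) (simp_all add: pair_measure_countable countable_lattice)
 also have "count_space (lattice E) \<Otimes>\<^sub>M count_space (lattice E) = count_space (lattice2 E :: 'n phase set)"
  by (rule pair_measure_countable) (rule countable_lattice)+
 also have "?q * ?q = en ((cube_vol E TYPE('n))\<^sup>2)"
  using cube_vol(1)[OF e, where 'n='n] by (simp add: ennreal_mult[symmetric] power2_eq_square)
 finally show ?thesis .
qed

section \<open>Values on a cell\<close>

section \<open>Windows\<close>

context weights
begin

text \<open>The cell estimates are also applied with \<open>v\<close> in the role of
  \<open>\<omega>\<close>, namely to the windows.\<close>

lemma self_weights: "weights v v c r" by unfold_locales (use v_pos c_ge_1 r_ge_0 v_moderate v_even v_exp in auto)

text \<open>The weight is taken at the lattice corner, which makes the integrand Borel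
  measurable.\<close>

definition cell_mass :: "real => real => 'n hermite_series => 'n::finite phase => ennreal" where
 "cell_mass p E f k = (LI y. en ((cmod (V f y) * \<omega> (cell2 E y)) powr p) * indicator {k} (cell2 E y))"

lemma cell_mass_borel:
 assumes "f \<in> flat_dual"
 shows "(\<lambda>y. en ((cmod (V f y) * \<omega> (cell2 E y)) powr p)) \<in> borel_measurable borel"
proof -
 have "(\<lambda>y. cmod (V f y) * \<omega> (cell2 E y)) \<in> borel_measurable borel"
  by (intro borel_measurable_times borel_measurable_step2 measurable_compose[OF V_borel[OF assms] borel_measurable_norm])
 moreover have "(\<lambda>t::real. en (t powr p)) \<in> borel_measurable borel" by measurable
 ultimately show ?thesis by (rule measurable_compose)
qed

text \<open>The unit ball around \<open>z\<close> meets only cells whose corners differ from that of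
  \<open>z\<close> by elements of a finite set \<open>N\<close> independent of \<open>z\<close>, and
  there the weights are comparable with constant \<open>B\<close>. The local mean value bound thus
  involves a fixed finite number of cell masses.\<close>

lemma weighted_cell_bound:
 assumes p: "0 < p" "p \<le> 1" and e: "E > 0"
 obtains C N where "C > 0" "finite N" "N \<subseteq> lattice2 E"
  "\<And>f z. f \<in> flat_dual ==> en ((cmod (V f z) * \<omega> z) powr p) \<le>
   en C * (\<integral>\<^sup>+ \<nu>. cell_mass p E f (cell2 E z + \<nu>) \<partial>count_space N)"
proof -
 obtain C where C: "C > 0" "\<And>f :: 'n hermite_series. \<And>z0. f \<in> flat_dual ==>
   en (cmod (V f z0) powr p) \<le> en C * (LI z. en (cmod (V f z) powr p) * indicator (ball z0 1) z)"
  using V_local_bound[OF p, of 1] by auto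
 define N where "N = {k \<in> lattice2 E :: 'n phase set. norm k \<le> 1 + 2 * (2 * real CARD('n) * E)}"
 have N: "finite N" "N \<subseteq> lattice2 E" unfolding N_def using finite_lattice2_ball[OF e] by auto
 define M where "M = (\<Sum>\<nu>\<in>N. v \<nu>)"
 have M: "v \<nu> \<le> M" if "\<nu> \<in> N" for \<nu>
  unfolding M_def using v_pos N(1) that by (intro member_le_sum) (auto simp: less_imp_le)
 let ?I = "\<lambda>f z. \<integral>\<^sup>+ \<nu>. cell_mass p E f (cell2 E z + \<nu>) \<partial>count_space N"
 define B where "B = cellc E * (c * (1 + M))"
 have M0: "M \<ge> 0" unfolding M_def using v_pos by (intro sum_nonneg) (simp add: less_imp_le)
 have B: "B > 0" unfolding B_def using M0 c_ge_1 cellc_pos[of E] by (intro mult_pos_pos) auto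
 have \<omega>B: "\<omega> z \<le> B * \<omega> (cell2 E z + \<nu>)" if "\<nu> \<in> N" for z \<nu>
 proof -
  have "\<omega> z \<le> cellc E * \<omega> (cell2 E z)" by (rule \<omega>_cell(1)[OF e])
  also have "... \<le> cellc E * (c * \<omega> (cell2 E z + \<nu>) * v \<nu>)"
   using cellc_pos[of E] \<omega>_moderate'[of "cell2 E z" \<nu>] by (intro mult_left_mono) auto
  also have "... \<le> cellc E * (c * \<omega> (cell2 E z + \<nu>) * (1 + M))"
   using cellc_pos[of E] M[OF that] c_ge_1 \<omega>_pos[of "cell2 E z + \<nu>"] by (intro mult_left_mono) auto
  finally show ?thesis by (simp add: B_def mult_ac)
 qed
 have "en ((cmod (V f z) * \<omega> z) powr p) \<le>
   en (C * B powr p) * ?I f z"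
  if f: "f \<in> flat_dual" for f z
 proof -
  let ?V = "\<lambda>y. en (cmod (V f y) powr p) * indicator (ball z 1) y" and ?w = "en (\<omega> z powr p)"
  let ?Q = "\<lambda>\<nu> y. en ((cmod (V f y) * \<omega> (cell2 E y)) powr p) * indicator {cell2 E z + \<nu>} (cell2 E y)"
  have Qm: "?Q \<nu> \<in> borel_measurable lborel" for \<nu>
   unfolding measurable_lborel2 by (intro borel_measurable_times_ennreal cell_mass_borel f borel_measurable_step2)
  have "?V \<in> borel_measurable lborel"
   unfolding measurable_lborel2 by (intro borel_measurable_times_ennreal V_powr_borel f borel_measurable_indicator) simp
  then have "(LI y. ?V y) * ?w = (LI y. ?V y * ?w)" by (rule nn_integral_multc[symmetric])
  also have "... \<le> (LI y. (\<integral>\<^sup>+ \<nu>. en (B powr p) * ?Q \<nu> y \<partial>count_space N))"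
  proof (rule nn_integral_mono)
   fix y
   show "?V y * ?w \<le> (\<integral>\<^sup>+ \<nu>. en (B powr p) * ?Q \<nu> y \<partial>count_space N)"
   proof (cases "y \<in> ball z 1")
    case True
    define \<nu> where "\<nu> = cell2 E y - cell2 E z"
    have eq: "\<nu> = (y - z) - (y - cell2 E y) + (z - cell2 E z)" by (simp add: \<nu>_def)
    have "norm \<nu> \<le> norm (y - z) + norm (y - cell2 E y) + norm (z - cell2 E z)"
     unfolding eq using norm_triangle_ineq4[of "y - z" "y - cell2 E y"]
      norm_triangle_ineq[of "(y - z) - (y - cell2 E y)" "z - cell2 E z"] by linarith
    also have "... \<le> 1 + 2 * real CARD('n) * E + 2 * real CARD('n) * E"
     using True norm_sub_cell2[OF e, of y] norm_sub_cell2[OF e, of z] by (intro add_mono) (auto simp: dist_norm norm_minus_commute)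
    finally have \<nu>: "\<nu> \<in> N" unfolding N_def
     using lattice2_closed(2)[OF cell2_in_lattice2[of E y] cell2_in_lattice2[of E z]] by (simp add: \<nu>_def mult_ac del: mem_Sigma_iff)
    have k: "cell2 E y = cell2 E z + \<nu>" by (simp add: \<nu>_def)
    have "\<omega> z powr p \<le> (B * \<omega> (cell2 E y)) powr p"
     unfolding k using p \<omega>_pos[of z] by (intro powr_mono2 \<omega>B[OF \<nu>]) auto
    also have "... = B powr p * \<omega> (cell2 E y) powr p" using B \<omega>_pos[of "cell2 E y"] by (simp add: powr_mult)
    finally have "cmod (V f y) powr p * \<omega> z powr p \<le> cmod (V f y) powr p * (B powr p * \<omega> (cell2 E y) powr p)"
     by (rule mult_left_mono) simp
    also have "... = B powr p * (cmod (V f y) * \<omega> (cell2 E y)) powr p"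
     using \<omega>_pos[of "cell2 E y"] by (simp add: powr_mult)
    finally have "?V y * ?w \<le> en (B powr p) * ?Q \<nu> y"
     using True k by (simp add: ennreal_mult[symmetric] ennreal_leI)
    also have "... \<le> (\<integral>\<^sup>+ \<nu>. en (B powr p) * ?Q \<nu> y \<partial>count_space N)" by (rule nn_integral_ge_point[OF \<nu>])
    finally show ?thesis .
   qed simp
  qed
  also have "... = (\<integral>\<^sup>+ \<nu>. (LI y. en (B powr p) * ?Q \<nu> y) \<partial>count_space N)"
   by (rule nn_integral_count_space_nn_integral[OF countable_finite[OF N(1)]]) (intro borel_measurable_times_ennreal borel_measurable_const Qm)
  also have "... = en (B powr p) * ?I f z"
   unfolding nn_integral_cmult[OF Qm] cell_mass_def by (rule nn_integral_cmult) simp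
  finally have le: "(LI y. ?V y) * ?w \<le> en (B powr p) * ?I f z" .
  have "en ((cmod (V f z) * \<omega> z) powr p) = en (cmod (V f z) powr p) * ?w"
   using \<omega>_pos[of z] by (simp add: powr_mult ennreal_mult)
  also have "... \<le> en C * ((LI y. ?V y) * ?w)"
   unfolding mult.assoc[symmetric] by (rule mult_right_mono[OF C(2)[OF f]]) simp
  also have "... \<le> en C * (en (B powr p) * ?I f z)"
   by (intro mult_left_mono le) simp
  also have "... = en (C * B powr p) * ?I f z"
   using C(1) by (simp add: ennreal_mult mult.assoc)
  finally show ?thesis .
 qed
 moreover have "C * B powr p > 0" using C(1) B by simp
 ultimately show ?thesis using that N by blast
qed

text \<open>Upgrades integrability to a step majorant with \<open>p\<close>-summable values, the
  amalgam property that turns analysis and synthesis into discrete convolutions. The values are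
  \<open>p\<close>-th roots of sums of neighbouring cell masses, in whose total every cell is
  counted as often as \<open>N\<close> has elements.\<close>

lemma window_exists:
 assumes p: "0 < p" "p \<le> 1" and e: "E > 0" and f: "f \<in> flat_dual"
  and fin: "(LI z. en ((cmod (V f z) * \<omega> z) powr p)) < \<infinity>"
 obtains b where "\<And>k. b k \<ge> 0" "\<And>z. cmod (V f z) * \<omega> z \<le> b (cell2 E z)"
  "(lsum E (\<lambda>k. en (b k powr p))) < \<infinity>"
proof -
 obtain C N where C: "C > 0" and N: "finite N" "N \<subseteq> lattice2 E"
  and le: "\<And>f z. f \<in> flat_dual ==> en ((cmod (V f z) * \<omega> z) powr p) \<le>
   en C * (\<integral>\<^sup>+ \<nu>. cell_mass p E f (cell2 E z + \<nu>) \<partial>count_space N)"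
  by (rule weighted_cell_bound[OF p e]) (rule that)
 let ?w = "\<lambda>z. cmod (V f z) * \<omega> z" and ?c = "\<lambda>z. cmod (V f z) * \<omega> (cell2 E z)"
 define \<beta> where "\<beta> k = en C * (\<integral>\<^sup>+ \<nu>. cell_mass p E f (k + \<nu>) \<partial>count_space N)" for k
 let ?I = "(LI z. en (?c z powr p))"
 have "en (inverse (cellc E) powr p) * ?I \<le> (LI z. en ((?w z) powr p))"
 proof -
  have m: "(\<lambda>z. en (?c z powr p)) \<in> borel_measurable lborel"
   unfolding measurable_lborel2 by (rule cell_mass_borel[OF f])
  show ?thesis unfolding nn_integral_cmult[OF m, symmetric]
  proof (rule nn_integral_mono)
   fix z
   have "inverse (cellc E) * \<omega> (cell2 E z) \<le> \<omega> z" using \<omega>_cell(2)[OF e, of z] cellc_pos[of E] by (simp add: field_simps)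
   from mult_left_mono[OF this norm_ge_zero[of "V f z"]]
   have "inverse (cellc E) * ?c z \<le> ?w z" by (simp only: mult_ac)
   then have "(inverse (cellc E) * ?c z) powr p \<le> (?w z) powr p"
    using p cellc_pos[of E] \<omega>_pos[of "cell2 E z"] by (intro powr_mono2) auto
   moreover have "(inverse (cellc E) * ?c z) powr p
     = inverse (cellc E) powr p * ?c z powr p"
    using cellc_pos[of E] \<omega>_pos[of "cell2 E z"] by (intro powr_mult)
   ultimately show "en (inverse (cellc E) powr p) * en (?c z powr p)
     \<le> en ((?w z) powr p)" by (simp add: ennreal_mult[symmetric] ennreal_leI)
  qed
 qed
 with fin have "en (inverse (cellc E) powr p) * ?I < \<infinity>" by (rule le_less_trans[rotated])
 moreover have "inverse (cellc E) powr p > 0" using cellc_pos[of E] by simp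
 ultimately have I: "?I < \<infinity>" by (auto simp: ennreal_mult_less_top)
 have "(lsum E (\<lambda>k. \<beta> k)) = en C * (lsum E (\<lambda>k. \<integral>\<^sup>+ \<nu>. cell_mass p E f (k + \<nu>) \<partial>count_space N))"
  unfolding \<beta>_def by (rule nn_integral_cmult) simp
 also have "(lsum E (\<lambda>k. \<integral>\<^sup>+ \<nu>. cell_mass p E f (k + \<nu>) \<partial>count_space N))
   = (\<integral>\<^sup>+ \<nu>. (lsum E (\<lambda>k. cell_mass p E f (k + \<nu>))) \<partial>count_space N)"
  by (rule nn_integral_count_space_nn_integral[OF countable_finite[OF N(1)]]) simp
 also have "... = (\<integral>\<^sup>+ \<nu>. ?I \<partial>count_space N)"
 proof (rule nn_integral_cong)
  fix \<nu> assume "\<nu> \<in> space (count_space N)"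
  then have "\<nu> \<in> lattice2 E" using N by auto
  then have "(lsum E (\<lambda>k. cell_mass p E f (k + \<nu>))) = (lsum E (\<lambda>k. cell_mass p E f k))"
   by (rule nn_integral_lattice2_translate)
  also have "... = ?I" unfolding cell_mass_def by (rule nn_integral_cells2[symmetric, OF cell_mass_borel[OF f]])
  finally show "(lsum E (\<lambda>k. cell_mass p E f (k + \<nu>))) = ?I" .
 qed
 also have "en C * ... < \<infinity>" using I N(1) by (simp add: ennreal_mult_less_top nn_integral_count_space_finite ennreal_of_nat_eq_real_of_nat)
 finally have \<beta>fin: "(lsum E (\<lambda>k. \<beta> k)) < \<infinity>" .
 have \<beta>k: "\<beta> k < \<infinity>" if "k \<in> lattice2 E" for k
  using nn_integral_ge_point[OF that, of \<beta>] \<beta>fin by (rule le_less_trans)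
 define b where "b k = enn2real (\<beta> k) powr (1 / p)" for k
 have bp: "b k powr p = enn2real (\<beta> k)" for k unfolding b_def using p by (simp add: powr_powr)
 show ?thesis
 proof (rule that[of b])
  show "b k \<ge> 0" for k by (simp add: b_def)
  show "(lsum E (\<lambda>k. en (b k powr p))) < \<infinity>"
  proof -
   have "(lsum E (\<lambda>k. en (b k powr p))) = (lsum E (\<lambda>k. \<beta> k))"
    unfolding bp by (rule nn_integral_cong) (use \<beta>k in \<open>simp add: less_top\<close>)
   then show ?thesis using \<beta>fin by simp
  qed
  show "?w z \<le> b (cell2 E z)" for z
  proof -
   have "en ((?w z) powr p) \<le> \<beta> (cell2 E z)" unfolding \<beta>_def by (rule le[OF f])
   from enn2real_mono[OF this] \<beta>k[OF cell2_in_lattice2]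
   have "(?w z) powr p \<le> enn2real (\<beta> (cell2 E z))" by (simp add: less_top[symmetric])
   then have "((?w z) powr p) powr (1 / p) \<le> b (cell2 E z)" unfolding b_def using p by (intro powr_mono2) auto
   moreover have "((?w z) powr p) powr (1 / p) = ?w z"
    using p \<omega>_pos[of z] by (simp add: powr_powr)
   ultimately show ?thesis by simp
  qed
 qed
qed

end

section \<open>Time-frequency atoms and window estimates\<close>

definition atom :: "(real^'n => complex) => 'n phase => 'n::finite hermite_series" where
 "atom \<phi> l = hermite_coeffs (tf_shift (fst l) (snd l) \<phi>)"

text \<open>The sequence \<open>b\<close> majorises the weighted transform of the window cell by
  cell; the size estimates see the window only through it.\<close>

locale window = weights \<omega> v c r
 for \<omega> v :: "'n::finite phase => real" and c r +
 fixes E p :: real and \<phi> :: "real^'n => complex" and b :: "'n phase => real"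
 assumes eps: "E > 0" and p: "0 < p" "p \<le> 1" and \<phi>_L2: "\<phi> \<in> square_integrable"
  and b_nonneg: "\<And>k. b k \<ge> 0"
  and b_bound: "\<And>z. cmod (V (hermite_coeffs \<phi>) z) * v z \<le> b (cell2 E z)"
  and b_sum: "(lsum E (\<lambda>k. en (b k powr p))) < \<infinity>"
begin

lemma atom_flat_dual: "atom \<phi> l \<in> flat_dual"
 unfolding atom_def by (intro hermite_coeffs_in_flat_dual square_integrable_tf_shift \<phi>_L2)

lemma atom_bound:
 assumes l: "l \<in> lattice2 E"
 shows "cmod (V (atom \<phi> l) z) * v (z - l) \<le> b (cell2 E z - l)"
proof -
 have "cmod (V (atom \<phi> l) z) = cmod (V (hermite_coeffs \<phi>) (z - l))" unfolding atom_def by (rule norm_V_tf_shift[OF \<phi>_L2])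
 then show ?thesis using b_bound[of "z - l"] cell2_diff_lattice2[OF eps l, of z] by simp
qed

definition S where "S = enn2real (lsum E (\<lambda>k. en (b k)))"

text \<open>As \<open>p \<le> 1\<close>, a \<open>p\<close>-summable sequence is summable.\<close>

lemma S: "(lsum E (\<lambda>k. en (b k))) = en S" "S \<ge> 0"
proof -
 have "epow p (lsum E (\<lambda>k. en (b k))) \<le> (lsum E (\<lambda>k. epow p (en (b k))))"
  by (rule epow_nn_integral_count_space[OF p])
 also have "... < \<infinity>" using b_sum by (simp add: epow_ennreal b_nonneg)
 finally show "(lsum E (\<lambda>k. en (b k))) = en S" unfolding epow_less_top_iff S_def by (simp add: less_top)
 show "S \<ge> 0" by (simp add: S_def)
qed

lemma b_le_S: "k \<in> lattice2 E ==> b k \<le> S"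
 using nn_integral_ge_point[of k "lattice2 E" "\<lambda>k. en (b k)"] S by simp

text \<open>Moderateness moves \<open>\<omega>\<close> from \<open>z\<close> to the lattice point
  \<open>l\<close> at the price \<open>v (z - l)\<close>, which \<open>b\<close> absorbs; a lattice
  convolution remains.\<close>

lemma synthesis_bound:
 fixes d :: "'n::finite phase => real"
 assumes d: "\<And>l. d l \<ge> 0"
 shows "(lsum E (\<lambda>l. en (d l * cmod (V (atom \<phi> l) z)))) * en (\<omega> z)
  \<le> en c * (lsum E (\<lambda>l. en (d l * \<omega> l) * en (b (cell2 E z - l))))"
proof -
 have "(lsum E (\<lambda>l. en (d l * cmod (V (atom \<phi> l) z)))) * en (\<omega> z)
  = (lsum E (\<lambda>l. en (d l * cmod (V (atom \<phi> l) z)) * en (\<omega> z)))" by (rule nn_integral_multc[symmetric]) simp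
 also have "... \<le> (lsum E (\<lambda>l. en c * (en (d l * \<omega> l) * en (b (cell2 E z - l)))))"
 proof (rule nn_integral_mono)
  fix l :: "'n phase" assume "l \<in> space (count_space (lattice2 E))"
  then have l: "l \<in> lattice2 E" by (simp only: space_count_space)
  have "d l * cmod (V (atom \<phi> l) z) * \<omega> z \<le> d l * cmod (V (atom \<phi> l) z) * (c * \<omega> l * v (z - l))"
   using d[of l] by (intro mult_left_mono \<omega>_diff mult_nonneg_nonneg) auto
  also have "... = (d l * c * \<omega> l) * (cmod (V (atom \<phi> l) z) * v (z - l))" by (simp only: mult_ac)
  also have "... \<le> (d l * c * \<omega> l) * b (cell2 E z - l)"
   using d[of l] c_ge_1 \<omega>_pos[of l] by (intro mult_left_mono atom_bound[OF l]) auto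
  also have "... = c * (d l * \<omega> l * b (cell2 E z - l))" by (simp only: mult_ac)
  finally have "en (d l * cmod (V (atom \<phi> l) z) * \<omega> z) \<le> en (c * (d l * \<omega> l * b (cell2 E z - l)))" by (rule ennreal_leI)
  then show "en (d l * cmod (V (atom \<phi> l) z)) * en (\<omega> z) \<le> en c * (en (d l * \<omega> l) * en (b (cell2 E z - l)))"
   using d[of l] c_ge_1 \<omega>_pos[of l] \<omega>_pos[of z] b_nonneg by (simp only: ennreal_mult[symmetric] mult_nonneg_nonneg less_imp_le norm_ge_zero order_trans[OF zero_le_one])
 qed
 also have "... = en c * (lsum E (\<lambda>l. en (d l * \<omega> l) * en (b (cell2 E z - l))))"
  by (rule nn_integral_cmult) simp
 finally show ?thesis .
qed

text \<open>The counterpart of \<open>synthesis_bound\<close> with the weight moved from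
  \<open>l\<close> to \<open>z\<close>. Integrating the resulting step function produces the square
  of \<open>cube_vol\<close>, the volume of a cell in phase space.\<close>

lemma analysis_bound:
 assumes A: "\<And>z. en (cmod (V f z) * \<omega> z) \<le> A (cell2 E z)" and l: "l \<in> lattice2 E"
 shows "(LI z. en (cmod (V f z) * cmod (V (atom \<phi> l) z)) * en (\<omega> l))
  \<le> en (c * (cube_vol E TYPE('n))\<^sup>2) * (lsum E (\<lambda>k. A k * en (b (k - l))))"
proof -
 have "(LI z. en (cmod (V f z) * cmod (V (atom \<phi> l) z)) * en (\<omega> l))
  \<le> (LI z. en c * (A (cell2 E z) * en (b (cell2 E z - l))))"
 proof (rule nn_integral_mono)
  fix z
  let ?F = "cmod (V f z)" and ?G = "cmod (V (atom \<phi> l) z)"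
  have "\<omega> l \<le> c * \<omega> z * v (z - l)" using \<omega>_diff[of l z] v_even[of "z - l"] by simp
  then have "?F * ?G * \<omega> l \<le> ?F * ?G * (c * \<omega> z * v (z - l))" by (intro mult_left_mono) auto
  also have "... = (c * (?F * \<omega> z)) * (?G * v (z - l))" by (simp only: mult_ac)
  also have "... \<le> (c * (?F * \<omega> z)) * b (cell2 E z - l)"
   using c_ge_1 \<omega>_pos[of z] by (intro mult_left_mono atom_bound[OF l]) auto
  also have "... = c * (?F * \<omega> z * b (cell2 E z - l))" by (simp only: mult_ac)
  finally have "en (?F * ?G * \<omega> l) \<le> en (c * (?F * \<omega> z * b (cell2 E z - l)))" by (rule ennreal_leI)
  also have "... = en c * (en (?F * \<omega> z) * en (b (cell2 E z - l)))"
   using c_ge_1 \<omega>_pos[of z] b_nonneg by (simp only: ennreal_mult mult_nonneg_nonneg less_imp_le norm_ge_zero order_trans[OF zero_le_one])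
  also have "... \<le> en c * (A (cell2 E z) * en (b (cell2 E z - l)))" by (intro mult_left_mono mult_right_mono A) auto
  finally show "en (?F * ?G) * en (\<omega> l) \<le> en c * (A (cell2 E z) * en (b (cell2 E z - l)))"
   using \<omega>_pos[of l] by (simp only: ennreal_mult[symmetric] mult_nonneg_nonneg less_imp_le norm_ge_zero)
 qed
 also have "... = en ((cube_vol E TYPE('n))\<^sup>2) * (lsum E (\<lambda>k. en c * (A k * en (b (k - l)))))"
  by (rule nn_integral_step2[OF eps])
 also have "... = en (c * (cube_vol E TYPE('n))\<^sup>2) * (lsum E (\<lambda>k. A k * en (b (k - l))))"
  using c_ge_1 by (subst nn_integral_cmult) (simp_all add: ennreal_mult mult_ac)
 finally show ?thesis .
qed

end

text \<open>Synthesis with the coefficients \<open>1 / \<omega>\<close>, the extreme case of a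
  bounded weighted sequence; it dominates every expansion of an element of
  \<open>M\<^sup>\<infinity>\<close>.\<close>

lemma (in window) atom_sum_le:
 "(lsum E (\<lambda>l. en (1 / \<omega> l * cmod (V (atom \<phi> l) z)))) \<le> en (c * S * (1 / \<omega> z))"
proof -
 let ?X = "(lsum E (\<lambda>l. en (1 / \<omega> l * cmod (V (atom \<phi> l) z))))"
 have "?X * en (\<omega> z) \<le> en c * (lsum E (\<lambda>l. en (1 / \<omega> l * \<omega> l) * en (b (cell2 E z - l))))"
  by (rule synthesis_bound) (use \<omega>_pos in \<open>simp add: less_imp_le\<close>)
 also have "(lsum E (\<lambda>l. en (1 / \<omega> l * \<omega> l) * en (b (cell2 E z - l)))) = (lsum E (\<lambda>l. en (b (cell2 E z - l))))"
 proof (rule nn_integral_cong)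
  fix l
  have "1 / \<omega> l * \<omega> l = 1" using \<omega>_pos[of l] by simp
  then show "en (1 / \<omega> l * \<omega> l) * en (b (cell2 E z - l)) = en (b (cell2 E z - l))" by simp
 qed
 also have "... = en S" using nn_integral_lattice2_reflect[OF cell2_in_lattice2[of E z], where f = "\<lambda>l. en (b l)"] S(1) by simp
 finally have "?X * en (\<omega> z) * en (1 / \<omega> z) \<le> en c * en S * en (1 / \<omega> z)"
  by (rule mult_right_mono) simp
 moreover have "?X * en (\<omega> z) * en (1 / \<omega> z) = ?X"
  unfolding mult.assoc using \<omega>_pos[of z] by (simp add: ennreal_mult[symmetric])
 moreover have "en c * en S * en (1 / \<omega> z) = en (c * S * (1 / \<omega> z))"
  using c_ge_1 S(2) \<omega>_pos[of z] by (simp add: ennreal_mult[symmetric] less_imp_le)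
 ultimately show ?thesis by simp
qed

lemma (in window) atom_M1:
 assumes l: "l \<in> lattice2 E"
 shows "M1_norm (atom \<phi> l) < \<infinity>"
proof -
 let ?K = "cellc 1 * c * (1 / \<omega> l)"
 have K: "?K \<ge> 0" using cellc_pos[of 1] c_ge_1 \<omega>_pos[of l] by (simp add: less_imp_le)
 have "M1_norm (atom \<phi> l) \<le> (LI z. en ?K * en (b (cell2 E z - l)))" unfolding M1_norm_def
 proof (rule nn_integral_mono)
  fix z
  let ?G = "cmod (V (atom \<phi> l) z)"
  have "?G * inv_weight z \<le> ?G * (cellc 1 * (1 / \<omega> z))" using inv_weight_le(1)[of z] by (intro mult_left_mono) auto
  also have "... \<le> ?G * (cellc 1 * (c * v (l - z) / \<omega> l))"
   using cellc_pos[of 1] by (intro mult_left_mono inv_\<omega>_le) auto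
  also have "... = ?K * (?G * v (z - l))" using v_even[of "z - l"] by simp
  also have "... \<le> ?K * b (cell2 E z - l)" by (intro mult_left_mono atom_bound[OF l] K)
  finally have "en (?G * inv_weight z) \<le> en (?K * b (cell2 E z - l))" by (rule ennreal_leI)
  then show "en (?G * inv_weight z) \<le> en ?K * en (b (cell2 E z - l))" unfolding ennreal_mult[OF K b_nonneg] .
 qed
 also have "... = en ((cube_vol E TYPE('n))\<^sup>2) * (lsum E (\<lambda>k. en ?K * en (b (k - l))))"
  by (rule nn_integral_step2[OF eps])
 also have "(lsum E (\<lambda>k. en ?K * en (b (k - l)))) = en ?K * (lsum E (\<lambda>k. en (b (k - l))))"
  by (rule nn_integral_cmult) simp
 also have "(lsum E (\<lambda>k. en (b (k - l)))) = en S"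
  using nn_integral_lattice2_translate[OF lattice2_closed(2)[OF lattice2_closed(3) l], where f = "\<lambda>l. en (b l)"] S(1) by simp
 also have "en ((cube_vol E TYPE('n))\<^sup>2) * (en ?K * en S) < \<infinity>" by (simp add: ennreal_mult_less_top)
 finally show ?thesis .
qed

lemma (in window) atom_Minf:
 assumes l: "l \<in> lattice2 E"
 shows "atom \<phi> l \<in> Minf"
proof -
 have "cmod (V (atom \<phi> l) z) * \<omega> z \<le> (c * \<omega> l) * S" for z
 proof -
  have "cmod (V (atom \<phi> l) z) * \<omega> z \<le> cmod (V (atom \<phi> l) z) * (c * \<omega> l * v (z - l))"
   by (intro mult_left_mono \<omega>_diff) simp
  also have "... = (c * \<omega> l) * (cmod (V (atom \<phi> l) z) * v (z - l))" by simp
  also have "... \<le> (c * \<omega> l) * b (cell2 E z - l)"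
   using c_ge_1 \<omega>_pos[of l] by (intro mult_left_mono atom_bound[OF l]) auto
  also have "... \<le> (c * \<omega> l) * S"
   using c_ge_1 \<omega>_pos[of l] by (intro mult_left_mono b_le_S lattice2_closed(2) cell2_in_lattice2 l) auto
  finally show ?thesis .
 qed
 then show ?thesis using atom_flat_dual unfolding Minf_def by blast
qed

lemma (in window) stft_eq:
 assumes f: "f \<in> Minf" and l: "l \<in> lattice2 E"
 shows "stft \<omega> \<phi> f l = of_real (stft_const TYPE('n)) * (LINT z|lborel. V f z * cnj (V (atom \<phi> l) z))"
 using dual_pairing_eq[OF f atom_flat_dual atom_M1[OF l]] by (simp add: stft_def split_def stft_const_def atom_def)

lemma (in window) stft_le:
 assumes f: "f \<in> Minf" and A: "\<And>z. en (cmod (V f z) * \<omega> z) \<le> A (cell2 E z)" and l: "l \<in> lattice2 E"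
 shows "en (cmod (stft \<omega> \<phi> f l) * \<omega> l)
  \<le> en (stft_const TYPE('n) * (c * (cube_vol E TYPE('n))\<^sup>2)) * (lsum E (\<lambda>k. A k * en (b (k - l))))"
proof -
 let ?s = "stft_const TYPE('n)"
 have s: "?s > 0" by (rule stft_const_pos)
 note int = Minf_M1_integrable[OF f atom_flat_dual atom_M1[OF l]]
 have m: "(\<lambda>z. en (cmod (V f z) * cmod (V (atom \<phi> l) z))) \<in> borel_measurable lborel"
  using borel_measurable_integrable[OF integrable_norm[OF int]] measurable_compose[OF _ measurable_ennreal] by (simp add: norm_mult)
 have "cmod (stft \<omega> \<phi> f l) = ?s * cmod (LINT z|lborel. V f z * cnj (V (atom \<phi> l) z))"
  unfolding stft_eq[OF f l] norm_mult using s by simp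
 then have "en (cmod (stft \<omega> \<phi> f l) * \<omega> l) = en ?s * (en (cmod (LINT z|lborel. V f z * cnj (V (atom \<phi> l) z))) * en (\<omega> l))"
  using s \<omega>_pos[of l] by (simp add: ennreal_mult mult.assoc)
 also have "... \<le> en ?s * ((LI z. en (cmod (V f z) * cmod (V (atom \<phi> l) z))) * en (\<omega> l))"
  using integral_norm_bound_ennreal[OF int] by (intro mult_left_mono mult_right_mono) (simp_all add: norm_mult)
 also have "(LI z. en (cmod (V f z) * cmod (V (atom \<phi> l) z))) * en (\<omega> l)
   = (LI z. en (cmod (V f z) * cmod (V (atom \<phi> l) z)) * en (\<omega> l))" by (rule nn_integral_multc[OF m, symmetric])
 also have "en ?s * ... \<le> en ?s * (en (c * (cube_vol E TYPE('n))\<^sup>2) * (lsum E (\<lambda>k. A k * en (b (k - l)))))"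
  by (intro mult_left_mono analysis_bound A l) simp
 also have "... = en (?s * (c * (cube_vol E TYPE('n))\<^sup>2)) * (lsum E (\<lambda>k. A k * en (b (k - l))))"
  using s c_ge_1 by (simp add: ennreal_mult mult.assoc)
 finally show ?thesis .
qed

text \<open>Analysis with a constant majorant \<open>C0\<close>, for which the convolution collapses
  to \<open>C0 * S\<close>. The integrals of absolute values are bounded along with the coefficients
  because the exchange of sum and integral in the expansion relies on them.\<close>

lemma (in window) pair_atom_le:
 assumes f: "f \<in> Minf"
 obtains C where "C \<ge> 0" "\<And>l. l \<in> lattice2 E ==> cmod (stft \<omega> \<phi> f l) \<le> C * (1 / \<omega> l)"
  "\<And>l. l \<in> lattice2 E ==> (LI z. en (cmod (V f z) * cmod (V (atom \<phi> l) z))) \<le> en (C * (1 / \<omega> l))"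
proof -
 obtain C0 where C0: "C0 \<ge> 0" "f \<in> flat_dual" "\<And>z. cmod (V f z) \<le> C0 * (1 / \<omega> z)"
  by (rule MinfE[OF f]) (rule that)
 have A: "en (cmod (V f z) * \<omega> z) \<le> en C0" for z
  using C0(3)[of z] \<omega>_pos[of z] by (intro ennreal_leI) (simp add: field_simps)
 define s where "s = stft_const TYPE('n)"
 define q where "q = c * (cube_vol E TYPE('n))\<^sup>2"
 have s: "s > 0" unfolding s_def by (rule stft_const_pos)
 have q: "q \<ge> 0" unfolding q_def using c_ge_1 by simp
 define C where "C = (s + 1) * q * (C0 * S)"
 have C: "C \<ge> 0" unfolding C_def using s q C0(1) S(2) by (intro mult_nonneg_nonneg) auto
 have le: "s * q * (C0 * S) \<le> C" "q * (C0 * S) \<le> C"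
 proof -
  have "0 \<le> q * (C0 * S)" using q C0(1) S(2) by (intro mult_nonneg_nonneg) auto
  moreover from this have "0 \<le> s * (q * (C0 * S))" by (rule mult_nonneg_nonneg[OF less_imp_le[OF s]])
  moreover have "C = s * (q * (C0 * S)) + q * (C0 * S)" unfolding C_def by (simp add: distrib_right mult.assoc)
  ultimately show "s * q * (C0 * S) \<le> C" "q * (C0 * S) \<le> C" by (simp_all add: mult.assoc)
 qed
 have conv: "(lsum E (\<lambda>k. en C0 * en (b (k - l)))) = en (C0 * S)" if l: "l \<in> lattice2 E" for l
 proof -
  have "(lsum E (\<lambda>k. en C0 * en (b (k - l)))) = en C0 * (lsum E (\<lambda>k. en (b (k - l))))"
   by (rule nn_integral_cmult) simp
  also have "(lsum E (\<lambda>k. en (b (k - l)))) = en S"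
   using nn_integral_lattice2_translate[OF lattice2_closed(2)[OF lattice2_closed(3) l], where f = "\<lambda>l. en (b l)"] S(1) by simp
  finally show ?thesis using C0(1) S(2) by (simp add: ennreal_mult)
 qed
 show ?thesis
 proof (rule that[OF C])
  fix l :: "'n phase" assume l: "l \<in> lattice2 E"
  have "en (cmod (stft \<omega> \<phi> f l) * \<omega> l) \<le> en (s * q) * en (C0 * S)"
   using stft_le[OF f A l] unfolding conv[OF l] s_def[symmetric] q_def[symmetric] .
  also have "... = en (s * q * (C0 * S))" using s q C0(1) S(2) by (intro ennreal_mult[symmetric]) auto
  also have "... \<le> en C" by (rule ennreal_leI[OF le(1)])
  finally show "cmod (stft \<omega> \<phi> f l) \<le> C * (1 / \<omega> l)" using C \<omega>_pos[of l] by (simp add: field_simps)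
  let ?X = "(LI z. en (cmod (V f z) * cmod (V (atom \<phi> l) z)))"
  have m: "(\<lambda>z. en (cmod (V f z) * cmod (V (atom \<phi> l) z))) \<in> borel_measurable lborel"
   using borel_measurable_integrable[OF integrable_norm[OF Minf_M1_integrable[OF f atom_flat_dual atom_M1[OF l]]]] measurable_compose[OF _ measurable_ennreal]
   by (simp add: norm_mult)
  have "?X * en (\<omega> l) \<le> en q * en (C0 * S)"
   using analysis_bound[where A = "\<lambda>_. en C0", OF A l] unfolding conv[OF l] nn_integral_multc[OF m] q_def[symmetric] .
  also have "... = en (q * (C0 * S))" using q C0(1) S(2) by (intro ennreal_mult[symmetric]) auto
  also have "... \<le> en C" by (rule ennreal_leI[OF le(2)])
  finally have "?X * en (\<omega> l) * en (1 / \<omega> l) \<le> en C * en (1 / \<omega> l)" by (rule mult_right_mono) simp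
  moreover have "?X * en (\<omega> l) * en (1 / \<omega> l) = ?X"
   unfolding mult.assoc using \<omega>_pos[of l] by (simp add: ennreal_mult[symmetric])
  ultimately show "?X \<le> en (C * (1 / \<omega> l))" using C \<omega>_pos[of l] by (simp add: ennreal_mult[symmetric])
 qed
qed

lemma (in weights) Minf_cmult: "f \<in> Minf ==> (\<lambda>J. a * f J) \<in> Minf"
proof -
 assume "f \<in> Minf"
 then obtain C where C: "f \<in> flat_dual" "\<And>z. cmod (V f z) * \<omega> z \<le> C" unfolding Minf_def by auto
 have "cmod (V (\<lambda>J. a * f J) z) * \<omega> z \<le> cmod a * C" for z
  using mult_left_mono[OF C(2)[of z], of "cmod a"] by (simp add: V_cmult norm_mult mult.assoc)
 then show ?thesis using flat_dual_cmult[OF C(1)] unfolding Minf_def by blast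
qed

lemma (in weights) Minf_add:
 assumes "f \<in> Minf" "g \<in> Minf" shows "(\<lambda>J. f J + g J) \<in> Minf"
proof -
 obtain C where C: "f \<in> flat_dual" "\<And>z. cmod (V f z) * \<omega> z \<le> C" using assms(1) unfolding Minf_def by auto
 obtain D where D: "g \<in> flat_dual" "\<And>z. cmod (V g z) * \<omega> z \<le> D" using assms(2) unfolding Minf_def by auto
 have "cmod (V (\<lambda>J. f J + g J) z) * \<omega> z \<le> C + D" for z
 proof -
  have "cmod (V (\<lambda>J. f J + g J) z) * \<omega> z \<le> (cmod (V f z) + cmod (V g z)) * \<omega> z"
   unfolding V_add[OF C(1) D(1)] using \<omega>_pos[of z] by (intro mult_right_mono norm_triangle_ineq) auto
  then show ?thesis using C(2)[of z] D(2)[of z] by (simp add: distrib_right)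
 qed
 then show ?thesis using flat_dual_add[OF C(1) D(1)] unfolding Minf_def by blast
qed

lemma (in weights) Minf_sum: "(\<And>i. i \<in> F ==> f i \<in> Minf) ==> (\<lambda>J. \<Sum>i\<in>F. f i J) \<in> Minf"
proof (induction F rule: infinite_finite_induct)
 case (insert i F)
 then show ?case using Minf_add[of "f i" "\<lambda>J. \<Sum>i\<in>F. f i J"] by simp
next
 case empty
 have "(\<lambda>J. 0) \<in> flat_dual" by (rule bounded_in_flat_dual[of _ 0]) simp
 moreover have "V (\<lambda>J. 0 :: complex) z = 0" for z :: "'n::finite phase" by (simp add: V_eq)
 ultimately show ?case unfolding Minf_def by (auto intro!: exI[of _ 0])
next
 case (infinite F)
 have "(\<lambda>J. 0) \<in> flat_dual" by (rule bounded_in_flat_dual[of _ 0]) simp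
 moreover have "V (\<lambda>J. 0 :: complex) z = 0" for z :: "'n phase" by (simp add: V_eq)
 ultimately show ?case using infinite(1) unfolding Minf_def by (auto intro!: exI[of _ 0])
qed

section \<open>The Gabor expansion\<close>

text \<open>Records analysis with \<open>\<phi>\<close> and synthesis with \<open>\<psi>\<close>;
  the other half of the duality is an instance with the windows exchanged.\<close>

locale gabor = weights \<omega> v c r + A: window \<omega> v c r E p \<phi> b + B: window \<omega> v c r E p \<psi> d
 for \<omega> v :: "'n::finite phase => real" and c r E p :: real and \<phi> \<psi> :: "real^'n => complex" and b d +
 assumes dual: "\<And>f. f \<in> square_integrable ==>
  L2_has_sum (\<lambda>(j, \<iota>) y. stft_L2 \<phi> f (j, \<iota>) * tf_shift j \<iota> \<psi> y) f (lattice2 E)"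
begin

text \<open>The frame identity in \<open>L\<^sup>2\<close>, applied to the Gaussian at
  \<open>z\<close> and paired with the Gaussian at \<open>w\<close>. This is the one place where
  that identity is used.\<close>

lemma kern_has_sum:
 "((\<lambda>l. cnj (V (atom \<phi> l) z) * V (atom \<psi> l) w) has_sum kern z w) (lattice2 E)"
proof -
 let ?G = "\<lambda>z. tf_shift (fst z) (snd z) gaussian :: real^'n => complex"
 let ?c = "complex_of_real (stft_const TYPE('n))"
 have G: "?G z \<in> square_integrable" for z by (rule square_integrable_tf_shift[OF square_integrable_gaussian])
 have sL2: "stft_L2 \<phi> (?G z) l = cnj (V (atom \<phi> l) z)" for l
 proof -
  have "stft_L2 \<phi> (?G z) l = ?c * ip (?G z) (tf_shift (fst l) (snd l) \<phi>)"
   unfolding stft_L2_def ip_def tf_shift_def[of "fst l"] split_def stft_const_def by (simp add: cis_cnj mult_ac)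
  also have "... = cnj (?c * ip (tf_shift (fst l) (snd l) \<phi>) (?G z))" using ip_cnj[of "tf_shift (fst l) (snd l) \<phi>" "?G z"] by simp
  also have "... = cnj (V (atom \<phi> l) z)" unfolding atom_def V_L2[OF square_integrable_tf_shift[OF A.\<phi>_L2]] ..
  finally show ?thesis .
 qed
 let ?u = "\<lambda>l y. stft_L2 \<phi> (?G z) l * tf_shift (fst l) (snd l) \<psi> y"
 have "L2_has_sum ?u (?G z) (lattice2 E)" using dual[OF G[of z]] unfolding split_def by simp
 from L2_has_sum_ip[OF this square_integrable_cmult[OF square_integrable_tf_shift[OF B.\<phi>_L2]] G G[of w]]
 have "((\<lambda>l. ip (?u l) (?G w)) has_sum ip (?G z) (?G w)) (lattice2 E)" .
 then have "((\<lambda>l. ?c * ip (?u l) (?G w)) has_sum ?c * ip (?G z) (?G w)) (lattice2 E)" by (rule has_sum_cmult_right)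
 moreover have "?c * ip (?G z) (?G w) = kern z w" unfolding kern_eq ..
 moreover have "?c * ip (?u l) (?G w) = cnj (V (atom \<phi> l) z) * V (atom \<psi> l) w" for l
  unfolding ip_cmult_left sL2 atom_def V_L2[OF square_integrable_tf_shift[OF B.\<phi>_L2]] by simp
 ultimately show ?thesis by simp
qed

text \<open>Multiplying the kernel expansion by \<open>V f\<close> and integrating term by term
  gives the result through the reproducing formula. The exchange is justified by
  \<open>atom_sum_le\<close> at the point \<open>w\<close>, so \<open>f\<close> may lie outside
  \<open>L\<^sup>2\<close>.\<close>

lemma expansion:
 assumes f: "f \<in> Minf"
 shows "((\<lambda>l. stft \<omega> \<phi> f l * V (atom \<psi> l) w) has_sum V f w) (lattice2 E)"
proof -
 let ?c = "complex_of_real (stft_const TYPE('n))"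
 obtain C where C: "C \<ge> 0" "\<And>l. l \<in> lattice2 E ==> (LI z. en (cmod (V f z) * cmod (V (atom \<phi> l) z))) \<le> en (C * (1 / \<omega> l))"
  by (rule A.pair_atom_le[OF f]) (rule that)
 have fd: "f \<in> flat_dual" "exp_bounded (V f)" by (rule MinfE[OF f], assumption)+
 let ?f = "\<lambda>l z. V f z * cnj (V (atom \<phi> l) z) * V (atom \<psi> l) w"
 have int: "integrable lborel (?f l)" if "l \<in> lattice2 E" for l
  by (intro integrable_mult_left Minf_M1_integrable f A.atom_flat_dual A.atom_M1 that)
 have "((\<lambda>l. LINT z|lborel. ?f l z) has_sum (LINT z|lborel. V f z * kern z w)) (lattice2 E)"
 proof (rule has_sum_lebesgue_integral(2)[OF countable_lattice2 int borel_measurable_integrable[OF V_reproducing(1)[OF fd]]])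
  show "((\<lambda>l. ?f l z) has_sum V f z * kern z w) (lattice2 E)" for z
   using has_sum_cmult_right[OF kern_has_sum[of z w], of "V f z"] by (simp add: mult.assoc)
  have "(lsum E (\<lambda>l. (LI z. en (cmod (?f l z)))))
   \<le> (lsum E (\<lambda>l. en C * en (1 / \<omega> l * cmod (V (atom \<psi> l) w))))"
  proof (rule nn_integral_mono)
   fix l :: "'n phase" assume "l \<in> space (count_space (lattice2 E))"
   then have l: "l \<in> lattice2 E" by (simp only: space_count_space)
   have m: "(\<lambda>z. en (cmod (V f z) * cmod (V (atom \<phi> l) z))) \<in> borel_measurable lborel"
    using borel_measurable_integrable[OF integrable_norm[OF Minf_M1_integrable[OF f A.atom_flat_dual A.atom_M1[OF l]]]] measurable_compose[OF _ measurable_ennreal]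
    by (simp add: norm_mult)
   have "(LI z. en (cmod (?f l z))) = (LI z. en (cmod (V f z) * cmod (V (atom \<phi> l) z)) * en (cmod (V (atom \<psi> l) w)))"
    by (simp add: norm_mult ennreal_mult)
   also have "... = (LI z. en (cmod (V f z) * cmod (V (atom \<phi> l) z))) * en (cmod (V (atom \<psi> l) w))"
    by (rule nn_integral_multc[OF m])
   also have "... \<le> en (C * (1 / \<omega> l)) * en (cmod (V (atom \<psi> l) w))" by (intro mult_right_mono C(2) l) simp
   also have "... = en C * en (1 / \<omega> l * cmod (V (atom \<psi> l) w))"
    using C(1) \<omega>_pos[of l] by (simp add: ennreal_mult[symmetric])
   finally show "(LI z. en (cmod (?f l z))) \<le> en C * en (1 / \<omega> l * cmod (V (atom \<psi> l) w))" .
  qed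
  also have "... = en C * (lsum E (\<lambda>l. en (1 / \<omega> l * cmod (V (atom \<psi> l) w))))"
   by (rule nn_integral_cmult) simp
  also have "... \<le> en C * en (c * B.S * (1 / \<omega> w))" by (intro mult_left_mono B.atom_sum_le) simp
  also have "... < \<infinity>" by (simp add: ennreal_mult_less_top)
  finally show "(lsum E (\<lambda>l. (LI z. en (cmod (?f l z))))) < \<infinity>" .
 qed
 from has_sum_cmult_right[OF this, of ?c]
 have "((\<lambda>l. ?c * (LINT z|lborel. ?f l z)) has_sum V f w) (lattice2 E)" using V_reproducing(2)[OF fd, of w] by simp
 moreover have "?c * (LINT z|lborel. ?f l z) = stft \<omega> \<phi> f l * V (atom \<psi> l) w" if "l \<in> lattice2 E" for l
  unfolding A.stft_eq[OF f that] by simp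
 ultimately show ?thesis by (subst (asm) has_sum_cong) auto
qed

text \<open>The pointwise expansion is integrated against \<open>V g\<close>. By
  \<open>atom_sum_le\<close> the absolute sums are dominated by a multiple of
  \<open>cmod (V g z) * inv_weight z\<close>, integrable for \<open>g\<close> in
  \<open>M\<^sup>1\<close>.\<close>

lemma weak_star_expansion:
 assumes f: "f \<in> Minf"
 shows "weak_star_has_sum \<omega> (\<lambda>l J. stft \<omega> \<phi> f l * atom \<psi> l J) f (lattice2 E)"
 unfolding weak_star_has_sum_def
proof
 fix g assume "g \<in> modulation_Lp 1 (\<lambda>z. 1 / \<omega> z)"
 then have g: "g \<in> flat_dual" "M1_norm g < \<infinity>" by (auto simp: modulation_L1_iff)
 obtain C where C: "C \<ge> 0" "\<And>l. l \<in> lattice2 E ==> cmod (stft \<omega> \<phi> f l) \<le> C * (1 / \<omega> l)"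
  by (rule A.pair_atom_le[OF f]) (rule that)
 let ?f = "\<lambda>l z. stft \<omega> \<phi> f l * (V (atom \<psi> l) z * cnj (V g z))"
 have int: "integrable lborel (?f l)" if "l \<in> lattice2 E" for l by (intro integrable_mult_right Minf_M1_integrable B.atom_Minf that g)
 let ?S = "\<lambda>F J. \<Sum>l\<in>F. stft \<omega> \<phi> f l * atom \<psi> l J" and ?a = "\<lambda>l z. 1 / \<omega> l * cmod (V (atom \<psi> l) z)"
 let ?K = "C * (c * B.S) * cellc 1"
 have K: "?K \<ge> 0" using C(1) c_ge_1 B.S(2) cellc_pos[of 1] by (intro mult_nonneg_nonneg) auto
 have "((\<lambda>l. LINT z|lborel. ?f l z) has_sum (LINT z|lborel. V f z * cnj (V g z))) (lattice2 E)"
 proof (rule has_sum_lebesgue_integral(2)[OF countable_lattice2 int borel_measurable_integrable[OF Minf_M1_integrable[OF f g]]])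
  show "((\<lambda>l. ?f l z) has_sum V f z * cnj (V g z)) (lattice2 E)" for z
   using has_sum_cmult_left[OF expansion[OF f, of z], of "cnj (V g z)"] by (simp add: mult.assoc)
  have fm: "(\<lambda>z. en (cmod (?f l z))) \<in> borel_measurable lborel" if "l \<in> lattice2 E" for l
   by (rule measurable_compose[OF measurable_compose[OF borel_measurable_integrable[OF int[OF that]] borel_measurable_norm] measurable_ennreal])
  have "(lsum E (\<lambda>l. (LI z. en (cmod (?f l z)))))
   = (LI z. (lsum E (\<lambda>l. en (cmod (?f l z)))))"
   by (rule nn_integral_count_space_nn_integral[OF countable_lattice2 fm, symmetric])
  also have "... \<le> (LI z. en ?K * en (cmod (V g z) * inv_weight z))"
  proof (rule nn_integral_mono)
   fix z
   let ?g = "cmod (V g z)"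
   have "(lsum E (\<lambda>l. en (cmod (?f l z)))) \<le> (lsum E (\<lambda>l. en (C * ?g) * en (?a l z)))"
   proof (rule nn_integral_mono)
    fix l :: "'n::finite phase" assume "l \<in> space (count_space (lattice2 E))"
    then have l: "l \<in> lattice2 E" by (simp only: space_count_space)
    have "cmod (?f l z) \<le> (C * (1 / \<omega> l)) * (cmod (V (atom \<psi> l) z) * ?g)"
     unfolding norm_mult complex_mod_cnj by (intro mult_right_mono C(2) l) simp
    also have "... = (C * ?g) * (?a l z)" by simp
    finally have "en (cmod (?f l z)) \<le> en ((C * ?g) * (?a l z))" by (rule ennreal_leI)
    also have "... = en (C * ?g) * en (?a l z)"
     using C(1) \<omega>_pos[of l] by (intro ennreal_mult mult_nonneg_nonneg) auto
    finally show "en (cmod (?f l z)) \<le> en (C * ?g) * en (?a l z)" .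
   qed
   also have "... = en (C * ?g) * (lsum E (\<lambda>l. en (?a l z)))"
    by (rule nn_integral_cmult) simp
   also have "... \<le> en (C * ?g) * en (c * B.S * (1 / \<omega> z))" by (intro mult_left_mono B.atom_sum_le) simp
   also have "... \<le> en (C * ?g) * en (c * B.S * (cellc 1 * inv_weight z))"
    using c_ge_1 B.S(2) by (intro mult_left_mono ennreal_leI inv_weight_le(2)) auto
   also have "... = en ((C * ?g) * (c * B.S * (cellc 1 * inv_weight z)))"
    using C(1) c_ge_1 B.S(2) cellc_pos[of 1] inv_weight_pos[of z] by (intro ennreal_mult[symmetric] mult_nonneg_nonneg) (auto simp: less_imp_le)
   also have "(C * ?g) * (c * B.S * (cellc 1 * inv_weight z)) = ?K * (?g * inv_weight z)" by (simp only: mult_ac)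
   also have "en ... = en ?K * en (?g * inv_weight z)"
    using inv_weight_pos[of z] by (intro ennreal_mult K mult_nonneg_nonneg) auto
   finally show "(lsum E (\<lambda>l. en (cmod (?f l z)))) \<le> en ?K * en (?g * inv_weight z)" .
  qed
  also have "... = en ?K * M1_norm g" unfolding M1_norm_def by (rule nn_integral_cmult[OF M1_norm_borel[OF g(1)]])
  also have "... < \<infinity>" using g(2) by (simp add: ennreal_mult_less_top)
  finally show "(lsum E (\<lambda>l. (LI z. en (cmod (?f l z))))) < \<infinity>" .
 qed
 then have lim: "((\<lambda>F. \<Sum>l\<in>F. LINT z|lborel. ?f l z) \<longlongrightarrow> dual_pairing \<omega> f g) (finite_subsets_at_top (lattice2 E))"
  unfolding has_sum_def dual_pairing_eq[OF f g] .
 show "((\<lambda>F. dual_pairing \<omega> (?S F) g) \<longlongrightarrow> dual_pairing \<omega> f g) (finite_subsets_at_top (lattice2 E))"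
 proof (rule Lim_transform_eventually[OF lim], rule eventually_finite_subsets_at_top_weakI)
  fix F :: "'n phase set" assume F: "finite F" "F \<subseteq> lattice2 E"
  have Ml: "(\<lambda>J. stft \<omega> \<phi> f l * atom \<psi> l J) \<in> Minf" if "l \<in> F" for l
   using that F by (intro Minf_cmult B.atom_Minf) auto
  have FM: "(?S F) \<in> Minf" by (rule Minf_sum) (rule Ml)
  have eq: "V (?S F) z * cnj (V g z) = (\<Sum>l\<in>F. ?f l z)" for z
   by (subst V_sum) (simp_all add: flat_dual_cmult B.atom_flat_dual V_cmult sum_distrib_right mult.assoc)
  have "dual_pairing \<omega> (?S F) g = (LINT z|lborel. (\<Sum>l\<in>F. ?f l z))"
   unfolding dual_pairing_eq[OF FM g] eq ..
  also have "... = (\<Sum>l\<in>F. LINT z|lborel. ?f l z)" by (rule Bochner_Integration.integral_sum) (use F int in auto)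
  finally show "(\<Sum>l\<in>F. LINT z|lborel. ?f l z) = dual_pairing \<omega> (?S F) g" ..
 qed
qed

end

section \<open>Reindexing of sums and uniqueness of weak star limits\<close>

lemma tendsto_finite_subsets_reindex:
 assumes "inj_on h B" "(X \<longlongrightarrow> L) (finite_subsets_at_top (h ` B))"
 shows "((\<lambda>F. X (h ` F)) \<longlongrightarrow> L) (finite_subsets_at_top B)"
 using assms(2) unfolding filtermap_image_finite_subsets_at_top[OF assms(1), symmetric] filterlim_filtermap .

lemma weak_star_has_sum_reindex:
 assumes "inj h" "weak_star_has_sum \<omega> u f (range h)"
 shows "weak_star_has_sum \<omega> (\<lambda>i. u (h i)) f UNIV" unfolding weak_star_has_sum_def
proof
 fix g :: "'c hermite_series" assume "g \<in> modulation_Lp 1 (\<lambda>z. 1 / \<omega> z)"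
 then have "((\<lambda>F. dual_pairing \<omega> (\<lambda>J. \<Sum>i\<in>F. u i J) g) \<longlongrightarrow> dual_pairing \<omega> f g) (finite_subsets_at_top (range h))"
  using assms(2) unfolding weak_star_has_sum_def by blast
 from tendsto_finite_subsets_reindex[OF assms(1) this]
 have "((\<lambda>F. dual_pairing \<omega> (\<lambda>J. \<Sum>i\<in>h ` F. u i J) g) \<longlongrightarrow> dual_pairing \<omega> f g) (finite_subsets_at_top UNIV)" .
 moreover have "(\<Sum>i\<in>h ` F. u i J) = (\<Sum>i\<in>F. u (h i) J)" for F J
  using sum.reindex[of h F "\<lambda>i. u i J"] inj_on_subset[OF assms(1)] by simp
 ultimately show "((\<lambda>F. dual_pairing \<omega> (\<lambda>J. \<Sum>i\<in>F. u (h i) J) g) \<longlongrightarrow> dual_pairing \<omega> f g) (finite_subsets_at_top UNIV)" by simp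
qed

lemma modulation_has_sum_reindex:
 assumes "inj h" "modulation_has_sum \<Phi>\<^sub>1 \<Phi>\<^sub>2 \<omega> u f (range h)"
 shows "modulation_has_sum \<Phi>\<^sub>1 \<Phi>\<^sub>2 \<omega> (\<lambda>i. u (h i)) f UNIV"
proof -
 have "(\<Sum>i\<in>h ` F. u i J) = (\<Sum>i\<in>F. u (h i) J)" for F J
  using sum.reindex[of h F "\<lambda>i. u i J"] inj_on_subset[OF assms(1)] by simp
 then show ?thesis using tendsto_finite_subsets_reindex[OF assms(1) assms(2)[unfolded modulation_has_sum_def]]
  unfolding modulation_has_sum_def by simp
qed

lemma inj_grid: "E > 0 ==> inj (grid E :: int^'n => real^'n)"
proof (rule injI)
 fix j k :: "int^'n" assume e: "E > 0" and eq: "grid E j = grid E k"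
 have "E * of_int (j $ i) = E * of_int (k $ i)" for i using arg_cong[OF eq, of "\<lambda>x. x $ i"] by (simp add: grid_def)
 then show "j = k" using e by (simp add: vec_eq_iff)
qed

definition grid2 :: "real => (int^'n) \<times> (int^'n) => 'n::finite phase" where
 "grid2 E j = (grid E (fst j), grid E (snd j))"

lemma inj_grid2: "E > 0 ==> inj (grid2 E)" by (rule injI) (simp add: grid2_def inj_eq[OF inj_grid] prod_eq_iff)

lemma range_grid2: "range (grid2 E) = lattice2 E"
proof (intro equalityI subsetI)
 fix z :: "'n::finite phase" assume "z \<in> lattice2 E"
 then obtain j k where "fst z = grid E j" "snd z = grid E k" by (auto simp: lattice_def)
 then have "z = grid2 E (j, k)" by (simp add: grid2_def prod_eq_iff)
 then show "z \<in> range (grid2 E)" by (rule range_eqI)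
qed (auto simp: grid2_def lattice_def)

lemma unit_in_flat:
 fixes \<beta> :: "'n::finite => nat"
 shows "(\<lambda>J. if J = \<beta> then 1 else 0) \<in> pilipovic_flat" unfolding pilipovic_flat_def
proof (intro CollectI exI conjI allI)
 fix J :: "'n => nat"
 have "multi_fact J > 0" "multi_fact \<beta> > 0" unfolding multi_fact_def by (intro prod_pos; simp)+
 then show "cmod (if J = \<beta> then 1 else 0) \<le> sqrt (multi_fact \<beta>) * 1 ^ (\<Sum>i\<in>UNIV. J i) / sqrt (multi_fact J)" by simp
qed simp

context weights
begin

lemma dual_pairing_unit:
 assumes f: "f \<in> Minf"
 shows "dual_pairing \<omega> f (\<lambda>J. if J = \<beta> then 1 else 0) = f \<beta>"
proof -
 let ?e = "\<lambda>J :: 'n => nat. if J = \<beta> then 1 else 0 :: complex"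
 have fd: "f \<in> flat_dual" "exp_bounded (V f)" by (rule MinfE[OF f], assumption)+
 note e = unit_in_flat[of \<beta>]
 have "l2_form f ?e = (\<Sum>\<^sub>\<infinity>J\<in>{\<beta>}. f J * cnj (?e J))" unfolding l2_form_def by (rule infsum_cong_neutral) auto
 then have "l2_form f ?e = f \<beta>" by simp
 then show ?thesis using dual_pairing_eq[OF f flat_subset_flat_dual[OF e] flat_M1[OF e]] l2_form_integral(2)[OF fd e] by simp
qed

text \<open>Unit coefficient series are admissible test elements, and pairing with them reads off
  single Hermite coefficients.\<close>

lemma weak_star_unique:
 assumes "f \<in> Minf" "g \<in> Minf" "weak_star_has_sum \<omega> u f A" "weak_star_has_sum \<omega> u g A"
 shows "f = g"
proof
 fix \<beta>
 let ?e = "\<lambda>J :: 'n => nat. if J = \<beta> then 1 else 0 :: complex"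
 note e = unit_in_flat[of \<beta>]
 have "?e \<in> modulation_Lp 1 (\<lambda>z. 1 / \<omega> z)"
  unfolding modulation_L1_iff using flat_subset_flat_dual[OF e] flat_M1[OF e] by blast
 then have "dual_pairing \<omega> f ?e = dual_pairing \<omega> g ?e" using assms(3,4) unfolding weak_star_has_sum_def
  by (blast intro: tendsto_unique[OF finite_subsets_at_top_neq_bot])
 then show "f \<beta> = g \<beta>" unfolding dual_pairing_unit[OF assms(1)] dual_pairing_unit[OF assms(2)] .
qed

end

text \<open>Synthesis is a description over \<open>M\<^sup>\<infinity>\<close>: the weak star
  expansion supplies the object, \<open>weak_star_unique\<close> its uniqueness. The restriction
  inside the analysis operator does not affect the summands, all of which are indexed by lattice
  points.\<close>

lemma (in gabor) frame_operator:
 assumes m: "\<omega> \<in> borel_measurable lebesgue" and f: "f \<in> Minf"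
 shows "gabor_frame_operator E \<omega> \<phi> \<psi> f = f"
proof -
 let ?u = "\<lambda>(j, \<iota>) J. gabor_analysis E \<omega> \<phi> f (j, \<iota>) * hermite_coeffs (tf_shift j \<iota> \<psi>) J"
 have "(\<Sum>l\<in>F. ?u l J) = (\<Sum>l\<in>F. stft \<omega> \<phi> f l * atom \<psi> l J)" if "F \<subseteq> lattice2 E" for F J
  using that by (intro sum.cong) (auto simp: gabor_analysis_def atom_def)
 then have ws: "weak_star_has_sum \<omega> ?u f (lattice2 E)" using weak_star_expansion[OF f] unfolding weak_star_has_sum_def
  by (auto elim!: Lim_transform_eventually intro!: eventually_finite_subsets_at_top_weakI)
 have "gabor_synthesis E \<omega> \<psi> (gabor_analysis E \<omega> \<phi> f) = f" unfolding gabor_synthesis_def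
 proof (rule the_equality, intro conjI ws)
  show "f \<in> modulation_Lp \<infinity> \<omega>" using Minf_subset_modulation_Linf[OF m] f by blast
  fix g assume "g \<in> modulation_Lp \<infinity> \<omega> \<and> weak_star_has_sum \<omega> ?u g (lattice2 E)"
  then show "g = f" using weak_star_unique[OF _ f _ ws] modulation_Linf_subset by blast
 qed
 then show ?thesis by (simp add: gabor_frame_operator_def)
qed

section \<open>Orlicz quasi-norms as powers of gauges\<close>

text \<open>Extends a Young function to infinity as \<open>orlicz_norm\<close> does, which makes it
  an instance of \<open>star_gauge\<close>.\<close>

definition star :: "(real => ennreal) => ennreal => ennreal" where
 "star \<Phi> x = (if x = \<infinity> then \<infinity> else \<Phi> (enn2real x))"

lemma star_gauge_star:
 assumes "young \<Phi>" shows "star_gauge (star \<Phi>)" unfolding star_gauge_def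
proof (intro conjI allI impI)
 show "star \<Phi> \<infinity> = \<infinity>" by (simp add: star_def)
 have "\<forall>\<^sub>F t in at_top. 1 < \<Phi> t" using assms unfolding young_def by (intro order_tendstoD(1)[of \<Phi> \<infinity>]) auto
 then have "\<forall>\<^sub>F t in at_top. 1 < \<Phi> t \<and> t \<ge> 0" using eventually_ge_at_top[of "0::real"] by eventually_elim simp
 then obtain t where "1 < \<Phi> t" "t \<ge> 0" by (auto dest: eventually_happens)
 then show "\<exists>x<\<infinity>. 1 < star \<Phi> x" by (intro exI[of _ "en t"]) (simp add: star_def)
 fix u x :: ennreal assume u: "u \<le> 1"
 then obtain a where a: "u = en a" "0 \<le> a" "a \<le> 1" by (cases u) (auto simp: top_unique)
 have \<Phi>0: "\<Phi> 0 = 0" using assms by (simp add: young_def)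
 show "star \<Phi> (u * x) \<le> u * star \<Phi> x"
 proof (cases x)
  case (real b)
  have "\<Phi> ((1 - a) * 0 + a * b) \<le> en (1 - a) * \<Phi> 0 + en a * \<Phi> b"
   using assms a real unfolding young_def by (metis atLeastAtMost_iff order_refl)
  then show ?thesis using a real \<Phi>0 by (simp add: star_def ennreal_mult[symmetric])
 next
  case top
  then show ?thesis using a \<Phi>0 by (cases "a = 0") (simp_all add: star_def ennreal_mult_top)
 qed
qed

text \<open>The scaling \<open>a\<close> for \<open>\<Phi>\<close> corresponds to
  \<open>a powr r\<close> for \<open>\<Phi>\<^sub>0\<close>, bijectively on positive numbers, and
  the two modular conditions agree. Raised to the power \<open>r\<close>, the quasi-norm is thus the
  gauge of a Young function.\<close>

lemma epow_orlicz_norm: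
 assumes r: "r > 0" and \<Phi>: "\<And>t. t \<ge> 0 ==> \<Phi> t = \<Phi>\<^sub>0 (t powr r)"
 shows "epow r (orlicz_norm M \<Phi> g) = lux M (star \<Phi>\<^sub>0) (\<lambda>x. epow r (g x))"
proof -
 let ?Q = "\<lambda>a. (\<integral>\<^sup>+ x. (if g x = \<infinity> then \<infinity> else \<Phi> (enn2real (g x) / a)) \<partial>M) \<le> 1"
 let ?R = "\<lambda>a. (\<integral>\<^sup>+ x. star \<Phi>\<^sub>0 (en (inverse a) * epow r (g x)) \<partial>M) \<le> 1"
 have eq: "?Q a \<longleftrightarrow> ?R (a powr r)" if a: "a > 0" for a
 proof -
  have "(if g x = \<infinity> then \<infinity> else \<Phi> (enn2real (g x) / a)) = star \<Phi>\<^sub>0 (en (inverse (a powr r)) * epow r (g x))" for x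
  proof (cases "g x")
   case (real t)
   have "(t / a) powr r = inverse (a powr r) * t powr r" using powr_divide[of t a r] a real by (simp add: divide_inverse[of _ "_ powr _"] mult.commute)
   then show ?thesis using real a r by (simp add: \<Phi> star_def epow_ennreal ennreal_mult[symmetric])
  next
   case top
   then show ?thesis using a by (simp add: star_def ennreal_mult_top)
  qed
  then show ?thesis by simp
 qed
 show ?thesis
 proof (rule antisym)
  show "epow r (orlicz_norm M \<Phi> g) \<le> lux M (star \<Phi>\<^sub>0) (\<lambda>x. epow r (g x))"
  proof (rule lux_greatest)
   fix a :: real assume a: "a > 0" "?R a"
   have ar: "(a powr (1 / r)) powr r = a" using a r by (simp add: powr_powr)
   have "orlicz_norm M \<Phi> g \<le> en (a powr (1 / r))" unfolding orlicz_norm_def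
   proof (rule Inf_lower, intro CollectI exI conjI, rule refl)
    show "a powr (1 / r) > 0" using a by simp
    then show "?Q (a powr (1 / r))" using eq[of "a powr (1 / r)"] a(2) unfolding ar by blast
   qed
   from epow_mono[OF r this] show "epow r (orlicz_norm M \<Phi> g) \<le> en a" by (simp add: epow_ennreal ar)
  qed
  have "epow (1 / r) (lux M (star \<Phi>\<^sub>0) (\<lambda>x. epow r (g x))) \<le> orlicz_norm M \<Phi> g" unfolding orlicz_norm_def
  proof (rule Inf_greatest)
   fix y assume "y \<in> {en a | a. a > 0 \<and> ?Q a}"
   then obtain a where a: "y = en a" "a > 0" "?Q a" by blast
   have "lux M (star \<Phi>\<^sub>0) (\<lambda>x. epow r (g x)) \<le> en (a powr r)" using a eq[OF a(2)] by (intro lux_le) auto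
   from epow_mono[OF _ this, of "1 / r"] show "epow (1 / r) (lux M (star \<Phi>\<^sub>0) (\<lambda>x. epow r (g x))) \<le> y"
    using r a by (simp add: epow_ennreal powr_powr)
  qed
  from epow_mono[OF r this] show "lux M (star \<Phi>\<^sub>0) (\<lambda>x. epow r (g x)) \<le> epow r (orlicz_norm M \<Phi> g)"
   using r by (simp add: epow_epow)
 qed
qed

lemma epow_mixed_orlicz_norm:
 assumes "r > 0" "\<And>t. t \<ge> 0 ==> \<Phi>\<^sub>1 t = \<Theta>\<^sub>1 (t powr r)" "\<And>t. t \<ge> 0 ==> \<Phi>\<^sub>2 t = \<Theta>\<^sub>2 (t powr r)" "\<And>z. \<omega> z \<ge> 0"
 shows "epow r (mixed_orlicz_norm M \<Phi>\<^sub>1 \<Phi>\<^sub>2 \<omega> F) = mlux M (star \<Theta>\<^sub>1) (star \<Theta>\<^sub>2) (\<lambda>z. en ((cmod (F z) * \<omega> z) powr r))"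
 unfolding mixed_orlicz_norm_def mlux_def
  epow_orlicz_norm[OF assms(1), of \<Phi>\<^sub>1 \<Theta>\<^sub>1, OF assms(2), simplified] epow_orlicz_norm[OF assms(1), of \<Phi>\<^sub>2 \<Theta>\<^sub>2, OF assms(3), simplified]
 using assms(4) by (simp add: epow_ennreal)

section \<open>Mixed gauges of lattice sequences and of functions\<close>

lemma mlux_step_le:
 assumes g: "star_gauge P" "star_gauge Q" and e: "E > 0"
 obtains C where "C > 0" "\<And>s :: 'n::finite phase => ennreal.
  mlux lborel P Q (\<lambda>z. s (cell2 E z)) \<le> en C * slux E P Q s"
proof -
 obtain C1 where C1: "C1 > 0" "\<And>s::real^'n => ennreal.
  lux lborel P (\<lambda>x. s (cell E x)) \<le> en C1 * lux (count_space (lattice E)) P s" by (rule lux_step_le[OF g(1) e]) (rule that)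
 obtain C2 where C2: "C2 > 0" "\<And>s::real^'n => ennreal.
  lux lborel Q (\<lambda>x. s (cell E x)) \<le> en C2 * lux (count_space (lattice E)) Q s" by (rule lux_step_le[OF g(2) e]) (rule that)
 have "mlux lborel P Q (\<lambda>z. s (cell2 E z)) \<le> en (C1 * C2) * slux E P Q s"
  for s :: "'n phase => ennreal"
 proof -
  have "mlux lborel P Q (\<lambda>z. s (cell2 E z)) \<le> en C1 * lux lborel Q (\<lambda>\<xi>. lux (count_space (lattice E)) P (\<lambda>j. s (j, cell E \<xi>)))"
   unfolding mlux_def cell2_def fst_conv snd_conv by (rule lux_mono_cmult[OF g(2) C1(1)]) (rule C1(2))
  also have "... \<le> en C1 * (en C2 * slux E P Q s)" unfolding mlux_def by (intro mult_left_mono C2(2)) simp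
  finally show ?thesis using C1(1) C2(1) by (simp add: ennreal_mult mult.assoc)
 qed
 then show ?thesis using C1(1) C2(1) that[of "C1 * C2"] by simp
qed

text \<open>Integrals over product cells are averaged one variable at a time. Minkowski's inequality
  carries the inner lattice gauge through the second integral, so the intermediate function
  \<open>n\<close> is a gauge over a countable set and hence measurable; the factor 4 in the
  constant is lost there.\<close>

lemma mlux_cell_integral_le:
 assumes g: "star_gauge P" "star_gauge Q" and e: "E > 0"
 obtains C where "C > 0" "\<And>h :: 'n::finite phase => ennreal. h \<in> borel_measurable borel ==>
  slux E P Q (\<lambda>k. (LI z. h z * indicator {k} (cell2 E z)))
   \<le> en C * mlux lborel P Q h"
proof -
 let ?L = "count_space (lattice E :: (real^'n) set)"
 obtain C1 where C1: "C1 > 0" "\<And>g::real^'n => ennreal. g \<in> borel_measurable borel ==>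
  lux ?L P (\<lambda>j. (LI u. g (j + u) * indicator (cube E) u)) \<le> en C1 * lux lborel P g"
  by (rule lux_lattice_average_le[OF g(1) e]) (rule that)
 obtain C2 where C2: "C2 > 0" "\<And>g::real^'n => ennreal. g \<in> borel_measurable borel ==>
  lux ?L Q (\<lambda>j. (LI u. g (j + u) * indicator (cube E) u)) \<le> en C2 * lux lborel Q g"
  by (rule lux_lattice_average_le[OF g(2) e]) (rule that)
 have "mlux ?L P Q (\<lambda>k. (LI z. h z * indicator {k} (cell2 E z))) \<le> en (4 * C2 * C1) * mlux lborel P Q h"
  if h: "h \<in> borel_measurable borel" for h :: "'n phase => ennreal"
 proof -
  have ci: "(\<lambda>u. indicator (cube E) u :: ennreal) \<in> borel_measurable (borel :: (real^'n) measure)"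
   by (rule borel_measurable_indicator[OF cube_borel])
  have comp: "(\<lambda>p. h (q p)) \<in> borel_measurable borel" if "continuous_on UNIV q" for q :: "'x::topological_space => 'n phase"
   by (rule measurable_compose[OF borel_continuous[OF that] h])
  define Y where "Y k1 \<eta> = (LI x. h (k1 + x, \<eta>) * indicator (cube E) x)" for k1 \<eta>
  have Ym: "Y k1 \<in> borel_measurable borel" for k1
  proof -
   have c: "continuous_on UNIV (\<lambda>p :: 'n phase. (k1 + snd p, fst p))" by (intro continuous_intros)
   have "(\<lambda>p :: 'n phase. indicator (cube E) (snd p) :: ennreal) \<in> borel_measurable borel"
    by (rule measurable_compose[OF borel_continuous[OF continuous_on_snd[OF continuous_on_id]] ci])
   then have "(\<lambda>p. h (k1 + snd p, fst p) * indicator (cube E) (snd p)) \<in> borel_measurable (lborel \<Otimes>\<^sub>M lborel)"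
    unfolding lborel_prod measurable_lborel2 by (intro borel_measurable_times_ennreal comp[OF c])
   from lborel.borel_measurable_nn_integral_fst[OF this]
   have "(\<lambda>\<eta>. (LI x. h (k1 + x, \<eta>) * indicator (cube E) x)) \<in> borel_measurable lborel" by simp
   then show ?thesis unfolding Y_def[abs_def] measurable_lborel2 .
  qed
  have Ym2: "(\<lambda>\<xi>. Y k1 (k2 + \<xi>) * indicator (cube E) \<xi>) \<in> borel_measurable lborel" for k1 k2
  proof -
   have "continuous_on UNIV (\<lambda>\<xi> :: real^'n. k2 + \<xi>)" by (intro continuous_intros)
   from measurable_compose[OF borel_continuous[OF this] Ym]
   show ?thesis unfolding measurable_lborel2 by (intro borel_measurable_times_ennreal ci)
  qed
  have X: "(LI z. h z * indicator {k} (cell2 E z)) = (LI \<xi>. Y (fst k) (snd k + \<xi>) * indicator (cube E) \<xi>)"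
   if k: "k \<in> lattice2 E" for k
  proof -
   have c: "continuous_on UNIV (\<lambda>p :: 'n phase. (fst k + fst p, snd k + snd p))" by (intro continuous_intros)
   have i1: "(\<lambda>p :: 'n phase. indicator (cube E) (fst p) :: ennreal) \<in> borel_measurable borel"
    "(\<lambda>p :: 'n phase. indicator (cube E) (snd p) :: ennreal) \<in> borel_measurable borel"
    by (rule measurable_compose[OF borel_continuous[OF continuous_on_fst[OF continuous_on_id]] ci],
      rule measurable_compose[OF borel_continuous[OF continuous_on_snd[OF continuous_on_id]] ci])
   have m: "(\<lambda>z. h z * indicator {k} (cell2 E z)) \<in> borel_measurable borel"
    by (intro borel_measurable_times_ennreal h borel_measurable_step2)
   have "(LI z. h z * indicator {k} (cell2 E z)) = (LI z. h (k + z) * indicator {k} (cell2 E (k + z)))"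
    by (rule nn_integral_translate_lborel[OF m, symmetric])
   also have "... = (LI z. h (fst k + fst z, snd k + snd z) * indicator (cube E) (fst z) * indicator (cube E) (snd z))"
   proof (rule nn_integral_cong)
    fix z :: "'n phase"
    have "cell2 E (k + z) = k \<longleftrightarrow> fst z \<in> cube E \<and> snd z \<in> cube E"
     unfolding cell2_add_lattice2[OF e k] cube_iff[OF e] by (simp add: cell2_def zero_prod_def)
    moreover have "k + z = (fst k + fst z, snd k + snd z)" by (simp add: plus_prod_def)
    ultimately show "h (k + z) * indicator {k} (cell2 E (k + z)) = h (fst k + fst z, snd k + snd z) * indicator (cube E) (fst z) * indicator (cube E) (snd z)"
     by (simp add: indicator_def)
   qed
   also have "... = (LI x. (LI \<xi>. h (fst k + x, snd k + \<xi>) * indicator (cube E) x * indicator (cube E) \<xi>))"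
    by (subst nn_integral_pair_lborel) (intro borel_measurable_times_ennreal comp[OF c] i1, simp)
   also have "... = (LI \<xi>. (LI x. h (fst k + x, snd k + \<xi>) * indicator (cube E) x * indicator (cube E) \<xi>))"
    by (rule nn_integral_lborel_swap[symmetric]) (intro borel_measurable_times_ennreal comp[OF c] i1)
   also have "... = (LI \<xi>. Y (fst k) (snd k + \<xi>) * indicator (cube E) \<xi>)"
   proof (rule nn_integral_cong)
    fix \<xi> :: "real^'n"
    have "continuous_on UNIV (\<lambda>x :: real^'n. (fst k + x, snd k + \<xi>))" by (intro continuous_intros)
    then have "(\<lambda>x. h (fst k + x, snd k + \<xi>) * indicator (cube E) x) \<in> borel_measurable lborel"
     unfolding measurable_lborel2 by (intro borel_measurable_times_ennreal comp ci)
    then show "(LI x. h (fst k + x, snd k + \<xi>) * indicator (cube E) x * indicator (cube E) \<xi>) = Y (fst k) (snd k + \<xi>) * indicator (cube E) \<xi>"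
     unfolding Y_def by (rule nn_integral_multc)
   qed
   finally show ?thesis .
  qed
  define n where "n \<eta> = lux ?L P (\<lambda>k1. Y k1 \<eta>)" for \<eta>
  have nm: "n \<in> borel_measurable borel" unfolding n_def[abs_def] by (rule borel_measurable_lux[OF g(1) countable_lattice Ym])
  have "mlux ?L P Q (\<lambda>k. (LI z. h z * indicator {k} (cell2 E z)))
    = lux ?L Q (\<lambda>k2. lux ?L P (\<lambda>k1. (LI z. h z * indicator {(k1, k2)} (cell2 E z))))" by (simp add: mlux_def)
  also have "... \<le> en 4 * lux ?L Q (\<lambda>k2. (LI \<xi>. n (k2 + \<xi>) * indicator (cube E) \<xi>))"
  proof (rule lux_mono_cmult[OF g(2)])
   fix k2 :: "real^'n" assume "k2 \<in> space ?L"
   then have k2: "k2 \<in> lattice E" by simp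
   have "lux ?L P (\<lambda>k1. (LI z. h z * indicator {(k1, k2)} (cell2 E z)))
    \<le> lux ?L P (\<lambda>k1. (LI \<xi>. Y k1 (k2 + \<xi>) * indicator (cube E) \<xi>))"
   proof (rule lux_mono[OF g(1)])
    fix k1 :: "real^'n" assume "k1 \<in> space ?L"
    then have "(k1, k2) \<in> lattice2 E" using k2 by simp
    from X[OF this] show "(LI z. h z * indicator {(k1, k2)} (cell2 E z)) \<le> (LI \<xi>. Y k1 (k2 + \<xi>) * indicator (cube E) \<xi>)" by simp
   qed
   also have "... \<le> 4 * (LI \<xi>. lux ?L P (\<lambda>k1. Y k1 (k2 + \<xi>) * indicator (cube E) \<xi>))"
    by (rule lux_minkowski[OF g(1) countable_lattice Ym2])
   also have "(LI \<xi>. lux ?L P (\<lambda>k1. Y k1 (k2 + \<xi>) * indicator (cube E) \<xi>)) = (LI \<xi>. n (k2 + \<xi>) * indicator (cube E) \<xi>)"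
    by (intro nn_integral_cong) (simp add: n_def lux_zero[OF g(1)] split: split_indicator)
   finally show "lux ?L P (\<lambda>k1. (LI z. h z * indicator {(k1, k2)} (cell2 E z))) \<le> en 4 * (LI \<xi>. n (k2 + \<xi>) * indicator (cube E) \<xi>)"
    by simp
  qed simp
  also have "... \<le> en 4 * (en C2 * lux lborel Q n)" by (intro mult_left_mono C2(2) nm) simp
  also have "... \<le> en 4 * (en C2 * (en C1 * mlux lborel P Q h))"
  proof (intro mult_left_mono)
   show "lux lborel Q n \<le> en C1 * mlux lborel P Q h" unfolding mlux_def
   proof (rule lux_mono_cmult[OF g(2) C1(1)])
    fix \<eta> :: "real^'n"
    have "continuous_on UNIV (\<lambda>x :: real^'n. (x, \<eta>))" by (intro continuous_intros)
    then show "n \<eta> \<le> en C1 * lux lborel P (\<lambda>x. h (x, \<eta>))" unfolding n_def Y_def by (intro C1(2) comp)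
   qed
  qed simp_all
  also have "... = en (4 * C2 * C1) * mlux lborel P Q h" using C1(1) C2(1) by (simp add: ennreal_mult mult.assoc)
  finally show ?thesis .
 qed
 moreover have "4 * C2 * C1 > 0" using C1(1) C2(1) by simp
 ultimately show ?thesis using that by blast
qed

lemma mlux_zero: "star_gauge P ==> star_gauge Q ==> mlux M P Q (\<lambda>_. 0) = 0"
 by (simp add: mlux_def lux_zero)

text \<open>Minkowski's inequality over the summation index, followed by translation invariance of
  the lattice gauge: a form of Young's inequality in which \<open>b\<close> enters through its
  sum.\<close>

lemma mlux_convolution_le:
 fixes A :: "'n::finite phase => ennreal"
 assumes g: "star_gauge P" "star_gauge Q" and b: "\<And>m. b m \<ge> 0"
 shows "slux E P Q (\<lambda>l. (lsum E (\<lambda>m. A (l + m) * en (b m))))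
  \<le> 16 * ((lsum E (\<lambda>m. en (b m))) * slux E P Q A)"
proof -
 let ?m = "slux E P Q :: ('n phase => ennreal) => ennreal"
 have "?m (\<lambda>l. (lsum E (\<lambda>m. A (l + m) * en (b m)))) \<le> 16 * (lsum E (\<lambda>m. ?m (\<lambda>l. A (l + m) * en (b m))))"
  by (rule mlux_minkowski[OF g countable_lattice]) simp
 also have "... \<le> 16 * (lsum E (\<lambda>m. en (b m) * ?m A))"
 proof (intro mult_left_mono nn_integral_mono)
  fix m :: "'n phase" assume "m \<in> space (count_space (lattice2 E))"
  then have m: "m \<in> lattice E \<times> lattice E" by (simp only: space_count_space)
  show "?m (\<lambda>l. A (l + m) * en (b m)) \<le> en (b m) * ?m A"
  proof (cases "b m = 0")
   case True then show ?thesis using mlux_zero[OF g] by simp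
  next
   case False
   then have "b m > 0" using b[of m] by simp
   then have "?m (\<lambda>l. A (l + m) * en (b m)) \<le> en (b m) * ?m (\<lambda>l. A (l + m))"
    by (intro mlux_mono_cmult[OF g]) (simp_all add: mult.commute)
   then show ?thesis unfolding mlux_lattice_translate[OF m] .
  qed
 qed simp
 also have "... = 16 * ((lsum E (\<lambda>m. en (b m))) * ?m A)" by (subst nn_integral_multc) simp_all
 finally show ?thesis .
qed

text \<open>Minkowski's inequality for counting measure on the two booleans.\<close>

lemma mlux_add_le:
 assumes g: "star_gauge P" "star_gauge Q" and A: "countable A"
 shows "mlux (count_space A) P Q (\<lambda>k. X k + Y k) \<le> 16 * (mlux (count_space A) P Q X + mlux (count_space A) P Q Y)"
proof -
 have "mlux (count_space A) P Q (\<lambda>k. \<integral>\<^sup>+ i. (if i then X k else Y k) \<partial>count_space (UNIV :: bool set))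
  \<le> 16 * (\<integral>\<^sup>+ i. mlux (count_space A) P Q (\<lambda>k. if i then X k else Y k) \<partial>count_space (UNIV :: bool set))"
  by (rule mlux_minkowski[OF g A]) simp
 then show ?thesis by (simp add: nn_integral_count_space_finite UNIV_bool add.commute)
qed

text \<open>Brings both orientations of a convolution to the shape \<open>f (k + m)\<close> to which
  \<open>mlux_convolution_le\<close> applies.\<close>

lemma nn_integral_lattice2_shift_out:
 assumes "k \<in> lattice2 E"
 shows "(lsum E (\<lambda>l. f l * g (k - l))) = (lsum E (\<lambda>m. f (k + m) * g (- m)))"
  and "(lsum E (\<lambda>l. f l * g (l - k))) = (lsum E (\<lambda>m. f (k + m) * g m))"
 using nn_integral_lattice2_translate[OF assms, of "\<lambda>l. f l * g (k - l)"]
  nn_integral_lattice2_translate[OF assms, of "\<lambda>l. f l * g (l - k)"] by (simp_all add: add.commute)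

section \<open>Norm estimates for analysis and synthesis\<close>

context weights
begin

text \<open>Lattice majorant of \<open>(cmod (V f z) * \<omega> z) powr p\<close>, with
  \<open>C\<close> and \<open>N\<close> as in \<open>weighted_cell_bound\<close>. It is the sequence
  through which a function gauge is converted into a lattice gauge.\<close>

definition cell_major :: "real => real => real => 'n::finite phase set => 'n hermite_series => 'n phase => ennreal" where
 "cell_major p E C N f k = en C * (\<integral>\<^sup>+ \<nu>. cell_mass p E f (k + \<nu>) \<partial>count_space N)"

text \<open>Translation by the finitely many \<open>\<nu>\<close> leaves the gauge unchanged, so the
  cell masses alone have to be bounded; they are cell integrals of the weighted power up to the
  factor \<open>cellc E powr p\<close>.\<close>

lemma mlux_cell_major:
 assumes g: "star_gauge P" "star_gauge Q" and p: "0 < p" "p \<le> 1" and e: "E > 0"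
 obtains C N K where "C > 0" "K > 0"
  "\<And>f z. f \<in> flat_dual ==> en ((cmod (V f z) * \<omega> z) powr p) \<le> cell_major p E C N f (cell2 E z)"
  "\<And>f. f \<in> flat_dual ==> slux E P Q (cell_major p E C N f)
   \<le> en K * mlux lborel P Q (\<lambda>z. en ((cmod (V f z) * \<omega> z) powr p))"
proof -
 let ?L = "count_space (lattice E :: (real^'n) set)"
 obtain C N where C: "C > 0" and N: "finite N" "N \<subseteq> lattice2 E"
  and le: "\<And>f z. f \<in> flat_dual ==> en ((cmod (V f z) * \<omega> z) powr p) \<le>
   en C * (\<integral>\<^sup>+ \<nu>. cell_mass p E f (cell2 E z + \<nu>) \<partial>count_space N)"
  by (rule weighted_cell_bound[OF p e]) (rule that)
 obtain C2 where C2: "C2 > 0" "\<And>h :: 'n phase => ennreal. h \<in> borel_measurable borel ==>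
  mlux ?L P Q (\<lambda>k. (LI z. h z * indicator {k} (cell2 E z))) \<le> en C2 * mlux lborel P Q h"
  by (rule mlux_cell_integral_le[OF g e]) (rule that)
 define K where "K = C * (16 * ((1 + real (card N)) * (C2 * cellc E powr p)))"
 have K: "K > 0" unfolding K_def using C C2(1) cellc_pos[of E] by (intro mult_pos_pos) (auto intro: add_pos_nonneg)
 show ?thesis
 proof (rule that[OF C K])
  show "en ((cmod (V f z) * \<omega> z) powr p) \<le> cell_major p E C N f (cell2 E z)" if "f \<in> flat_dual" for f z
   unfolding cell_major_def by (rule le[OF that])
  fix f :: "'n hermite_series" assume f: "f \<in> flat_dual"
  let ?M = "mlux lborel P Q (\<lambda>z. en ((cmod (V f z) * \<omega> z) powr p))"
  have "mlux ?L P Q (cell_major p E C N f) \<le> en C * mlux ?L P Q (\<lambda>k. \<integral>\<^sup>+ \<nu>. cell_mass p E f (k + \<nu>) \<partial>count_space N)"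
   by (rule mlux_mono_cmult[OF g C]) (simp add: cell_major_def)
  also have "... \<le> en C * (16 * (\<integral>\<^sup>+ \<nu>. mlux ?L P Q (\<lambda>k. cell_mass p E f (k + \<nu>)) \<partial>count_space N))"
   by (intro mult_left_mono mlux_minkowski[OF g countable_lattice]) simp_all
  also have "(\<integral>\<^sup>+ \<nu>. mlux ?L P Q (\<lambda>k. cell_mass p E f (k + \<nu>)) \<partial>count_space N) = (\<integral>\<^sup>+ \<nu>. mlux ?L P Q (cell_mass p E f) \<partial>count_space N)"
  proof (rule nn_integral_cong)
   fix \<nu> assume "\<nu> \<in> space (count_space N)"
   then have "\<nu> \<in> lattice E \<times> lattice E" using N by auto
   then show "mlux ?L P Q (\<lambda>k. cell_mass p E f (k + \<nu>)) = mlux ?L P Q (cell_mass p E f)" by (rule mlux_lattice_translate)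
  qed
  also have "... = en (real (card N)) * mlux ?L P Q (cell_mass p E f)"
   using N(1) by (simp add: nn_integral_count_space_finite ennreal_of_nat_eq_real_of_nat mult.commute)
  also have "... \<le> en (1 + real (card N)) * (en C2 * (en (cellc E powr p) * ?M))"
  proof (intro mult_mono)
   have "mlux ?L P Q (cell_mass p E f) \<le> en C2 * mlux lborel P Q (\<lambda>z. en ((cmod (V f z) * \<omega> (cell2 E z)) powr p))"
    unfolding cell_mass_def[abs_def] by (rule C2(2)[OF cell_mass_borel[OF f]])
   also have "... \<le> en C2 * (en (cellc E powr p) * ?M)"
   proof (intro mult_left_mono mlux_mono_cmult[OF g])
    fix x \<xi> :: "real^'n"
    let ?z = "(x, \<xi>)"
    have "cmod (V f ?z) * \<omega> (cell2 E ?z) \<le> cmod (V f ?z) * (cellc E * \<omega> ?z)"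
     by (intro mult_left_mono \<omega>_cell(2)[OF e]) simp
    then have "(cmod (V f ?z) * \<omega> (cell2 E ?z)) powr p \<le> (cellc E * (cmod (V f ?z) * \<omega> ?z)) powr p"
     using p \<omega>_pos[of "cell2 E ?z"] by (intro powr_mono2) (simp_all add: mult_ac less_imp_le)
    also have "... = cellc E powr p * (cmod (V f ?z) * \<omega> ?z) powr p"
     using cellc_pos[of E] \<omega>_pos[of ?z] by (intro powr_mult)
    finally show "en ((cmod (V f ?z) * \<omega> (cell2 E ?z)) powr p) \<le> en (cellc E powr p) * en ((cmod (V f ?z) * \<omega> ?z) powr p)"
     by (simp add: ennreal_mult[symmetric] ennreal_leI)
   qed (use cellc_pos[of E] in simp_all)
   finally show "mlux ?L P Q (cell_mass p E f) \<le> en C2 * (en (cellc E powr p) * ?M)" .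
  qed (simp_all add: ennreal_leI)
  also have "en C * (16 * (en (1 + real (card N)) * (en C2 * (en (cellc E powr p) * ?M)))) = en K * ?M"
  proof -
   have "en K = en C * (en 16 * (en (1 + real (card N)) * (en C2 * en (cellc E powr p))))"
    unfolding K_def using C C2(1) by (simp only: ennreal_mult[symmetric] mult_nonneg_nonneg less_imp_le powr_ge_zero add_nonneg_nonneg of_nat_0_le_iff zero_le_one zero_le_numeral)
   then show ?thesis by (simp add: mult.assoc)
  qed
  finally show "mlux ?L P Q (cell_major p E C N f) \<le> en K * ?M" by (simp add: mult_left_mono)
 qed
qed

end

abbreviation (in weights) Vpow :: "real => 'n hermite_series => 'n::finite phase => ennreal" where
 "Vpow p f \<equiv> \<lambda>z. en ((cmod (V f z) * \<omega> z) powr p)"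

text \<open>The cell majorant has finite gauge and is therefore a bounded sequence. This places the
  modulation spaces inside \<open>M\<^sup>\<infinity>\<close>, where the pairing is an
  integral.\<close>

lemma (in weights) finite_mlux_Minf:
 assumes g: "star_gauge P" "star_gauge Q" and p: "0 < p" "p \<le> 1"
  and f: "f \<in> flat_dual" and fin: "mlux lborel P Q (Vpow p f) < \<infinity>"
 shows "f \<in> Minf"
proof -
 obtain C N K where K: "C > 0" "K > 0"
  "\<And>f z. f \<in> flat_dual ==> Vpow p f z \<le> cell_major p 1 C N f (cell2 1 z)"
  "\<And>f. f \<in> flat_dual ==> mlux (count_space (lattice 1)) P Q (cell_major p 1 C N f) \<le> en K * mlux lborel P Q (Vpow p f)"
  by (rule mlux_cell_major[OF g p zero_less_one]) (rule that)
 obtain T where T: "T > 0" "\<And>A k g. k \<in> A \<times> A ==> g k \<le> en T * mlux (count_space A) P Q (g :: 'n::finite phase => ennreal)"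
  by (rule mlux_point_le[OF g]) (rule that)
 define B where "B = en T * (en K * mlux lborel P Q (Vpow p f))"
 have B: "B < \<infinity>" unfolding B_def using fin by (simp add: ennreal_mult_less_top)
 have "cmod (V f z) * \<omega> z \<le> enn2real B powr (1 / p)" for z
 proof -
  have "Vpow p f z \<le> cell_major p 1 C N f (cell2 1 z)" by (rule K(3)[OF f])
  also have "... \<le> en T * mlux (count_space (lattice 1)) P Q (cell_major p 1 C N f)" by (rule T(2)[OF cell2_in_lattice2])
  also have "... \<le> B" unfolding B_def by (intro mult_left_mono K(4) f) simp
  finally have "(cmod (V f z) * \<omega> z) powr p \<le> enn2real B"
   using B enn2real_mono[of "Vpow p f z" B] by (simp add: less_top[symmetric])
  then have "((cmod (V f z) * \<omega> z) powr p) powr (1 / p) \<le> enn2real B powr (1 / p)" using p by (intro powr_mono2) auto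
  then show ?thesis using p \<omega>_pos[of z] by (simp add: powr_powr)
 qed
 then show ?thesis using f unfolding Minf_def by blast
qed

lemma epow_mult_const_sum:
 assumes p: "0 < p" "p \<le> 1" and K: "K \<ge> 0" and x: "x \<ge> 0" and b: "\<And>l. b l \<ge> 0"
  and le: "en x \<le> en K * (\<integral>\<^sup>+ l. a l * en (b l) \<partial>count_space A)"
 shows "en (x powr p) \<le> en (K powr p) * (\<integral>\<^sup>+ l. epow p (a l) * en (b l powr p) \<partial>count_space A)"
proof -
 have "en (x powr p) = epow p (en x)" by (simp add: epow_ennreal x)
 also have "... \<le> epow p (en K * (\<integral>\<^sup>+ l. a l * en (b l) \<partial>count_space A))" by (rule epow_mono[OF p(1) le])
 also have "... = en (K powr p) * epow p (\<integral>\<^sup>+ l. a l * en (b l) \<partial>count_space A)"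
  by (simp add: epow_mult[OF p(1)] epow_ennreal K)
 also have "... \<le> en (K powr p) * (\<integral>\<^sup>+ l. epow p (a l * en (b l)) \<partial>count_space A)"
  by (intro mult_left_mono epow_nn_integral_count_space p) simp
 also have "(\<integral>\<^sup>+ l. epow p (a l * en (b l)) \<partial>count_space A) = (\<integral>\<^sup>+ l. epow p (a l) * en (b l powr p) \<partial>count_space A)"
  by (simp add: epow_mult[OF p(1)] epow_ennreal b)
 finally show ?thesis .
qed

context window
begin

definition Sp where "Sp = enn2real (lsum E (\<lambda>k. en (b k powr p)))"

lemma Sp: "(lsum E (\<lambda>k. en (b k powr p))) = en Sp" "Sp \<ge> 0" using b_sum unfolding Sp_def by (simp_all add: less_top)

lemma Sp_reflect: "(lsum E (\<lambda>k. en (b (- k) powr p))) = en Sp"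
 using nn_integral_lattice2_reflect[OF lattice2_closed(3), where f = "\<lambda>k. en (b k powr p)"] Sp(1) by simp

text \<open>The bound \<open>stft_le\<close> is applied with the \<open>p\<close>-th root of the
  cell majorant. Taking \<open>p\<close>-th powers inside the sum leaves a convolution of the
  majorant itself with \<open>b powr p\<close>.\<close>

lemma analysis_norm:
 assumes g: "star_gauge P" "star_gauge Q"
 obtains K where "K > 0" "\<And>f. f \<in> Minf ==>
  slux E P Q (\<lambda>l. en ((cmod (stft \<omega> \<phi> f l) * \<omega> l) powr p)) \<le> en K * mlux lborel P Q (Vpow p f)"
proof -
 let ?m = "slux E P Q :: ('n::finite phase => ennreal) => ennreal"
 obtain C N K1 where K1: "C > 0" "K1 > 0"
  "\<And>f z. f \<in> flat_dual ==> Vpow p f z \<le> cell_major p E C N f (cell2 E z)"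
  "\<And>f. f \<in> flat_dual ==> ?m (cell_major p E C N f) \<le> en K1 * mlux lborel P Q (Vpow p f)"
  by (rule mlux_cell_major[OF g p eps]) (rule that)
 define K0 where "K0 = stft_const TYPE('n) * (c * (cube_vol E TYPE('n))\<^sup>2)"
 have K0: "K0 > 0" unfolding K0_def using stft_const_pos[of "TYPE('n)"] c_ge_1 cube_vol(1)[OF eps, where 'n='n] by simp
 define K where "K = K0 powr p * (16 * ((Sp + 1) * K1))"
 have K: "K > 0" unfolding K_def using K0 Sp(2) K1(2) by simp
 have "?m (\<lambda>l. en ((cmod (stft \<omega> \<phi> f l) * \<omega> l) powr p)) \<le> en K * mlux lborel P Q (Vpow p f)" if f: "f \<in> Minf" for f
 proof -
  let ?A = "cell_major p E C N f"
  have fd: "f \<in> flat_dual" by (rule MinfE[OF f])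
  have A: "en (cmod (V f z) * \<omega> z) \<le> epow (1 / p) (?A (cell2 E z))" for z
  proof -
   have "en (cmod (V f z) * \<omega> z) = epow (1 / p) (Vpow p f z)" using p \<omega>_pos[of z] by (simp add: epow_ennreal powr_powr)
   also have "... \<le> epow (1 / p) (?A (cell2 E z))" using p by (intro epow_mono K1(3) fd) simp
   finally show ?thesis .
  qed
  have pt: "en ((cmod (stft \<omega> \<phi> f l) * \<omega> l) powr p) \<le> en (K0 powr p) * (lsum E (\<lambda>m. ?A (l + m) * en (b m powr p)))"
   if l: "l \<in> lattice2 E" for l
  proof -
   have "en ((cmod (stft \<omega> \<phi> f l) * \<omega> l) powr p) \<le> en (K0 powr p) * (lsum E (\<lambda>k. epow p (epow (1 / p) (?A k)) * en (b (k - l) powr p)))"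
    using stft_le[OF f, where A = "\<lambda>k. epow (1 / p) (?A k)", OF A l] K0 \<omega>_pos[of l]
    unfolding K0_def[symmetric] by (intro epow_mult_const_sum p b_nonneg) auto
   then show ?thesis
    unfolding epow_epow(2)[OF p(1)] nn_integral_lattice2_shift_out(2)[OF l, where f = ?A and g = "\<lambda>k. en (b k powr p)"] .
  qed
  have "?m (\<lambda>l. en ((cmod (stft \<omega> \<phi> f l) * \<omega> l) powr p)) \<le> en (K0 powr p) * ?m (\<lambda>l. (lsum E (\<lambda>m. ?A (l + m) * en (b m powr p))))"
   by (rule mlux_mono_cmult[OF g]) (use K0 pt in auto)
  also have "... \<le> en (K0 powr p) * (16 * (en Sp * ?m ?A))"
   using mlux_convolution_le[OF g, of "\<lambda>m. b m powr p" E ?A] unfolding Sp(1) by (intro mult_left_mono) simp_all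
  also have "... \<le> en (K0 powr p) * (16 * (en (Sp + 1) * (en K1 * mlux lborel P Q (Vpow p f))))"
   by (intro mult_left_mono mult_mono K1(4) fd ennreal_leI) simp_all
  also have "... = en K * mlux lborel P Q (Vpow p f)"
  proof -
   have "en K = en (K0 powr p) * (en 16 * (en (Sp + 1) * en K1))"
    unfolding K_def using Sp(2) K1(2) by (simp only: ennreal_mult[symmetric] mult_nonneg_nonneg less_imp_le powr_ge_zero add_nonneg_nonneg zero_le_one zero_le_numeral)
   then show ?thesis by (simp add: mult.assoc)
  qed
  finally show ?thesis .
 qed
 then show ?thesis using K that by blast
qed

text \<open>Formulated for any \<open>G\<close> dominated by the absolute synthesis sum, so that
  full expansions and remainders are covered alike.\<close>

lemma synthesis_norm:
 assumes g: "star_gauge P" "star_gauge Q"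
 obtains K where "K > 0" "\<forall>d G. (\<forall>l. d l \<ge> 0) \<longrightarrow>
  (\<forall>z. en (cmod (G z)) \<le> (lsum E (\<lambda>l. en (d l * cmod (V (atom \<phi> l) z))))) \<longrightarrow>
  mlux lborel P Q (\<lambda>z. en ((cmod (G z :: complex) * \<omega> z) powr p)) \<le> en K * slux E P Q (\<lambda>l. en ((d l * \<omega> l) powr p))"
proof -
 let ?m = "slux E P Q :: ('n::finite phase => ennreal) => ennreal"
 obtain C1 where C1: "C1 > 0" "\<And>s :: 'n phase => ennreal. mlux lborel P Q (\<lambda>z. s (cell2 E z)) \<le> en C1 * ?m s"
  by (rule mlux_step_le[OF g eps]) (rule that)
 define K where "K = c powr p * (C1 * (16 * (Sp + 1)))"
 have K: "K > 0" unfolding K_def using c_ge_1 Sp(2) C1(1) by simp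
 have "mlux lborel P Q (\<lambda>z. en ((cmod (G z) * \<omega> z) powr p)) \<le> en K * ?m (\<lambda>l. en ((d l * \<omega> l) powr p))"
  if d: "\<And>l. d l \<ge> 0" and G: "\<And>z. en (cmod (G z)) \<le> (lsum E (\<lambda>l. en (d l * cmod (V (atom \<phi> l) z))))"
  for d and G :: "'n phase => complex"
 proof -
  let ?a = "\<lambda>l. en ((d l * \<omega> l) powr p)"
  define s where "s k = (lsum E (\<lambda>m. ?a (k + m) * en (b (- m) powr p)))" for k
  have pt: "en ((cmod (G z) * \<omega> z) powr p) \<le> en (c powr p) * s (cell2 E z)" for z
  proof -
   have "en (cmod (G z) * \<omega> z) = en (cmod (G z)) * en (\<omega> z)" using \<omega>_pos[of z] by (simp add: ennreal_mult)
   also have "... \<le> (lsum E (\<lambda>l. en (d l * cmod (V (atom \<phi> l) z)))) * en (\<omega> z)"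
    by (intro mult_right_mono G) simp
   also have "... \<le> en c * (lsum E (\<lambda>l. en (d l * \<omega> l) * en (b (cell2 E z - l))))"
    by (rule synthesis_bound[OF d])
   finally have "en ((cmod (G z) * \<omega> z) powr p) \<le> en (c powr p) * (lsum E (\<lambda>l. epow p (en (d l * \<omega> l)) * en (b (cell2 E z - l) powr p)))"
    using c_ge_1 \<omega>_pos[of z] by (intro epow_mult_const_sum p b_nonneg) auto
   also have "(lsum E (\<lambda>l. epow p (en (d l * \<omega> l)) * en (b (cell2 E z - l) powr p))) = s (cell2 E z)"
    unfolding s_def nn_integral_lattice2_shift_out(1)[OF cell2_in_lattice2, where f = ?a and g = "\<lambda>k. en (b k powr p)", symmetric]
    using d \<omega>_pos by (simp add: epow_ennreal less_imp_le)
   finally show ?thesis .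
  qed
  have "mlux lborel P Q (\<lambda>z. en ((cmod (G z) * \<omega> z) powr p)) \<le> en (c powr p) * mlux lborel P Q (\<lambda>z. s (cell2 E z))"
   by (rule mlux_mono_cmult[OF g]) (use c_ge_1 pt in auto)
  also have "... \<le> en (c powr p) * (en C1 * ?m s)" by (intro mult_left_mono C1(2)) simp
  also have "... \<le> en (c powr p) * (en C1 * (16 * (en (Sp + 1) * ?m ?a)))"
  proof (intro mult_left_mono)
   have "?m s \<le> 16 * (en Sp * ?m ?a)"
    using mlux_convolution_le[OF g, of "\<lambda>m. b (- m) powr p" E ?a] unfolding Sp_reflect s_def[abs_def] by simp
   also have "... \<le> 16 * (en (Sp + 1) * ?m ?a)" by (intro mult_left_mono mult_right_mono ennreal_leI) simp_all
   finally show "?m s \<le> 16 * (en (Sp + 1) * ?m ?a)" .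
  qed simp_all
  also have "... = en K * ?m ?a"
  proof -
   have "en K = en (c powr p) * (en C1 * (en 16 * en (Sp + 1)))"
    unfolding K_def using Sp(2) C1(1) by (simp only: ennreal_mult[symmetric] mult_nonneg_nonneg less_imp_le powr_ge_zero add_nonneg_nonneg zero_le_one zero_le_numeral)
   then show ?thesis by (simp add: mult.assoc)
  qed
  finally show ?thesis .
 qed
 then show ?thesis using K that by blast
qed

end

context gabor
begin

text \<open>The remainder after a finite set is synthesised from the coefficients off that set. The
  empty set yields the norm bound, growing sets yield convergence.\<close>

lemma modulation_le_analysis:
 assumes g: "star_gauge P" "star_gauge Q"
 obtains K where "K > 0" "\<And>f F. f \<in> Minf ==> finite F ==> F \<subseteq> lattice2 E ==>
  mlux lborel P Q (Vpow p (\<lambda>J. f J - (\<Sum>l\<in>F. stft \<omega> \<phi> f l * atom \<psi> l J)))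
   \<le> en K * slux E P Q (\<lambda>l. en ((cmod (stft \<omega> \<phi> f l) * \<omega> l) powr p) * indicator (- F) l)"
proof -
 obtain K where K: "K > 0" "\<forall>d G. (\<forall>l. d l \<ge> 0) \<longrightarrow>
  (\<forall>z. en (cmod (G z)) \<le> (lsum E (\<lambda>l. en (d l * cmod (V (atom \<psi> l) z))))) \<longrightarrow>
  mlux lborel P Q (\<lambda>z. en ((cmod (G z :: complex) * \<omega> z) powr p)) \<le> en K * slux E P Q (\<lambda>l. en ((d l * \<omega> l) powr p))"
  by (rule B.synthesis_norm[OF g]) (rule that)
 have "mlux lborel P Q (Vpow p (\<lambda>J. f J - (\<Sum>l\<in>F. stft \<omega> \<phi> f l * atom \<psi> l J)))
   \<le> en K * slux E P Q (\<lambda>l. en ((cmod (stft \<omega> \<phi> f l) * \<omega> l) powr p) * indicator (- F) l)"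
  if f: "f \<in> Minf" and F: "finite F" "F \<subseteq> lattice2 E" for f F
 proof -
  have fd: "f \<in> flat_dual" by (rule MinfE[OF f])
  let ?h = "\<lambda>J. \<Sum>l\<in>F. stft \<omega> \<phi> f l * atom \<psi> l J"
  have hd: "?h \<in> flat_dual" by (intro flat_dual_sum flat_dual_cmult B.atom_flat_dual)
  let ?d = "\<lambda>l. cmod (stft \<omega> \<phi> f l) * indicator (- F) l"
  have V: "V (\<lambda>J. f J - ?h J) z = V f z - (\<Sum>l\<in>F. stft \<omega> \<phi> f l * V (atom \<psi> l) z)" for z
   unfolding V_diff[OF fd hd] by (subst V_sum) (simp_all add: flat_dual_cmult B.atom_flat_dual V_cmult)
  have pt: "en (cmod (V (\<lambda>J. f J - ?h J) z)) \<le> lsum E (\<lambda>l. en (?d l * cmod (V (atom \<psi> l) z)))" for z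
  proof -
   have "en (cmod (V (\<lambda>J. f J - ?h J) z)) \<le> lsum E (\<lambda>l. en (cmod (stft \<omega> \<phi> f l * V (atom \<psi> l) z)) * indicator (- F) l)"
    unfolding V by (rule norm_has_sum_diff_le[OF expansion[OF f] F])
   also have "... = lsum E (\<lambda>l. en (?d l * cmod (V (atom \<psi> l) z)))"
    by (intro nn_integral_cong) (simp add: norm_mult split: split_indicator)
   finally show ?thesis .
  qed
  have "mlux lborel P Q (Vpow p (\<lambda>J. f J - ?h J)) \<le> en K * slux E P Q (\<lambda>l. en ((?d l * \<omega> l) powr p))"
   by (rule K(2)[rule_format, where d = ?d and G = "V (\<lambda>J. f J - ?h J)", OF _ pt]) simp
  moreover have "en ((?d l * \<omega> l) powr p) = en ((cmod (stft \<omega> \<phi> f l) * \<omega> l) powr p) * indicator (- F) l" for l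
   using A.p by (simp split: split_indicator)
  ultimately show ?thesis by simp
 qed
 then show ?thesis using K(1) that by blast
qed

end

section \<open>Tails of sequences when the Schwartz space is dense\<close>

lemma schwartzD:
 assumes "G \<in> schwartz"
 shows "continuous_on UNIV G" "\<exists>B. \<forall>x. norm x ^ k * cmod (G x) \<le> B"
proof -
 have 0: "iterated_partial [] G = G" by (simp add: iterated_partial_def)
 have a: "G differentiable_on UNIV" "\<And>k::nat. bounded (range (\<lambda>x. norm x ^ k * cmod (G x)))"
  using assms unfolding schwartz_def by (auto dest: spec[of _ "[]"] simp: 0)
 show "continuous_on UNIV G" using a(1) by (rule differentiable_imp_continuous_on)
 obtain B where B: "\<forall>y\<in>range (\<lambda>x. norm x ^ k * cmod (G x)). norm y \<le> B" using a(2)[of k] unfolding bounded_iff by blast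
 have "norm x ^ k * cmod (G x) \<le> B" for x using bspec[OF B rangeI[of _ x]] unfolding real_norm_def by (rule order_trans[OF abs_ge_self])
 then show "\<exists>B. \<forall>x. norm x ^ k * cmod (G x) \<le> B" by blast
qed

lemma nn_integral_inverse_1_plus_square: "(\<integral>\<^sup>+ t. en (inverse (1 + t\<^sup>2)) \<partial>(lborel :: real measure)) < \<infinity>"
proof -
 have "set_integrable lborel (einterval (-\<infinity>) \<infinity>) (\<lambda>t::real. inverse (1 + t\<^sup>2))" by (rule integrable_inverse_1_plus_square)
 then have "integrable lborel (\<lambda>t::real. inverse (1 + t\<^sup>2))" by (simp add: set_integrable_def)
 then show ?thesis unfolding integrable_iff_bounded by simp
qed

lemma nn_integral_product_decay:
 "(\<integral>\<^sup>+ z. en ((\<Prod>i\<in>UNIV. inverse (1 + (fst z $ i)\<^sup>2)) * (\<Prod>i\<in>UNIV. inverse (1 + (snd z $ i)\<^sup>2))) \<partial>(lborel :: 'n::finite phase measure)) < \<infinity>"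
proof -
 let ?q = "\<lambda>x :: real^'n. \<Prod>i\<in>UNIV. inverse (1 + (x $ i)\<^sup>2)"
 have q0: "?q x \<ge> 0" for x by (intro prod_nonneg) simp
 have nz: "1 + (t::real)\<^sup>2 \<noteq> 0" for t by (metis add_pos_nonneg zero_le_power2 zero_less_one less_irrefl)
 have qc: "continuous_on UNIV ?q" by (intro continuous_intros) (use nz in auto)
 have I: "(LI x. en (?q x)) < \<infinity>"
 proof -
  have "(\<lambda>t::real. inverse (1 + t\<^sup>2)) \<in> borel_measurable borel"
   by (intro borel_continuous continuous_intros) (use nz in auto)
  then have "(LI x. en (?q x)) = (\<Prod>i\<in>(UNIV::'n set). (LI t. en (inverse (1 + t\<^sup>2))))"
   using nn_integral_inverse_1_plus_square by (intro nn_integral_lborel_vec) (auto simp: add_nonneg_nonneg)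
  also have "... < \<infinity>" using nn_integral_inverse_1_plus_square by (simp add: power_less_top_ennreal)
  finally show ?thesis .
 qed
 have m: "(\<lambda>x. en (?q x)) \<in> borel_measurable lborel"
  unfolding measurable_lborel2 by (rule measurable_compose[OF borel_continuous[OF qc] measurable_ennreal])
 have "continuous_on UNIV (\<lambda>z :: 'n phase. ?q (fst z) * ?q (snd z))"
  by (intro continuous_on_mult continuous_on_compose2[OF qc] continuous_intros) auto
 from nn_integral_pair_lborel[OF measurable_compose[OF borel_continuous[OF this] measurable_ennreal]]
 have "(LI z. en (?q (fst z) * ?q (snd z))) = (LI x. (LI y. en (?q x * ?q y)))" unfolding fst_conv snd_conv .
 also have "... = (LI x. en (?q x) * (LI y. en (?q y)))" unfolding ennreal_mult[OF q0 q0] nn_integral_cmult[OF m] ..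
 also have "... = (LI x. en (?q x)) * (LI y. en (?q y))" by (rule nn_integral_multc[OF m])
 also have "... < \<infinity>" using I by (simp add: ennreal_mult_less_top)
 finally show ?thesis .
qed

text \<open>Small \<open>p\<close> is compensated by a large decay order \<open>m\<close> with
  \<open>real m * p \<ge> real (2 * CARD('n))\<close>; the power of \<open>cmod (G z)\<close> then
  lies below a multiple of the product of \<open>inverse (1 + t\<^sup>2)\<close> over all phase
  space coordinates.\<close>

lemma schwartz_powr_integral:
 fixes G :: "'n::finite phase => complex"
 assumes G: "G \<in> schwartz" and p: "p > 0"
 shows "(LI z. en (cmod (G z) powr p)) < \<infinity>"
proof -
 let ?n = "CARD('n)"
 obtain m :: nat where m: "real (2 * ?n) / p \<le> real m" using real_arch_simple by blast
 obtain B0 B1 where B: "\<And>x. norm x ^ 0 * cmod (G x) \<le> B0" "\<And>x. norm x ^ (2 * m) * cmod (G x) \<le> B1"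
  using schwartzD(2)[OF G, of 0] schwartzD(2)[OF G, of "2 * m"] by blast
 define B where "B = 2 ^ m * (B0 + B1)"
 have "B0 \<ge> 0" "B1 \<ge> 0" using order_trans[OF _ B(1)[of 0]] order_trans[OF _ B(2)[of 0]] by auto
 then have B0: "B \<ge> 0" by (simp add: B_def)
 let ?q = "\<lambda>x :: real^'n. \<Prod>i\<in>UNIV. inverse (1 + (x $ i)\<^sup>2)"
 have pos: "1 + (t::real)\<^sup>2 > 0" for t by (simp add: add_pos_nonneg)
 have q: "inverse ((1 + (norm z)\<^sup>2) ^ ?n) \<le> ?q x" if "norm x \<le> norm z" for x :: "real^'n" and z :: "'n phase"
 proof -
  have "(x $ i)\<^sup>2 \<le> (norm z)\<^sup>2" for i
   using component_le_norm_cart[of x i] that by (metis abs_le_square_iff abs_norm_cancel order_trans)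
  then have "(\<Prod>i\<in>(UNIV::'n set). inverse (1 + (norm z)\<^sup>2)) \<le> ?q x"
   using pos by (intro prod_mono conjI le_imp_inverse_le) (auto simp: less_imp_le)
  then show ?thesis by (simp add: power_inverse)
 qed
 have le: "cmod (G z) powr p \<le> B powr p * (?q (fst z) * ?q (snd z))" for z
 proof -
  define s where "s = norm z"
  have s: "s \<ge> 0" by (simp add: s_def)
  have "(1 + s\<^sup>2) ^ m \<le> 2 ^ m * (1 + s ^ (2 * m))"
  proof (cases "s \<le> 1")
   case True
   then have "(1 + s\<^sup>2) ^ m \<le> 2 ^ m" using s by (intro power_mono) (auto simp: power_le_one)
   also have "... \<le> 2 ^ m * (1 + s ^ (2 * m))" using s by simp
   finally show ?thesis .
  next
   case False
   then have "1 \<le> s\<^sup>2" by (simp add: one_le_power)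
   then have "(1 + s\<^sup>2) ^ m \<le> (2 * s\<^sup>2) ^ m" by (intro power_mono) auto
   also have "... \<le> 2 ^ m * (1 + s ^ (2 * m))" by (simp add: power_mult_distrib power_mult)
   finally show ?thesis .
  qed
  then have "(1 + s\<^sup>2) ^ m * cmod (G z) \<le> 2 ^ m * (1 + s ^ (2 * m)) * cmod (G z)" by (rule mult_right_mono) simp
  also have "... = 2 ^ m * (cmod (G z) + s ^ (2 * m) * cmod (G z))" by (simp add: algebra_simps)
  also have "... \<le> B" unfolding B_def using B(1)[of z] B(2)[of z] by (intro mult_left_mono add_mono) (auto simp: s_def)
  finally have "cmod (G z) \<le> B * inverse ((1 + s\<^sup>2) ^ m)" using pos[of s] by (simp add: field_simps)
  then have "cmod (G z) powr p \<le> (B * inverse ((1 + s\<^sup>2) ^ m)) powr p" using p by (intro powr_mono2) auto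
  also have "... = B powr p * inverse ((1 + s\<^sup>2) powr (real m * p))"
   using B0 pos[of s] by (simp add: powr_mult powr_realpow[symmetric] powr_powr powr_minus[symmetric])
  also have "... \<le> B powr p * inverse ((1 + s\<^sup>2) ^ (2 * ?n))"
  proof (intro mult_left_mono le_imp_inverse_le)
   have "real (2 * ?n) \<le> real m * p" using m p by (simp add: field_simps)
   then have "(1 + s\<^sup>2) powr real (2 * ?n) \<le> (1 + s\<^sup>2) powr (real m * p)" by (intro powr_mono) auto
   then show "(1 + s\<^sup>2) ^ (2 * ?n) \<le> (1 + s\<^sup>2) powr (real m * p)" using pos[of s] by (simp only: powr_realpow)
  qed (use pos[of s] in auto)
  also have "inverse ((1 + s\<^sup>2) ^ (2 * ?n)) = inverse ((1 + s\<^sup>2) ^ ?n) * inverse ((1 + s\<^sup>2) ^ ?n)"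
   by (simp add: mult_2 power_add)
  also have "B powr p * ... \<le> B powr p * (?q (fst z) * ?q (snd z))"
   unfolding s_def using q[of "fst z" z] q[of "snd z" z] norm_fst_le[of "fst z" "snd z"] norm_snd_le[of "snd z" "fst z"]
   by (intro mult_left_mono mult_mono) (auto intro: prod_nonneg)
  finally show ?thesis .
 qed
 have "(LI z. en (cmod (G z) powr p)) \<le> (LI z. en (B powr p) * en (?q (fst z) * ?q (snd z)))"
  using le by (intro nn_integral_mono) (simp add: ennreal_mult[symmetric] prod_nonneg ennreal_leI)
 also have "... = en (B powr p) * (LI z. en (?q (fst z) * ?q (snd z)))"
 proof (rule nn_integral_cmult)
  have nz: "1 + (t::real)\<^sup>2 \<noteq> 0" for t using pos[of t] by simp
  have "continuous_on UNIV (\<lambda>z :: 'n phase. ?q (fst z) * ?q (snd z))" by (intro continuous_intros) (use nz in auto)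
  then show "(\<lambda>z. en (?q (fst z) * ?q (snd z))) \<in> borel_measurable lborel"
   unfolding measurable_lborel2 by (intro measurable_compose[OF borel_continuous measurable_ennreal])
 qed
 also have "... < \<infinity>" using nn_integral_product_decay[where 'n='n] by (simp add: ennreal_mult_less_top)
 finally show ?thesis .
qed

lemma epow_add_le:
 assumes "0 < p" "p \<le> 1" shows "epow p (x + y) \<le> epow p x + epow p y"
 using epow_nn_integral_count_space[OF assms, where x = "\<lambda>i. if i then x else y" and A = "UNIV :: bool set"]
 by (simp add: nn_integral_count_space_finite UNIV_bool add.commute)

text \<open>The step function is its difference from \<open>G\<close> plus \<open>G\<close>. The
  \<open>p\<close>-th power is subadditive, and integrating the constant value over its cell gives
  the cell volume.\<close>

lemma cell_average_le:
 fixes a :: "'n::finite phase => real" and G :: "'n phase => complex"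
 assumes p: "0 < p" "p \<le> 1" and e: "E > 0" and a: "\<And>k. a k \<ge> 0" and G: "G \<in> borel_measurable borel" and k: "k \<in> lattice2 E"
 shows "en ((cube_vol E TYPE('n))\<^sup>2) * en (a k powr p)
  \<le> (LI z. en (cmod (of_real (a (cell2 E z)) - G z) powr p) * indicator {k} (cell2 E z))
   + (LI z. en (cmod (G z) powr p) * indicator {k} (cell2 E z))"
proof -
 let ?F = "\<lambda>z. complex_of_real (a (cell2 E z))"
 have pm: "(\<lambda>z::complex. en (cmod z powr p)) \<in> borel_measurable borel" by measurable
 have Fm: "?F \<in> borel_measurable borel" by (rule borel_measurable_step2)
 have m1: "(\<lambda>z. en (cmod (?F z - G z) powr p) * indicator {k} (cell2 E z)) \<in> borel_measurable lborel"
  unfolding measurable_lborel2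
  by (intro borel_measurable_times_ennreal borel_measurable_step2 measurable_compose[OF borel_measurable_diff[OF Fm G] pm])
 have m2: "(\<lambda>z. en (cmod (G z) powr p) * indicator {k} (cell2 E z)) \<in> borel_measurable lborel" unfolding measurable_lborel2
  by (intro borel_measurable_times_ennreal borel_measurable_step2 measurable_compose[OF G pm])
 have "en ((cube_vol E TYPE('n))\<^sup>2) * en (a k powr p)
  = en ((cube_vol E TYPE('n))\<^sup>2) * (lsum E (\<lambda>l. (if l = k then en (a l powr p) else 0)))"
  using nn_integral_count_space_delta[OF k, of "\<lambda>l. en (a l powr p)"] by simp
 also have "... = (LI z. (if cell2 E z = k then en (a (cell2 E z) powr p) else 0))" by (rule nn_integral_step2[OF e, symmetric])
 also have "... \<le> (LI z. en (cmod (?F z - G z) powr p) * indicator {k} (cell2 E z) + en (cmod (G z) powr p) * indicator {k} (cell2 E z))"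
 proof (rule nn_integral_mono)
  fix z
  have "cmod (?F z) \<le> cmod (?F z - G z) + cmod (G z)" using norm_triangle_ineq[of "?F z - G z" "G z"] by simp
  then have "en (a (cell2 E z)) \<le> en (cmod (?F z - G z)) + en (cmod (G z))"
   using a[of "cell2 E z"] by (simp add: ennreal_plus[symmetric] ennreal_leI del: ennreal_plus)
  from order_trans[OF epow_mono[OF p(1) this] epow_add_le[OF p]]
  have "en (a (cell2 E z) powr p) \<le> en (cmod (?F z - G z) powr p) + en (cmod (G z) powr p)"
   using a by (simp add: epow_ennreal)
  then show "(if cell2 E z = k then en (a (cell2 E z) powr p) else 0)
   \<le> en (cmod (?F z - G z) powr p) * indicator {k} (cell2 E z) + en (cmod (G z) powr p) * indicator {k} (cell2 E z)"
   by (auto simp: indicator_def)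
 qed
 also have "... = (LI z. en (cmod (?F z - G z) powr p) * indicator {k} (cell2 E z))
   + (LI z. en (cmod (G z) powr p) * indicator {k} (cell2 E z))" by (rule nn_integral_add[OF m1 m2])
 finally show ?thesis .
qed

text \<open>Every sequence is its own convolution with the unit sequence at 0, so the gauge is
  controlled by the sum times the gauge of that unit sequence.\<close>

lemma mlux_le_sum:
 fixes y :: "'n::finite phase => real"
 assumes g: "star_gauge P" "star_gauge Q" and y: "\<And>k. y k \<ge> 0"
 shows "slux E P Q (\<lambda>k. en (y k))
  \<le> 16 * ((lsum E (\<lambda>k. en (y k))) * slux E P Q (indicator {0 :: 'n phase}))"
proof -
 let ?m = "slux E P Q :: ('n phase => ennreal) => ennreal"
 have "(lsum E (\<lambda>m. indicator {0} (l + m) * en (y (- m)))) = en (y l)"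
  if l: "l \<in> lattice2 E" for l :: "'n phase"
 proof -
  have "- l \<in> lattice2 E" using lattice2_closed(2)[OF lattice2_closed(3) l] by simp
  from nn_integral_count_space_delta[OF this, of "\<lambda>m. en (y (- m))"]
  have "(lsum E (\<lambda>m. (if m = - l then en (y (- m)) else 0))) = en (y l)" by simp
  moreover have "l + m = 0 \<longleftrightarrow> m = - l" for m by (metis add.commute add_eq_0_iff)
  ultimately show ?thesis by (simp add: indicator_def of_bool_def if_distrib[where f = "\<lambda>t. t * _"] cong: if_cong)
 qed
 then have "?m (\<lambda>k. en (y k))
  \<le> ?m (\<lambda>l. (lsum E (\<lambda>m. indicator {0} (l + m) * en (y (- m)))))" by (intro mlux_mono[OF g]) simp
 also have "... \<le> 16 * ((lsum E (\<lambda>m. en (y (- m)))) * ?m (indicator {0}))"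
  using mlux_convolution_le[OF g, of "\<lambda>m. y (- m)" E "indicator {0}"] y by simp
 also have "(lsum E (\<lambda>m. en (y (- m)))) = (lsum E (\<lambda>k. en (y k)))"
  using nn_integral_lattice2_reflect[OF lattice2_closed(3), where f = "\<lambda>k. en (y k)"] by simp
 finally show ?thesis .
qed

lemma tendsto_0_ennrealI:
 fixes X :: "'a => ennreal"
 assumes "\<And>e::real. e > 0 ==> \<forall>\<^sub>F x in F. X x \<le> en e"
 shows "(X \<longlongrightarrow> 0) F"
proof (rule order_tendstoI)
 fix y :: ennreal assume "0 < y"
 then obtain z where z: "0 < z" "z < y" using dense by blast
 then have zt: "z < top" using order_less_le_trans[OF z(2) top_greatest] by simp
 define e where "e = enn2real z"
 have e: "e > 0" "en e = z" using z(1) zt by (auto simp: e_def enn2real_positive_iff)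
 show "\<forall>\<^sub>F x in F. X x < y" using assms[OF e(1)] by eventually_elim (use e z in \<open>auto intro: le_less_trans\<close>)
qed simp

text \<open>The sequence is read as a step function in the Orlicz space and approximated by a
  Schwartz function \<open>G\<close>. On the lattice the contribution \<open>X\<close> of the
  difference is small in gauge, while the cell masses \<open>Y\<close> of \<open>G\<close> are
  summable, so their tails vanish in the sum and by \<open>mlux_le_sum\<close> in the gauge.\<close>

lemma tail_tendsto:
 fixes a :: "'n::finite phase => real"
 assumes g: "star_gauge (star \<Theta>\<^sub>1)" "star_gauge (star \<Theta>\<^sub>2)" and p: "0 < p" "p \<le> 1" and e: "E > 0"
  and \<Phi>: "\<And>t. t \<ge> 0 ==> \<Phi>\<^sub>1 t = \<Theta>\<^sub>1 (t powr p)" "\<And>t. t \<ge> 0 ==> \<Phi>\<^sub>2 t = \<Theta>\<^sub>2 (t powr p)"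
  and dense: "dense_in_mixed_orlicz (schwartz :: ('n phase => complex) set) \<Phi>\<^sub>1 \<Phi>\<^sub>2"
  and a: "\<And>k. a k \<ge> 0"
  and fin: "slux E (star \<Theta>\<^sub>1) (star \<Theta>\<^sub>2) (\<lambda>k. en (a k powr p)) < \<infinity>"
 shows "((\<lambda>S. slux E (star \<Theta>\<^sub>1) (star \<Theta>\<^sub>2) (\<lambda>k. en (a k powr p) * indicator (- S) k)) \<longlongrightarrow> 0) (finite_subsets_at_top (lattice2 E))"
proof (cases "\<forall>k\<in>lattice2 E. a k = 0")
 case True
 have "slux E (star \<Theta>\<^sub>1) (star \<Theta>\<^sub>2) (\<lambda>k. en (a k powr p) * indicator (- S) k)
   \<le> slux E (star \<Theta>\<^sub>1) (star \<Theta>\<^sub>2) (\<lambda>_ :: 'n phase. 0)" for S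
  by (rule mlux_mono[OF g]) (use True in simp)
 then show ?thesis unfolding mlux_zero[OF g] by simp
next
 case False
 then obtain k0 where k0: "k0 \<in> lattice2 E" "a k0 > 0" using a by (metis order_le_less)
 let ?m = "slux E (star \<Theta>\<^sub>1) (star \<Theta>\<^sub>2) :: ('n phase => ennreal) => ennreal"
 let ?n = "mlux lborel (star \<Theta>\<^sub>1) (star \<Theta>\<^sub>2) :: ('n phase => ennreal) => ennreal"
 let ?d = "\<lambda>G z. en (cmod (complex_of_real (a (cell2 E z)) - G z) powr p)"
 \<comment> \<open>A unit sequence has finite gauge because some \<open>a k0\<close> is positive and
   the gauge of \<open>a\<close> is finite; the zero sequence is treated separately for this
   reason.\<close>
 define D where "D = ?m (indicator {0})"
 have D: "D < \<infinity>"
 proof -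
  have "D = ?m (\<lambda>k. indicator {k0} (k + k0))" unfolding D_def by (rule arg_cong[where f = ?m]) (auto simp: fun_eq_iff indicator_def)
  also have "... = ?m (indicator {k0})" by (rule mlux_lattice_translate[OF k0(1)])
  also have "... \<le> en (inverse (a k0 powr p)) * ?m (\<lambda>k. en (a k powr p))"
   by (rule mlux_mono_cmult[OF g]) (use k0 in \<open>auto simp: indicator_def ennreal_mult[symmetric]\<close>)
  also have "... < \<infinity>" using fin by (simp add: ennreal_mult_less_top)
  finally show ?thesis .
 qed
 define q where "q = (cube_vol E TYPE('n))\<^sup>2"
 have q: "q > 0" unfolding q_def using cube_vol(1)[OF e, where 'n='n] by simp
 obtain C where C: "C > 0" "\<And>h :: 'n phase => ennreal. h \<in> borel_measurable borel ==>
  ?m (\<lambda>k. (LI z. h z * indicator {k} (cell2 E z))) \<le> en C * ?n h"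
  by (rule mlux_cell_integral_le[OF g e]) (rule that)
 obtain C1 where C1: "C1 > 0" "\<And>s :: 'n phase => ennreal. ?n (\<lambda>z. s (cell2 E z)) \<le> en C1 * ?m s"
  by (rule mlux_step_le[OF g e]) (rule that)
 let ?F = "\<lambda>z. complex_of_real (a (cell2 E z))"
 have norm_eq: "epow p (mixed_orlicz_norm lebesgue \<Phi>\<^sub>1 \<Phi>\<^sub>2 (\<lambda>_. 1) H) = ?n (\<lambda>z. en (cmod (H z) powr p))" for H :: "'n phase => complex"
  using epow_mixed_orlicz_norm[where r = p and \<Phi>\<^sub>1 = \<Phi>\<^sub>1 and \<Theta>\<^sub>1 = \<Theta>\<^sub>1 and \<Phi>\<^sub>2 = \<Phi>\<^sub>2 and \<Theta>\<^sub>2 = \<Theta>\<^sub>2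
   and M = lebesgue and \<omega> = "\<lambda>_. 1" and F = H, OF p(1) \<Phi>] by (simp add: mlux_lebesgue)
 have Fm: "?F \<in> borel_measurable borel" by (rule borel_measurable_step2)
 have Fs: "?F \<in> mixed_orlicz_space \<Phi>\<^sub>1 \<Phi>\<^sub>2"
 proof -
  have "epow p (mixed_orlicz_norm lebesgue \<Phi>\<^sub>1 \<Phi>\<^sub>2 (\<lambda>_. 1) ?F) \<le> en C1 * ?m (\<lambda>k. en (a k powr p))"
   unfolding norm_eq using C1(2)[of "\<lambda>k. en (a k powr p)"] a by simp
  also have "... < \<infinity>" using fin by (simp add: ennreal_mult_less_top)
  finally have "mixed_orlicz_norm lebesgue \<Phi>\<^sub>1 \<Phi>\<^sub>2 (\<lambda>_. 1) ?F < \<infinity>" unfolding epow_less_top_iff .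
  moreover have "?F \<in> borel_measurable lebesgue" by (rule measurable_completion) (simp only: measurable_lborel2 Fm)
  ultimately show ?thesis unfolding mixed_orlicz_space_def by simp
 qed
 have approx: "\<exists>G\<in>schwartz. ?n (?d G) \<le> en t" if t: "t > 0" for t
 proof -
  have "en (t powr (1 / p)) > 0" using t by simp
  from mp[OF spec[OF bspec[OF conjunct2[OF dense[unfolded dense_in_mixed_orlicz_def]] Fs]] this]
  obtain G :: "'n phase => complex" where G: "G \<in> schwartz" "mixed_orlicz_norm lebesgue \<Phi>\<^sub>1 \<Phi>\<^sub>2 (\<lambda>_. 1) (\<lambda>z. ?F z - G z) < en (t powr (1 / p))"
   by (rule bexE)
  from epow_mono[OF p(1) less_imp_le[OF G(2)]] have "?n (?d G) \<le> en t"
   unfolding norm_eq using p t by (simp add: epow_ennreal powr_powr)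
  then show ?thesis using G(1) by (rule bexI)
 qed
 show ?thesis
 proof (rule tendsto_0_ennrealI)
  fix y :: real assume y: "y > 0"
  \<comment> \<open>Makes the first error \<open>16 / q * (C * t)\<close> equal to
    \<open>y / 2\<close>. The 256 below is the product of the factors 16 from
    \<open>mlux_add_le\<close> and \<open>mlux_le_sum\<close>.\<close>
  define t where "t = y * q / (32 * C)"
  have t: "t > 0" unfolding t_def using y q C(1) by simp
  obtain G :: "'n phase => complex" where G: "G \<in> schwartz"
   "?n (?d G) \<le> en t"
   using approx[OF t] by (rule bexE)
  have Gm: "G \<in> borel_measurable borel" by (rule borel_continuous[OF schwartzD(1)[OF G(1)]])
  have pm: "(\<lambda>z::complex. en (cmod z powr p)) \<in> borel_measurable borel" by measurable
  define X where "X k = (LI z. ?d G z * indicator {k} (cell2 E z))" for k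
  define Y where "Y k = (LI z. en (cmod (G z) powr p) * indicator {k} (cell2 E z))" for k
  have X: "?m X \<le> en (C * t)"
  proof -
   have "?m X \<le> en C * ?n (?d G)"
    unfolding X_def[abs_def] by (rule C(2)) (rule measurable_compose[OF borel_measurable_diff[OF Fm Gm] pm])
   also have "... \<le> en C * en t" by (intro mult_left_mono G(2)) simp
   finally show ?thesis using C(1) t by (simp add: ennreal_mult)
  qed
  have Ysum: "lsum E Y < \<infinity>" unfolding Y_def nn_integral_cells2[OF measurable_compose[OF Gm pm], of E, symmetric]
   by (rule schwartz_powr_integral[OF G(1) p(1)])
  have Yk: "en (enn2real (Y k)) = Y k" if "k \<in> lattice2 E" for k
   using le_less_trans[OF nn_integral_ge_point[OF that, of Y] Ysum] by (simp add: less_top)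
  let ?T = "\<lambda>S. (lsum E (\<lambda>k. Y k * indicator (- S) k))"
  have "((\<lambda>S. en (256 / q) * (D * ?T S)) \<longlongrightarrow> en (256 / q) * (D * 0)) (finite_subsets_at_top (lattice2 E))"
   using D by (intro ennreal_tendsto_cmult nn_integral_count_space_tail Ysum) auto
  then have "((\<lambda>S. en (256 / q) * (D * ?T S)) \<longlongrightarrow> 0) (finite_subsets_at_top (lattice2 E))" by simp
  moreover have "(0::ennreal) < en (y / 2)" using y by simp
  ultimately have "\<forall>\<^sub>F S in finite_subsets_at_top (lattice2 E). en (256 / q) * (D * ?T S) < en (y / 2)"
   by (rule order_tendstoD(2))
  then show "\<forall>\<^sub>F S in finite_subsets_at_top (lattice2 E). ?m (\<lambda>k. en (a k powr p) * indicator (- S) k) \<le> en y"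
  proof eventually_elim
   case (elim S)
   let ?Y = "\<lambda>k. Y k * indicator (- S) k"
   have "?m (\<lambda>k. en (a k powr p) * indicator (- S) k) \<le> en (1 / q) * ?m (\<lambda>k. X k + ?Y k)"
   proof (rule mlux_mono_cmult[OF g])
    fix x \<xi> :: "real^'n" assume "x \<in> space (count_space (lattice E))" "\<xi> \<in> space (count_space (lattice E))"
    then have k: "(x, \<xi>) \<in> lattice2 E" by simp
    have "en q * en (a (x, \<xi>) powr p) \<le> X (x, \<xi>) + Y (x, \<xi>)"
     unfolding q_def X_def Y_def by (rule cell_average_le[OF p e a Gm k])
    then have "en (1 / q) * (en q * en (a (x, \<xi>) powr p)) \<le> en (1 / q) * (X (x, \<xi>) + Y (x, \<xi>))"
     by (rule mult_left_mono) simp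
    moreover have "en (1 / q) * (en q * en (a (x, \<xi>) powr p)) = en (a (x, \<xi>) powr p)"
     unfolding mult.assoc[symmetric] using q by (simp add: ennreal_mult[symmetric])
    ultimately show "en (a (x, \<xi>) powr p) * indicator (- S) (x, \<xi>) \<le> en (1 / q) * (X (x, \<xi>) + Y (x, \<xi>) * indicator (- S) (x, \<xi>))"
     by (simp split: split_indicator)
   qed (use q in simp)
   also have "... \<le> en (1 / q) * (16 * (?m X + ?m ?Y))" by (intro mult_left_mono mlux_add_le[OF g countable_lattice]) simp
   also have "... \<le> en (1 / q) * (16 * (en (C * t) + 16 * (?T S * D)))"
   proof (intro mult_left_mono add_mono X)
    let ?y = "\<lambda>k. enn2real (Y k) * indicator (- S) k"
    have yk: "en (?y k) = ?Y k" if "k \<in> lattice2 E" for k using Yk[OF that] by (simp split: split_indicator)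
    have "?m ?Y \<le> ?m (\<lambda>k. en (?y k))" by (rule mlux_mono[OF g]) (use yk in simp)
    also have "... \<le> 16 * ((lsum E (\<lambda>k. en (?y k))) * D)" unfolding D_def by (rule mlux_le_sum[OF g]) simp
    also have "(lsum E (\<lambda>k. en (?y k))) = ?T S" by (intro nn_integral_cong) (simp only: space_count_space yk)
    finally show "?m ?Y \<le> 16 * (?T S * D)" .
   qed simp_all
   also have "... = en (16 / q * (C * t)) + en (256 / q) * (D * ?T S)"
   proof -
    have 1: "en (1 / q) * en 16 = en (16 / q)" "en (1 / q) * (en 16 * en 16) = en (256 / q)"
    proof -
     have "en 16 * en 16 = en 256" by (subst ennreal_mult[symmetric]) simp_all
     moreover have "en (1 / q) * en x = en (x / q)" if "x \<ge> 0" for x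
      using q that by (subst ennreal_mult[symmetric]) simp_all
     ultimately show "en (1 / q) * en 16 = en (16 / q)" "en (1 / q) * (en 16 * en 16) = en (256 / q)"
      by (simp_all del: ennreal_numeral)
    qed
    have "en (1 / q) * (16 * (en (C * t) + 16 * (?T S * D))) = en (1 / q) * en 16 * en (C * t) + en (1 / q) * (en 16 * en 16) * (D * ?T S)"
     by (simp add: distrib_left mult.assoc mult.commute[of D])
    moreover have 2: "en (16 / q * (C * t)) = en (16 / q) * en (C * t)" using q C(1) t by (intro ennreal_mult) auto
    ultimately show ?thesis unfolding 1 2 by simp
   qed
   also have "16 / q * (C * t) = y / 2" unfolding t_def using q C(1) by (simp add: field_simps)
   also have "en (y / 2) + en (256 / q) * (D * ?T S) \<le> en (y / 2) + en (y / 2)"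
    using elim by (intro add_left_mono) (rule less_imp_le)
   also have "... = en y" using y by (simp add: ennreal_plus[symmetric] del: ennreal_plus)
   finally show ?case .
  qed
 qed
qed

section \<open>Return from gauges to quasi-norms\<close>

lemma epow_tendsto_0_iff:
 assumes p: "p > 0" and "((\<lambda>x. epow p (X x)) \<longlongrightarrow> 0) F"
 shows "(X \<longlongrightarrow> 0) F"
proof (rule tendsto_0_ennrealI)
 fix e :: real assume e: "e > 0"
 have "(0::ennreal) < en (e powr p)" using e by simp
 from order_tendstoD(2)[OF assms(2) this]
 show "\<forall>\<^sub>F x in F. X x \<le> en e"
 proof eventually_elim
  case (elim x)
  then have "epow p (X x) \<le> epow p (en e)" using e by (simp add: epow_ennreal)
  then show ?case by (simp add: epow_le_iff[OF p])
 qed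
qed

lemma lesssim_onI:
 assumes p: "p > 0" and K: "K > 0" and le: "\<And>f. f \<in> A ==> epow p (N f) \<le> en K * epow p (N' f)"
 shows "lesssim_on A N N'" unfolding lesssim_on_def
proof (intro exI conjI ballI)
 show "K powr (1 / p) > 0" using K by simp
 fix f assume "f \<in> A"
 from le[OF this] have "epow p (N f) \<le> epow p (en (K powr (1 / p)) * N' f)"
  using p K by (simp add: epow_mult epow_ennreal powr_powr)
 then show "N f \<le> en (K powr (1 / p)) * N' f" unfolding epow_le_iff[OF p] .
qed

lemma lesssim_on_trans:
 assumes "lesssim_on A N N'" "lesssim_on A N' N''"
 shows "lesssim_on A N N''"
proof -
 obtain c d where c: "c > 0" "\<And>f. f \<in> A ==> N f \<le> en c * N' f" and d: "d > 0" "\<And>f. f \<in> A ==> N' f \<le> en d * N'' f"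
  using assms unfolding lesssim_on_def by blast
 have "N f \<le> en (c * d) * N'' f" if "f \<in> A" for f
 proof -
  have "N f \<le> en c * N' f" by (rule c(2)[OF that])
  also have "... \<le> en c * (en d * N'' f)" by (intro mult_left_mono d(2) that) simp
  finally show ?thesis using c(1) d(1) by (simp add: ennreal_mult mult.assoc)
 qed
 then show ?thesis unfolding lesssim_on_def using c(1) d(1) by (intro exI[of _ "c * d"]) simp
qed

text \<open>The order of both quasi-Young functions and the exponent of the windows are the same
  \<open>p\<close>, so a single power turns quasi-norms into gauges and windows into summable
  sequences.\<close>

locale orlicz_gabor = gabor \<omega> v c r E p \<phi> \<psi> b d
 for \<omega> v :: "'n::finite phase => real" and c r E p :: real and \<phi> \<psi> :: "real^'n => complex" and b d +
 fixes \<Phi>\<^sub>1 \<Phi>\<^sub>2 \<Theta>\<^sub>1 \<Theta>\<^sub>2 :: "real => ennreal"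
 assumes young: "young \<Theta>\<^sub>1" "young \<Theta>\<^sub>2"
  and \<Phi>: "\<And>t. t \<ge> 0 ==> \<Phi>\<^sub>1 t = \<Theta>\<^sub>1 (t powr p)" "\<And>t. t \<ge> 0 ==> \<Phi>\<^sub>2 t = \<Theta>\<^sub>2 (t powr p)"
begin

lemmas gauges = star_gauge_star[OF young(1)] star_gauge_star[OF young(2)]

lemma epow_mixed:
 "epow p (mixed_orlicz_norm M \<Phi>\<^sub>1 \<Phi>\<^sub>2 \<omega> F) = mlux M (star \<Theta>\<^sub>1) (star \<Theta>\<^sub>2) (\<lambda>z. en ((cmod (F z) * \<omega> z) powr p))"
 by (rule epow_mixed_orlicz_norm[where r = p and \<Phi>\<^sub>1 = \<Phi>\<^sub>1 and \<Theta>\<^sub>1 = \<Theta>\<^sub>1 and \<Phi>\<^sub>2 = \<Phi>\<^sub>2 and \<Theta>\<^sub>2 = \<Theta>\<^sub>2, OF A.p(1) \<Phi>])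
  (use \<omega>_pos in \<open>simp_all add: less_imp_le\<close>)

lemma epow_modulation_norm:
 "epow p (modulation_norm \<Phi>\<^sub>1 \<Phi>\<^sub>2 \<omega> f) = mlux lborel (star \<Theta>\<^sub>1) (star \<Theta>\<^sub>2) (Vpow p f)"
 unfolding modulation_norm_def epow_mixed mlux_lebesgue ..

lemma modulation_space_finite:
 "f \<in> modulation_space \<Phi>\<^sub>1 \<Phi>\<^sub>2 \<omega> ==> mlux lborel (star \<Theta>\<^sub>1) (star \<Theta>\<^sub>2) (Vpow p f) < \<infinity>"
 unfolding epow_modulation_norm[symmetric] epow_less_top_iff by (simp add: modulation_space_def)

lemma modulation_space_Minf: "f \<in> modulation_space \<Phi>\<^sub>1 \<Phi>\<^sub>2 \<omega> ==> f \<in> Minf"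
 using finite_mlux_Minf[OF gauges A.p _ modulation_space_finite] by (simp add: modulation_space_def)

lemma analysis_lesssim:
 "lesssim_on (modulation_space \<Phi>\<^sub>1 \<Phi>\<^sub>2 \<omega>)
  (\<lambda>f. mixed_orlicz_norm (count_space (lattice E)) \<Phi>\<^sub>1 \<Phi>\<^sub>2 \<omega> (stft \<omega> \<phi> f)) (\<lambda>f. modulation_norm \<Phi>\<^sub>1 \<Phi>\<^sub>2 \<omega> f)"
proof -
 obtain K where K: "K > 0" "\<And>f. f \<in> Minf ==>
  slux E (star \<Theta>\<^sub>1) (star \<Theta>\<^sub>2) (\<lambda>l. en ((cmod (stft \<omega> \<phi> f l) * \<omega> l) powr p)) \<le> en K * mlux lborel (star \<Theta>\<^sub>1) (star \<Theta>\<^sub>2) (Vpow p f)"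
  by (rule A.analysis_norm[OF gauges]) (rule that)
 show ?thesis by (rule lesssim_onI[OF A.p(1) K(1)]) (unfold epow_mixed epow_modulation_norm, rule K(2), rule modulation_space_Minf)
qed

lemma modulation_lesssim:
 "lesssim_on (modulation_space \<Phi>\<^sub>1 \<Phi>\<^sub>2 \<omega>) (\<lambda>f. modulation_norm \<Phi>\<^sub>1 \<Phi>\<^sub>2 \<omega> f)
  (\<lambda>f. mixed_orlicz_norm (count_space (lattice E)) \<Phi>\<^sub>1 \<Phi>\<^sub>2 \<omega> (stft \<omega> \<phi> f))"
proof -
 obtain K where K: "K > 0" "\<And>f F. f \<in> Minf ==> finite F ==> F \<subseteq> lattice2 E ==>
  mlux lborel (star \<Theta>\<^sub>1) (star \<Theta>\<^sub>2) (Vpow p (\<lambda>J. f J - (\<Sum>l\<in>F. stft \<omega> \<phi> f l * atom \<psi> l J)))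
   \<le> en K * slux E (star \<Theta>\<^sub>1) (star \<Theta>\<^sub>2) (\<lambda>l. en ((cmod (stft \<omega> \<phi> f l) * \<omega> l) powr p) * indicator (- F) l)"
  using modulation_le_analysis[OF gauges] by blast
 show ?thesis
 proof (rule lesssim_onI[OF A.p(1) K(1)])
  fix f assume "f \<in> modulation_space \<Phi>\<^sub>1 \<Phi>\<^sub>2 \<omega>"
  from K(2)[OF modulation_space_Minf[OF this], of "{}"]
  show "epow p (modulation_norm \<Phi>\<^sub>1 \<Phi>\<^sub>2 \<omega> f) \<le> en K * epow p (mixed_orlicz_norm (count_space (lattice E)) \<Phi>\<^sub>1 \<Phi>\<^sub>2 \<omega> (stft \<omega> \<phi> f))"
   unfolding epow_mixed epow_modulation_norm by simp
 qed
qed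

text \<open>The remainder is bounded by a tail of the coefficient sequence, whose gauge is finite by
  the analysis estimate; density of the Schwartz functions makes that tail vanish.\<close>

lemma modulation_expansion:
 assumes dense: "dense_in_mixed_orlicz (schwartz :: ('n::finite phase => complex) set) \<Phi>\<^sub>1 \<Phi>\<^sub>2"
  and f: "f \<in> modulation_space \<Phi>\<^sub>1 \<Phi>\<^sub>2 \<omega>"
 shows "modulation_has_sum \<Phi>\<^sub>1 \<Phi>\<^sub>2 \<omega> (\<lambda>l J. stft \<omega> \<phi> f l * atom \<psi> l J) f (lattice2 E)"
 unfolding modulation_has_sum_def
proof (rule epow_tendsto_0_iff[OF A.p(1)], unfold epow_modulation_norm)
 note fm = modulation_space_Minf[OF f]
 let ?a = "\<lambda>l. cmod (stft \<omega> \<phi> f l) * \<omega> l"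
 let ?R = "\<lambda>f F. mlux lborel (star \<Theta>\<^sub>1) (star \<Theta>\<^sub>2) (Vpow p (\<lambda>J. f J - (\<Sum>l\<in>F. stft \<omega> \<phi> f l * atom \<psi> l J)))"
 let ?m = "slux E (star \<Theta>\<^sub>1) (star \<Theta>\<^sub>2) :: ('n phase => ennreal) => ennreal"
 obtain K where K: "K > 0" "\<And>f. f \<in> Minf ==>
  ?m (\<lambda>l. en ((cmod (stft \<omega> \<phi> f l) * \<omega> l) powr p)) \<le> en K * mlux lborel (star \<Theta>\<^sub>1) (star \<Theta>\<^sub>2) (Vpow p f)"
  by (rule A.analysis_norm[OF gauges]) (rule that)
 have "en K * mlux lborel (star \<Theta>\<^sub>1) (star \<Theta>\<^sub>2) (Vpow p f) < \<infinity>"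
  using modulation_space_finite[OF f] by (simp add: ennreal_mult_less_top)
 with K(2)[OF fm] have fin: "?m (\<lambda>l. en (?a l powr p)) < \<infinity>" by (rule le_less_trans)
 have a: "?a l \<ge> 0" for l using \<omega>_pos[of l] by simp
 have tail: "((\<lambda>S. ?m (\<lambda>l. en (?a l powr p) * indicator (- S) l)) \<longlongrightarrow> 0) (finite_subsets_at_top (lattice2 E))"
  by (rule tail_tendsto[where \<Phi>\<^sub>1 = \<Phi>\<^sub>1 and \<Phi>\<^sub>2 = \<Phi>\<^sub>2, OF gauges A.p A.eps \<Phi> dense a fin])
 obtain K' where K': "K' > 0" "\<And>f F. f \<in> Minf ==> finite F ==> F \<subseteq> lattice2 E ==>
  ?R f F
   \<le> en K' * ?m (\<lambda>l. en ((cmod (stft \<omega> \<phi> f l) * \<omega> l) powr p) * indicator (- F) l)"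
  using modulation_le_analysis[OF gauges] by blast
 have lim: "((\<lambda>S. en K' * ?m (\<lambda>l. en (?a l powr p) * indicator (- S) l)) \<longlongrightarrow> 0) (finite_subsets_at_top (lattice2 E))"
  using ennreal_tendsto_cmult[OF _ tail, of "en K'"] by simp
 show "((\<lambda>F. ?R f F) \<longlongrightarrow> 0) (finite_subsets_at_top (lattice2 E))"
 proof (rule tendsto_sandwich[OF _ _ tendsto_const lim])
  show "\<forall>\<^sub>F F in finite_subsets_at_top (lattice2 E). ?R f F
   \<le> en K' * ?m (\<lambda>l. en (?a l powr p) * indicator (- F) l)"
   by (rule eventually_finite_subsets_at_top_weakI) (rule K'(2)[OF fm])
 qed simp
qed

end

text \<open>Here the membership of the windows in \<open>M\<^sup>p\<close> enters:
  \<open>window_exists\<close> is used with \<open>v\<close> as the weight.\<close>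

lemma window_from_modulation_Lp:
 assumes "weights \<omega> v c r" "E > 0" "0 < p" "p \<le> 1" "\<phi> \<in> square_integrable" "hermite_coeffs \<phi> \<in> modulation_Lp (en p) v"
 obtains b where "window \<omega> v c r E p \<phi> b"
proof -
 interpret weights \<omega> v c r by fact
 have fd: "hermite_coeffs \<phi> \<in> flat_dual" using assms(6) by (simp add: modulation_Lp_def)
 have "Lp_norm (en p) v (V (hermite_coeffs \<phi>)) < \<infinity>"
  using assms(6) by (simp add: modulation_Lp_def modulation_Lp_norm_def)
 then have "(LI z. en ((cmod (V (hermite_coeffs \<phi>) z) * v z) powr p)) < \<infinity>"
  using assms(3) by (simp add: Lp_norm_def Let_def nn_integral_completion less_top split: if_splits)
 note fin = this
 obtain b where "\<And>k. b k \<ge> 0" "\<And>z. cmod (V (hermite_coeffs \<phi>) z) * v z \<le> b (cell2 E z)"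
  "(lsum E (\<lambda>k. en (b k powr p))) < \<infinity>"
  by (rule weights.window_exists[OF self_weights assms(3,4,2) fd fin]) (rule that)
 then have "window \<omega> v c r E p \<phi> b" using assms by unfold_locales auto
 then show ?thesis by (rule that)
qed

theorem theorem4p7:
  fixes \<epsilon> r\<^sub>0 :: real
    and \<Phi>\<^sub>1 \<Phi>\<^sub>2 :: "real \<Rightarrow> ennreal"
    and \<omega> v :: "(real^'n) \<times> (real^'n) \<Rightarrow> real"
    and \<phi> \<psi> :: "real^'n \<Rightarrow> complex"
  assumes "\<epsilon> > 0"
    and "0 < r\<^sub>0" and "r\<^sub>0 \<le> 1"
    and "quasi_young r\<^sub>0 \<Phi>\<^sub>1" and "quasi_young r\<^sub>0 \<Phi>\<^sub>2"
    and "\<omega> \<in> moderate_weights" and "v \<in> moderate_weights"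
    and "submultiplicative v" and "moderate v \<omega>"
    and "hermite_coeffs \<phi> \<in> modulation_Lp (ennreal r\<^sub>0) v"
    and "hermite_coeffs \<psi> \<in> modulation_Lp (ennreal r\<^sub>0) v"
    and "dual_gabor_frames \<epsilon> \<phi> \<psi>"
  shows "(\<forall>f\<in>modulation_space \<Phi>\<^sub>1 \<Phi>\<^sub>2 \<omega>. gabor_frame_operator \<epsilon> \<omega> \<phi> \<psi> f = f) \<and>
    (\<forall>f\<in>modulation_space \<Phi>\<^sub>1 \<Phi>\<^sub>2 \<omega>.
       let
         u = (\<lambda>(k, \<kappa>) \<alpha>. stft \<omega> \<psi> f (grid \<epsilon> k, grid \<epsilon> \<kappa>) *
                hermite_coeffs (tf_shift (grid \<epsilon> k) (grid \<epsilon> \<kappa>) \<phi>) \<alpha>);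
         w = (\<lambda>(k, \<kappa>) \<alpha>. stft \<omega> \<phi> f (grid \<epsilon> k, grid \<epsilon> \<kappa>) *
                hermite_coeffs (tf_shift (grid \<epsilon> k) (grid \<epsilon> \<kappa>) \<psi>) \<alpha>)
       in if dense_in_mixed_orlicz (schwartz :: ((real^'n) \<times> (real^'n) \<Rightarrow> complex) set) \<Phi>\<^sub>1 \<Phi>\<^sub>2
          then modulation_has_sum \<Phi>\<^sub>1 \<Phi>\<^sub>2 \<omega> u f UNIV \<and> modulation_has_sum \<Phi>\<^sub>1 \<Phi>\<^sub>2 \<omega> w f UNIV
          else weak_star_has_sum \<omega> u f UNIV \<and> weak_star_has_sum \<omega> w f UNIV) \<and>
    equivalent_on (modulation_space \<Phi>\<^sub>1 \<Phi>\<^sub>2 \<omega>)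
      (\<lambda>f. mixed_orlicz_norm (count_space (lattice \<epsilon>)) \<Phi>\<^sub>1 \<Phi>\<^sub>2 \<omega> (stft \<omega> \<phi> f))
      (\<lambda>f. mixed_orlicz_norm (count_space (lattice \<epsilon>)) \<Phi>\<^sub>1 \<Phi>\<^sub>2 \<omega> (stft \<omega> \<psi> f)) \<and>
    equivalent_on (modulation_space \<Phi>\<^sub>1 \<Phi>\<^sub>2 \<omega>)
      (\<lambda>f. mixed_orlicz_norm (count_space (lattice \<epsilon>)) \<Phi>\<^sub>1 \<Phi>\<^sub>2 \<omega> (stft \<omega> \<psi> f))
      (\<lambda>f. modulation_norm \<Phi>\<^sub>1 \<Phi>\<^sub>2 \<omega> f)"
proof -
 have weights': "weight \<omega>" "weight v" using assms(6,7) by (auto simp: moderate_weights_def)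
 then have \<omega>m: "\<omega> \<in> borel_measurable lebesgue" by (simp add: weight_def)
 obtain c r where W: "weights \<omega> v c r" by (rule weights_exist[OF weights' assms(8,9)])
 have L2: "\<phi> \<in> square_integrable" "\<psi> \<in> square_integrable"
  using assms(12) by (auto simp: dual_gabor_frames_def gabor_frame_def)
 obtain b where b: "window \<omega> v c r \<epsilon> r\<^sub>0 \<phi> b"
  by (rule window_from_modulation_Lp[OF W assms(1-3) L2(1) assms(10)])
 obtain d where d: "window \<omega> v c r \<epsilon> r\<^sub>0 \<psi> d"
  by (rule window_from_modulation_Lp[OF W assms(1-3) L2(2) assms(11)])
 obtain \<Theta>\<^sub>1 where \<Theta>1: "young \<Theta>\<^sub>1" "\<And>t. t \<ge> 0 ==> \<Phi>\<^sub>1 t = \<Theta>\<^sub>1 (t powr r\<^sub>0)" using assms(4) unfolding quasi_young_def by blast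
 obtain \<Theta>\<^sub>2 where \<Theta>2: "young \<Theta>\<^sub>2" "\<And>t. t \<ge> 0 ==> \<Phi>\<^sub>2 t = \<Theta>\<^sub>2 (t powr r\<^sub>0)" using assms(5) unfolding quasi_young_def by blast
 interpret A: orlicz_gabor \<omega> v c r \<epsilon> r\<^sub>0 \<phi> \<psi> b d \<Phi>\<^sub>1 \<Phi>\<^sub>2 \<Theta>\<^sub>1 \<Theta>\<^sub>2
  by (intro orlicz_gabor.intro gabor.intro gabor_axioms.intro orlicz_gabor_axioms.intro W b d \<Theta>1 \<Theta>2)
   (use assms(12) in \<open>simp add: dual_gabor_frames_def\<close>)
 \<comment> \<open>The hypotheses are symmetric in the two windows; exchanging them yields the
   second expansion and the estimates for the second coefficient sequence.\<close>
 interpret B: orlicz_gabor \<omega> v c r \<epsilon> r\<^sub>0 \<psi> \<phi> d b \<Phi>\<^sub>1 \<Phi>\<^sub>2 \<Theta>\<^sub>1 \<Theta>\<^sub>2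
  by (intro orlicz_gabor.intro gabor.intro gabor_axioms.intro orlicz_gabor_axioms.intro W b d \<Theta>1 \<Theta>2)
   (use assms(12) in \<open>simp add: dual_gabor_frames_def\<close>)
 let ?t = "\<lambda>\<gamma> \<eta> f i. (\<lambda>l \<alpha>. stft \<omega> \<gamma> f l * atom \<eta> l \<alpha>) (grid2 \<epsilon> i)"
 have eq: "(\<lambda>(k, \<kappa>) \<alpha>. stft \<omega> \<gamma> f (grid \<epsilon> k, grid \<epsilon> \<kappa>) * hermite_coeffs (tf_shift (grid \<epsilon> k) (grid \<epsilon> \<kappa>) \<eta>) \<alpha>)
   = ?t \<gamma> \<eta> f" for \<gamma> \<eta> :: "real^'n => complex" and f
  by (simp add: fun_eq_iff grid2_def atom_def)
 note inj = inj_grid2[OF assms(1)]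
 have sums: "(if dense_in_mixed_orlicz (schwartz :: ('n phase => complex) set) \<Phi>\<^sub>1 \<Phi>\<^sub>2
   then modulation_has_sum \<Phi>\<^sub>1 \<Phi>\<^sub>2 \<omega> (?t \<psi> \<phi> f) f UNIV \<and>
    modulation_has_sum \<Phi>\<^sub>1 \<Phi>\<^sub>2 \<omega> (?t \<phi> \<psi> f) f UNIV
   else weak_star_has_sum \<omega> (?t \<psi> \<phi> f) f UNIV \<and>
    weak_star_has_sum \<omega> (?t \<phi> \<psi> f) f UNIV)"
  if f: "f \<in> modulation_space \<Phi>\<^sub>1 \<Phi>\<^sub>2 \<omega>" for f
 proof (split if_split, intro conjI impI)
  note fm = A.modulation_space_Minf[OF f]
  show "weak_star_has_sum \<omega> (?t \<psi> \<phi> f) f UNIV"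
   by (rule weak_star_has_sum_reindex[OF inj]) (unfold range_grid2, rule B.weak_star_expansion[OF fm])
  show "weak_star_has_sum \<omega> (?t \<phi> \<psi> f) f UNIV"
   by (rule weak_star_has_sum_reindex[OF inj]) (unfold range_grid2, rule A.weak_star_expansion[OF fm])
  assume dense: "dense_in_mixed_orlicz (schwartz :: ('n phase => complex) set) \<Phi>\<^sub>1 \<Phi>\<^sub>2"
  show "modulation_has_sum \<Phi>\<^sub>1 \<Phi>\<^sub>2 \<omega> (?t \<psi> \<phi> f) f UNIV"
   by (rule modulation_has_sum_reindex[OF inj]) (unfold range_grid2, rule B.modulation_expansion[OF dense f])
  show "modulation_has_sum \<Phi>\<^sub>1 \<Phi>\<^sub>2 \<omega> (?t \<phi> \<psi> f) f UNIV"
   by (rule modulation_has_sum_reindex[OF inj]) (unfold range_grid2, rule A.modulation_expansion[OF dense f])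
 qed
 \<comment> \<open>The two coefficient norms are compared with each other through the modulation
   norm: analysis with one window after synthesis from the other.\<close>
 show ?thesis unfolding Let_def eq equivalent_on_def using sums A.frame_operator[OF \<omega>m A.modulation_space_Minf]
   lesssim_on_trans[OF A.analysis_lesssim B.modulation_lesssim] lesssim_on_trans[OF B.analysis_lesssim A.modulation_lesssim]
   B.analysis_lesssim B.modulation_lesssim by (intro conjI ballI)
qed

end
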